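(* Let $b_0:=2z_0e^{-\pi i z_0}$. For each $\sigma\in\mathbb Z$ there are complex numbers $b_1(\sigma),b_2(\sigma),\dots$ such that for every integer $m\geqslant1$ there is a constant $K=K(\sigma,m)$ with $$\left|\mathcal A_1(N,\sigma) - \operatorname{Re}\left[\frac{w_0^{-N}}{N^{2}} \left( b_{0}+\frac{b_{1}(\sigma)}{N}+ \dots +\frac{b_{m-1}(\sigma)}{N^{m-1}}\right)\right]\right| \leqslant K\frac{|w_0|^{-N}}{N^{m+2}}$$ for all integers $N\geqslant 1$.
   Context: For $N\in\mathbb Z_{\ge1}$ and $\sigma\in\mathbb C$ let $Q(z;N,\sigma):=e^{2\pi i\sigma z}\prod_{j=1}^N(1-e^{2\pi i j z})^{-1}$, and for coprime $0\le h<k\le N$ let $Q_{hk\sigma}(N):=2\pi i\operatorname{Res}_{z=h/k}Q(z;N,\sigma)$. Let $\mathcal A(N):=\{h/k : N/2<k\le N,\ h=1 \text{ or } h=k-1\}$ and $\mathcal A_1(N,\sigma):=\sum_{h/k\in\mathcal A(N)}Q_{hk\sigma}(N)$. $\operatorname{Li}_2$ is the principal branch of the dilogarithm, $\log$ the principal logarithm; $w_0$ is the unique solution $w\in\mathbb C\setminus((-\infty,0]\cup[1,\infty))$ of $\operatorname{Li}_2(w)-2\pi i\log w=0$ ($w_0\approx0.9161978-0.1824589i$) and $z_0:=1+\log(1-w_0)/(2\pi i)$. *)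

theory Defs
  imports "HOL-Complex_Analysis.Complex_Analysis"
begin

definition Q :: "complex \<Rightarrow> nat \<Rightarrow> complex \<Rightarrow> complex" where
  "Q z N \<sigma> =
     exp (2 * of_real pi * \<i> * \<sigma> * z) *
     (\<Prod>j = 1..N. inverse (1 - exp (2 * of_real pi * \<i> * of_nat j * z)))"

definition Q_res :: "nat \<Rightarrow> nat \<Rightarrow> complex \<Rightarrow> nat \<Rightarrow> complex" where
  "Q_res h k \<sigma> N =
     2 * of_real pi * \<i> * residue (\<lambda>z. Q z N \<sigma>) (of_nat h / of_nat k)"

text \<open>
  A reduced fraction \<open>h/k\<close> is represented by the pair \<open>(h, k)\<close>. The conditions \<open>h < k\<close> and
  \<open>coprime h k\<close> are those under which the residues are indexed; the former excludes
  only \<open>1/1\<close> for \<open>N = 1\<close>. For \<open>k = 2\<close> both choices of \<open>h\<close> give the single fraction \<open>1/2\<close>.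
\<close>
definition A_set :: "nat \<Rightarrow> (nat \<times> nat) set" where
  "A_set N = {(h, k). real N / 2 < real k \<and> k \<le> N \<and> h < k \<and> coprime h k \<and>
                      (h = 1 \<or> h = k - 1)}"

definition A1 :: "nat \<Rightarrow> complex \<Rightarrow> complex" where
  "A1 N \<sigma> = (\<Sum>(h, k) \<in> A_set N. Q_res h k \<sigma> N)"

text \<open>
  Principal branch of the dilogarithm, meant for \<open>w\<close> outside the cut \<open>[1, \<infinity>)\<close>; there the segment
  from \<open>0\<close> to \<open>w\<close> avoids the cut. The integrand has a removable singularity at \<open>0\<close>.
\<close>
definition Li2 :: "complex \<Rightarrow> complex" where
  "Li2 w = - contour_integral (linepath 0 w) (\<lambda>u. Ln (1 - u) / u)"

definition w0 :: complex where
  "w0 = (THE w. w \<notin> of_real ` ({..0} \<union> {1..}) \<and> Li2 w - 2 * of_real pi * \<i> * Ln w = 0)"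

definition z0 :: complex where
  "z0 = 1 + Ln (1 - w0) / (2 * of_real pi * \<i>)"

definition b0 :: complex where
  "b0 = 2 * z0 * exp (- of_real pi * \<i> * z0)"

end

theory Submission
  imports Defs "HOL-Real_Asymp.Real_Asymp" "HOL-Probability.Probability"
begin

text \<open>
  The residues at \<open>1/k\<close> and \<open>(k-1)/k\<close> are conjugate, and the poles of \<open>Q\<close> with real part strictly between
  \<open>1/(N+1/2)\<close> and \<open>2/(N+1/2)\<close> are exactly the \<open>1/k\<close> with \<open>N/2 < k \<le> N\<close>. Hence \<open>A1\<close> is twice the real part of the
  integral of \<open>Q\<close> around a rectangle with these abscissas. Put \<open>\<nu> = N + 1/2\<close>. The Euler-Maclaurin formula for
  \<open>\<Sum>j\<le>N. log (1 - exp (2 \<pi> i j z/\<nu>))\<close>, after removal of the singularity at \<open>0\<close> by means of Stirling's formula, shows that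
  \<open>Q (z/\<nu>)\<close> is \<open>exp (\<nu> p z) / sqrt \<nu>\<close> times an asymptotic series in \<open>1/\<nu>\<close> with holomorphic coefficients, where
  \<open>p z = (Li2 (exp (2 \<pi> i z)) - \<pi>\<^sup>2/6) / (2 \<pi> i z)\<close>. The point \<open>z0\<close> is a saddle point of \<open>p\<close> with
  \<open>p z0 = - log w0\<close>, and \<open>Re p\<close> attains its maximum on the horizontal segment \<open>1 \<le> Re z \<le> 2\<close> through \<open>z0\<close> only there. On the vertical
  sides a product of sines over the residues modulo \<open>2N+1\<close> shows that \<open>Q\<close> is exponentially smaller, and the
  bottom side is harmless because \<open>Q\<close> is bounded there. Laplace's method on the top side gives the expansion.
\<close>

section \<open>The dilogarithm\<close>

text \<open>The half-integer \<open>\<nu> = N + 1/2\<close> is chosen for two reasons. The abscissas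
  \<open>1/\<nu>\<close> and \<open>2/\<nu>\<close> have the form \<open>c / (2N+1)\<close> with
  \<open>c\<close> coprime to \<open>2N+1\<close>, so the unimodular parts of the factors of
  \<open>Q\<close> have a product with an exact value there. And the sum over
  \<open>j \<le> N\<close> stops half a step short of \<open>\<nu>\<close>, so the Euler-Maclaurin
  formula has no boundary value of the function at the far end. The expansion of \<open>Q\<close> is
  uniform only on compact subsets of the upper half plane, hence the separate estimate on the lower
  part of the vertical sides. Since \<open>w0\<close> is given by a definite description, existence,
  uniqueness and rough numerical bounds have to precede every statement about \<open>z0\<close>. Two
  decimals suffice, because the comparison along the top side is reduced to sign and concavity
  arguments. The power \<open>N^-2\<close> is made of one factor \<open>1/\<nu>\<close> from
  rescaling the variable and one factor \<open>1 / sqrt \<nu>\<close> each from the size of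
  \<open>Q\<close> and from Laplace's integral. As the exponent at the saddle point is
  \<open>N + 1/2\<close> times \<open>- log w0\<close>, an extra factor \<open>w0^(-1/2)\<close>
  appears, which cancels in \<open>b0\<close>.\<close>

definition dilog_dom :: "complex set" where
  "dilog_dom = - (complex_of_real ` {1..})"

text \<open>The value \<open>-1\<close> is the limit of \<open>Ln (1 - u) / u\<close> at
  \<open>0\<close>. It makes the kernel holomorphic on all of \<open>dilog_dom\<close> and changes
  no integral.\<close>

definition dilog_ker :: "complex \<Rightarrow> complex" where
  "dilog_ker u = (if u = 0 then -1 else Ln (1 - u) / u)"

lemma in_dilog_dom: "u \<in> dilog_dom \<longleftrightarrow> 1 - u \<notin> \<real>\<^sub>\<le>\<^sub>0"
proof -
  have "(\<exists>x\<ge>1. u = of_real x) \<longleftrightarrow> (\<exists>r\<le>0. 1 - u = of_real r)"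
  proof
    assume "\<exists>x\<ge>1. u = of_real x"
    then obtain x where "x \<ge> 1" "u = of_real x" by blast
    then show "\<exists>r\<le>0. 1 - u = of_real r" by (intro exI[of _ "1 - x"]) auto
  next
    assume "\<exists>r\<le>0. 1 - u = of_real r"
    then obtain r where r: "r \<le> 0" "1 - u = of_real r" by blast
    then have "u = of_real (1 - r)" by (simp add: algebra_simps)
    with r show "\<exists>x\<ge>1. u = of_real x" by (intro exI[of _ "1 - r"]) auto
  qed
  then show ?thesis
    by (auto simp: dilog_dom_def nonpos_Reals_def)
qed

lemma open_dilog_dom: "open dilog_dom"
proof -
  have "dilog_dom = (\<lambda>u. 1 - u) -` (- \<real>\<^sub>\<le>\<^sub>0)" using in_dilog_dom by auto
  moreover have "open ((\<lambda>u::complex. 1 - u) -` (- \<real>\<^sub>\<le>\<^sub>0))"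
    by (intro continuous_open_vimage open_Compl closed_nonpos_Reals_complex)
       (auto intro: continuous_intros)
  ultimately show ?thesis by simp
qed

lemma dilog_dom_scale: "w \<in> dilog_dom \<Longrightarrow> 0 \<le> t \<Longrightarrow> t \<le> 1 \<Longrightarrow> of_real t * w \<in> dilog_dom"
proof -
  assume w: "w \<in> dilog_dom" and t: "0 \<le> t" "t \<le> 1"
  show ?thesis
  proof (rule ccontr)
    assume "of_real t * w \<notin> dilog_dom"
    then obtain x where x: "x \<ge> 1" "of_real t * w = of_real x" by (auto simp: dilog_dom_def)
    then have "t \<noteq> 0" by auto
    with x have "w = of_real (x / t)" by (simp add: field_simps)
    moreover have "x / t \<ge> 1" using x t \<open>t \<noteq> 0\<close> by (simp add: field_simps)
    ultimately show False using w by (auto simp: dilog_dom_def simp del: of_real_divide)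
  qed
qed

lemma zero_in_dilog_dom [simp]: "0 \<in> dilog_dom"
  by (auto simp: dilog_dom_def)

lemma segment_dilog_dom: "w \<in> dilog_dom \<Longrightarrow> closed_segment 0 w \<subseteq> dilog_dom"
  using dilog_dom_scale by (auto simp: closed_segment_def scaleR_conv_of_real)

lemma starlike_dilog_dom: "starlike dilog_dom"
  unfolding starlike_def using segment_dilog_dom zero_in_dilog_dom by blast

lemma dilog_ker_holomorphic: "dilog_ker holomorphic_on dilog_dom"
proof (rule pole_theorem_open_0[where g = "\<lambda>u. Ln (1 - u)" and a = 0])
  show "(\<lambda>u. Ln (1 - u)) holomorphic_on dilog_dom"
    by (intro holomorphic_intros) (simp add: in_dilog_dom)
  have "((\<lambda>u. Ln (1 - u)) has_field_derivative -1) (at 0)"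
    by (auto intro!: derivative_eq_intros)
  then show "dilog_ker 0 = deriv (\<lambda>u. Ln (1 - u)) 0"
    by (simp add: dilog_ker_def DERIV_imp_deriv)
qed (auto simp: dilog_ker_def open_dilog_dom)

lemma contour_integral_dilog_ker:
  "contour_integral (linepath 0 w) (\<lambda>u. Ln (1 - u) / u) = contour_integral (linepath 0 w) dilog_ker"
proof (cases "w = 0")
  case False
  show ?thesis
    by (rule contour_integral_spike_finite_simple_path[where A = "{0}"])
       (use False in \<open>auto simp: dilog_ker_def simple_path_linepath\<close>)
qed (simp only: contour_integral_trivial)

text \<open>On a starlike domain \<open>dilog_ker\<close> has a primitive \<open>F\<close>. The
  segments from \<open>0\<close> stay in the domain, so \<open>Li2\<close> is
  \<open>F 0 - F\<close>.\<close>

lemma Li2_has_field_derivative: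
  assumes "w \<in> dilog_dom"
  shows "(Li2 has_field_derivative - dilog_ker w) (at w)"
proof -
  have "\<exists>F. \<forall>x\<in>dilog_dom. (F has_field_derivative dilog_ker x) (at x)"
    by (rule holomorphic_starlike_primitive[where k = "{}"])
       (use dilog_ker_holomorphic open_dilog_dom in
         \<open>auto simp: starlike_dilog_dom holomorphic_on_imp_continuous_on holomorphic_on_open
            field_differentiable_def\<close>)
  then obtain F where F: "\<And>x. x \<in> dilog_dom \<Longrightarrow> (F has_field_derivative dilog_ker x) (at x)"
    by blast
  have Li2: "Li2 x = F 0 - F x" if "x \<in> dilog_dom" for x
  proof -
    have "(dilog_ker has_contour_integral (F (pathfinish (linepath 0 x)) - F (pathstart (linepath 0 x))))
        (linepath 0 x)"
    proof (rule contour_integral_primitive[where S = dilog_dom])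
      show "path_image (linepath 0 x) \<subseteq> dilog_dom"
        unfolding path_image_linepath by (rule segment_dilog_dom[OF that])
    qed (rule has_field_derivative_at_within[OF F], assumption, rule valid_path_linepath)
    then show ?thesis
      unfolding Li2_def contour_integral_dilog_ker by (simp add: contour_integral_unique)
  qed
  have "((\<lambda>x. F 0 - F x) has_field_derivative - dilog_ker w) (at w)"
    using F[OF assms] by (auto intro!: derivative_eq_intros)
  then show ?thesis
    by (rule has_field_derivative_transform_within_open[OF _ open_dilog_dom assms]) (simp add: Li2)
qed

lemma Li2_0 [simp]: "Li2 0 = 0"
  by (simp only: Li2_def contour_integral_trivial minus_zero)

lemma ball_subset_dilog_dom: "cmod u < 1 \<Longrightarrow> u \<in> dilog_dom"
  by (auto simp: dilog_dom_def)

lemma Im_nonzero_dilog_dom: "Im u \<noteq> 0 \<Longrightarrow> u \<in> dilog_dom"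
  by (auto simp: dilog_dom_def)

section \<open>Power series of the dilogarithm, its value at 1, and reflection\<close>

definition dilog_series :: "complex \<Rightarrow> complex" where
  "dilog_series u = (\<Sum>n. u ^ Suc n / of_nat (Suc n) ^ 2)"

lemma summable_inverse_Suc_squares: "summable (\<lambda>n. 1 / real (Suc n) ^ 2)"
  using inverse_squares_sums by (simp add: sums_iff add.commute)

lemma dilog_series_bound:
  "cmod u \<le> 1 \<Longrightarrow> norm (u ^ Suc n / of_nat (Suc n) ^ 2) \<le> 1 / real (Suc n) ^ 2"
proof -
  assume "cmod u \<le> 1"
  then have "cmod u ^ Suc n \<le> 1" by (intro power_le_one) auto
  then show ?thesis
    by (simp only: norm_divide norm_power norm_of_nat) (intro divide_right_mono, auto)
qed

lemma dilog_series_sums: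
  "cmod u \<le> 1 \<Longrightarrow> (\<lambda>n. u ^ Suc n / of_nat (Suc n) ^ 2) sums dilog_series u"
  unfolding dilog_series_def
  by (intro summable_sums summable_comparison_test'[OF summable_inverse_Suc_squares])
     (rule dilog_series_bound)

text \<open>Uniform convergence on the closed disc reaches the branch point \<open>1\<close>, which
  \<open>dilog_dom\<close> excludes and from which the constant \<open>pi\<^sup>2 / 6\<close> of the
  phase originates.\<close>

lemma continuous_on_dilog_series: "continuous_on (cball 0 1) dilog_series"
proof -
  have "uniform_limit (cball (0::complex) 1) (\<lambda>n u. \<Sum>i<n. u ^ Suc i / of_nat (Suc i) ^ 2)
      (\<lambda>u. \<Sum>i. u ^ Suc i / of_nat (Suc i) ^ 2) sequentially"
    by (rule Weierstrass_m_test[OF _ summable_inverse_Suc_squares])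
       (simp only: mem_cball dist_0_norm, rule dilog_series_bound)
  then have "continuous_on (cball 0 1) (\<lambda>u::complex. \<Sum>i. u ^ Suc i / of_nat (Suc i) ^ 2)"
    by (rule uniform_limit_theorem[rotated]) (auto intro!: always_eventually continuous_intros simp del: of_nat_Suc)
  then show ?thesis unfolding dilog_series_def .
qed

lemma dilog_series_1: "dilog_series 1 = of_real (pi\<^sup>2 / 6)"
proof -
  have "(\<lambda>n. complex_of_real (1 / real (Suc n) ^ 2)) sums of_real (pi\<^sup>2 / 6)"
    using inverse_squares_sums by (intro sums_of_real) (simp add: add.commute)
  moreover have "(\<lambda>n. complex_of_real (1 / real (Suc n) ^ 2)) = (\<lambda>n. 1 ^ Suc n / of_nat (Suc n) ^ 2)"
    by auto
  ultimately have "(\<lambda>n. (1::complex) ^ Suc n / of_nat (Suc n) ^ 2) sums of_real (pi\<^sup>2 / 6)"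
    by (simp only:)
  from sums_unique2[OF this dilog_series_sums] show ?thesis by simp
qed

text \<open>Both sides vanish at \<open>0\<close> and have derivative \<open>- dilog_ker\<close> on
  the open disc.\<close>

lemma Li2_eq_series:
  assumes "cmod u < 1" shows "Li2 u = dilog_series u"
proof -
  define c where "c = (\<lambda>n::nat. if n = 0 then 0 else 1 / complex_of_nat n ^ 2)"
  have sc: "(\<lambda>n. c n * x ^ n) sums dilog_series x" if "cmod x < 1" for x
  proof -
    have "(\<lambda>n. c (Suc n) * x ^ Suc n) sums dilog_series x"
      using dilog_series_sums[of x] that by (simp add: c_def)
    then show ?thesis by (subst (asm) sums_Suc_iff) (simp add: c_def)
  qed
  have der: "(dilog_series has_field_derivative - dilog_ker x) (at x)" if x: "x \<in> ball 0 1" for x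
  proof -
    have "((\<lambda>x. \<Sum>n. c n * x ^ n) has_field_derivative (\<Sum>n. diffs c n * x ^ n)) (at x)"
      by (rule termdiffs_strong'[where K = 1])
         (use x sc in \<open>auto simp: sums_iff\<close>)
    moreover have "(\<Sum>n. diffs c n * x ^ n) = - dilog_ker x"
    proof (cases "x = 0")
      case True
      then show ?thesis by (simp only: powser_zero) (simp add: dilog_ker_def diffs_def c_def)
    next
      case False
      have "(\<lambda>n. - (x ^ n) / of_nat n) sums ln (1 + (-x))"
        using Ln_series'[of "-x"] x by simp
      then have "(\<lambda>n. - (x ^ Suc n) / of_nat (Suc n)) sums ln (1 - x)"
        by (subst sums_Suc_iff) simp
      then have "(\<lambda>n. (-1/x) * (- (x ^ Suc n) / of_nat (Suc n))) sums ((-1/x) * ln (1 - x))"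
        by (rule sums_mult)
      moreover have "(\<lambda>n. (-1/x) * (- (x ^ Suc n) / of_nat (Suc n))) = (\<lambda>n. diffs c n * x ^ n)"
        using False by (auto simp: diffs_def c_def field_simps power2_eq_square simp del: of_nat_Suc)
      ultimately show ?thesis using False by (simp add: sums_iff dilog_ker_def)
    qed
    ultimately have "((\<lambda>x. \<Sum>n. c n * x ^ n) has_field_derivative - dilog_ker x) (at x)" by simp
    then show ?thesis
      by (rule has_field_derivative_transform_within_open[where S = "ball 0 1"])
         (use x sc in \<open>auto simp: sums_iff\<close>)
  qed
  have "\<exists>k. \<forall>x\<in>ball 0 1. Li2 x - dilog_series x = k"
  proof (rule has_field_derivative_zero_constant[OF convex_ball])
    fix x :: complex assume x: "x \<in> ball 0 1"
    then have "x \<in> dilog_dom" by (intro ball_subset_dilog_dom) simp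
    from DERIV_diff[OF Li2_has_field_derivative[OF this] der[OF x]]
    show "((\<lambda>x. Li2 x - dilog_series x) has_field_derivative 0) (at x within ball 0 1)"
      by (simp add: has_field_derivative_at_within)
  qed
  then obtain k where k: "\<And>x. x \<in> ball 0 1 \<Longrightarrow> Li2 x - dilog_series x = k" by blast
  have "dilog_series 0 = 0" by (simp add: dilog_series_def)
  then have "k = 0" using k[of 0] by simp
  then show ?thesis using k[of u] assms by simp
qed

text \<open>An Abel limit: since the series is continuous on the closed disc, \<open>f\<close> may
  approach \<open>1\<close> along any path inside the open disc.\<close>

lemma Li2_real_tendsto:
  assumes "(f \<longlongrightarrow> 1) F" "eventually (\<lambda>x. cmod (f x) < 1) F"
  shows "((\<lambda>x. Li2 (f x)) \<longlongrightarrow> of_real (pi\<^sup>2 / 6)) F"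
proof -
  have "((\<lambda>x. dilog_series (f x)) \<longlongrightarrow> dilog_series 1) F"
    by (rule continuous_on_tendsto_compose[OF continuous_on_dilog_series assms(1)])
       (use assms(2) in \<open>auto elim: eventually_mono\<close>)
  moreover have "\<forall>\<^sub>F x in F. dilog_series (f x) = Li2 (f x)"
    using assms(2) by eventually_elim (simp add: Li2_eq_series)
  ultimately show ?thesis unfolding dilog_series_1 by (rule Lim_transform_eventually)
qed

text \<open>The combination \<open>H\<close> has derivative zero in the upper half plane; its
  constant value is found by letting the argument tend to \<open>0\<close>.\<close>

lemma Li2_reflection:
  assumes "Im u > 0"
  shows "Li2 (1 - u) = of_real (pi\<^sup>2 / 6) - Ln u * Ln (1 - u) - Li2 u"
proof -
  define H where "H = (\<lambda>u. Li2 (1 - u) + Ln u * Ln (1 - u) + Li2 u)"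
  define S where "S = {u. Im u > 0}"
  have der: "(H has_field_derivative 0) (at u)" if "u \<in> S" for u
  proof -
    have u: "u \<noteq> 0" "1 - u \<noteq> 0" "u \<notin> \<real>\<^sub>\<le>\<^sub>0" "1 - u \<notin> \<real>\<^sub>\<le>\<^sub>0" "u \<in> dilog_dom" "1 - u \<in> dilog_dom"
      using that by (auto simp: S_def complex_nonpos_Reals_iff dilog_dom_def complex_eq_iff)
    have 1: "((\<lambda>u. Li2 (1 - u)) has_field_derivative (- dilog_ker (1 - u)) * (-1)) (at u)"
      by (rule DERIV_chain2[OF Li2_has_field_derivative])
         (use u in \<open>auto intro!: derivative_eq_intros\<close>)
    have 2: "((\<lambda>u. Ln u * Ln (1 - u)) has_field_derivative
        (Ln (1 - u) / u - Ln u / (1 - u))) (at u)"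
      using u by (auto intro!: derivative_eq_intros simp: field_simps)
    have "(H has_field_derivative (- dilog_ker (1 - u)) * (-1) + (Ln (1 - u) / u - Ln u / (1 - u))
       + (- dilog_ker u)) (at u)"
      unfolding H_def by (intro DERIV_add 1 2 Li2_has_field_derivative u)
    then show ?thesis using u by (simp add: dilog_ker_def)
  qed
  have "convex S" unfolding S_def by (rule convex_halfspace_Im_gt)
  then have "\<exists>k. \<forall>u\<in>S. H u = k"
    by (intro has_field_derivative_zero_constant)
       (auto intro: has_field_derivative_at_within der)
  then obtain k where k: "\<And>u. u \<in> S \<Longrightarrow> H u = k" by blast
  \<comment> \<open>The diagonal direction keeps \<open>h e\<close> in the upper half plane and at
    the same time \<open>1 - h e\<close> in the unit disc, as \<open>Li2_real_tendsto\<close>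
    requires. The vertical direction would leave the disc.\<close>
  define h where "h = (\<lambda>e::real. of_real e * (1 + \<i>))"
  have hS: "eventually (\<lambda>e. h e \<in> S) (at_right 0)"
    by (intro eventually_at_rightI[of 0 1]) (auto simp: h_def S_def)
  have h0: "(h \<longlongrightarrow> 0) (at_right 0)"
    unfolding h_def by (auto intro!: tendsto_eq_intros)
  have "((\<lambda>e. H (h e)) \<longlongrightarrow> of_real (pi\<^sup>2 / 6) + 0 + 0) (at_right 0)"
    unfolding H_def
  proof (intro tendsto_add)
    show "((\<lambda>e. Li2 (1 - h e)) \<longlongrightarrow> of_real (pi\<^sup>2 / 6)) (at_right 0)"
    proof (rule Li2_real_tendsto)
      show "((\<lambda>e. 1 - h e) \<longlongrightarrow> 1) (at_right 0)"
        using h0 by (auto intro!: tendsto_eq_intros)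
      show "\<forall>\<^sub>F e in at_right 0. cmod (1 - h e) < 1"
      proof (rule eventually_at_rightI[of 0 1])
        fix e :: real assume "e \<in> {0<..<1}"
        then have "(1 - e)\<^sup>2 + e\<^sup>2 < 1" by (simp add: power2_eq_square algebra_simps)
        then show "cmod (1 - h e) < 1" by (simp add: h_def cmod_def)
      qed simp
    qed
    have "((\<lambda>e. Li2 (h e)) \<longlongrightarrow> Li2 0) (at_right 0)"
      using Li2_has_field_derivative[of 0]
      by (intro isCont_tendsto_compose[OF _ h0]) (auto intro: DERIV_isCont)
    then show "((\<lambda>e. Li2 (h e)) \<longlongrightarrow> 0) (at_right 0)" by simp
    \<comment> \<open>The product of logarithms is \<open>h e * Ln (h e)\<close> times
      \<open>dilog_ker (h e)\<close>; the first factor tends to \<open>0\<close> like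
      \<open>e * ln e\<close>, the second stays bounded.\<close>
    have "((\<lambda>e. (of_real (e * ln e) * (1 + \<i>) + of_real e * ((1 + \<i>) * Ln (1 + \<i>))) * dilog_ker (h e))
        \<longlongrightarrow> (of_real 0 * (1 + \<i>) + of_real 0 * ((1 + \<i>) * Ln (1 + \<i>))) * dilog_ker 0) (at_right 0)"
    proof (intro tendsto_intros)
      show "((\<lambda>e::real. e * ln e) \<longlongrightarrow> 0) (at_right 0)" by real_asymp
      have "isCont dilog_ker 0"
        using dilog_ker_holomorphic open_dilog_dom zero_in_dilog_dom
        by (meson continuous_on_eq_continuous_at holomorphic_on_imp_continuous_on)
      then show "((\<lambda>e. dilog_ker (h e)) \<longlongrightarrow> dilog_ker 0) (at_right 0)"
        by (rule isCont_tendsto_compose[OF _ h0])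
    qed
    moreover have "\<forall>\<^sub>F e in at_right 0. (of_real (e * ln e) * (1 + \<i>) + of_real e * ((1 + \<i>) * Ln (1 + \<i>))) * dilog_ker (h e)
        = Ln (h e) * Ln (1 - h e)"
    proof (rule eventually_at_rightI[of 0 1])
      fix e :: real assume e: "e \<in> {0<..<1}"
      then have ne: "h e \<noteq> 0" by (simp add: h_def complex_eq_iff)
      have "1 + \<i> \<noteq> 0" by (simp add: complex_eq_iff)
      then have "Ln (h e) = of_real (ln e) + Ln (1 + \<i>)"
        unfolding h_def using e by (subst Ln_times_of_real) (auto simp: Ln_of_real)
      then have "(of_real (e * ln e) * (1 + \<i>) + of_real e * ((1 + \<i>) * Ln (1 + \<i>))) = h e * Ln (h e)"
        by (simp add: h_def algebra_simps)
      then show "(of_real (e * ln e) * (1 + \<i>) + of_real e * ((1 + \<i>) * Ln (1 + \<i>))) * dilog_ker (h e)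
        = Ln (h e) * Ln (1 - h e)"
        using ne by (simp add: dilog_ker_def)
    qed simp
    ultimately show "((\<lambda>e. Ln (h e) * Ln (1 - h e)) \<longlongrightarrow> 0) (at_right 0)"
      by (auto intro: Lim_transform_eventually)
  qed
  moreover have "\<forall>\<^sub>F e in at_right 0. H (h e) = k"
    using hS by eventually_elim (rule k)
  ultimately have "((\<lambda>e::real. k) \<longlongrightarrow> of_real (pi\<^sup>2 / 6)) (at_right 0)"
    by (auto intro: Lim_transform_eventually)
  then have "k = of_real (pi\<^sup>2 / 6)" by (simp add: tendsto_const_iff)
  with k[of u] assms show ?thesis by (simp add: S_def H_def algebra_simps)
qed

section \<open>The zero of the dilogarithm equation\<close>

text \<open>
  In the coordinate \<open>s = Ln w\<close> the equation for \<open>w0\<close> is \<open>Phi s = 0\<close>. The point is that \<open>Im (Phi' s) < - 2 * pi\<close>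
  for \<open>-pi < Im s < 0\<close>, so that \<open>Phi\<close> is injective there and has a zero next to every near-zero.
\<close>
definition Phi :: "complex \<Rightarrow> complex" where
  "Phi s = Li2 (exp s) - 2 * of_real pi * \<i> * s"

lemma Phi_has_field_derivative:
  assumes "exp s \<in> dilog_dom"
  shows "(Phi has_field_derivative - Ln (1 - exp s) - 2 * of_real pi * \<i>) (at s)"
proof -
  have "((\<lambda>s. Li2 (exp s)) has_field_derivative (- dilog_ker (exp s)) * exp s) (at s)"
    by (rule DERIV_chain2[where f = Li2 and g = exp, OF Li2_has_field_derivative[OF assms]]) (auto intro!: derivative_eq_intros)
  then have "((\<lambda>s. Li2 (exp s)) has_field_derivative - Ln (1 - exp s)) (at s)"
    by (simp add: dilog_ker_def)
  then show ?thesis unfolding Phi_def by (auto intro!: derivative_eq_intros)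
qed

text \<open>A complex difference quotient obeys no mean value theorem, but the real part of any
  constant multiple of it does. The multipliers \<open>- \<i>\<close> and \<open>1\<close> yield its
  imaginary and its real part, at possibly different points of the segment.\<close>

lemma Phi_quotient:
  assumes ne: "s \<noteq> t" and seg: "\<And>x. x \<in> closed_segment s t \<Longrightarrow> exp x \<in> dilog_dom"
  shows "\<exists>x\<in>closed_segment s t. Im ((Phi t - Phi s) / (t - s)) = - Im (Ln (1 - exp x)) - 2 * pi"
    and "\<exists>x\<in>closed_segment s t. Re ((Phi t - Phi s) / (t - s)) = - ln (cmod (1 - exp x))"
proof -
  have d: "\<And>x. x \<in> closed_segment s t \<Longrightarrow>
      ((\<lambda>x. c * Phi x / (t - s)) has_field_derivative c * (- Ln (1 - exp x) - 2 * of_real pi * \<i>) / (t - s)) (at x)" for c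
    using seg by (intro DERIV_cdivide DERIV_cmult Phi_has_field_derivative)
  have eq: "c * p / (t - s) * (t - s) = c * p" for c p using ne by simp
  have "\<exists>x. x \<in> closed_segment s t \<and> Re (c * ((Phi t - Phi s) / (t - s))) =
      Re (c * (- Ln (1 - exp x) - 2 * of_real pi * \<i>))" for c
    using complex_mvt_line[where w = s and z = t and f = "\<lambda>x. c * Phi x / (t - s)", OF d, simplified eq]
    by (simp add: diff_divide_distrib right_diff_distrib)
  note * = this
  show "\<exists>x\<in>closed_segment s t. Im ((Phi t - Phi s) / (t - s)) = - Im (Ln (1 - exp x)) - 2 * pi"
  proof -
    obtain x where x: "x \<in> closed_segment s t"
        "Re (- \<i> * ((Phi t - Phi s) / (t - s))) = Re (- \<i> * (- Ln (1 - exp x) - 2 * of_real pi * \<i>))"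
      using *[of "- \<i>"] by blast
    have "Re (- \<i> * z) = Im z" for z by simp
    then have "Im ((Phi t - Phi s) / (t - s)) = Im (- Ln (1 - exp x) - 2 * of_real pi * \<i>)"
      using x(2) by (simp only:)
    then show ?thesis using x(1) by (intro bexI[of _ x]) auto
  qed
  show "\<exists>x\<in>closed_segment s t. Re ((Phi t - Phi s) / (t - s)) = - ln (cmod (1 - exp x))"
  proof -
    obtain x where x: "x \<in> closed_segment s t" "Re ((Phi t - Phi s) / (t - s)) = Re (- Ln (1 - exp x) - 2 * of_real pi * \<i>)"
      using *[of 1] by auto
    have "1 - exp x \<noteq> 0" using seg[OF x(1)] by (auto simp: in_dilog_dom)
    then show ?thesis using x by (intro bexI[of _ x]) auto
  qed
qed

lemma lower_strip:
  assumes "-pi < Im s" "Im s < 0"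
  shows "Im (exp s) < 0" "exp s \<in> dilog_dom" "Im (Ln (1 - exp s)) > 0"
proof -
  have "sin (Im s) < 0" using sin_gt_zero[of "- Im s"] assms by simp
  then show 1: "Im (exp s) < 0" by (simp add: Im_exp mult_pos_neg)
  then show "exp s \<in> dilog_dom" by (intro Im_nonzero_dilog_dom) simp
  have "Im (1 - exp s) > 0" using 1 by simp
  then show "Im (Ln (1 - exp s)) > 0"
    using Im_Ln_pos_lt_imp by blast
qed

lemma closed_segment_lower_strip:
  assumes "-pi < Im s" "Im s < 0" "-pi < Im t" "Im t < 0" "x \<in> closed_segment s t"
  shows "-pi < Im x \<and> Im x < 0"
proof -
  have "convex {x. Im x > -pi}" "convex {x. Im x < 0}"
    by (rule convex_halfspace_Im_gt, rule convex_halfspace_Im_lt)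
  then have "convex ({x. Im x > -pi} \<inter> {x. Im x < 0})" by (rule convex_Int)
  then have "closed_segment s t \<subseteq> ({x. Im x > -pi} \<inter> {x. Im x < 0})"
    using assms by (intro closed_segment_subset) auto
  with assms show ?thesis by auto
qed

lemma Phi_expanding:
  assumes "-pi < Im s" "Im s < 0" "-pi < Im t" "Im t < 0"
  shows "cmod (Phi t - Phi s) \<ge> 2 * pi * cmod (t - s)"
proof (cases "s = t")
  case False
  note seg = closed_segment_lower_strip[OF assms]
  obtain x where x: "x \<in> closed_segment s t" "Im ((Phi t - Phi s) / (t - s)) = - Im (Ln (1 - exp x)) - 2 * pi"
    using Phi_quotient(1)[OF False] lower_strip(2) seg by metis
  have "Im (Ln (1 - exp x)) > 0" using lower_strip(3) seg[OF x(1)] by blast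
  then have "2 * pi \<le> \<bar>Im ((Phi t - Phi s) / (t - s))\<bar>" using x(2) by simp
  also have "\<dots> \<le> cmod ((Phi t - Phi s) / (t - s))" by (rule abs_Im_le_cmod)
  finally show ?thesis using False by (simp add: norm_divide field_simps)
qed simp

text \<open>All terms of the series are real and nonnegative, and the first one is
  \<open>x\<close>.\<close>

lemma Li2_real_bounds:
  assumes "0 \<le> x" "x < 1"
  shows "Im (Li2 (of_real x)) = 0" "x \<le> Re (Li2 (of_real x))"
proof -
  have s: "(\<lambda>n. complex_of_real (x ^ Suc n / real (Suc n) ^ 2)) sums Li2 (of_real x)"
    using dilog_series_sums[of "of_real x"] Li2_eq_series[of "of_real x"] assms by simp
  from sums_Im[OF s] show "Im (Li2 (of_real x)) = 0" by (simp add: sums_iff)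
  have r: "(\<lambda>n. x ^ Suc n / real (Suc n) ^ 2) sums Re (Li2 (of_real x))"
    using sums_Re[OF s] by simp
  have "sum (\<lambda>n. x ^ Suc n / real (Suc n) ^ 2) {..<1} \<le> Re (Li2 (of_real x))"
    using assms by (intro sum_le_suminf[of _ "{..<1}", THEN order_trans, OF sums_summable[OF r]])
       (use sums_unique[OF r] in auto)
  then show "x \<le> Re (Li2 (of_real x))" by simp
qed

text \<open>\<open>Phi_expanding\<close> covers only the lower strip, so a zero elsewhere has to be
  excluded. On the real axis \<open>Im (Phi s) = - 2 * pi * Re s\<close> leaves only
  \<open>s = 0\<close>, which is outside the domain. A zero \<open>s\<close> in the upper strip is
  joined to a real point \<open>L < 0\<close> close to \<open>0\<close>: the quotient
  \<open>m\<close> between them has \<open>Im m \<le> - pi\<close> and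
  \<open>Re m \<ge> - M\<close>, and solving \<open>m * (s - L) = - Phi L\<close> for
  \<open>Im s\<close> gives a negative value.\<close>

lemma Phi_zero_lower:
  assumes "\<bar>Im s\<bar> < pi" "exp s \<in> dilog_dom" "Phi s = 0"
  shows "Im s < 0"
proof (rule ccontr)
  assume "\<not> Im s < 0"
  then consider "Im s = 0" | "Im s > 0" by linarith
  then show False
  proof cases
    case 1
    then have s: "s = of_real (Re s)" by (simp add: complex_eq_iff)
    then have e: "exp s = of_real (exp (Re s))" by (metis exp_of_real)
    have "exp (Re s) < 1"
    proof (rule ccontr)
      assume "\<not> exp (Re s) < 1"
      then show False using assms(2) unfolding e by (auto simp: dilog_dom_def)
    qed
    then have "Im (Li2 (exp s)) = 0" unfolding e by (intro Li2_real_bounds) auto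
    then have "Im (Phi s) = - 2 * pi * Re s" unfolding Phi_def by simp
    then have "Re s = 0" using assms(3) by simp
    then show False using \<open>exp (Re s) < 1\<close> by simp
  next
    case 2
    \<comment> \<open>Bounds \<open>ln (cmod (1 - exp x))\<close> on the whole segment, where
      \<open>Re x \<le> \<bar>Re s\<bar>\<close>.\<close>
    define M where "M = ln (1 + exp \<bar>Re s\<bar>)"
    have "M > 0" unfolding M_def by (intro ln_gt_zero) simp
    \<comment> \<open>The first entry of the minimum gives \<open>exp L \<ge> 1/2\<close> and hence
      \<open>Li2 (exp L) \<ge> 1/2\<close>. The second makes \<open>2 * pi * (- L) * M\<close> at
      most \<open>pi / 4\<close>, too small to compensate the term \<open>- pi / 2\<close> at the
      end.\<close>
    define L where "L = - min (ln 2) (1 / (8 * M))"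
    have L: "L < 0" "L \<ge> - ln 2" "- L * M \<le> 1 / 8"
    proof -
      show "L < 0" using \<open>M > 0\<close> by (simp add: L_def)
      show "L \<ge> - ln 2" by (simp add: L_def)
      have "- L * M \<le> 1 / (8 * M) * M" using \<open>M > 0\<close> by (intro mult_right_mono) (auto simp: L_def)
      then show "- L * M \<le> 1 / 8" using \<open>M > 0\<close> by simp
    qed
    have "exp (- ln 2) \<le> exp L" using L by simp
    then have eL: "exp L \<ge> 1 / 2" "exp L < 1" using L by (auto simp: exp_minus)
    have ne: "of_real L \<noteq> s" using 2 by auto
    have seg: "x = of_real L \<or> (0 < Im x \<and> Im x < pi) \<and> \<bar>Re x\<bar> \<le> max \<bar>L\<bar> \<bar>Re s\<bar> \<and> Re x \<le> \<bar>Re s\<bar>" if "x \<in> closed_segment (of_real L) s" for x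
    proof -
      have "\<exists>u. 0 \<le> u \<and> u \<le> 1 \<and> x = (1 - u) *\<^sub>R of_real L + u *\<^sub>R s"
        using that by (simp only: in_segment)
      then obtain u where u: "0 \<le> u" "u \<le> 1" "x = (1 - u) *\<^sub>R of_real L + u *\<^sub>R s"
        by metis
      show ?thesis
      proof (cases "u = 0")
        case False
        then have "0 < u * Im s" using u 2 by simp
        moreover have "u * Im s \<le> 1 * Im s" using u 2 by (intro mult_right_mono) auto
        moreover have "Re x = (1 - u) * L + u * Re s" using u by simp
        moreover have "(1 - u) * L \<le> 0" using L u by (simp add: mult_nonneg_nonpos)
        moreover have "u * Re s \<le> u * \<bar>Re s\<bar>" using u by (intro mult_left_mono) auto
        moreover have "u * \<bar>Re s\<bar> \<le> 1 * \<bar>Re s\<bar>" using u by (intro mult_right_mono) auto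
        moreover have "\<bar>Re x\<bar> \<le> max \<bar>L\<bar> \<bar>Re s\<bar>"
        proof -
          have "\<bar>Re x\<bar> \<le> \<bar>(1 - u) * L\<bar> + \<bar>u * Re s\<bar>" using u by simp
          also have "\<dots> = (1 - u) * \<bar>L\<bar> + u * \<bar>Re s\<bar>" using u by (simp add: abs_mult)
          also have "\<dots> \<le> (1 - u) * max \<bar>L\<bar> \<bar>Re s\<bar> + u * max \<bar>L\<bar> \<bar>Re s\<bar>"
            using u by (intro add_mono mult_left_mono) auto
          finally show ?thesis by (simp add: algebra_simps)
        qed
        ultimately show ?thesis using u assms by auto
      qed (use u in simp)
    qed
    have dom: "exp x \<in> dilog_dom" "Im (Ln (1 - exp x)) \<ge> - pi" "ln (cmod (1 - exp x)) \<le> M"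
      if "x \<in> closed_segment (of_real L) s" for x
    proof -
      show d: "exp x \<in> dilog_dom"
        using seg[OF that]
      proof
        assume "x = of_real L"
        then show ?thesis using eL by (simp add: ball_subset_dilog_dom)
      next
        assume "(0 < Im x \<and> Im x < pi) \<and> \<bar>Re x\<bar> \<le> max \<bar>L\<bar> \<bar>Re s\<bar> \<and> Re x \<le> \<bar>Re s\<bar>"
        then have "Im (exp x) > 0" using sin_gt_zero by (simp add: Im_exp)
        then show ?thesis by (intro Im_nonzero_dilog_dom) simp
      qed
      have ne: "1 - exp x \<noteq> 0" using d by (auto simp: in_dilog_dom)
      then show "Im (Ln (1 - exp x)) \<ge> - pi" using mpi_less_Im_Ln[of "1 - exp x"] by simp
      have "Re x \<le> \<bar>Re s\<bar>" using seg[OF that] L by auto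
      have "cmod (1 - exp x) \<le> 1 + cmod (exp x)" using norm_triangle_ineq4[of 1 "exp x"] by simp
      also have "\<dots> \<le> 1 + exp \<bar>Re s\<bar>" using \<open>Re x \<le> \<bar>Re s\<bar>\<close> by simp
      finally show "ln (cmod (1 - exp x)) \<le> M" unfolding M_def using ne
        by (subst ln_le_cancel_iff) (auto intro: add_pos_pos)
    qed
    define m where "m = (Phi s - Phi (of_real L)) / (s - of_real L)"
    obtain x where x: "x \<in> closed_segment (of_real L) s" "Im m = - Im (Ln (1 - exp x)) - 2 * pi"
      using Phi_quotient(1)[OF ne dom(1)] unfolding m_def by blast
    obtain x' where x': "x' \<in> closed_segment (of_real L) s" "Re m = - ln (cmod (1 - exp x'))"
      using Phi_quotient(2)[OF ne dom(1)] unfolding m_def by blast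
    have m: "Im m \<le> - pi" "Re m \<ge> - M"
      using x(2) dom(2)[OF x(1)] x'(2) dom(3)[OF x'(1)] by linarith+
    have "m * (s - of_real L) = - Phi (of_real L)" using ne assms by (simp add: m_def)
    moreover have "Phi (of_real L) = Li2 (of_real (exp L)) - 2 * of_real pi * \<i> * of_real L"
      by (simp add: Phi_def exp_of_real)
    ultimately have eq: "m * (s - of_real L) = - Li2 (of_real (exp L)) + 2 * of_real pi * \<i> * of_real L"
      by simp
    define l where "l = Re (Li2 (of_real (exp L)))"
    have l: "l \<ge> 1 / 2" "Im (Li2 (of_real (exp L))) = 0"
      using Li2_real_bounds[of "exp L"] eL unfolding l_def by auto
    have e1: "Re m * (Re s - L) - Im m * Im s = - l"
      using arg_cong[OF eq, of Re] by (simp add: l_def)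
    have e2: "Re m * Im s + Im m * (Re s - L) = 2 * pi * L"
      using arg_cong[OF eq, of Im] l by simp
    \<comment> \<open>Multiplication by the conjugate of \<open>m\<close> eliminates
      \<open>Re s\<close>, about which nothing is known.\<close>
    have "((Re m)\<^sup>2 + (Im m)\<^sup>2) * Im s = Re m * (Re m * Im s + Im m * (Re s - L)) - Im m * (Re m * (Re s - L) - Im m * Im s)"
      by (simp add: power2_eq_square algebra_simps)
    also have "\<dots> = Re m * (2 * pi * L) + Im m * l" unfolding e1 e2 by simp
    also have "\<dots> \<le> (- M) * (2 * pi * L) + (- pi) * (1 / 2)"
    proof (rule add_mono)
      show "Re m * (2 * pi * L) \<le> (- M) * (2 * pi * L)"
        using m L by (intro mult_right_mono_neg) (auto simp: mult_nonneg_nonpos)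
      have "Im m * l \<le> (- pi) * l" using m l by (intro mult_right_mono) auto
      also have "\<dots> \<le> (- pi) * (1/2)" using l by (intro mult_left_mono_neg) auto
      finally show "Im m * l \<le> (- pi) * (1/2)" .
    qed
    also have "(- M) * (2 * pi * L) + (- pi) * (1 / 2) = 2 * pi * (- L * M - 1 / 4)" by (simp add: algebra_simps)
    also have "\<dots> < 0"
    proof (rule mult_pos_neg)
      show "- L * M - 1 / 4 < 0" using L(3) by linarith
    qed simp
    finally have "((Re m)\<^sup>2 + (Im m)\<^sup>2) * Im s < 0" .
    moreover have "((Re m)\<^sup>2 + (Im m)\<^sup>2) * Im s \<ge> 0"
      by (intro mult_nonneg_nonneg add_nonneg_nonneg zero_le_power2 less_imp_le[OF 2])
    ultimately show False by linarith
  qed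
qed

section \<open>Numerical location of the zero\<close>

lemma arctan_bounds_poly:
  assumes "0 \<le> x"
  shows "x - x ^ 3 / 3 \<le> arctan x" "arctan x \<le> x - x ^ 3 / 3 + x ^ 5 / 5"
proof -
  have "arctan 0 - (0 - 0 ^ 3 / 3) \<le> arctan x - (x - x ^ 3 / 3)"
  proof (rule DERIV_nonneg_imp_nondecreasing[OF assms])
    fix t :: real
    have "inverse (1 + t\<^sup>2) - (1 - t\<^sup>2) = t ^ 4 / (1 + t\<^sup>2)"
      using sum_power2_gt_zero_iff[of 1 t] by (simp add: field_simps power2_eq_square power4_eq_xxxx)
    also have "\<dots> \<ge> 0" by simp
    finally show "\<exists>y. ((\<lambda>t. arctan t - (t - t ^ 3 / 3)) has_real_derivative y) (at t) \<and> 0 \<le> y"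
      by (intro exI[of _ "inverse (1 + t\<^sup>2) - (1 - t\<^sup>2)"] conjI) (auto intro!: derivative_eq_intros)
  qed
  then show "x - x ^ 3 / 3 \<le> arctan x" by simp
  have "(0 - 0 ^ 3 / 3 + 0 ^ 5 / 5) - arctan 0 \<le> (x - x ^ 3 / 3 + x ^ 5 / 5) - arctan x"
  proof (rule DERIV_nonneg_imp_nondecreasing[OF assms])
    fix t :: real
    have "(1 - t\<^sup>2 + t ^ 4) - inverse (1 + t\<^sup>2) = t ^ 6 / (1 + t\<^sup>2)"
      using sum_power2_gt_zero_iff[of 1 t] by (simp add: field_simps eval_nat_numeral)
    also have "\<dots> \<ge> 0" by simp
    finally show "\<exists>y. ((\<lambda>t. (t - t ^ 3 / 3 + t ^ 5 / 5) - arctan t) has_real_derivative y) (at t) \<and> 0 \<le> y"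
      by (intro exI[of _ "(1 - t\<^sup>2 + t ^ 4) - inverse (1 + t\<^sup>2)"] conjI) (auto intro!: derivative_eq_intros)
  qed
  then show "arctan x \<le> x - x ^ 3 / 3 + x ^ 5 / 5" by simp
qed

text \<open>From the third term on the coefficients are at most \<open>1/9\<close>, so the tail is
  dominated by a geometric series.\<close>

lemma dilog_series_approx:
  assumes "cmod u < 1"
  shows "cmod (Li2 u - (u + u\<^sup>2 / 4)) \<le> cmod u ^ 3 / (9 * (1 - cmod u))"
proof -
  have "(\<lambda>n. u ^ Suc n / of_nat (Suc n) ^ 2) sums Li2 u"
    using dilog_series_sums[of u] Li2_eq_series[OF assms] assms by simp
  from sums_split_initial_segment[OF this, of 2]
  have s: "(\<lambda>n. u ^ Suc (n + 2) / of_nat (Suc (n + 2)) ^ 2) sums (Li2 u - (u + u\<^sup>2 / 4))"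
    by (simp add: numeral_2_eq_2)
  have g: "(\<lambda>n. cmod u ^ 3 / 9 * cmod u ^ n) sums (cmod u ^ 3 / 9 * (1 / (1 - cmod u)))"
    by (intro sums_mult geometric_sums) (use assms in simp)
  have "cmod (suminf (\<lambda>n. u ^ Suc (n + 2) / of_nat (Suc (n + 2)) ^ 2)) \<le> suminf (\<lambda>n. cmod u ^ 3 / 9 * cmod u ^ n)"
  proof (rule norm_suminf_le)
    fix n
    have "norm (u ^ Suc (n + 2) / of_nat (Suc (n + 2)) ^ 2) = cmod u ^ 3 * cmod u ^ n / real (n + 3) ^ 2"
      by (simp only: norm_divide norm_power norm_of_nat) (simp add: power_add eval_nat_numeral)
    also have "\<dots> \<le> cmod u ^ 3 * cmod u ^ n / 9"
    proof (intro divide_left_mono)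
      have "(3::real) ^ 2 \<le> real (n + 3) ^ 2" by (intro power_mono) auto
      then show "9 \<le> real (n + 3) ^ 2" by simp
    qed auto
    finally show "norm (u ^ Suc (n + 2) / of_nat (Suc (n + 2)) ^ 2) \<le> cmod u ^ 3 / 9 * cmod u ^ n" by simp
  qed (use g in \<open>simp add: sums_iff\<close>)
  then show ?thesis using s g by (simp add: sums_iff)
qed

lemma mult_interval:
  fixes x y :: real
  assumes "0 \<le> a" "a \<le> x" "x \<le> b" "0 \<le> c" "c \<le> y" "y \<le> d"
  shows "a * c \<le> x * y \<and> x * y \<le> b * d"
  using assms by (intro conjI mult_mono) auto

lemma ln_5_bounds: "1606/1000 \<le> ln (5::real)" "ln (5::real) \<le> 1613/1000"
  using ln_approx_bounds[of 5 5] by (simp_all add: eval_nat_numeral)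

text \<open>
  By the reflection formula \<open>Li2 wc\<close> is obtained from the power series at \<open>1 - wc\<close>, which has modulus about \<open>1/5\<close>.
\<close>
lemma Phi_small:
  defines "wc \<equiv> Complex (11/12) (-2/11)"
  shows "cmod (Phi (Ln wc)) < (3/100)" "-(1963/10000) < Im (Ln wc)" "Im (Ln wc) < -(1952/10000)"
proof -
  \<comment> \<open>\<open>wc\<close> and \<open>uc\<close> are simple rational approximations to
    \<open>w0\<close> and \<open>1 - w0\<close>. Their squared moduli have the common denominator
    \<open>17424\<close>, which is \<open>132\<close> squared.\<close>
  define uc where "uc = Complex (1/12) (2/11)"
  have wu: "wc = 1 - uc" "1 - wc = uc" by (auto simp: wc_def uc_def complex_eq_iff)
  have ne: "wc \<noteq> 0" "uc \<noteq> 0" by (auto simp: wc_def uc_def complex_eq_iff)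
  have nw: "cmod wc = sqrt (15217/17424)" "cmod uc = sqrt (697/17424)"
    by (simp_all add: wc_def uc_def cmod_def power2_eq_square)
  have "ln (17424/15217::real) \<in> {(1352/10000)..(1356/10000)}"
    using ln_approx_bounds[of "17424/15217" 1] by (simp add: eval_nat_numeral)
  moreover have "ln (17424/15217::real) = - ln (15217/17424)" by (simp add: ln_div)
  ultimately have A: "(676/10000) \<le> - Re (Ln wc)" "- Re (Ln wc) \<le> (678/10000)"
    using ne nw by (simp_all add: ln_sqrt)
  have "Im (Ln wc) = - arctan (24/121)"
    using ne by (subst Im_Ln_eq) (auto simp: wc_def arctan_minus)
  then have B: "(1957/10000) \<le> - Im (Ln wc)" "- Im (Ln wc) \<le> (1959/10000)"
    using arctan_bounds_poly[of "24/121"] by (simp_all add: eval_nat_numeral)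
  show "-(1963/10000) < Im (Ln wc)" "Im (Ln wc) < -(1952/10000)" using B by simp_all
  have l5: "ln (25::real) = 2 * ln 5" using ln_realpow[of 5 2] by simp
  \<comment> \<open>\<open>17424 / 697\<close> lies just below \<open>25\<close>, so bounds for
    \<open>ln 5\<close> determine the modulus well enough.\<close>
  have "ln (697/17424::real) \<ge> ln (1/25)" "ln (697/17424::real) \<le> ln (1/24)"
    by (subst ln_le_cancel_iff; simp)+
  moreover have "ln (25/24::real) \<le> 25/24 - 1" by (rule ln_le_minus_one) simp
  moreover have "ln (1/24::real) = ln (25/24) - ln 25" "ln (1/25::real) = - ln 25" 
    by (simp_all add: ln_div)
  moreover have "Re (Ln uc) = ln (697/17424) / 2" using ne nw by (simp add: ln_sqrt)
  ultimately have C: "(1585/1000) \<le> - Re (Ln uc)" "- Re (Ln uc) \<le> (1614/1000)"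
    using ln_5_bounds l5 by simp_all
  have "Im (Ln uc) = arctan (24/11)"
    using ne by (subst Im_Ln_eq) (auto simp: uc_def)
  also have "\<dots> = pi / 2 - arctan (11/24)" using arctan_inverse[of "24/11"] by simp
  finally have D: "(7423/1000) \<le> Im (Ln uc) + 2 * pi" "Im (Ln uc) + 2 * pi \<le> (74283/10000)"
    using arctan_bounds_poly[of "11/24"] pi_approx by (simp_all add: eval_nat_numeral)
  define E where "E = Li2 uc - (uc + uc\<^sup>2 / 4)"
  have "cmod uc \<le> (2001/10000)" unfolding nw by (intro real_le_lsqrt) (auto simp: power2_eq_square)
  have "cmod E \<le> cmod uc ^ 3 / (9 * (1 - cmod uc))"
    unfolding E_def by (rule dilog_series_approx) (use \<open>cmod uc \<le> (2001/10000)\<close> in simp)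
  also have "\<dots> \<le> (2001/10000) ^ 3 / (9 * (1 - (2001/10000)))"
    using \<open>cmod uc \<le> (2001/10000)\<close> by (intro frac_le power_mono mult_left_mono) auto
  also have "\<dots> \<le> (12/10000)" by (simp add: eval_nat_numeral)
  finally have E: "cmod E \<le> (12/10000)" .
  then have E': "\<bar>Re E\<bar> \<le> (12/10000)" "\<bar>Im E\<bar> \<le> (12/10000)"
    using abs_Re_le_cmod[of E] abs_Im_le_cmod[of E] by linarith+
  have LiE: "Li2 uc = uc + uc\<^sup>2 / 4 + E" by (simp add: E_def)
  have L: "Re (Li2 uc) \<in> {(755/10000)..(781/10000)}" "Im (Li2 uc) \<in> {(188/1000)..(1907/10000)}"
    using E' unfolding LiE by (auto simp: uc_def power2_eq_square abs_le_iff)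
  have "Im uc > 0" by (simp add: uc_def)
  from Li2_reflection[OF this] have "Li2 wc = of_real (pi\<^sup>2 / 6) - Ln uc * Ln wc - Li2 uc"
    unfolding wu by simp
  \<comment> \<open>The reflection formula contributes \<open>Ln uc * Ln wc\<close>, which merges
    with the linear term of \<open>Phi\<close> into one product. Up to sign its real and imaginary
    parts are built from the positive numbers \<open>a\<close>, \<open>b\<close>, \<open>c\<close>,
    \<open>d\<close>, so that interval products can be bounded end by end.\<close>
  then have P: "Phi (Ln wc) = of_real (pi\<^sup>2 / 6) - (Ln uc + 2 * of_real pi * \<i>) * Ln wc - Li2 uc"
    unfolding Phi_def using ne by (simp add: algebra_simps)
  define a b c d where abcd: "a = - Re (Ln wc)" "b = - Im (Ln wc)" "c = - Re (Ln uc)" "d = Im (Ln uc) + 2 * pi"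
  have reim: "Re (Ln uc) = - c" "Im (Ln uc) = d - 2 * pi" "Re (Ln wc) = - a" "Im (Ln wc) = - b"
    using abcd by auto
  have "Re (Phi (Ln wc)) = pi\<^sup>2 / 6 - c * a - d * b - Re (Li2 uc)"
    unfolding P by (simp add: reim)
  moreover have "Im (Phi (Ln wc)) = - c * b + d * a - Im (Li2 uc)"
    unfolding P by (simp add: reim algebra_simps)
  moreover note ABCD = A[folded abcd] B[folded abcd] C[folded abcd] D[folded abcd]
  moreover have "(1585/1000) * (676/10000) \<le> c * a \<and> c * a \<le> (1614/1000) * (678/10000)"
    by (rule mult_interval) (use ABCD in simp_all)
  moreover have "(1585/1000) * (1957/10000) \<le> c * b \<and> c * b \<le> (1614/1000) * (1959/10000)"
    by (rule mult_interval) (use ABCD in simp_all)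
  moreover have "(7423/1000) * (676/10000) \<le> d * a \<and> d * a \<le> (74283/10000) * (678/10000)"
    by (rule mult_interval) (use ABCD in simp_all)
  moreover have "(7423/1000) * (1957/10000) \<le> d * b \<and> d * b \<le> (74283/10000) * (1959/10000)"
    by (rule mult_interval) (use ABCD in simp_all)
  moreover have "(31415/10000) * (31415/10000) \<le> pi * pi \<and> pi * pi \<le> (31416/10000) * (31416/10000)"
    by (rule mult_interval) (use pi_approx in simp_all)
  ultimately have "\<bar>Re (Phi (Ln wc))\<bar> \<le> (13/1000)" "\<bar>Im (Phi (Ln wc))\<bar> \<le> (12/1000)"
    using L unfolding power2_eq_square atLeastAtMost_iff by - (linarith+)
  then show "cmod (Phi (Ln wc)) < (3/100)"
    using cmod_le[of "Phi (Ln wc)"] by linarith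
qed

definition w0_adm :: "complex \<Rightarrow> bool" where
  "w0_adm w \<longleftrightarrow> w \<notin> of_real ` ({..0} \<union> {1..}) \<and> Li2 w - 2 * of_real pi * \<i> * Ln w = 0"

lemma w0_adm_imp:
  assumes "w0_adm w"
  shows "Phi (Ln w) = 0" "-pi < Im (Ln w)" "Im (Ln w) < 0" "exp (Ln w) = w"
proof -
  have ne: "w \<noteq> 0" "w \<in> dilog_dom" "w \<notin> \<real>\<^sub>\<le>\<^sub>0"
    using assms by (auto simp: w0_adm_def dilog_dom_def image_Un nonpos_Reals_def image_iff)
  show e: "exp (Ln w) = w" using ne by simp
  show P: "Phi (Ln w) = 0" using assms ne by (simp add: Phi_def w0_adm_def)
  have i: "\<bar>Im (Ln w)\<bar> < pi"
    using Im_Ln_less_pi[OF ne(3)] mpi_less_Im_Ln[OF ne(1)] by linarith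
  then show "-pi < Im (Ln w)" by linarith
  show "Im (Ln w) < 0" by (rule Phi_zero_lower[OF i]) (use e ne P in auto)
qed

text \<open>On the circle of radius \<open>1/100\<close> around \<open>Ln wc\<close> the expansion
  property gives \<open>cmod (Phi s) \<ge> 2 * pi / 100 - 3/100\<close>, which exceeds
  \<open>3/100\<close> and thus the value at the centre; so there is a zero inside. Passing from
  \<open>s\<close> back to \<open>exp s\<close> costs at most the factor
  \<open>(9346/10000) * (102/100)\<close>, whence \<open>96/10000\<close>.\<close>

lemma w0_adm_exists:
  defines "wc \<equiv> Complex (11/12) (-2/11)"
  shows "\<exists>w. w0_adm w \<and> cmod (w - wc) < (96/10000)"
proof -
  define sc where "sc = Ln wc"
  note num = Phi_small[folded wc_def, folded sc_def]
  have strip: "-pi < Im s \<and> Im s < 0" if "cmod (s - sc) \<le> 1/100" for s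
  proof -
    have "\<bar>Im (s - sc)\<bar> \<le> 1/100" using abs_Im_le_cmod[of "s - sc"] that by linarith
    then have "\<bar>Im s - Im sc\<bar> \<le> 1/100" by simp
    then show ?thesis using num pi_gt3 by (intro conjI; linarith)
  qed
  have der: "(Phi has_field_derivative - Ln (1 - exp s) - 2 * of_real pi * \<i>) (at s)" if "s \<in> cball sc (1/100)" for s
    using strip[of s] that by (intro Phi_has_field_derivative lower_strip(2)) (auto simp: dist_norm norm_minus_commute)
  have "\<exists>s\<in>ball sc (1/100). Phi s = 0"
  proof (rule holomorphic_contract_to_zero)
    show "continuous_on (cball sc (1/100)) Phi"
      using der by (meson DERIV_isCont continuous_at_imp_continuous_on)
    show "Phi holomorphic_on ball sc (1/100)"
      using der ball_subset_cball by (subst holomorphic_on_open) blast+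
    show "cmod (Phi sc) < cmod (Phi s)" if "cmod (sc - s) = 1/100" for s
    proof -
      have "cmod (s - sc) = 1/100" using that by (simp add: norm_minus_commute)
      with Phi_expanding[of sc s] have "-pi < Im sc \<and> Im sc < 0 \<Longrightarrow> -pi < Im s \<and> Im s < 0 \<Longrightarrow>
          cmod (Phi s - Phi sc) \<ge> 2 * pi * (1/100)" by metis
      then have "cmod (Phi s - Phi sc) \<ge> 2 * pi * (1/100)"
        using strip[of s] strip[of sc] \<open>cmod (s - sc) = 1/100\<close> by simp
      moreover have "cmod (Phi s - Phi sc) \<le> cmod (Phi s) + cmod (Phi sc)" by (rule norm_triangle_ineq4)
      ultimately show ?thesis using num(1) pi_gt3 by linarith
    qed
  qed auto
  then obtain s where s: "cmod (s - sc) < 1/100" "Phi s = 0"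
    by (auto simp: dist_norm norm_minus_commute)
  have st: "-pi < Im s" "Im s < 0" using strip[of s] s by auto
  then have L: "Ln (exp s) = s" using pi_gt_zero by (intro Ln_exp) linarith+
  have im: "Im (exp s) < 0" by (rule lower_strip(1)[OF st])
  have "w0_adm (exp s)"
    using s im unfolding w0_adm_def L by (auto simp: Phi_def)
  moreover have "cmod (exp s - wc) < (96/10000)"
  proof -
    have "wc \<noteq> 0" by (simp add: wc_def complex_eq_iff)
    then have "exp s - wc = wc * (exp (s - sc) - 1)"
      by (simp add: exp_diff sc_def field_simps)
    then have "cmod (exp s - wc) = cmod wc * cmod (exp (s - sc) - 1)"
      by (simp add: norm_mult)
    also have "\<dots> \<le> (9346/10000) * ((102/100) * cmod (s - sc))"
    proof (rule mult_mono)
      have "\<bar>Re (s - sc)\<bar> \<le> 1/100" using abs_Re_le_cmod[of "s - sc"] s by linarith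
      then have "exp \<bar>Re (s - sc)\<bar> \<le> 1 + \<bar>Re (s - sc)\<bar> + \<bar>Re (s - sc)\<bar>\<^sup>2"
        by (intro exp_bound) auto
      also have "\<bar>Re (s - sc)\<bar>\<^sup>2 \<le> (1/100)\<^sup>2"
        using \<open>\<bar>Re (s - sc)\<bar> \<le> 1/100\<close> by (intro power_mono) auto
      finally have "exp \<bar>Re (s - sc)\<bar> \<le> 102/100"
        using \<open>\<bar>Re (s - sc)\<bar> \<le> 1/100\<close> by (simp add: power2_eq_square)
      then have "exp \<bar>Re (s - sc)\<bar> * cmod (s - sc) \<le> (102/100) * cmod (s - sc)"
        by (rule mult_right_mono) simp
      then show "cmod (exp (s - sc) - 1) \<le> (102/100) * cmod (s - sc)"
        using Taylor_exp[of "s - sc" 0] by simp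
      show "cmod wc \<le> 9346/10000"
        unfolding wc_def cmod_def by (intro real_le_lsqrt) (auto simp: power2_eq_square)
    qed auto
    finally have "cmod (exp s - wc) \<le> (9346/10000) * ((102/100) * cmod (s - sc))" .
    then show ?thesis using s by simp
  qed
  ultimately show ?thesis by blast
qed

lemma w0_adm_unique:
  assumes "w0_adm w" "w0_adm w'" shows "w = w'"
proof -
  note a = w0_adm_imp[OF assms(1)] and b = w0_adm_imp[OF assms(2)]
  have "2 * pi * cmod (Ln w' - Ln w) \<le> 0"
    using Phi_expanding[OF a(2,3) b(2,3)] a(1) b(1) by simp
  moreover have "\<not> pi \<le> 0" using pi_gt_zero by linarith
  ultimately have "Ln w' = Ln w" by (simp add: mult_le_0_iff)
  then show ?thesis using a(4) b(4) by metis
qed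

lemma w0_adm_w0: "w0_adm w0" and w0_near: "cmod (w0 - Complex (11/12) (-2/11)) < (96/10000)"
proof -
  obtain w where w: "w0_adm w" "cmod (w - Complex (11/12) (-2/11)) < (96/10000)"
    using w0_adm_exists by blast
  have "w0 = (THE w. w0_adm w)" by (simp add: w0_def w0_adm_def)
  also have "\<dots> = w" using w w0_adm_unique by (intro the_equality) auto
  finally show "w0_adm w0" "cmod (w0 - Complex (11/12) (-2/11)) < (96/10000)" using w by simp_all
qed

text \<open>The triangle inequality around \<open>wc\<close> with the error \<open>96/10000\<close>
  from \<open>w0_near\<close>. These bounds are the only decimals on which the later sign arguments
  rest.\<close>

lemma w0_bounds:
  "9249/10000 \<le> cmod w0" "cmod w0 \<le> 9443/10000"
  "1903/10000 \<le> cmod (1 - w0)" "cmod (1 - w0) \<le> 2097/10000"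
  "1700/10000 < Im (1 - w0)" "0 < Re (1 - w0)" "Re (1 - w0) < 1000/10000" "Im w0 < 0" "0 < Re w0"
proof -
  define wc where "wc = Complex (11/12) (-2/11)"
  define d where "d = w0 - wc"
  have d: "cmod d < 96/10000" using w0_near by (simp add: d_def wc_def)
  have w: "w0 = wc + d" "1 - w0 = (1 - wc) - d" by (simp_all add: d_def)
  have nw: "cmod wc = sqrt (15217/17424)" "cmod (1 - wc) = sqrt (697/17424)"
    by (simp_all add: wc_def cmod_def power2_eq_square)
  have 1: "9345/10000 \<le> cmod wc" "2000/10000 - 1/10000 \<le> cmod (1 - wc)"
    unfolding nw by (intro real_le_rsqrt; simp add: power2_eq_square)+
  have 2: "cmod wc \<le> 9346/10000" "cmod (1 - wc) \<le> 2001/10000"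
    unfolding nw by (intro real_le_lsqrt; simp add: power2_eq_square)+
  show "9249/10000 \<le> cmod w0"
    using norm_diff_ineq[of wc d] d 1 unfolding w(1) by linarith
  show "1903/10000 \<le> cmod (1 - w0)"
    using norm_triangle_ineq2[of "1 - wc" d] d 1 unfolding w(2) by linarith
  show "cmod w0 \<le> 9443/10000"
    using norm_triangle_ineq[of wc d] d 2 unfolding w(1) by linarith
  show "cmod (1 - w0) \<le> 2097/10000"
    using norm_triangle_ineq4[of "1 - wc" d] d 2 unfolding w(2) by linarith
  have "\<bar>Re d\<bar> < 96/10000" "\<bar>Im d\<bar> < 96/10000"
    using abs_Re_le_cmod[of d] abs_Im_le_cmod[of d] d by linarith+
  then show "1700/10000 < Im (1 - w0)" "0 < Re (1 - w0)" "Re (1 - w0) < 1000/10000" "Im w0 < 0" "0 < Re w0"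
    unfolding w by (simp_all add: wc_def abs_less_iff)
qed

section \<open>The phase function and its saddle point\<close>

text \<open>The exponential rate of \<open>A1\<close>. By \<open>phase_z0\<close> it is also
  \<open>Re (phase z0)\<close>, the value that \<open>Re (phase z)\<close> must not reach on the
  rest of the contour.\<close>

definition growth :: real where "growth = - ln (cmod w0)"

lemma growth_ge: "557/10000 \<le> growth"
proof -
  have "ln (cmod w0) \<le> cmod w0 - 1" using w0_bounds by (intro ln_le_minus_one) linarith
  then show ?thesis unfolding growth_def using w0_bounds by linarith
qed

lemma Ln_u0: "Ln (1 - w0) = 2 * of_real pi * \<i> * (z0 - 1)"
  unfolding z0_def by simp

lemma z0_parts: "Re z0 = 1 + Im (Ln (1 - w0)) / (2 * pi)" "Im z0 = - ln (cmod (1 - w0)) / (2 * pi)"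
proof -
  have "1 - w0 \<noteq> 0" using w0_bounds by auto
  have z: "z0 = 1 - \<i> * Ln (1 - w0) / of_real (2 * pi)"
    unfolding z0_def by (simp add: field_simps)
  show "Re z0 = 1 + Im (Ln (1 - w0)) / (2 * pi)" "Im z0 = - ln (cmod (1 - w0)) / (2 * pi)"
    unfolding z minus_complex.sel Re_divide_of_real Im_divide_of_real using \<open>1 - w0 \<noteq> 0\<close> by simp_all
qed

lemma exp_z0: "exp (2 * of_real pi * \<i> * z0) = 1 - w0"
proof -
  have "1 - w0 \<noteq> 0" using w0_bounds by auto
  have "2 * of_real pi * \<i> * z0 = Ln (1 - w0) + 2 * of_real pi * \<i>"
    by (simp add: Ln_u0 algebra_simps)
  then show ?thesis using \<open>1 - w0 \<noteq> 0\<close> by (simp add: exp_add)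
qed

text \<open>\<open>1 - w0\<close> lies in the first quadrant above the diagonal, so its argument is
  between \<open>pi / 4\<close> and \<open>pi / 2\<close>. The lower bound is relaxed to
  \<open>pi / 6\<close>, that is \<open>13/12\<close> for the real part: there sine and cosine are
  explicit, and the study of \<open>descent\<close> is split at this point.\<close>

lemma Re_z0: "13/12 < Re z0" "Re z0 < 5/4"
proof -
  have "1 - w0 \<noteq> 0" "Re (1 - w0) > 0" "Im (1 - w0) > Re (1 - w0)" using w0_bounds by auto
  then have "Im (Ln (1 - w0)) = arctan (Im (1 - w0) / Re (1 - w0))"
    by (subst Im_Ln_eq) auto
  also have "\<dots> > arctan 1" using \<open>Re (1 - w0) > 0\<close> \<open>Im (1 - w0) > Re (1 - w0)\<close>
    by (intro arctan_monotone) (simp add: field_simps)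
  finally have "Im (Ln (1 - w0)) > pi / 4" by (simp add: arctan_one)
  then have "Im (Ln (1 - w0)) > pi / 6" using pi_gt_zero by linarith
  then show "13/12 < Re z0" unfolding z0_parts using pi_gt_zero by (simp add: field_simps)
  have "Im (Ln (1 - w0)) < pi / 2" using Re_Ln_pos_lt_imp[of "1 - w0"] \<open>Re (1 - w0) > 0\<close> by auto
  then show "Re z0 < 5/4" unfolding z0_parts using pi_gt_zero by (simp add: field_simps)
qed

text \<open>The height of the top side of the rectangle in the rescaled variable.\<close>

definition v0 :: real where "v0 = Im z0"

lemma v0_bounds: "0 < v0" "pi * v0 \<le> 833/1000" "v0 \<le> 278/1000"
proof -
  have p: "pi * v0 = - ln (cmod (1 - w0)) / 2" unfolding v0_def z0_parts by simp
  have "ln (cmod (1 - w0)) \<le> cmod (1 - w0) - 1" using w0_bounds by (intro ln_le_minus_one) linarith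
  then have "pi * v0 > 0" unfolding p using w0_bounds by linarith
  then show "0 < v0" by (simp add: zero_less_mult_iff)
  have "ln (1903/10000::real) \<le> ln (cmod (1 - w0))" using w0_bounds by (subst ln_le_cancel_iff) auto
  \<comment> \<open>The argument is \<open>1903/10000\<close>, the lower bound for
    \<open>cmod (1 - w0)\<close>, written so that only \<open>ln 5\<close> and a logarithm close to
    \<open>0\<close> occur.\<close>
  moreover have "ln (inverse (5 * (2000/1903))::real) = - (ln 5 + ln (2000/1903))"
    by (subst ln_inverse, subst ln_mult) simp_all
  moreover have "ln (2000/1903::real) \<le> 2000/1903 - 1" by (intro ln_le_minus_one) simp
  ultimately have "- ln (cmod (1 - w0)) \<le> 1665/1000" using ln_5_bounds by simp
  then show *: "pi * v0 \<le> 833/1000" unfolding p by simp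
  have "3 * v0 \<le> pi * v0" using \<open>0 < v0\<close> pi_gt3 by (intro mult_right_mono) auto
  then show "v0 \<le> 278/1000" using * by simp
qed

definition unit_exp :: "complex \<Rightarrow> complex" where "unit_exp z = exp (2 * of_real pi * \<i> * z)"

lemma norm_unit_exp: "cmod (unit_exp z) = exp (- 2 * pi * Im z)"
  by (simp add: unit_exp_def)

lemma norm_unit_exp_less_1: "Im z > 0 \<Longrightarrow> cmod (unit_exp z) < 1"
  by (simp add: norm_unit_exp)

lemma Re_unit_exp: "Re (unit_exp z) = cmod (unit_exp z) * cos (2 * pi * Re z)"
  and Im_unit_exp: "Im (unit_exp z) = cmod (unit_exp z) * sin (2 * pi * Re z)"
  unfolding norm_unit_exp by (simp_all add: unit_exp_def Re_exp Im_exp)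

lemma unit_exp_has_field_derivative [derivative_intros]:
  "(unit_exp has_field_derivative 2 * of_real pi * \<i> * unit_exp z) (at z)"
  unfolding unit_exp_def by (auto intro!: derivative_eq_intros)

lemma one_minus_unit_exp: "Im z > 0 \<Longrightarrow> Re (1 - unit_exp z) > 0" "Im z > 0 \<Longrightarrow> 1 - unit_exp z \<notin> \<real>\<^sub>\<le>\<^sub>0" "Im z > 0 \<Longrightarrow> 1 - unit_exp z \<noteq> 0"
proof -
  assume "Im z > 0"
  then have "Re (unit_exp z) < 1" using norm_unit_exp_less_1[of z] complex_Re_le_cmod[of "unit_exp z"] by linarith
  then show "Re (1 - unit_exp z) > 0" "1 - unit_exp z \<notin> \<real>\<^sub>\<le>\<^sub>0" "1 - unit_exp z \<noteq> 0"
    by (auto simp: complex_nonpos_Reals_iff)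
qed

lemma Li2_unit_exp_has_field_derivative:
  assumes "Im z > 0"
  shows "((\<lambda>z. Li2 (unit_exp z)) has_field_derivative - 2 * of_real pi * \<i> * Ln (1 - unit_exp z)) (at z)"
proof -
  have "unit_exp z \<in> dilog_dom" using assms by (intro ball_subset_dilog_dom norm_unit_exp_less_1)
  from DERIV_chain2[where f = Li2 and g = unit_exp, OF Li2_has_field_derivative[OF this] unit_exp_has_field_derivative]
  have "((\<lambda>z. Li2 (unit_exp z)) has_field_derivative (- dilog_ker (unit_exp z)) * (2 * of_real pi * \<i> * unit_exp z)) (at z)" .
  moreover have "unit_exp z \<noteq> 0" by (simp add: unit_exp_def)
  ultimately show ?thesis by (simp add: dilog_ker_def mult_ac)
qed

lemma Ln_unit_exp_has_field_derivative:
  assumes "Im z > 0"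
  shows "((\<lambda>z. Ln (1 - unit_exp z)) has_field_derivative - 2 * of_real pi * \<i> * unit_exp z / (1 - unit_exp z)) (at z)"
  using one_minus_unit_exp[OF assms] by (auto intro!: derivative_eq_intros simp: field_simps)

text \<open>
  At \<open>z / (N + 1/2)\<close> the function \<open>Q\<close> behaves like \<open>exp ((N + 1/2) * phase z)\<close>, with a saddle point at \<open>z0\<close>.
\<close>
definition phase :: "complex \<Rightarrow> complex" where
  "phase z = (Li2 (unit_exp z) - of_real (pi\<^sup>2 / 6)) / (2 * of_real pi * \<i> * z)"

definition phase' :: "complex \<Rightarrow> complex" where
  "phase' z = - (phase z + Ln (1 - unit_exp z)) / z"

lemma phase_has_field_derivative:
  assumes "Im z > 0"
  shows "(phase has_field_derivative phase' z) (at z)"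
proof -
  have "z \<noteq> 0" using assms by auto
  then show ?thesis unfolding phase_def phase'_def
    by (auto intro!: derivative_eq_intros Li2_unit_exp_has_field_derivative assms simp: field_simps power2_eq_square)
qed

lemma phase'_has_field_derivative:
  assumes "Im z > 0"
  shows "(phase' has_field_derivative (2 * of_real pi * \<i> * unit_exp z / (1 - unit_exp z) - 2 * phase' z) / z) (at z)"
proof -
  have "z \<noteq> 0" using assms by auto
  have "((\<lambda>z. - (phase z + Ln (1 - unit_exp z)) / z) has_field_derivative
     (- (phase' z + - 2 * of_real pi * \<i> * unit_exp z / (1 - unit_exp z)) * z - - (phase z + Ln (1 - unit_exp z)) * 1) / (z * z)) (at z)"
    by (intro DERIV_divide DERIV_minus DERIV_add phase_has_field_derivative Ln_unit_exp_has_field_derivative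
        assms DERIV_ident \<open>z \<noteq> 0\<close>)
  moreover have "- (phase z + Ln (1 - unit_exp z)) = z * phase' z" using \<open>z \<noteq> 0\<close> by (simp add: phase'_def)
  ultimately have "((\<lambda>z. - (phase z + Ln (1 - unit_exp z)) / z) has_field_derivative
     (- (phase' z + - 2 * of_real pi * \<i> * unit_exp z / (1 - unit_exp z)) * z - (z * phase' z) * 1) / (z * z)) (at z)" by simp
  moreover have "(- (phase' z + - 2 * of_real pi * \<i> * unit_exp z / (1 - unit_exp z)) * z - (z * phase' z) * 1) / (z * z)
     = (2 * of_real pi * \<i> * unit_exp z / (1 - unit_exp z) - 2 * phase' z) / z"
    using \<open>z \<noteq> 0\<close> one_minus_unit_exp(3)[OF assms] by (simp add: field_simps)
  ultimately show ?thesis unfolding phase'_def by simp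
qed

lemma unit_exp_z0: "unit_exp z0 = 1 - w0" by (simp add: unit_exp_def exp_z0)

lemma Im_z0: "Im z0 > 0" using v0_bounds by (simp add: v0_def)

lemma z0_ne: "z0 \<noteq> 0" using Im_z0 by auto

text \<open>Here the equation for \<open>w0\<close> enters. Together with reflection it gives
  \<open>Li2 (1 - w0) - pi\<^sup>2 / 6 = - (Ln (1 - w0) + 2 pi i) * Ln w0\<close>, and the bracket
  is \<open>2 pi i * z0\<close>. This explains the summand \<open>1\<close> in the definition of
  \<open>z0\<close>.\<close>

lemma Li2_u0: "Li2 (1 - w0) - of_real (pi\<^sup>2 / 6) = - (2 * of_real pi * \<i> * z0) * Ln w0"
proof -
  have "Im (1 - w0) > 0" using w0_bounds by linarith
  from Li2_reflection[OF this] have "Li2 w0 = of_real (pi\<^sup>2 / 6) - Ln (1 - w0) * Ln w0 - Li2 (1 - w0)" by simp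
  moreover have "Li2 w0 = 2 * of_real pi * \<i> * Ln w0" using w0_adm_w0 by (simp add: w0_adm_def)
  moreover have "Ln (1 - w0) = 2 * of_real pi * \<i> * z0 - 2 * of_real pi * \<i>" by (simp add: Ln_u0 algebra_simps)
  ultimately show ?thesis by (simp add: algebra_simps)
qed

lemma phase_z0: "phase z0 = - Ln w0"
  unfolding phase_def unit_exp_z0 Li2_u0 using z0_ne by simp

lemma phase'_z0: "phase' z0 = 0"
  unfolding phase'_def phase_z0 unit_exp_z0 by simp

text \<open>
  This is \<open>2 * pi * (cmod z)\<^sup>2 * (Re (phase z) - Re (phase z0))\<close> on the line \<open>Im z = v0\<close> through the saddle point. Without
  the denominator the second derivative is simple enough to show concavity near the double zero \<open>Re z0\<close>.
\<close>
definition descent :: "real \<Rightarrow> real" where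
  "descent x = x * Im (Li2 (unit_exp (Complex x v0))) + v0 * (pi\<^sup>2 / 6 - Re (Li2 (unit_exp (Complex x v0)))) - 2 * pi * growth * (x\<^sup>2 + v0\<^sup>2)"

definition descent' :: "real \<Rightarrow> real" where
  "descent' x = Im (Li2 (unit_exp (Complex x v0))) - 2 * pi * x * ln (cmod (1 - unit_exp (Complex x v0)))
      - 2 * pi * v0 * Im (Ln (1 - unit_exp (Complex x v0))) - 4 * pi * growth * x"

definition descent'' :: "real \<Rightarrow> real" where
  "descent'' x = - 4 * pi * ln (cmod (1 - unit_exp (Complex x v0)))
     - 4 * pi\<^sup>2 * (x * Im (unit_exp (Complex x v0) / (1 - unit_exp (Complex x v0))) - v0 * Re (unit_exp (Complex x v0) / (1 - unit_exp (Complex x v0))))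
     - 4 * pi * growth"

lemma Re_Im_horizontal_derivative:
  assumes "(f has_field_derivative f') (at (Complex x v))"
  shows "((\<lambda>x. Re (f (Complex x v))) has_real_derivative Re f') (at x)"
    and "((\<lambda>x. Im (f (Complex x v))) has_real_derivative Im f') (at x)"
proof -
  have c: "Complex x v = of_real x + \<i> * of_real v" for x by (simp add: complex_eq_iff)
  have "((\<lambda>x. f (of_real x + \<i> * of_real v)) has_vector_derivative f') (at x)"
  proof -
    have "((\<lambda>z. f (z + \<i> * of_real v)) has_field_derivative f') (at (of_real x))"
      using assms unfolding c by (subst DERIV_shift[symmetric])
    from has_vector_derivative_real_field[OF this] show ?thesis by simp
  qed
  then have *: "((\<lambda>x. f (Complex x v)) has_vector_derivative f') (at x)" unfolding c .
  show "((\<lambda>x. Re (f (Complex x v))) has_real_derivative Re f') (at x)"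
    using bounded_linear.has_vector_derivative[OF bounded_linear_Re *]
    by (simp add: has_real_derivative_iff_has_vector_derivative)
  show "((\<lambda>x. Im (f (Complex x v))) has_real_derivative Im f') (at x)"
    using bounded_linear.has_vector_derivative[OF bounded_linear_Im *]
    by (simp add: has_real_derivative_iff_has_vector_derivative)
qed

lemma descent_deriv: "(descent has_real_derivative descent' x) (at x)"
proof -
  define z where "z = Complex x v0"
  have im: "Im z > 0" using v0_bounds by (simp add: z_def)
  note d = Li2_unit_exp_has_field_derivative[OF im, unfolded z_def]
  show ?thesis unfolding descent_def descent'_def
    by (rule derivative_eq_intros Re_Im_horizontal_derivative[OF d] refl)+
       (use one_minus_unit_exp(3)[OF im] in \<open>simp add: z_def algebra_simps\<close>)
qed

lemma descent'_deriv: "(descent' has_real_derivative descent'' x) (at x)"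
proof -
  define z where "z = Complex x v0"
  have im: "Im (Complex x v0) > 0" for x using v0_bounds by simp
  have c: "ln (cmod (1 - unit_exp (Complex x v0))) = Re (Ln (1 - unit_exp (Complex x v0)))" for x
    using one_minus_unit_exp(3)[OF im, of x] by simp
  note d = Li2_unit_exp_has_field_derivative[OF im] Ln_unit_exp_has_field_derivative[OF im]
  define q where "q = unit_exp (Complex x v0) / (1 - unit_exp (Complex x v0))"
  have q: "- 2 * of_real pi * \<i> * unit_exp (Complex x v0) / (1 - unit_exp (Complex x v0)) = - 2 * of_real pi * \<i> * q"
    by (simp add: q_def)
  note D = Re_Im_horizontal_derivative(2)[OF d(1)] Re_Im_horizontal_derivative[OF d(2)[of x, unfolded q]]
  show ?thesis unfolding descent'_def descent''_def c
    by (rule DERIV_cong[OF DERIV_diff[OF DERIV_diff[OF DERIV_diff[OF D(1)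
          DERIV_mult[OF DERIV_cmult[OF DERIV_ident, of "2 * pi"] D(2)]] DERIV_cmult[OF D(3)]]
          DERIV_cmult[OF DERIV_ident]]])
       (simp add: q q_def[symmetric] power2_eq_square algebra_simps del: Re_Ln)
qed

section \<open>Signs on the horizontal line through the saddle point\<close>

lemma Li2_cnj: "cmod u < 1 \<Longrightarrow> Li2 (cnj u) = cnj (Li2 u)"
proof -
  assume u: "cmod u < 1"
  have "(\<lambda>n. cnj (u ^ Suc n / of_nat (Suc n) ^ 2)) sums cnj (dilog_series u)"
    using dilog_series_sums[of u] u by (simp add: sums_cnj del: complex_cnj_divide)
  then have "(\<lambda>n. cnj u ^ Suc n / of_nat (Suc n) ^ 2) sums cnj (dilog_series u)"
    by (simp only: complex_cnj_divide complex_cnj_power complex_cnj_of_nat)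
  then have "dilog_series (cnj u) = cnj (dilog_series u)"
    using dilog_series_sums[of "cnj u"] u sums_unique2 by fastforce
  then show ?thesis using u by (simp add: Li2_eq_series)
qed

lemma Im_Ln_one_minus: "cmod u < 1 \<Longrightarrow> 0 \<le> Im u \<Longrightarrow> Im (Ln (1 - u)) \<le> 0"
proof -
  assume u: "cmod u < 1" "0 \<le> Im u"
  then have "Re u < 1" using complex_Re_le_cmod[of u] by linarith
  then have r: "Re (1 - u) > 0" "1 - u \<noteq> 0" by auto
  then have "Im (Ln (1 - u)) = arctan (Im (1 - u) / Re (1 - u))" by (subst Im_Ln_eq) auto
  moreover have "Im (1 - u) / Re (1 - u) \<le> 0" using r u by (intro divide_nonpos_pos) auto
  ultimately show ?thesis by (simp only: arctan_le_zero_iff)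
qed

text \<open>Along the ray \<open>t * u\<close> the derivative of \<open>Li2\<close> is
  \<open>- Ln (1 - t * u) / t\<close>, whose imaginary part is nonnegative by
  \<open>Im_Ln_one_minus\<close>.\<close>

lemma Im_Li2_nonneg:
  assumes u: "cmod u < 1" "0 \<le> Im u"
  shows "0 \<le> Im (Li2 u)"
proof -
  have "Im (Li2 (of_real 0 * u)) \<le> Im (Li2 (of_real 1 * u))"
  proof (rule DERIV_nonneg_imp_nondecreasing[where f = "\<lambda>t. Im (Li2 (of_real t * u))"])
    fix t :: real assume t: "0 \<le> t" "t \<le> 1"
    have tu: "cmod (of_real t * u) < 1"
      using t u mult_left_le_one_le[of "cmod u" t] by (simp add: norm_mult)
    have "((\<lambda>z. Li2 (z * u)) has_field_derivative - dilog_ker (of_real t * u) * u) (at (of_real t))"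
      by (rule DERIV_chain2[OF Li2_has_field_derivative])
         (use tu in \<open>auto intro!: derivative_eq_intros ball_subset_dilog_dom\<close>)
    from has_vector_derivative_real_field[OF this]
    have "((\<lambda>t. Li2 (of_real t * u)) has_vector_derivative - dilog_ker (of_real t * u) * u) (at t)" .
    from bounded_linear.has_vector_derivative[OF bounded_linear_Im this]
    have "((\<lambda>t. Im (Li2 (of_real t * u))) has_real_derivative Im (- dilog_ker (of_real t * u) * u)) (at t)"
      by (simp add: has_real_derivative_iff_has_vector_derivative)
    moreover have "0 \<le> Im (- dilog_ker (of_real t * u) * u)"
    proof (cases "of_real t * u = 0")
      case True
      then show ?thesis using u by (auto simp: dilog_ker_def)
    next
      case False
      then have "- dilog_ker (of_real t * u) * u = of_real (1 / t) * (- Ln (1 - of_real t * u))"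
        by (simp add: dilog_ker_def field_simps)
      moreover have "Im (Ln (1 - of_real t * u)) \<le> 0"
        using tu u t by (intro Im_Ln_one_minus) auto
      ultimately show ?thesis using t
        by (simp del: of_real_divide add: mult_nonneg_nonpos divide_nonpos_nonneg)
    qed
    ultimately show "\<exists>y. ((\<lambda>t. Im (Li2 (of_real t * u))) has_real_derivative y) (at t) \<and> 0 \<le> y"
      by blast
  qed simp
  then show ?thesis by simp
qed

lemma Im_Li2_nonpos: "cmod u < 1 \<Longrightarrow> Im u \<le> 0 \<Longrightarrow> Im (Li2 u) \<le> 0"
  using Im_Li2_nonneg[of "cnj u"] Li2_cnj[of u] by simp

abbreviation line_exp :: "real \<Rightarrow> complex" where "line_exp x \<equiv> unit_exp (Complex x v0)"

lemma norm_line_exp: "cmod (line_exp x) = cmod (1 - w0)"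
proof -
  have "cmod (unit_exp (Complex x v0)) = cmod (unit_exp z0)" by (simp add: norm_unit_exp v0_def)
  then show ?thesis by (simp add: unit_exp_z0)
qed

lemma line_exp_shift: "Re (line_exp x) = cmod (1 - w0) * cos (2 * pi * (x - 1))"
  "Im (line_exp x) = cmod (1 - w0) * sin (2 * pi * (x - 1))"
proof -
  have "2 * pi * x = 2 * pi * (x - 1) + 2 * pi" by (simp add: algebra_simps)
  then have "cos (2 * pi * x) = cos (2 * pi * (x - 1))" "sin (2 * pi * x) = sin (2 * pi * (x - 1))"
    by (metis cos_periodic, metis sin_periodic)
  then show "Re (line_exp x) = cmod (1 - w0) * cos (2 * pi * (x - 1))"
    "Im (line_exp x) = cmod (1 - w0) * sin (2 * pi * (x - 1))"
    by (simp_all add: Re_unit_exp Im_unit_exp norm_line_exp)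
qed

lemma norm_one_minus_line_exp: "(cmod (1 - line_exp x))\<^sup>2 = 1 - 2 * cmod (1 - w0) * cos (2 * pi * (x - 1)) + (cmod (1 - w0))\<^sup>2"
proof -
  have "(cmod (1 - line_exp x))\<^sup>2 = 1 - 2 * Re (line_exp x) + (cmod (line_exp x))\<^sup>2"
    unfolding cmod_power2 by (simp add: power2_eq_square algebra_simps)
  then show ?thesis by (simp only: norm_line_exp line_exp_shift mult.assoc)
qed

lemma line_exp_ne: "1 - line_exp x \<noteq> 0" "cmod (1 - line_exp x) > 0" "cmod (line_exp x) < 1"
  using one_minus_unit_exp(3)[of "Complex x v0"] norm_unit_exp_less_1[of "Complex x v0"] v0_bounds by auto

text \<open>With \<open>R\<close> the square of \<open>cmod (1 - line_exp x)\<close>, the inequality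
  \<open>ln (1 / R) \<le> 1 / R - 1\<close> brings all terms except \<open>growth\<close> over the
  denominator \<open>R\<close>. What remains is governed by the sign of
  \<open>(1 + pi * v0) * cos t - pi * x * sin t\<close>, which is nonpositive from
  \<open>t = pi / 6\<close> on.\<close>

lemma descent''_neg:
  assumes x: "13/12 \<le> x" "x \<le> 3/2"
  shows "descent'' x < 0"
proof -
  define r where "r = cmod (1 - w0)"
  define t where "t = 2 * pi * (x - 1)"
  define R where "R = (cmod (1 - line_exp x))\<^sup>2"
  have R: "R = 1 - 2 * r * cos t + r\<^sup>2" unfolding R_def r_def t_def by (rule norm_one_minus_line_exp)
  have Rpos: "R > 0" unfolding R_def using line_exp_ne(1)[of x] by simp
  have r: "1903/10000 \<le> r" "r \<le> 2097/10000" using w0_bounds by (auto simp: r_def)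
  have q: "line_exp x / (1 - line_exp x) = (line_exp x * cnj (1 - line_exp x)) / of_real R"
    unfolding R_def using complex_div_cnj[of "line_exp x" "1 - line_exp x"] by simp
  have "line_exp x * cnj (1 - line_exp x) = line_exp x - of_real (r\<^sup>2)"
    using complex_norm_square[of "line_exp x"] unfolding norm_line_exp r_def[symmetric] by (simp add: algebra_simps)
  then have q': "Re (line_exp x / (1 - line_exp x)) = (r * cos t - r\<^sup>2) / R" "Im (line_exp x / (1 - line_exp x)) = r * sin t / R"
    unfolding q Re_divide_of_real Im_divide_of_real
    by (simp_all add: line_exp_shift r_def t_def del: of_real_power)
  have "- ln (cmod (1 - line_exp x)) = ln (1 / R) / 2"
    using line_exp_ne[of x] Rpos unfolding R_def by (simp add: ln_div ln_realpow)
  also have "\<dots> \<le> (1 / R - 1) / 2" using Rpos by (intro divide_right_mono ln_le_minus_one) auto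
  also have "\<dots> = (r * cos t - r\<^sup>2 / 2) / R" using Rpos by (simp add: R field_simps)
  finally have ln: "- ln (cmod (1 - line_exp x)) \<le> (r * cos t - r\<^sup>2 / 2) / R" .
  have key: "(1 + pi * v0) * cos t \<le> pi * x * sin t"
  proof -
    have t: "pi / 6 \<le> t" "t \<le> pi" using x pi_gt_zero by (auto simp: t_def field_simps)
    have s: "sin t \<ge> 0" using t pi_gt_zero by (intro sin_ge_zero) linarith+
    show ?thesis
    proof (cases "t \<le> pi / 2")
      case False
      then have "cos t \<le> 0" using t cos_monotone_0_pi_le[of "pi/2" t] pi_gt_zero by simp
      then have "(1 + pi * v0) * cos t \<le> 0" using v0_bounds by (intro mult_nonneg_nonpos) auto
      moreover have "0 \<le> pi * x * sin t" using s x by simp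
      ultimately show ?thesis by linarith
    next
      case True
      have "cos t \<le> cos (pi / 6)" using t pi_gt_zero by (intro cos_monotone_0_pi_le) auto
      also have "\<dots> = sqrt 3 / 2" by (rule cos_30)
      also have "sqrt 3 \<le> 1733/1000" by (intro real_le_lsqrt) (auto simp: power2_eq_square)
      finally have c: "cos t \<le> 867/1000" by simp
      have "sin (pi / 6) \<le> sin t" using t True pi_gt_zero by (intro sin_monotone_2pi_le) auto
      then have s2: "1 / 2 \<le> sin t" by (simp add: sin_30)
      \<comment> \<open>The margin is small: the left side is below \<open>1.59\<close>, the right
        side at least \<open>3 * (13/12) / 2 = 1.625\<close>.\<close>
      have "(1 + pi * v0) * cos t \<le> (1 + pi * v0) * (867/1000)"
        using c v0_bounds by (intro mult_left_mono) auto
      also have "\<dots> \<le> (1833/1000) * (867/1000)" using v0_bounds by (intro mult_right_mono) auto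
      also have "\<dots> \<le> (3 * (13/12)) * (1/2)" by simp
      also have "\<dots> \<le> (pi * x) * sin t"
        using s2 x pi_gt3 by (intro mult_mono) auto
      finally show ?thesis .
    qed
  qed
  have "descent'' x = 4 * pi * (- ln (cmod (1 - line_exp x)) - pi * (x * (r * sin t / R) - v0 * ((r * cos t - r\<^sup>2) / R)) - growth)"
    unfolding descent''_def q' by (simp add: power2_eq_square algebra_simps)
  moreover have "- ln (cmod (1 - line_exp x)) - pi * (x * (r * sin t / R) - v0 * ((r * cos t - r\<^sup>2) / R)) - growth < 0"
  proof -
    have "- ln (cmod (1 - line_exp x)) - pi * (x * (r * sin t / R) - v0 * ((r * cos t - r\<^sup>2) / R)) \<le>
       (r * cos t - r\<^sup>2 / 2) / R - pi * (x * (r * sin t / R) - v0 * ((r * cos t - r\<^sup>2) / R))"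
      using ln by simp
    also have "\<dots> = (r * ((1 + pi * v0) * cos t - pi * x * sin t) - r\<^sup>2 * (1/2 + pi * v0)) / R"
      using Rpos by (simp add: field_simps)
    also have "\<dots> \<le> 0"
    proof -
      have "r * ((1 + pi * v0) * cos t - pi * x * sin t) \<le> 0"
        using key r by (intro mult_nonneg_nonpos) auto
      moreover have "0 \<le> r\<^sup>2 * (1/2 + pi * v0)" using v0_bounds by simp
      ultimately show ?thesis using Rpos by (simp add: divide_nonpos_pos)
    qed
    finally show ?thesis using growth_ge by linarith
  qed
  ultimately show ?thesis using pi_gt_zero by (simp add: mult_pos_neg)
qed

text \<open>Left of \<open>13/12\<close> no concavity is shown. Instead all three summands of
  \<open>descent'\<close> have the right sign; the decisive one is
  \<open>- ln (cmod (1 - line_exp x)) - 2 * growth\<close>, positive because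
  \<open>cmod (1 - line_exp x)\<close> is smaller than the square of \<open>cmod w0\<close>.\<close>

lemma descent'_pos:
  assumes x: "1 \<le> x" "x \<le> 13/12"
  shows "descent' x > 0"
proof -
  define r where "r = cmod (1 - w0)"
  define t where "t = 2 * pi * (x - 1)"
  have r: "1903/10000 \<le> r" "r \<le> 2097/10000" using w0_bounds by (auto simp: r_def)
  have t: "0 \<le> t" "t \<le> pi / 6" using x pi_gt_zero by (auto simp: t_def field_simps)
  have "sin t \<ge> 0" using t pi_gt_zero by (intro sin_ge_zero) linarith+
  then have im: "Im (line_exp x) \<ge> 0" by (simp add: line_exp_shift t_def)
  have 1: "Im (Li2 (line_exp x)) \<ge> 0" "Im (Ln (1 - line_exp x)) \<le> 0"
    using line_exp_ne im by (auto intro: Im_Li2_nonneg Im_Ln_one_minus)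
  have c: "cos t \<ge> cos (pi / 6)" using t pi_gt_zero by (intro cos_monotone_0_pi_le) auto
  have "sqrt 3 \<ge> 1732/1000" by (intro real_le_rsqrt) (auto simp: power2_eq_square)
  then have c: "cos t \<ge> 866/1000" using c cos_30 by simp
  have "(cmod (1 - line_exp x))\<^sup>2 = 1 - 2 * r * cos t + r\<^sup>2"
    unfolding r_def t_def by (rule norm_one_minus_line_exp)
  also have "\<dots> = 1 - r * (2 * cos t - r)" by (simp add: power2_eq_square algebra_simps)
  also have "\<dots> \<le> 1 - (1903/10000) * (2 * (866/1000) - 1903/10000)"
  proof -
    have "(1903/10000) * (2 * (866/1000) - 1903/10000) \<le> r * (2 * (866/1000) - r)"
    proof -
      \<comment> \<open>\<open>r * (2 * c - r)\<close> increases in \<open>r\<close> below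
        \<open>c\<close>, so the smallest admissible \<open>r\<close> is the worst case.\<close>
      have "(r - a) * (2 * c - a - r) = r * (2 * c - r) - a * (2 * c - a)" for a c :: real
        by (simp add: algebra_simps)
      moreover have "0 \<le> (r - 1903/10000) * (2 * (866/1000) - 1903/10000 - r)"
        using r by (intro mult_nonneg_nonneg) auto
      ultimately show ?thesis by (metis diff_ge_0_iff_ge)
    qed
    also have "\<dots> \<le> r * (2 * cos t - r)" using c r by (intro mult_left_mono) auto
    finally show ?thesis by simp
  qed
  also have "\<dots> < ((9249/10000)\<^sup>2)\<^sup>2" by (simp add: power2_eq_square)
  also have "\<dots> \<le> ((cmod w0)\<^sup>2)\<^sup>2" using w0_bounds by (intro power_mono) auto
  finally have "cmod (1 - line_exp x) < (cmod w0)\<^sup>2" by (rule power2_less_imp_less) simp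
  then have "ln (cmod (1 - line_exp x)) < ln ((cmod w0)\<^sup>2)"
    using line_exp_ne[of x] by (subst ln_less_cancel_iff) auto
  also have "\<dots> = - 2 * growth" using w0_bounds by (subst ln_realpow) (auto simp: growth_def)
  finally have l: "- ln (cmod (1 - line_exp x)) - 2 * growth > 0" by simp
  have "descent' x = Im (Li2 (line_exp x)) + 2 * pi * x * (- ln (cmod (1 - line_exp x)) - 2 * growth) + 2 * pi * v0 * (- Im (Ln (1 - line_exp x)))"
    unfolding descent'_def by (simp add: algebra_simps)
  moreover have "2 * pi * x * (- ln (cmod (1 - line_exp x)) - 2 * growth) > 0" using l x pi_gt_zero by (intro mult_pos_pos) auto
  moreover have "2 * pi * v0 * (- Im (Ln (1 - line_exp x))) \<ge> 0" using 1 v0_bounds by (intro mult_nonneg_nonneg) auto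
  ultimately show ?thesis using 1 by linarith
qed

text \<open>Far from the saddle point crude bounds suffice: \<open>Im (Li2 (line_exp x))\<close> is
  nonpositive, its real part is at most \<open>1/4\<close> in modulus, and the growth term alone
  outweighs \<open>2 * v0\<close>.\<close>

lemma descent_neg_right:
  assumes x: "3/2 \<le> x" "x \<le> 2"
  shows "descent x < 0"
proof -
  define r where "r = cmod (1 - w0)"
  have r: "1903/10000 \<le> r" "r \<le> 2097/10000" using w0_bounds by (auto simp: r_def)
  have "0 \<le> sin (2 * pi * (2 - x))" using x pi_gt_zero by (intro sin_ge_zero) auto
  moreover have "sin (2 * pi * (x - 1)) = - sin (2 * pi * (2 - x))"
  proof -
    have "2 * pi * (2 - x) = 2 * pi - 2 * pi * (x - 1)" by (simp add: algebra_simps)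
    then show ?thesis by (simp add: sin_diff)
  qed
  ultimately have "Im (line_exp x) \<le> 0" using r by (simp add: line_exp_shift r_def mult_nonneg_nonneg)
  then have 1: "Im (Li2 (line_exp x)) \<le> 0" using line_exp_ne by (intro Im_Li2_nonpos) auto
  have "cmod (Li2 (line_exp x)) \<le> cmod (line_exp x + (line_exp x)\<^sup>2 / 4) + cmod (line_exp x) ^ 3 / (9 * (1 - cmod (line_exp x)))"
    using dilog_series_approx[of "line_exp x"] line_exp_ne[of x] norm_triangle_sub[of "Li2 (line_exp x)" "line_exp x + (line_exp x)\<^sup>2 / 4"] by simp
  also have "cmod (line_exp x + (line_exp x)\<^sup>2 / 4) \<le> r + r\<^sup>2 / 4"
    using norm_triangle_ineq[of "line_exp x" "(line_exp x)\<^sup>2 / 4"] by (simp add: norm_line_exp r_def norm_power norm_divide)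
  also have "cmod (line_exp x) ^ 3 / (9 * (1 - cmod (line_exp x))) = r ^ 3 / (9 * (1 - r))" by (simp add: norm_line_exp r_def)
  also have "r ^ 3 / (9 * (1 - r)) \<le> (2097/10000) ^ 3 / (9 * (1 - 2097/10000))"
    using r by (intro frac_le power_mono mult_left_mono) auto
  also have "r + r\<^sup>2 / 4 \<le> 2097/10000 + (2097/10000)\<^sup>2 / 4"
    using r by (intro add_mono divide_right_mono power_mono) auto
  finally have "cmod (Li2 (line_exp x)) \<le> 25/100" by (simp add: eval_nat_numeral)
  then have 2: "- Re (Li2 (line_exp x)) \<le> 25/100" using abs_Re_le_cmod[of "Li2 (line_exp x)"] by linarith
  have "pi\<^sup>2 \<le> (315/100)\<^sup>2" using pi_approx pi_gt_zero by (intro power_mono) auto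
  then have 3: "pi\<^sup>2 / 6 - Re (Li2 (line_exp x)) \<le> 2" using 2 by (simp add: power2_eq_square)
  have "descent x \<le> v0 * 2 - 2 * pi * growth * (x\<^sup>2 + v0\<^sup>2)"
    using mult_left_mono[OF 3, of v0] v0_bounds mult_nonneg_nonpos[OF _ 1, of x] x unfolding descent_def by linarith
  moreover have "2 * 3 * (557/10000) * (9/4) \<le> 2 * pi * growth * (x\<^sup>2 + v0\<^sup>2)"
  proof (intro mult_mono)
    have "(3/2)\<^sup>2 \<le> x\<^sup>2" using x by (intro power_mono) auto
    then have "9/4 \<le> x\<^sup>2" by (simp add: power2_eq_square)
    then show "9/4 \<le> x\<^sup>2 + v0\<^sup>2" using zero_le_power2[of v0] by linarith
  qed (use growth_ge pi_gt3 in auto)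
  ultimately show ?thesis using v0_bounds by simp
qed

lemma descent_x0: "descent (Re z0) = 0" "descent' (Re z0) = 0"
proof -
  have z: "Complex (Re z0) v0 = z0" by (simp add: v0_def)
  have w: "w0 \<noteq> 0" using w0_bounds by auto
  have Re_L: "Re (Ln w0) = - growth" using w by (simp add: growth_def)
  have L: "Li2 (1 - w0) = of_real (pi\<^sup>2 / 6) - 2 * of_real pi * \<i> * z0 * Ln w0"
    using Li2_u0 by (simp add: algebra_simps)
  have i: "Im (Li2 (1 - w0)) = 2 * pi * (Re z0 * growth + v0 * Im (Ln w0))"
   and r: "Re (Li2 (1 - w0)) = pi\<^sup>2 / 6 + 2 * pi * (- v0 * growth + Re z0 * Im (Ln w0))"
    unfolding L using Re_L by (simp_all add: v0_def algebra_simps del: Re_Ln)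
  show "descent (Re z0) = 0" unfolding descent_def z unit_exp_z0 i r
    by (simp add: algebra_simps power2_eq_square)
  show "descent' (Re z0) = 0" unfolding descent'_def z unit_exp_z0 i
    by (simp add: growth_def algebra_simps)
qed

text \<open>\<open>descent'\<close> vanishes at \<open>Re z0\<close>, so concavity fixes its sign on
  \<open>[13/12, 3/2]\<close>. The stretches to the left and to the right are supplied by
  \<open>descent'_pos\<close> and \<open>descent_neg_right\<close>.\<close>

lemma descent_neg:
  assumes x: "1 \<le> x" "x \<le> 2" "x \<noteq> Re z0"
  shows "descent x < 0"
proof -
  have x0: "13/12 < Re z0" "Re z0 < 3/2" using Re_z0 by auto
  have left: "descent' y > 0" if "13/12 \<le> y" "y < Re z0" for y
    using DERIV_neg_imp_decreasing[of y "Re z0" descent'] descent'_deriv descent''_neg that x0 descent_x0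
    by (metis less_trans less_imp_le order_trans)
  have right: "descent' y < 0" if "Re z0 < y" "y \<le> 3/2" for y
    using DERIV_neg_imp_decreasing[of "Re z0" y descent'] descent'_deriv descent''_neg that x0 descent_x0
    by (metis less_trans less_imp_le order_trans)
  have cont: "continuous_on S descent" for S
    using descent_deriv by (meson DERIV_isCont continuous_at_imp_continuous_on)
  show ?thesis
  proof (cases "x < Re z0")
    case True
    have "descent x < descent (Re z0)"
    proof (rule DERIV_pos_imp_increasing_open[where f = descent, OF True])
      fix y assume y: "x < y" "y < Re z0"
      then have "descent' y > 0" using left[of y] descent'_pos[of y] x by (cases "y \<le> 13/12") auto
      then show "\<exists>D. (descent has_real_derivative D) (at y) \<and> 0 < D" using descent_deriv by blast
    qed (rule cont)
    then show ?thesis by (simp add: descent_x0)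
  next
    case False
    show ?thesis
    proof (cases "x \<le> 3/2")
      case True
      have "descent x < descent (Re z0)"
      proof (rule DERIV_neg_imp_decreasing_open[where f = descent])
        show "Re z0 < x" using False x by simp
        fix y assume y: "Re z0 < y" "y < x"
        then have "descent' y < 0" using right[of y] True by auto
        then show "\<exists>D. (descent has_real_derivative D) (at y) \<and> D < 0" using descent_deriv by blast
      qed (rule cont)
      then show ?thesis by (simp add: descent_x0)
    next
      case False
      then show ?thesis using x by (intro descent_neg_right) auto
    qed
  qed
qed

lemma Re_phase:
  assumes "Im z > 0"
  shows "2 * pi * (cmod z)\<^sup>2 * Re (phase z) = Re z * Im (Li2 (unit_exp z)) + Im z * (pi\<^sup>2 / 6 - Re (Li2 (unit_exp z)))"
proof -
  have z: "z \<noteq> 0" using assms by auto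
  define D where "D = Li2 (unit_exp z) - of_real (pi\<^sup>2 / 6)"
  have "phase z * of_real (2 * pi * (cmod z)\<^sup>2) = - \<i> * D * cnj z"
    unfolding phase_def D_def[symmetric]
    using z complex_norm_square[of z] by (simp add: field_simps)
  then have "Re (phase z * of_real (2 * pi * (cmod z)\<^sup>2)) = Re (- \<i> * D * cnj z)" by (rule arg_cong)
  then have "Re (phase z) * (2 * pi * (cmod z)\<^sup>2) = Re (- \<i> * D * cnj z)"
    by (simp only: Re_complex_of_real Im_complex_of_real times_complex.sel)
  also have "\<dots> = Re z * Im D - Im z * Re D" by (simp add: algebra_simps)
  finally show ?thesis unfolding D_def by (simp add: algebra_simps)
qed

lemma Re_phase_top:
  assumes "1 \<le> x" "x \<le> 2" "x \<noteq> Re z0"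
  shows "Re (phase (Complex x v0)) < growth"
proof -
  have c: "(cmod (Complex x v0))\<^sup>2 = x\<^sup>2 + v0\<^sup>2" by (simp add: cmod_power2)
  have "2 * pi * (x\<^sup>2 + v0\<^sup>2) * Re (phase (Complex x v0)) - 2 * pi * growth * (x\<^sup>2 + v0\<^sup>2) = descent x"
    using Re_phase[of "Complex x v0"] v0_bounds unfolding c by (simp add: descent_def)
  then have "2 * pi * (x\<^sup>2 + v0\<^sup>2) * (Re (phase (Complex x v0)) - growth) < 0"
    using descent_neg[OF assms] by (simp add: algebra_simps)
  moreover have "2 * pi * (x\<^sup>2 + v0\<^sup>2) > 0" using assms by (intro mult_pos_pos add_pos_nonneg) auto
  moreover have "\<not> x\<^sup>2 + v0\<^sup>2 < 0" by (simp add: not_less)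
  ultimately show ?thesis by (simp add: mult_less_0_iff)
qed

lemma Re_dilog_series_mono:
  assumes "0 \<le> x" "x \<le> y" "y \<le> 1"
  shows "Re (dilog_series (of_real x)) \<le> Re (dilog_series (of_real y))"
proof (rule sums_le)
  have s: "(\<lambda>n. x ^ Suc n / real (Suc n) ^ 2) sums Re (dilog_series (of_real x))" if "0 \<le> x" "x \<le> 1" for x
  proof -
    have "(\<lambda>n. complex_of_real x ^ Suc n / of_nat (Suc n) ^ 2) = (\<lambda>n. of_real (x ^ Suc n / real (Suc n) ^ 2))"
      by simp
    then have "(\<lambda>n. complex_of_real (x ^ Suc n / real (Suc n) ^ 2)) sums dilog_series (of_real x)"
      using dilog_series_sums[of "of_real x"] that by (simp del: of_real_divide of_real_power of_real_mult power_Suc of_nat_Suc)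
    from sums_Re[OF this] show ?thesis by (simp only: Re_complex_of_real)
  qed
  show "(\<lambda>n. x ^ Suc n / real (Suc n) ^ 2) sums Re (dilog_series (of_real x))" using assms by (intro s) auto
  show "(\<lambda>n. y ^ Suc n / real (Suc n) ^ 2) sums Re (dilog_series (of_real y))" using assms by (intro s) auto
  show "x ^ Suc n / real (Suc n) ^ 2 \<le> y ^ Suc n / real (Suc n) ^ 2" for n
    using assms by (intro divide_right_mono power_mono) auto
qed

text \<open>Above the abscissas \<open>1\<close> and \<open>2\<close> the argument of the
  dilogarithm is real, and \<open>Re (phase z)\<close> becomes
  \<open>f v * v / (a\<^sup>2 + v\<^sup>2)\<close> up to a constant. Both factors increase in
  \<open>v\<close> up to \<open>v0 < 1\<close>, so the upper corner, which lies on the top side, is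
  the worst point.\<close>

lemma Re_phase_sides:
  assumes a: "a = 1 \<or> a = (2::real)" and v: "0 < v" "v \<le> v0"
  shows "Re (phase (Complex a v)) < growth"
proof -
  have u: "unit_exp (Complex a v) = of_real (exp (- 2 * pi * v))" if "v > 0" for v
  proof -
    have "2 * of_real pi * \<i> * Complex a v = of_real (- 2 * pi * v) + \<i> * of_real (2 * pi * a)"
      by (simp add: complex_eq_iff)
    then have "unit_exp (Complex a v) = exp (of_real (- 2 * pi * v)) * cis (2 * pi * a)"
      unfolding unit_exp_def by (simp only: exp_add cis_conv_exp)
    moreover have "cis (2 * pi * a) = 1" 
      using cis_multiple_2pi[of 1] cis_multiple_2pi[of 2] a by (auto simp: mult_ac)
    moreover have "exp (complex_of_real (- 2 * pi * v)) = of_real (exp (- 2 * pi * v))" by (rule exp_of_real)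
    ultimately show ?thesis by (simp only: mult_1_right)
  qed
  define f where "f = (\<lambda>v. pi\<^sup>2 / 6 - Re (dilog_series (of_real (exp (- 2 * pi * v)))))"
  have P: "Re (phase (Complex a v)) = f v * (v / (a\<^sup>2 + v\<^sup>2)) / (2 * pi)" if "v > 0" for v
  proof -
    have e: "exp (- 2 * pi * v) < 1" using that by simp
    have c: "(cmod (Complex a v))\<^sup>2 = a\<^sup>2 + v\<^sup>2" by (simp add: cmod_power2)
    have "Li2 (unit_exp (Complex a v)) = dilog_series (of_real (exp (- 2 * pi * v)))"
      unfolding u[OF that] using e by (intro Li2_eq_series) simp
    moreover have "Im (Li2 (unit_exp (Complex a v))) = 0"
      unfolding u[OF that] using e by (intro Li2_real_bounds) auto
    ultimately have "2 * pi * (a\<^sup>2 + v\<^sup>2) * Re (phase (Complex a v)) = v * f v"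
      using Re_phase[of "Complex a v"] that unfolding c f_def by simp
    moreover have "a\<^sup>2 + v\<^sup>2 > 0" using a by (auto intro: add_pos_nonneg)
    moreover have "R = fv * (v / s) / (2 * pi)" if "2 * pi * s * R = v * fv" "s > 0" for s R fv :: real
      using that by (simp add: field_simps)
    ultimately show ?thesis by blast
  qed
  have f0: "f v \<ge> 0"
    using Re_dilog_series_mono[of "exp (- 2 * pi * v)" 1] v by (simp add: f_def dilog_series_1)
  have f1: "f v \<le> f v0"
    using Re_dilog_series_mono[of "exp (- 2 * pi * v0)" "exp (- 2 * pi * v)"] v by (simp add: f_def)
  have m: "v / (a\<^sup>2 + v\<^sup>2) \<le> v0 / (a\<^sup>2 + v0\<^sup>2)"
  proof -
    have "v * v0 \<le> 1 * 1" using v v0_bounds by (intro mult_mono) auto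
    moreover have "1 \<le> a\<^sup>2" using a by auto
    ultimately have "0 \<le> (v0 - v) * (a\<^sup>2 - v * v0)" using v by (intro mult_nonneg_nonneg) auto
    moreover have "a\<^sup>2 + v\<^sup>2 > 0" "a\<^sup>2 + v0\<^sup>2 > 0" using a by (auto intro: add_pos_nonneg)
    ultimately show ?thesis by (simp add: field_simps power2_eq_square)
  qed
  have "Re (phase (Complex a v)) \<le> Re (phase (Complex a v0))"
    unfolding P[OF v(1)] P[OF v0_bounds(1)]
    using f0 f1 m v by (intro divide_right_mono mult_mono) (auto intro!: divide_nonneg_nonneg)
  also have "\<dots> < growth" using a Re_z0 by (intro Re_phase_top) auto
  finally show ?thesis .
qed

definition phase2 :: complex where "phase2 = 2 * of_real pi * \<i> * (1 - w0) / (w0 * z0)"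

lemma phase'_z0_deriv: "(phase' has_field_derivative phase2) (at z0)"
proof -
  have "w0 \<noteq> 0" using w0_bounds by auto
  then show ?thesis
    using phase'_has_field_derivative[OF Im_z0] unfolding unit_exp_z0 phase'_z0 phase2_def by simp
qed

text \<open>At the double zero \<open>Re z0\<close> the value of \<open>descent''\<close> is
  \<open>2 * pi * (cmod z0)\<^sup>2 * Re phase2\<close>, so the concavity already shown decides the
  sign.\<close>

lemma Re_phase2: "Re phase2 < 0"
proof -
  have z: "Complex (Re z0) v0 = z0" by (simp add: v0_def)
  have w: "w0 \<noteq> 0" using w0_bounds by auto
  define q where "q = (1 - w0) / w0"
  have "descent'' (Re z0) = - 4 * pi\<^sup>2 * (Re z0 * Im q - v0 * Re q)"
    unfolding descent''_def z unit_exp_z0 q_def by (simp add: growth_def algebra_simps)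
  then have "4 * pi\<^sup>2 * (Re z0 * Im q - v0 * Re q) > 0"
    using descent''_neg[of "Re z0"] Re_z0 by simp
  then have pos: "Re z0 * Im q - v0 * Re q > 0" by (simp add: zero_less_mult_iff)
  have "phase2 = of_real (2 * pi) * (\<i> * (q / z0))" using w z0_ne by (simp add: phase2_def q_def field_simps)
  also have "q / z0 = q * cnj z0 / of_real ((cmod z0)\<^sup>2)" using complex_div_cnj[of q z0] by simp
  finally have p: "phase2 = of_real (2 * pi) * (\<i> * (q * cnj z0 / of_real ((cmod z0)\<^sup>2)))" .
  have "Re phase2 = - (2 * pi * (Im (q * cnj z0) / (cmod z0)\<^sup>2))"
    unfolding p by (simp del: of_real_power of_real_mult times_divide_eq_right)
  also have "Im (q * cnj z0) = Re z0 * Im q - v0 * Re q" by (simp add: v0_def algebra_simps)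
  finally show ?thesis using pos z0_ne by simp
qed

section \<open>Uniform asymptotic expansions\<close>

text \<open>
  Expansions of order \<open>M\<close> in powers of the scale \<open>y N\<close>, uniform in \<open>z \<in> S\<close> and with bounded holomorphic coefficients,
  peeled off one coefficient at a time.
\<close>
fun has_asymp :: "(nat \<Rightarrow> real) \<Rightarrow> complex set \<Rightarrow> nat \<Rightarrow> (nat \<Rightarrow> complex \<Rightarrow> complex) \<Rightarrow> bool" where
  "has_asymp y S 0 a \<longleftrightarrow> (\<exists>C. \<forall>\<^sub>F N in sequentially. \<forall>z\<in>S. cmod (a N z) \<le> C)"
| "has_asymp y S (Suc M) a \<longleftrightarrow> (\<exists>e a'. e holomorphic_on S \<and> bounded (e ` S) \<and> has_asymp y S M a' \<and>
     (\<forall>\<^sub>F N in sequentially. \<forall>z\<in>S. a N z = e z + of_real (y N) * a' N z))"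

lemma has_asymp_SucI:
  "e holomorphic_on S \<Longrightarrow> bounded (e ` S) \<Longrightarrow> has_asymp y S M a' \<Longrightarrow>
   (\<forall>\<^sub>F N in sequentially. \<forall>z\<in>S. a N z = e z + of_real (y N) * a' N z) \<Longrightarrow> has_asymp y S (Suc M) a"
  by auto

lemma has_asymp_cong:
  assumes "\<forall>\<^sub>F N in sequentially. \<forall>z\<in>S. a N z = b N z" "has_asymp y S M b"
  shows "has_asymp y S M a"
proof (cases M)
  case 0
  with assms(2) obtain C where "\<forall>\<^sub>F N in sequentially. \<forall>z\<in>S. cmod (b N z) \<le> C" by auto
  with assms(1) have "\<forall>\<^sub>F N in sequentially. \<forall>z\<in>S. cmod (a N z) \<le> C" by eventually_elim auto
  then show ?thesis using 0 by auto
next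
  case (Suc M')
  with assms(2) obtain e a' where e: "e holomorphic_on S" "bounded (e ` S)" "has_asymp y S M' a'"
    "\<forall>\<^sub>F N in sequentially. \<forall>z\<in>S. b N z = e z + of_real (y N) * a' N z" by auto
  have "\<forall>\<^sub>F N in sequentially. \<forall>z\<in>S. a N z = e z + of_real (y N) * a' N z"
    using assms(1) e(4) by eventually_elim auto
  then show ?thesis using e(1-3) unfolding Suc by (rule has_asymp_SucI[rotated 3])
qed

lemma has_asymp_const: "e holomorphic_on S \<Longrightarrow> bounded (e ` S) \<Longrightarrow> has_asymp y S M (\<lambda>_. e)"
proof (induction M arbitrary: e)
  case 0
  then obtain C where "\<forall>z\<in>S. cmod (e z) \<le> C" by (auto simp: bounded_iff)
  then show ?case by (auto intro!: exI[of _ C] always_eventually)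
next
  case (Suc M)
  have "has_asymp y S M (\<lambda>_ _. 0)" using Suc.IH[of "\<lambda>_. 0"] by (auto simp: bounded_iff)
  then show ?case by (rule has_asymp_SucI[OF Suc.prems]) (auto intro: always_eventually)
qed

lemma has_asymp_constant: "has_asymp y S M (\<lambda>_ _. c)"
  by (rule has_asymp_const) (auto simp: bounded_iff)

lemma bounded_mult_image:
  fixes f g :: "'a \<Rightarrow> complex"
  assumes "bounded (f ` S)" "bounded (g ` S)"
  shows "bounded ((\<lambda>x. f x * g x) ` S)"
proof -
  obtain A B where "\<forall>x\<in>S. cmod (f x) \<le> A" "\<forall>x\<in>S. cmod (g x) \<le> B"
    using assms by (auto simp: bounded_iff)
  then have "\<forall>x\<in>S. cmod (f x) \<le> \<bar>A\<bar>" "\<forall>x\<in>S. cmod (g x) \<le> \<bar>B\<bar>" by force+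
  then have "\<forall>x\<in>S. cmod (f x * g x) \<le> \<bar>A\<bar> * \<bar>B\<bar>"
    by (simp add: norm_mult mult_mono)
  then show ?thesis by (auto simp: bounded_iff)
qed

text \<open>Abstract because two scales are used, \<open>inv_nu\<close> and later
  \<open>recip\<close>. The bound \<open>2\<close> is the value of \<open>inv_nu\<close> at
  \<open>N = 0\<close>.\<close>

locale asymp_scale =
  fixes y :: "nat \<Rightarrow> real"
  assumes y_pos: "\<And>N. y N > 0" and y_le: "\<And>N. y N \<le> 2" and y_tendsto: "y \<longlonglongrightarrow> 0"
begin

lemma norm_y_mult: "cmod x \<le> C \<Longrightarrow> cmod (of_real (y N) * x) \<le> 2 * C"
  using mult_mono[of "y N" 2 "cmod x" C] y_pos[of N] y_le[of N] by (simp add: norm_mult)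

lemma has_asymp_Suc_imp: "has_asymp y S (Suc M) a \<Longrightarrow> has_asymp y S M a"
proof (induction M arbitrary: a)
  case 0
  then obtain e a' where e: "bounded (e ` S)" "has_asymp y S 0 a'"
    "\<forall>\<^sub>F N in sequentially. \<forall>z\<in>S. a N z = e z + of_real (y N) * a' N z" by auto
  from e(1) obtain B where B: "\<And>z. z \<in> S \<Longrightarrow> cmod (e z) \<le> B" by (auto simp: bounded_iff)
  from e(2) obtain C where "\<forall>\<^sub>F N in sequentially. \<forall>z\<in>S. cmod (a' N z) \<le> C" by auto
  with e(3) have "\<forall>\<^sub>F N in sequentially. \<forall>z\<in>S. cmod (a N z) \<le> B + 2 * C"
  proof eventually_elim
    case (elim N)
    then show ?case using B norm_y_mult by (fastforce intro!: norm_triangle_mono)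
  qed
  then show ?case by auto
next
  case (Suc M)
  from Suc.prems obtain e a' where e: "e holomorphic_on S" "bounded (e ` S)" "has_asymp y S (Suc M) a'"
    "\<forall>\<^sub>F N in sequentially. \<forall>z\<in>S. a N z = e z + of_real (y N) * a' N z"
    by (subst (asm) has_asymp.simps(2)) blast
  from has_asymp_SucI[OF e(1,2) Suc.IH[OF e(3)] e(4)] show ?case .
qed

lemma has_asymp_add: "has_asymp y S M a \<Longrightarrow> has_asymp y S M b \<Longrightarrow> has_asymp y S M (\<lambda>N z. a N z + b N z)"
proof (induction M arbitrary: a b)
  case 0
  then obtain A B where "\<forall>\<^sub>F N in sequentially. \<forall>z\<in>S. cmod (a N z) \<le> A"
      "\<forall>\<^sub>F N in sequentially. \<forall>z\<in>S. cmod (b N z) \<le> B" by auto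
  then have "\<forall>\<^sub>F N in sequentially. \<forall>z\<in>S. cmod (a N z + b N z) \<le> A + B"
    by eventually_elim (auto intro: norm_triangle_mono)
  then show ?case by auto
next
  case (Suc M)
  from Suc.prems(1) obtain e a' where e: "e holomorphic_on S" "bounded (e ` S)" "has_asymp y S M a'"
    "\<forall>\<^sub>F N in sequentially. \<forall>z\<in>S. a N z = e z + of_real (y N) * a' N z" by auto
  from Suc.prems(2) obtain f b' where f: "f holomorphic_on S" "bounded (f ` S)" "has_asymp y S M b'"
    "\<forall>\<^sub>F N in sequentially. \<forall>z\<in>S. b N z = f z + of_real (y N) * b' N z" by auto
  show ?case
  proof (rule has_asymp_SucI[OF _ _ Suc.IH[OF e(3) f(3)]])
    show "(\<lambda>z. e z + f z) holomorphic_on S" using e f by (intro holomorphic_intros)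
    show "bounded ((\<lambda>z. e z + f z) ` S)" using e f by (intro bounded_plus_comp)
    show "\<forall>\<^sub>F N in sequentially. \<forall>z\<in>S. a N z + b N z = e z + f z + of_real (y N) * (a' N z + b' N z)"
      using e(4) f(4) by eventually_elim (auto simp: algebra_simps)
  qed
qed

lemma has_asymp_y: "has_asymp y S M a \<Longrightarrow> has_asymp y S (Suc M) (\<lambda>N z. of_real (y N) * a N z)"
  by (rule has_asymp_SucI[where e = "\<lambda>_. 0"]) (auto simp: bounded_iff)

lemma has_asymp_y': "has_asymp y S M a \<Longrightarrow> has_asymp y S M (\<lambda>N z. of_real (y N) * a N z)"
  by (rule has_asymp_Suc_imp[OF has_asymp_y])

lemma has_asymp_mult: "has_asymp y S M a \<Longrightarrow> has_asymp y S M b \<Longrightarrow> has_asymp y S M (\<lambda>N z. a N z * b N z)"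
proof (induction M arbitrary: a b)
  case 0
  then obtain A B where "\<forall>\<^sub>F N in sequentially. \<forall>z\<in>S. cmod (a N z) \<le> A"
      "\<forall>\<^sub>F N in sequentially. \<forall>z\<in>S. cmod (b N z) \<le> B" by auto
  then have "\<forall>\<^sub>F N in sequentially. \<forall>z\<in>S. cmod (a N z * b N z) \<le> \<bar>A\<bar> * \<bar>B\<bar>"
  proof eventually_elim
    case (elim N)
    show ?case
    proof
      fix z assume "z \<in> S"
      then have "cmod (a N z) \<le> \<bar>A\<bar>" "cmod (b N z) \<le> \<bar>B\<bar>" using elim by force+
      then show "cmod (a N z * b N z) \<le> \<bar>A\<bar> * \<bar>B\<bar>" by (simp add: norm_mult mult_mono)
    qed
  qed
  then show ?case by auto
next
  case (Suc M)
  from Suc.prems(1) obtain e a' where e: "e holomorphic_on S" "bounded (e ` S)" "has_asymp y S M a'"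
    "\<forall>\<^sub>F N in sequentially. \<forall>z\<in>S. a N z = e z + of_real (y N) * a' N z" by auto
  from Suc.prems(2) obtain f b' where f: "f holomorphic_on S" "bounded (f ` S)" "has_asymp y S M b'"
    "\<forall>\<^sub>F N in sequentially. \<forall>z\<in>S. b N z = f z + of_real (y N) * b' N z" by auto
  have h: "has_asymp y S M (\<lambda>N z. (e z * b' N z + a' N z * f z) + of_real (y N) * (a' N z * b' N z))"
    by (intro has_asymp_add Suc.IH has_asymp_y' e f has_asymp_const)
  show ?case
  proof (rule has_asymp_SucI[OF _ _ h])
    show "(\<lambda>z. e z * f z) holomorphic_on S" using e f by (intro holomorphic_intros)
    show "bounded ((\<lambda>z. e z * f z) ` S)" using e f by (intro bounded_mult_image)
    show "\<forall>\<^sub>F N in sequentially. \<forall>z\<in>S. a N z * b N z = e z * f z +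
        of_real (y N) * ((e z * b' N z + a' N z * f z) + of_real (y N) * (a' N z * b' N z))"
      using e(4) f(4) by eventually_elim (auto simp: algebra_simps)
  qed
qed

lemma has_asymp_minus: "has_asymp y S M a \<Longrightarrow> has_asymp y S M (\<lambda>N z. - a N z)"
  using has_asymp_mult[OF has_asymp_constant[of y S M "-1"]] by simp

lemma has_asymp_diff: "has_asymp y S M a \<Longrightarrow> has_asymp y S M b \<Longrightarrow> has_asymp y S M (\<lambda>N z. a N z - b N z)"
  using has_asymp_add[OF _ has_asymp_minus, of S M a b] by simp

text \<open>Write \<open>f s = f 0 + s * g s\<close> with \<open>g\<close> entire. The factor
  \<open>s = y N * a N z\<close> carries a power of the scale, so one order more is obtained than is
  known of \<open>a\<close>.\<close>

lemma has_asymp_entire: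
  assumes "f holomorphic_on UNIV" "has_asymp y S M a"
  shows "has_asymp y S (Suc M) (\<lambda>N z. f (of_real (y N) * a N z))"
proof -
  have split: "\<exists>g. g holomorphic_on UNIV \<and> (\<forall>s. f s = f 0 + s * g s)" if "f holomorphic_on UNIV" for f :: "complex \<Rightarrow> complex"
  proof (intro exI conjI allI)
    define g where "g = (\<lambda>s. if s = 0 then deriv f 0 else (f s - f 0) / s)"
    show "g holomorphic_on UNIV"
    proof (rule pole_theorem_open_0[where g = "\<lambda>s. f s - f 0" and a = 0])
      show "(\<lambda>s. f s - f 0) holomorphic_on UNIV" using that by (intro holomorphic_intros)
      have "f field_differentiable at 0" using that by (simp add: holomorphic_on_def)
      then have "deriv (\<lambda>s. f s - f 0) 0 = deriv f 0" by (subst deriv_diff) auto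
      then show "g 0 = deriv (\<lambda>s. f s - f 0) 0" by (simp add: g_def)
    qed (auto simp: g_def)
    show "f s = f 0 + s * g s" for s by (simp add: g_def)
  qed
  \<comment> \<open>First the version without gain, by induction on the order; one more splitting
    then yields the extra order.\<close>
  have *: "has_asymp y S M (\<lambda>N z. f (of_real (y N) * a N z))" if "f holomorphic_on UNIV" "has_asymp y S M a" for M f
    using that
  proof (induction M arbitrary: f)
    case 0
    from has_asymp_y'[OF 0(2)] obtain C where C: "\<forall>\<^sub>F N in sequentially. \<forall>z\<in>S. cmod (of_real (y N) * a N z) \<le> C" by auto
    have "compact (f ` cball 0 C)"
      using 0(1) by (intro compact_continuous_image holomorphic_on_imp_continuous_on compact_cball)
        (auto intro: holomorphic_on_subset)
    then obtain B where "\<forall>x\<in>cball 0 C. cmod (f x) \<le> B"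
      by (auto dest!: compact_imp_bounded simp: bounded_iff)
    then have B: "\<And>x. cmod x \<le> C \<Longrightarrow> cmod (f x) \<le> B" by simp
    from C have "\<forall>\<^sub>F N in sequentially. \<forall>z\<in>S. cmod (f (of_real (y N) * a N z)) \<le> B"
      by eventually_elim (use B in auto)
    then show ?case by auto
  next
    case (Suc M)
    from split[OF Suc.prems(1)] obtain g where g: "g holomorphic_on UNIV" "\<And>s. f s = f 0 + s * g s" by blast
    have a: "has_asymp y S M a" by (rule has_asymp_Suc_imp[OF Suc.prems(2)])
    have "has_asymp y S (Suc M) (\<lambda>N z. f 0 + of_real (y N) * (a N z * g (of_real (y N) * a N z)))"
      by (intro has_asymp_add has_asymp_constant has_asymp_y has_asymp_mult a Suc.IH g)
    then show ?case
      by (rule has_asymp_cong[rotated]) (subst g(2), simp add: mult.assoc)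
  qed
  from split[OF assms(1)] obtain g where g: "g holomorphic_on UNIV" "\<And>s. f s = f 0 + s * g s" by blast
  have "has_asymp y S (Suc M) (\<lambda>N z. f 0 + of_real (y N) * (a N z * g (of_real (y N) * a N z)))"
    by (intro has_asymp_add has_asymp_constant has_asymp_y has_asymp_mult assms * g)
  then show ?thesis
    by (rule has_asymp_cong[rotated]) (subst g(2), simp add: mult.assoc)
qed

text \<open>Division by the scale preserves smallness beyond all orders, so every coefficient can be
  taken to be zero.\<close>

lemma has_asymp_negligible:
  assumes "\<And>M. \<exists>C. \<forall>\<^sub>F N in sequentially. \<forall>z\<in>S. cmod (a N z) \<le> C * y N ^ M"
  shows "has_asymp y S M a"
  using assms
proof (induction M arbitrary: a)
  case 0
  then show ?case using 0[of 0] by simp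
next
  case (Suc M)
  have "has_asymp y S M (\<lambda>N z. a N z / of_real (y N))"
  proof (rule Suc.IH)
    fix L
    from Suc.prems[of "Suc L"] obtain C where C: "\<forall>\<^sub>F N in sequentially. \<forall>z\<in>S. cmod (a N z) \<le> C * y N ^ Suc L" by blast
    have "\<forall>\<^sub>F N in sequentially. \<forall>z\<in>S. cmod (a N z / of_real (y N)) \<le> C * y N ^ L"
      using C
    proof eventually_elim
      case (elim N)
      then show ?case using y_pos[of N] by (auto simp: norm_divide divide_le_eq mult_ac)
    qed
    then show "\<exists>C. \<forall>\<^sub>F N in sequentially. \<forall>z\<in>S. cmod (a N z / of_real (y N)) \<le> C * y N ^ L" by blast
  qed
  from has_asymp_y[OF this] show ?case
    by (rule has_asymp_cong[rotated]) (auto simp: y_pos less_imp_neq[OF y_pos, symmetric])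
qed

lemma has_asymp_at_point:
  assumes "has_asymp y {p} M a"
  shows "has_asymp y S M (\<lambda>N z. a N p)"
  using assms
proof (induction M arbitrary: a)
  case (Suc M)
  then obtain e a' where e: "has_asymp y {p} M a'"
    "\<forall>\<^sub>F N in sequentially. a N p = e p + of_real (y N) * a' N p" by auto
  show ?case
    by (rule has_asymp_SucI[OF _ _ Suc.IH[OF e(1)], where e = "\<lambda>_. e p"])
       (use e(2) in \<open>auto simp: bounded_iff\<close>)
qed auto

lemma has_asymp_expansion:
  assumes "has_asymp y S M a" "p \<in> S"
  shows "\<exists>b C. \<forall>\<^sub>F N in sequentially. cmod (a N p - (\<Sum>j<M. b j * of_real (y N) ^ j)) \<le> C * y N ^ M"
  using assms
proof (induction M arbitrary: a)
  case 0
  then obtain C where "\<forall>\<^sub>F N in sequentially. \<forall>z\<in>S. cmod (a N z) \<le> C" by auto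
  then have "\<forall>\<^sub>F N in sequentially. cmod (a N p) \<le> C" using 0(2) by (auto elim: eventually_mono)
  then show ?case by auto
next
  case (Suc M)
  then obtain e a' where e: "has_asymp y S M a'"
    "\<forall>\<^sub>F N in sequentially. \<forall>z\<in>S. a N z = e z + of_real (y N) * a' N z" by auto
  from Suc.IH[OF e(1) Suc.prems(2)] obtain b C where b: 
    "\<forall>\<^sub>F N in sequentially. cmod (a' N p - (\<Sum>j<M. b j * of_real (y N) ^ j)) \<le> C * y N ^ M" by blast
  define b' where "b' = (\<lambda>j. if j = 0 then e p else b (j - 1))"
  have "\<forall>\<^sub>F N in sequentially. cmod (a N p - (\<Sum>j<Suc M. b' j * of_real (y N) ^ j)) \<le> C * y N ^ Suc M"
    using e(2) b
  proof eventually_elim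
    case (elim N)
    have "(\<Sum>j<Suc M. b' j * of_real (y N) ^ j) = e p + of_real (y N) * (\<Sum>j<M. b j * of_real (y N) ^ j)"
      by (subst sum.lessThan_Suc_shift) (simp add: b'_def sum_distrib_left mult_ac)
    then have "a N p - (\<Sum>j<Suc M. b' j * of_real (y N) ^ j) = of_real (y N) * (a' N p - (\<Sum>j<M. b j * of_real (y N) ^ j))"
      using elim Suc.prems(2) by (simp add: algebra_simps)
    then show ?case using elim y_pos[of N] by (simp add: norm_mult mult_left_mono mult_ac)
  qed
  then show ?case by blast
qed

end

section \<open>Euler-Maclaurin expansion along rays\<close>

text \<open>The properties of the periodic Bernoulli functions that repeated integration by parts
  needs; no Bernoulli numbers have to be computed. Mean zero ensures that a primitive is periodic
  again.\<close>

definition periodic_kernel :: "(real \<Rightarrow> real) \<Rightarrow> bool" where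
  "periodic_kernel k \<longleftrightarrow> continuous_on UNIV k \<and> (\<forall>x. k (x + 1) = k x) \<and> integral {0..1} k = 0"

lemma periodic_kernel_add_nat: "periodic_kernel k \<Longrightarrow> k (x + of_nat n) = k x"
proof (induction n)
  case (Suc n)
  have "k (x + of_nat (Suc n)) = k ((x + of_nat n) + 1)" by (simp add: algebra_simps)
  also have "\<dots> = k (x + of_nat n)" using Suc.prems unfolding periodic_kernel_def by blast
  finally show ?case using Suc by simp
qed simp

lemma periodic_kernel_bounded:
  assumes "periodic_kernel k" shows "\<exists>B. \<forall>x\<ge>0. \<bar>k x\<bar> \<le> B"
proof -
  have "compact (k ` {0..1})"
    using assms unfolding periodic_kernel_def
    by (intro compact_continuous_image) (auto intro: continuous_on_subset)
  then obtain B where B: "\<forall>x\<in>{0..1}. \<bar>k x\<bar> \<le> B"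
    by (auto dest!: compact_imp_bounded simp: bounded_iff)
  have "\<bar>k x\<bar> \<le> B" if "x \<ge> 0" for x
  proof -
    have "x = frac x + of_nat (nat \<lfloor>x\<rfloor>)" using that by (simp add: frac_def)
    then have "k x = k (frac x)" using periodic_kernel_add_nat[OF assms, of "frac x"] by metis
    then show ?thesis using B frac_ge_0[of x] frac_lt_1[of x] by auto
  qed
  then show ?thesis by blast
qed

text \<open>Mean zero makes \<open>F 1 = F 0\<close>, so any primitive \<open>F\<close> is periodic.
  Subtracting its own mean restores mean zero without changing the derivative.\<close>

lemma periodic_kernel_primitive:
  assumes k: "periodic_kernel k"
  shows "\<exists>K. periodic_kernel K \<and> (\<forall>x. (K has_real_derivative k x) (at x))"
proof -
  have "\<exists>F. \<forall>x::real. -\<infinity> < ereal x \<longrightarrow> ereal x < \<infinity> \<longrightarrow> (F has_vector_derivative k x) (at x)"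
    by (rule einterval_antiderivative)
       (use k in \<open>auto simp: periodic_kernel_def continuous_on_eq_continuous_at\<close>)
  then obtain F where F: "\<And>x. (F has_real_derivative k x) (at x)"
    by (auto simp: has_real_derivative_iff_has_vector_derivative)
  define c where "c = integral {0..1} F"
  define K where "K = (\<lambda>x. F x - c)"
  have K: "(K has_real_derivative k x) (at x)" for x
    unfolding K_def using F by (auto intro!: derivative_eq_intros)
  have contF: "continuous_on S F" for S
    using F by (meson DERIV_isCont continuous_at_imp_continuous_on)
  have "(k has_integral (F 1 - F 0)) {0..1}"
    by (rule fundamental_theorem_of_calculus)
       (use F in \<open>auto simp: has_real_derivative_iff_has_vector_derivative[symmetric] intro: has_field_derivative_at_within\<close>)
  then have F10: "F 1 - F 0 = 0" using k by (simp add: periodic_kernel_def integral_unique)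
  have "F (x + 1) - F x = F (0 + 1) - F 0" for x
  proof (rule DERIV_isconst_all[where f = "\<lambda>x. F (x + 1) - F x"], rule allI)
    fix x
    have "((\<lambda>x. F (x + 1)) has_real_derivative k (x + 1)) (at x)"
      using F[of "x + 1"] by (simp add: DERIV_shift)
    from DERIV_diff[OF this F[of x]]
    show "((\<lambda>x. F (x + 1) - F x) has_real_derivative 0) (at x)"
      using k by (simp add: periodic_kernel_def)
  qed
  then have per: "K (x + 1) = K x" for x using F10 by (simp add: K_def)
  have "integral {0..1} K = integral {0..1} F - integral {0..1} (\<lambda>_::real. c)"
    unfolding K_def
    by (rule Henstock_Kurzweil_Integration.integral_diff[OF integrable_continuous_interval[OF contF] integrable_const_ivl])
  then have "integral {0..1} K = 0" by (simp add: c_def)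
  moreover have "continuous_on UNIV K"
    using K by (meson DERIV_isCont continuous_at_imp_continuous_on)
  ultimately show ?thesis using per K unfolding periodic_kernel_def by blast
qed

text \<open>Half of the second Bernoulli polynomial, continued periodically.\<close>

definition bernoulli_ker :: "real \<Rightarrow> real" where
  "bernoulli_ker x = (frac x)\<^sup>2 / 2 - frac x / 2 + 1 / 12"

text \<open>The polynomial takes the same value at both ends of a cell, so the formula holds on
  closed cells and the fundamental theorem applies up to the nodes.\<close>

lemma bernoulli_ker_cell:
  assumes "of_int n \<le> x" "x \<le> of_int n + 1"
  shows "bernoulli_ker x = (x - of_int n)\<^sup>2 / 2 - (x - of_int n) / 2 + 1 / 12"
proof (cases "x = of_int n + 1")
  case True
  then have "frac x = 0" by simp
  then show ?thesis using True by (simp add: bernoulli_ker_def)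
next
  case False
  then have "\<lfloor>x\<rfloor> = n" using assms by (intro floor_unique) auto
  then show ?thesis by (simp add: bernoulli_ker_def frac_def)
qed

lemma periodic_kernel_bernoulli_ker: "periodic_kernel bernoulli_ker"
  unfolding periodic_kernel_def
proof (intro conjI allI)
  have cell: "continuous_on {of_int n..of_int n + 1} bernoulli_ker" for n
    by (rule continuous_on_eq[where f = "\<lambda>x. (x - of_int n)\<^sup>2 / 2 - (x - of_int n) / 2 + 1 / 12"])
       (auto intro!: continuous_intros simp: bernoulli_ker_cell)
  have "isCont bernoulli_ker x" for x
  proof -
    define n where "n = \<lfloor>x\<rfloor>"
    have "continuous_on ({of_int (n - 1)..of_int (n - 1) + 1} \<union> {of_int n..of_int n + 1}) bernoulli_ker"
      by (intro continuous_on_closed_Un cell) auto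
    then have "continuous_on {of_int n - 1<..<of_int n + 1} bernoulli_ker"
      by (rule continuous_on_subset) auto
    moreover have "x \<in> {of_int n - 1<..<of_int n + 1}"
      unfolding n_def using floor_correct[of x] by simp linarith
    ultimately show ?thesis by (simp add: continuous_on_eq_continuous_at)
  qed
  then show "continuous_on UNIV bernoulli_ker" by (simp add: continuous_at_imp_continuous_on)
  show "bernoulli_ker (x + 1) = bernoulli_ker x" for x by (simp add: bernoulli_ker_def frac_1_eq)
  have "((\<lambda>x. x\<^sup>2 / 2 - x / 2 + 1 / 12) has_integral ((1::real) ^ 3 / 6 - 1\<^sup>2 / 4 + 1 / 12 - (0 ^ 3 / 6 - 0\<^sup>2 / 4 + 0 / 12))) {0..1}"
    by (rule fundamental_theorem_of_calculus)
       (auto intro!: derivative_eq_intros simp: has_real_derivative_iff_has_vector_derivative[symmetric] field_simps)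
  then have "(bernoulli_ker has_integral 0) {0..1}"
    by (subst has_integral_cong[where g = "\<lambda>x. x\<^sup>2 / 2 - x / 2 + 1 / 12"])
       (use bernoulli_ker_cell[of 0] in auto)
  then show "integral {0..1} bernoulli_ker = 0" by (rule integral_unique)
qed

text \<open>
  The sum excludes the left end point, a node, whereas the right end point lies midway between two nodes; hence the
  different corrections at the two ends.
\<close>
lemma euler_maclaurin_midpoint:
  fixes G G' G'' :: "real \<Rightarrow> complex"
  assumes G: "\<And>x. 0 \<le> x \<Longrightarrow> x \<le> of_nat n + 1/2 \<Longrightarrow> (G has_vector_derivative G' x) (at x)"
    and G': "\<And>x. 0 \<le> x \<Longrightarrow> x \<le> of_nat n + 1/2 \<Longrightarrow> (G' has_vector_derivative G'' x) (at x)"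
  shows "((\<lambda>s. bernoulli_ker s *\<^sub>R G'' s - G s) has_integral
     (- (\<Sum>j=1..n. G (of_nat j)) - G 0 / 2 - G' (of_nat n + 1/2) / 24 - G' 0 / 12)) {0..of_nat n + 1/2}"
proof -
  \<comment> \<open>The primitive on the cell \<open>[k, k + 1]\<close>, found by integrating by
    parts twice. The quadratic factor matches at the nodes, whereas the linear one jumps
    there.\<close>
  define H where "H = (\<lambda>k::int. \<lambda>s. ((s - of_int k)\<^sup>2 / 2 - (s - of_int k) / 2 + 1 / 12) *\<^sub>R G' s - (s - of_int k - 1/2) *\<^sub>R G s)"
  have cell: "((\<lambda>s. bernoulli_ker s *\<^sub>R G'' s - G s) has_integral (H k \<beta> - H k \<alpha>)) {\<alpha>..\<beta>}"
    if "0 \<le> \<alpha>" "\<alpha> \<le> \<beta>" "\<beta> \<le> of_nat n + 1/2" "of_int k \<le> \<alpha>" "\<beta> \<le> of_int k + 1" for k \<alpha> \<beta>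
  proof (rule fundamental_theorem_of_calculus[OF that(2)])
    fix s assume s: "s \<in> {\<alpha>..\<beta>}"
    then have b: "bernoulli_ker s = (s - of_int k)\<^sup>2 / 2 - (s - of_int k) / 2 + 1 / 12"
      using that by (intro bernoulli_ker_cell) auto
    have 1: "((\<lambda>s. (s - of_int k)\<^sup>2 / 2 - (s - of_int k) / 2 + 1 / 12) has_real_derivative (s - of_int k - 1/2)) (at s)"
      by (auto intro!: derivative_eq_intros simp: field_simps)
    have 2: "((\<lambda>s. s - of_int k - 1/2) has_real_derivative 1) (at s)"
      by (auto intro!: derivative_eq_intros)
    have "0 \<le> s" "s \<le> of_nat n + 1/2" using s that by auto
    from has_vector_derivative_diff[OF
        has_vector_derivative_scaleR[OF 1 G'[OF this]] has_vector_derivative_scaleR[OF 2 G[OF this]]]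
    have "(H k has_vector_derivative (bernoulli_ker s *\<^sub>R G'' s - G s)) (at s)"
      unfolding H_def b by (simp add: algebra_simps)
    then show "(H k has_vector_derivative (bernoulli_ker s *\<^sub>R G'' s - G s)) (at s within {\<alpha>..\<beta>})"
      by (rule has_vector_derivative_at_within)
  qed
  have "((\<lambda>s. bernoulli_ker s *\<^sub>R G'' s - G s) has_integral
     (- (\<Sum>j=1..m. G (of_nat j)) - G 0 / 2 - G' (of_nat m + 1/2) / 24 - G' 0 / 12)) {0..of_nat m + 1/2}"
    if "m \<le> n" for m
    using that
  proof (induction m)
    case 0
    have "H 0 (1/2) - H 0 0 = - (\<Sum>j=1..0. G (of_nat j)) - G 0 / 2 - G' (of_nat 0 + 1/2) / 24 - G' 0 / 12"
      unfolding H_def by (simp add: scaleR_conv_of_real power2_eq_square field_simps)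
    with cell[of 0 "1/2" 0] show ?case by simp
  next
    case (Suc m)
    have le: "real m + 1 \<le> real n" using Suc.prems by linarith
    have 1: "((\<lambda>s. bernoulli_ker s *\<^sub>R G'' s - G s) has_integral (H (int m) (of_nat m + 1) - H (int m) (of_nat m + 1/2))) {of_nat m + 1/2..of_nat m + 1}"
      by (rule cell) (use le in auto)
    have 2: "((\<lambda>s. bernoulli_ker s *\<^sub>R G'' s - G s) has_integral (H (int m + 1) (of_nat m + 3/2) - H (int m + 1) (of_nat m + 1))) {of_nat m + 1..of_nat m + 3/2}"
      by (rule cell) (use le in auto)
    have 12: "((\<lambda>s. bernoulli_ker s *\<^sub>R G'' s - G s) has_integral
        ((H (int m) (of_nat m + 1) - H (int m) (of_nat m + 1/2)) + (H (int m + 1) (of_nat m + 3/2) - H (int m + 1) (of_nat m + 1))))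
        {of_nat m + 1/2..of_nat m + 3/2}"
      by (rule has_integral_combine[OF _ _ 1 2]) auto
    have main: "((\<lambda>s. bernoulli_ker s *\<^sub>R G'' s - G s) has_integral
        ((- (\<Sum>j=1..m. G (of_nat j)) - G 0 / 2 - G' (of_nat m + 1/2) / 24 - G' 0 / 12) +
         ((H (int m) (of_nat m + 1) - H (int m) (of_nat m + 1/2)) + (H (int m + 1) (of_nat m + 3/2) - H (int m + 1) (of_nat m + 1)))))
        {0..of_nat m + 3/2}"
      by (rule has_integral_combine[OF _ _ Suc.IH 12]) (use Suc.prems in auto)
    \<comment> \<open>Crossing the node \<open>m + 1\<close> the linear factor jumps from
      \<open>1/2\<close> to \<open>-1/2\<close>, which produces the summand
      \<open>- G (m + 1)\<close>; at the midpoints it vanishes.\<close>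
    have H: "(H (int m) (of_nat m + 1) - H (int m) (of_nat m + 1/2)) + (H (int m + 1) (of_nat m + 3/2) - H (int m + 1) (of_nat m + 1))
        = - G (of_nat (Suc m)) - G' (of_nat m + 3/2) / 24 + G' (of_nat m + 1/2) / 24"
      unfolding H_def by (simp add: scaleR_conv_of_real power2_eq_square field_simps)
    have r: "real (Suc m) + 1/2 = real m + 3/2" by simp
    show ?case unfolding r using main unfolding H by (rule has_integral_eq_rhs) simp
  qed
  then show ?thesis by blast
qed

definition nu :: "nat \<Rightarrow> real" where "nu N = real N + 1/2"
definition inv_nu :: "nat \<Rightarrow> real" where "inv_nu N = 1 / nu N"

lemma nu_pos: "nu N > 0" by (simp add: nu_def)
lemma nu_inv_nu [simp]: "nu N * inv_nu N = 1" "inv_nu N * nu N = 1" using nu_pos[of N] by (simp_all add: inv_nu_def)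

interpretation inv_nu: asymp_scale inv_nu
proof
  show "inv_nu N > 0" for N using nu_pos[of N] by (simp add: inv_nu_def)
  show "inv_nu N \<le> 2" for N by (simp add: inv_nu_def nu_def divide_simps)
  have "(\<lambda>N::nat. 1 / (real N + 1/2)) \<longlonglongrightarrow> 0" by real_asymp
  then show "inv_nu \<longlonglongrightarrow> 0" unfolding inv_nu_def nu_def .
qed

text \<open>\<open>S\<close> is the set of parameters \<open>z\<close>, \<open>T\<close> a compact
  set containing the rays from \<open>0\<close> to \<open>S\<close>, and \<open>U\<close> the domain
  of the functions. Compactness of \<open>T\<close> makes all bounds uniform in
  \<open>z\<close>.\<close>

locale em_region =
  fixes U S T :: "complex set"
  assumes open_U: "open U" and compact_T: "compact T" and T_U: "T \<subseteq> U"
    and star: "\<And>z t. z \<in> S \<Longrightarrow> 0 \<le> t \<Longrightarrow> t \<le> 1 \<Longrightarrow> of_real t * z \<in> T"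
begin

lemma S_T: "S \<subseteq> T" using star[of _ 1] by auto

lemma hol_bounded_S:
  assumes "\<phi> holomorphic_on U" shows "\<phi> holomorphic_on S" "bounded (\<phi> ` S)" "bounded (\<phi> ` T)"
proof -
  show "\<phi> holomorphic_on S" using assms S_T T_U by (meson holomorphic_on_subset)
  have "continuous_on T \<phi>" using assms T_U by (meson holomorphic_on_subset holomorphic_on_imp_continuous_on)
  then show "bounded (\<phi> ` T)" by (intro compact_imp_bounded compact_continuous_image compact_T)
  then show "bounded (\<phi> ` S)" using S_T by (meson bounded_subset image_mono)
qed

lemma id_bounded_S: "bounded ((\<lambda>z. z) ` S)"
  using compact_imp_bounded[OF compact_T] S_T by (auto intro: bounded_subset)

lemma ray_mem:
  assumes "z \<in> S" "0 \<le> s" "s \<le> nu N"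
  shows "of_real (s * inv_nu N) * z \<in> T" "of_real (s * inv_nu N) * z \<in> U"
proof -
  have "s * inv_nu N \<le> nu N * inv_nu N" using assms inv_nu.y_pos[of N] by (intro mult_right_mono) auto
  then have "s * inv_nu N \<le> 1" by simp
  then show "of_real (s * inv_nu N) * z \<in> T" using assms inv_nu.y_pos[of N] by (intro star) (auto intro: mult_nonneg_nonneg less_imp_le)
  then show "of_real (s * inv_nu N) * z \<in> U" using T_U by blast
qed

lemma ray_deriv:
  assumes "\<phi> holomorphic_on U" "z \<in> S" "0 \<le> s" "s \<le> nu N"
  shows "((\<lambda>s. \<phi> (of_real (s * inv_nu N) * z)) has_vector_derivative
     of_real (inv_nu N) * z * deriv \<phi> (of_real (s * inv_nu N) * z)) (at s)"
proof -
  have d: "(\<phi> has_field_derivative deriv \<phi> (of_real (s * inv_nu N) * z)) (at (of_real (s * inv_nu N) * z))"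
    using assms(1) open_U ray_mem(2)[OF assms(2-4)] by (rule holomorphic_derivI)
  have "((\<lambda>x. \<phi> (x * (of_real (inv_nu N) * z))) has_field_derivative
      deriv \<phi> (of_real (s * inv_nu N) * z) * (of_real (inv_nu N) * z)) (at (of_real s))"
    by (rule DERIV_chain2[where f = \<phi>]) (use d in \<open>auto intro!: derivative_eq_intros simp: mult.assoc\<close>)
  from has_vector_derivative_real_field[OF this] show ?thesis by (simp add: mult_ac)
qed

lemma ray_cont:
  assumes "\<phi> holomorphic_on U" "z \<in> S"
  shows "continuous_on {0..nu N} (\<lambda>s. \<phi> (of_real (s * inv_nu N) * z))"
  using ray_deriv[OF assms] by (auto intro!: continuous_at_imp_continuous_on has_vector_derivative_continuous)

text \<open>After the substitution \<open>s = nu N * t\<close> this is the integral over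
  \<open>t\<close> from \<open>0\<close> to \<open>1\<close> of \<open>k (nu N * t)\<close> times
  \<open>\<phi> (t * z)\<close>, an average against a rapidly oscillating kernel.\<close>

definition ker_integral :: "(real \<Rightarrow> real) \<Rightarrow> (complex \<Rightarrow> complex) \<Rightarrow> nat \<Rightarrow> complex \<Rightarrow> complex" where
  "ker_integral k \<phi> N z = of_real (inv_nu N) * integral {0..nu N} (\<lambda>s. k s *\<^sub>R \<phi> (of_real (s * inv_nu N) * z))"

text \<open>Integration by parts against the periodic primitive \<open>K\<close> gains a factor
  \<open>inv_nu N\<close>. The boundary values do not depend on \<open>N\<close>, since
  \<open>K (nu N) = K (1/2)\<close> by periodicity, and the remaining integral has the same form
  with \<open>deriv \<phi>\<close> in place of \<open>\<phi>\<close>.\<close>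

lemma ker_integral_has_asymp:
  assumes "periodic_kernel k" "\<phi> holomorphic_on U"
  shows "has_asymp inv_nu S M (ker_integral k \<phi>)"
  using assms
proof (induction M arbitrary: k \<phi>)
  case 0
  from periodic_kernel_bounded[OF 0(1)] obtain B where B: "\<And>x. x \<ge> 0 \<Longrightarrow> \<bar>k x\<bar> \<le> B" by blast
  from hol_bounded_S(3)[OF 0(2)] obtain C where C: "\<And>x. x \<in> T \<Longrightarrow> cmod (\<phi> x) \<le> C" by (auto simp: bounded_iff)
  have "cmod (ker_integral k \<phi> N z) \<le> B * C" if z: "z \<in> S" for N z
  proof -
    have B0: "B \<ge> 0" using B[of 0] by auto
    have "0 \<in> T" using star[OF z, of 0] by simp
    then have "C \<ge> 0" using C[of 0] norm_ge_zero[of "\<phi> 0"] by linarith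
    have k: "continuous_on {0..nu N} k" using 0(1) unfolding periodic_kernel_def by (auto intro: continuous_on_subset)
    have "norm (integral {0..nu N} (\<lambda>s. k s *\<^sub>R \<phi> (of_real (s * inv_nu N) * z))) \<le> B * C * (nu N - 0)"
    proof (rule integral_bound)
      show "0 \<le> nu N" using nu_pos[of N] by simp
      show "continuous_on {0..nu N} (\<lambda>s. k s *\<^sub>R \<phi> (of_real (s * inv_nu N) * z))"
        by (intro continuous_intros k ray_cont 0 z)
      show "norm (k s *\<^sub>R \<phi> (of_real (s * inv_nu N) * z)) \<le> B * C" if "s \<in> {0..nu N}" for s
        using that B[of s] C[OF ray_mem(1)[OF z, of s N]] B0 by (auto intro!: mult_mono)
    qed
    then have "cmod (ker_integral k \<phi> N z) \<le> inv_nu N * (B * C * nu N)"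
      unfolding ker_integral_def using inv_nu.y_pos[of N] by (simp add: norm_mult)
    also have "\<dots> = B * C * (nu N * inv_nu N)" by (simp add: mult_ac)
    finally show ?thesis by simp
  qed
  then show ?case by (auto intro: always_eventually)
next
  case (Suc M)
  from periodic_kernel_primitive[OF Suc.prems(1)] obtain K where K: "periodic_kernel K"
    "\<And>x. (K has_real_derivative k x) (at x)" by blast
  have d\<phi>: "deriv \<phi> holomorphic_on U" using Suc.prems open_U by (intro holomorphic_deriv)
  have "has_asymp inv_nu S M (\<lambda>N z. of_real (K (1/2)) * \<phi> z - of_real (K 0) * \<phi> 0 - z * ker_integral K (deriv \<phi>) N z)"
    by (intro inv_nu.has_asymp_diff inv_nu.has_asymp_mult Suc.IH K d\<phi> has_asymp_constant has_asymp_const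
        hol_bounded_S Suc.prems id_bounded_S) (auto intro: holomorphic_intros)
  from inv_nu.has_asymp_y[OF this] show ?case
  proof (rule has_asymp_cong[rotated], intro always_eventually allI ballI)
    fix N z assume z: "z \<in> S"
    have cK: "continuous_on {0..nu N} K" and ck: "continuous_on {0..nu N} k"
      using K(1) Suc.prems unfolding periodic_kernel_def by (auto intro: continuous_on_subset)
    have "((\<lambda>s. K s *\<^sub>R (of_real (inv_nu N) * z * deriv \<phi> (of_real (s * inv_nu N) * z)) + k s *\<^sub>R \<phi> (of_real (s * inv_nu N) * z))
       has_integral (K (nu N) *\<^sub>R \<phi> (of_real (nu N * inv_nu N) * z) - K 0 *\<^sub>R \<phi> (of_real (0 * inv_nu N) * z))) {0..nu N}"
    proof (rule fundamental_theorem_of_calculus[where f = "\<lambda>s. K s *\<^sub>R \<phi> (of_real (s * inv_nu N) * z)"])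
      show "0 \<le> nu N" using nu_pos[of N] by simp
      fix s assume "s \<in> {0..nu N}"
      then have "0 \<le> s" "s \<le> nu N" by auto
      from has_vector_derivative_scaleR[OF K(2) ray_deriv[OF Suc.prems(2) z this]]
      show "((\<lambda>s. K s *\<^sub>R \<phi> (of_real (s * inv_nu N) * z)) has_vector_derivative
          K s *\<^sub>R (of_real (inv_nu N) * z * deriv \<phi> (of_real (s * inv_nu N) * z)) + k s *\<^sub>R \<phi> (of_real (s * inv_nu N) * z)) (at s within {0..nu N})"
        by (rule has_vector_derivative_at_within)
    qed
    from integral_unique[OF this] have "integral {0..nu N} (\<lambda>s. K s *\<^sub>R (of_real (inv_nu N) * z * deriv \<phi> (of_real (s * inv_nu N) * z)) + k s *\<^sub>R \<phi> (of_real (s * inv_nu N) * z))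
       = K (nu N) *\<^sub>R \<phi> z - K 0 *\<^sub>R \<phi> 0" by (simp only: nu_inv_nu of_real_1 mult_1_left mult_zero_left of_real_0)
    moreover have "integral {0..nu N} (\<lambda>s. K s *\<^sub>R (of_real (inv_nu N) * z * deriv \<phi> (of_real (s * inv_nu N) * z)) + k s *\<^sub>R \<phi> (of_real (s * inv_nu N) * z))
      = integral {0..nu N} (\<lambda>s. K s *\<^sub>R (of_real (inv_nu N) * z * deriv \<phi> (of_real (s * inv_nu N) * z))) + integral {0..nu N} (\<lambda>s. k s *\<^sub>R \<phi> (of_real (s * inv_nu N) * z))"
      by (intro Henstock_Kurzweil_Integration.integral_add integrable_continuous_interval continuous_intros cK ck ray_cont d\<phi> Suc.prems z)
    moreover have "integral {0..nu N} (\<lambda>s. K s *\<^sub>R (of_real (inv_nu N) * z * deriv \<phi> (of_real (s * inv_nu N) * z)))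
      = z * ker_integral K (deriv \<phi>) N z"
    proof -
      have "(\<lambda>s. K s *\<^sub>R (of_real (inv_nu N) * z * deriv \<phi> (of_real (s * inv_nu N) * z))) = (\<lambda>s. (of_real (inv_nu N) * z) * (K s *\<^sub>R deriv \<phi> (of_real (s * inv_nu N) * z)))"
        by auto
      then show ?thesis by (simp only: Henstock_Kurzweil_Integration.integral_mult_right ker_integral_def mult_ac)
    qed
    moreover have "K (nu N) = K (1/2)"
      using periodic_kernel_add_nat[OF K(1), of "1/2" N] by (simp add: nu_def add.commute)
    ultimately have "integral {0..nu N} (\<lambda>s. k s *\<^sub>R \<phi> (of_real (s * inv_nu N) * z)) = K (1/2) *\<^sub>R \<phi> z - K 0 *\<^sub>R \<phi> 0 - z * ker_integral K (deriv \<phi>) N z"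
      by (simp add: algebra_simps)
    then show "ker_integral k \<phi> N z = of_real (inv_nu N) * (of_real (K (1/2)) * \<phi> z - of_real (K 0) * \<phi> 0 - z * ker_integral K (deriv \<phi>) N z)"
      unfolding ker_integral_def[of k] by (simp add: scaleR_conv_of_real)
  qed
qed

text \<open>Each derivative along the ray brings a factor \<open>inv_nu N * z\<close>. Hence every
  correction apart from \<open>\<phi> 0 / 2\<close> carries a power of the scale, and the kernel
  integral supplies its expansion.\<close>

lemma euler_maclaurin_has_asymp:
  assumes \<phi>: "\<phi> holomorphic_on U"
  shows "\<exists>R. (\<forall>M. has_asymp inv_nu S M R) \<and> (\<forall>N. \<forall>z\<in>S. (\<Sum>j=1..N. \<phi> (of_real (real j * inv_nu N) * z)) =
     integral {0..nu N} (\<lambda>s. \<phi> (of_real (s * inv_nu N) * z)) - \<phi> 0 / 2 + of_real (inv_nu N) * R N z)"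
proof -
  define R where "R = (\<lambda>N z. (-1/24) * (z * deriv \<phi> z) - (deriv \<phi> 0 / 12) * z - (z * z) * ker_integral bernoulli_ker (deriv (deriv \<phi>)) N z)"
  have d\<phi>: "deriv \<phi> holomorphic_on U" by (rule holomorphic_deriv[OF \<phi> open_U])
  have dd\<phi>: "deriv (deriv \<phi>) holomorphic_on U" by (rule holomorphic_deriv[OF d\<phi> open_U])
  have id: "has_asymp inv_nu S M (\<lambda>_ z. z)" for M
    by (intro has_asymp_const id_bounded_S) (auto intro: holomorphic_intros)
  have h: "has_asymp inv_nu S M (\<lambda>_. deriv \<phi>)" for M
    by (intro has_asymp_const hol_bounded_S d\<phi>)
  have "has_asymp inv_nu S M R" for M
    unfolding R_def
    by (intro inv_nu.has_asymp_diff inv_nu.has_asymp_mult id h has_asymp_constant ker_integral_has_asymp dd\<phi> periodic_kernel_bernoulli_ker)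
  moreover have "(\<Sum>j=1..N. \<phi> (of_real (real j * inv_nu N) * z)) =
     integral {0..nu N} (\<lambda>s. \<phi> (of_real (s * inv_nu N) * z)) - \<phi> 0 / 2 + of_real (inv_nu N) * R N z" if z: "z \<in> S" for N z
  proof -
    define y where "y = complex_of_real (inv_nu N)"
    define G where "G = (\<lambda>s. \<phi> (of_real (s * inv_nu N) * z))"
    define G1 where "G1 = (\<lambda>s. y * z * deriv \<phi> (of_real (s * inv_nu N) * z))"
    define G2 where "G2 = (\<lambda>s. (y * z) * (y * z * deriv (deriv \<phi>) (of_real (s * inv_nu N) * z)))"
    have 1: "(G has_vector_derivative G1 s) (at s)" if "0 \<le> s" "s \<le> nu N" for s
      unfolding G_def G1_def y_def by (rule ray_deriv[OF \<phi> z that])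
    have 2: "(G1 has_vector_derivative G2 s) (at s)" if "0 \<le> s" "s \<le> nu N" for s
      unfolding G1_def G2_def using ray_deriv[OF d\<phi> z that]
      by (intro has_vector_derivative_mult_right) (simp add: y_def)
    have "((\<lambda>s. bernoulli_ker s *\<^sub>R G2 s - G s) has_integral
       (- (\<Sum>j=1..N. G (of_nat j)) - G 0 / 2 - G1 (nu N) / 24 - G1 0 / 12)) {0..nu N}"
      using euler_maclaurin_midpoint[of N G G1 G2] 1 2 by (simp add: nu_def)
    then have e1: "integral {0..nu N} (\<lambda>s. bernoulli_ker s *\<^sub>R G2 s - G s) =
       - (\<Sum>j=1..N. G (of_nat j)) - G 0 / 2 - G1 (nu N) / 24 - G1 0 / 12" by (rule integral_unique)
    have cb: "continuous_on {0..nu N} bernoulli_ker"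
      using periodic_kernel_bernoulli_ker unfolding periodic_kernel_def by (auto intro: continuous_on_subset)
    have e2: "integral {0..nu N} (\<lambda>s. bernoulli_ker s *\<^sub>R G2 s - G s) =
       integral {0..nu N} (\<lambda>s. bernoulli_ker s *\<^sub>R G2 s) - integral {0..nu N} G"
      unfolding G2_def G_def
      by (intro Henstock_Kurzweil_Integration.integral_diff integrable_continuous_interval continuous_intros cb ray_cont \<phi> dd\<phi> z)
    have "(\<lambda>s. bernoulli_ker s *\<^sub>R G2 s) = (\<lambda>s. (y * z * (y * z)) * (bernoulli_ker s *\<^sub>R deriv (deriv \<phi>) (of_real (s * inv_nu N) * z)))"
      by (auto simp: G2_def mult_ac)
    then have e3: "integral {0..nu N} (\<lambda>s. bernoulli_ker s *\<^sub>R G2 s) = y * (z * z) * ker_integral bernoulli_ker (deriv (deriv \<phi>)) N z"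
      by (simp only: Henstock_Kurzweil_Integration.integral_mult_right ker_integral_def y_def mult_ac)
    have g: "G 0 = \<phi> 0" "G1 (nu N) = y * z * deriv \<phi> z" "G1 0 = y * z * deriv \<phi> 0"
      by (simp_all add: G_def G1_def del: of_real_mult)
    have "(\<Sum>j=1..N. G (of_nat j)) = integral {0..nu N} G - \<phi> 0 / 2 + y * R N z"
    proof -
      have *: "S = I - P / 2 + (- (1/24) * A - (1/12) * B - X)"
        if "X - I = - S - P / 2 - A / 24 - B / 12" for X I S P A B :: complex
        using that by (simp add: algebra_simps)
      show ?thesis unfolding *[OF e1[unfolded e2 e3 g]] R_def by (simp add: algebra_simps)
    qed
    then show ?thesis by (simp add: G_def y_def)
  qed
  ultimately show ?thesis by blast
qed

lemma ray_integral:
  assumes "F holomorphic_on U" "\<And>x. x \<in> U \<Longrightarrow> deriv F x = \<phi> x" "z \<in> S"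
  shows "z * integral {0..nu N} (\<lambda>s. \<phi> (of_real (s * inv_nu N) * z)) = of_real (nu N) * (F z - F 0)"
proof -
  have "((\<lambda>s. of_real (inv_nu N) * z * deriv F (of_real (s * inv_nu N) * z)) has_integral
     (F (of_real (nu N * inv_nu N) * z) - F (of_real (0 * inv_nu N) * z))) {0..nu N}"
  proof (rule fundamental_theorem_of_calculus[where f = "\<lambda>s. F (of_real (s * inv_nu N) * z)"])
    show "0 \<le> nu N" using nu_pos[of N] by simp
    fix s assume "s \<in> {0..nu N}"
    then have "0 \<le> s" "s \<le> nu N" by auto
    from ray_deriv[OF assms(1,3) this]
    show "((\<lambda>s. F (of_real (s * inv_nu N) * z)) has_vector_derivative
          of_real (inv_nu N) * z * deriv F (of_real (s * inv_nu N) * z)) (at s within {0..nu N})"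
      by (rule has_vector_derivative_at_within)
  qed
  from integral_unique[OF this] have "integral {0..nu N} (\<lambda>s. of_real (inv_nu N) * z * deriv F (of_real (s * inv_nu N) * z)) = F z - F 0"
    by (simp only: nu_inv_nu of_real_1 mult_1_left mult_zero_left of_real_0)
  then have "of_real (inv_nu N) * z * integral {0..nu N} (\<lambda>s. deriv F (of_real (s * inv_nu N) * z)) = F z - F 0"
    by (simp only: Henstock_Kurzweil_Integration.integral_mult_right)
  moreover have "integral {0..nu N} (\<lambda>s. deriv F (of_real (s * inv_nu N) * z)) = integral {0..nu N} (\<lambda>s. \<phi> (of_real (s * inv_nu N) * z))"
    by (rule Henstock_Kurzweil_Integration.integral_cong) (use assms ray_mem(2) in auto)
  ultimately have "of_real (nu N) * (of_real (inv_nu N) * z * integral {0..nu N} (\<lambda>s. \<phi> (of_real (s * inv_nu N) * z))) = of_real (nu N) * (F z - F 0)" by simp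
  moreover have "of_real (nu N) * of_real (inv_nu N) = (1::complex)" by (simp flip: of_real_mult)
  ultimately show ?thesis by (simp add: mult.assoc[symmetric])
qed

end

lemma nu_power_exp_le_1:
  assumes "c > 0"
  shows "\<forall>\<^sub>F N in sequentially. nu N ^ k * exp (- (c * nu N)) \<le> 1"
proof -
  have "filterlim (\<lambda>N. c * nu N) at_top sequentially"
    unfolding nu_def by (rule filterlim_tendsto_pos_mult_at_top[OF tendsto_const assms]) real_asymp
  then have "(\<lambda>N. (c * nu N) ^ k / exp (c * nu N)) \<longlonglongrightarrow> 0"
    by (rule filterlim_compose[OF tendsto_power_div_exp_0])
  moreover have "0 < c ^ k" using assms by simp
  ultimately have "\<forall>\<^sub>F N in sequentially. (c * nu N) ^ k / exp (c * nu N) < c ^ k"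
    by (rule order_tendstoD)
  then show ?thesis
  proof eventually_elim
    case (elim N)
    then have "c ^ k * (nu N ^ k * exp (- (c * nu N))) < c ^ k * 1"
      by (simp add: power_mult_distrib exp_minus divide_inverse mult_ac)
    then show ?case using assms by simp
  qed
qed

lemma has_asymp_exp_small:
  assumes "c > 0" and b: "\<forall>\<^sub>F N in sequentially. \<forall>z\<in>S. cmod (a N z) \<le> A * nu N ^ k * exp (- (c * nu N))"
  shows "has_asymp inv_nu S M a"
proof (rule inv_nu.has_asymp_negligible)
  fix M
  have "\<forall>\<^sub>F N in sequentially. \<forall>z\<in>S. cmod (a N z) \<le> \<bar>A\<bar> * inv_nu N ^ M"
    using b nu_power_exp_le_1[OF assms(1), of "k + M"]
  proof eventually_elim
    case (elim N)
    show ?case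
    proof
      fix z assume "z \<in> S"
      then have "cmod (a N z) \<le> A * (nu N ^ k * exp (- (c * nu N)))" using elim by (simp add: mult.assoc)
      also have "\<dots> \<le> \<bar>A\<bar> * (nu N ^ k * exp (- (c * nu N)))"
        using nu_pos[of N] by (intro mult_right_mono) auto
      also have "nu N ^ k * exp (- (c * nu N)) = (nu N ^ (k + M) * exp (- (c * nu N))) * inv_nu N ^ M"
        using nu_pos[of N] by (simp add: inv_nu_def power_add field_simps)
      also have "\<dots> \<le> 1 * inv_nu N ^ M"
        using elim inv_nu.y_pos[of N] by (intro mult_right_mono) auto
      finally show "cmod (a N z) \<le> \<bar>A\<bar> * inv_nu N ^ M" by (simp add: mult_left_mono)
    qed
  qed
  then show "\<exists>C. \<forall>\<^sub>F N in sequentially. \<forall>z\<in>S. cmod (a N z) \<le> C * inv_nu N ^ M" by blast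
qed

section \<open>Laplace's method\<close>

definition gauss :: "real \<Rightarrow> real" where
  "gauss b = integral {0..b} (\<lambda>t. exp (- t\<^sup>2))"

lemma gauss_deriv: "b > 0 \<Longrightarrow> (gauss has_real_derivative exp (- b\<^sup>2)) (at b)"
proof -
  assume b: "b > 0"
  have "((\<lambda>u. integral {0..u} (\<lambda>t. exp (- t\<^sup>2))) has_real_derivative exp (- b\<^sup>2)) (at b within {0..b+1})"
    by (rule integral_has_real_derivative) (use b in \<open>auto intro!: continuous_intros\<close>)
  then show ?thesis
    using b unfolding gauss_def by (subst (asm) at_within_Icc_at) auto
qed

lemma gauss_limit: "(gauss \<longlongrightarrow> sqrt pi / 2) at_top"
proof -
  let ?f = "\<lambda>x::real. indicator {0..} x *\<^sub>R exp (- x\<^sup>2)"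
  have hb: "has_bochner_integral lborel ?f (sqrt pi / 2)" by (rule gaussian_moment_0)
  then have "((\<lambda>b. \<integral>x. indicator {..b} x *\<^sub>R ?f x \<partial>lborel) \<longlongrightarrow> (\<integral>x. ?f x \<partial>lborel)) at_top"
    by (intro tendsto_integral_at_top) (auto simp: has_bochner_integral_iff)
  moreover have "(\<integral>x. indicator {..b} x *\<^sub>R ?f x \<partial>lborel) = gauss b" for b
  proof -
    have "(\<integral>x. indicator {..b} x *\<^sub>R ?f x \<partial>lborel) = (LINT x:{0..b}|lborel. exp (- x\<^sup>2))"
      unfolding set_lebesgue_integral_def
      by (intro Bochner_Integration.integral_cong) (auto simp: indicator_def)
    also have "\<dots> = gauss b" unfolding gauss_def
      by (intro set_borel_integral_eq_integral(2) borel_integrable_atLeastAtMost' continuous_intros)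
    finally show ?thesis .
  qed
  moreover have "(\<integral>x. ?f x \<partial>lborel) = sqrt pi / 2" using hb by (simp add: has_bochner_integral_iff)
  ultimately show ?thesis by (simp only:)
qed

text \<open>\<open>gauss\<close> increases, and from \<open>1\<close> on
  \<open>gauss c + exp (- c\<^sup>2) / 2\<close> decreases because its derivative is
  \<open>exp (- c\<^sup>2) * (1 - c)\<close>. Both are compared with the limit of
  \<open>gauss\<close>.\<close>

lemma gauss_bounds:
  assumes "b \<ge> 1"
  shows "gauss b \<le> sqrt pi / 2" "sqrt pi / 2 \<le> gauss b + exp (- b\<^sup>2) / 2"
proof -
  have 1: "gauss b \<le> gauss c" if "b \<le> c" for c
    using that
  proof (rule DERIV_nonneg_imp_nondecreasing)
    fix x assume "b \<le> x"
    then show "\<exists>y. (gauss has_real_derivative y) (at x) \<and> 0 \<le> y"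
      using gauss_deriv[of x] assms by (intro exI[of _ "exp (- x\<^sup>2)"]) auto
  qed
  show "gauss b \<le> sqrt pi / 2"
    by (rule tendsto_lowerbound[OF gauss_limit]) (auto intro: eventually_mono[OF eventually_ge_at_top[of b]] 1)
  have 2: "gauss c + exp (- c\<^sup>2) / 2 \<le> gauss b + exp (- b\<^sup>2) / 2" if "b \<le> c" for c
    using that
  proof (rule DERIV_nonpos_imp_nonincreasing)
    fix x assume x: "b \<le> x"
    have "((\<lambda>c. gauss c + exp (- c\<^sup>2) / 2) has_real_derivative (exp (- x\<^sup>2) * (1 - x))) (at x)"
      using x assms by (auto intro!: derivative_eq_intros gauss_deriv simp: algebra_simps)
    moreover have "exp (- x\<^sup>2) * (1 - x) \<le> 0" using x assms by (intro mult_nonneg_nonpos) auto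
    ultimately show "\<exists>y. ((\<lambda>c. gauss c + exp (- c\<^sup>2) / 2) has_real_derivative y) (at x) \<and> y \<le> 0" by blast
  qed
  have "gauss c \<le> gauss b + exp (- b\<^sup>2) / 2" if "b \<le> c" for c
  proof -
    have "gauss c \<le> gauss c + exp (- c\<^sup>2) / 2" by simp
    also have "\<dots> \<le> gauss b + exp (- b\<^sup>2) / 2" by (rule 2[OF that])
    finally show ?thesis .
  qed
  then show "sqrt pi / 2 \<le> gauss b + exp (- b\<^sup>2) / 2"
    by (intro tendsto_upperbound[OF gauss_limit]) (auto intro: eventually_mono[OF eventually_ge_at_top[of b]])
qed

lemma gauss_le: "gauss b \<le> sqrt pi / 2"
proof (cases "b \<ge> 1")
  case False
  have i: "(\<lambda>t::real. exp (- t\<^sup>2)) integrable_on {a..b}" for a b :: real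
    by (intro integrable_continuous_interval continuous_intros)
  have "gauss b \<le> gauss 1" unfolding gauss_def
    by (rule integral_subset_le) (use False i in auto)
  then show ?thesis using gauss_bounds(1)[of 1] by simp
qed (rule gauss_bounds)

text \<open>The error function without its usual factor, as an entire function: the primitive is
  needed along complex paths.\<close>

definition Gauss :: "complex \<Rightarrow> complex" where
  "Gauss = (SOME E. E 0 = 0 \<and> (\<forall>z. (E has_field_derivative exp (- z\<^sup>2)) (at z)))"

lemma Gauss_0: "Gauss 0 = 0" and Gauss_deriv: "(Gauss has_field_derivative exp (- z\<^sup>2)) (at z)"
proof -
  have "\<exists>g. \<forall>x\<in>UNIV. (g has_field_derivative exp (- x\<^sup>2)) (at (x::complex))"
    by (rule holomorphic_starlike_primitive[where k = "{}"])
       (auto intro!: continuous_intros convex_imp_starlike simp: field_differentiable_def intro!: exI derivative_eq_intros)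
  then obtain g :: "complex \<Rightarrow> complex" where g: "\<And>x. (g has_field_derivative exp (- x\<^sup>2)) (at x)" by blast
  have "\<exists>E::complex \<Rightarrow> complex. E 0 = 0 \<and> (\<forall>z. (E has_field_derivative exp (- z\<^sup>2)) (at z))"
    by (rule exI[of _ "\<lambda>z. g z - g 0"]) (auto intro!: derivative_eq_intros g)
  from someI_ex[OF this, folded Gauss_def]
  show "Gauss 0 = 0" "(Gauss has_field_derivative exp (- z\<^sup>2)) (at z)" by auto
qed

lemma Gauss_minus: "Gauss (- z) = - Gauss z"
proof -
  have "\<exists>c. \<forall>z\<in>UNIV. Gauss z + Gauss (- z) = c"
  proof (rule has_field_derivative_zero_constant)
    fix z
    have "((\<lambda>z. Gauss (- z)) has_field_derivative exp (- (- z)\<^sup>2) * (-1)) (at z)"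
      by (rule DERIV_chain2[where f = Gauss, OF Gauss_deriv]) (auto intro!: derivative_eq_intros)
    from DERIV_add[OF Gauss_deriv this] show "((\<lambda>z. Gauss z + Gauss (- z)) has_field_derivative 0) (at z)"
      by simp
  qed auto
  then obtain c where c: "\<And>z. Gauss z + Gauss (- z) = c" by blast
  from c[of 0] have "c = 0" by (simp add: Gauss_0)
  then show ?thesis using c[of z] by (simp add: eq_neg_iff_add_eq_0 add.commute)
qed

lemma Gauss_of_real: "b \<ge> 0 \<Longrightarrow> Gauss (of_real b) = of_real (gauss b)"
proof -
  assume b: "b \<ge> 0"
  have "((\<lambda>t. exp (- (complex_of_real t)\<^sup>2)) has_integral (Gauss (of_real b) - Gauss (of_real 0))) {0..b}"
    by (rule fundamental_theorem_of_calculus[OF b])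
       (intro has_vector_derivative_real_field Gauss_deriv)
  moreover have "(\<lambda>t. exp (- (complex_of_real t)\<^sup>2)) = (\<lambda>t. complex_of_real (exp (- t\<^sup>2)))"
    by (auto simp: exp_of_real[symmetric])
  ultimately have 1: "((\<lambda>t. complex_of_real (exp (- t\<^sup>2))) has_integral Gauss (of_real b)) {0..b}"
    by (simp add: Gauss_0)
  have "(\<lambda>t::real. exp (- t\<^sup>2)) integrable_on {0..b}"
    by (intro integrable_continuous_interval continuous_intros)
  then have "((\<lambda>t. complex_of_real (exp (- t\<^sup>2))) has_integral of_real (gauss b)) {0..b}"
    unfolding gauss_def by (intro has_integral_of_real integrable_integral)
  with 1 show ?thesis by (rule has_integral_unique)
qed

text \<open>A vertical segment joins the real point \<open>t * Re a\<close> to \<open>t * a\<close>.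
  On it the real part of the square is least at \<open>t * a\<close>, which bounds the change; the
  error at the real point is smaller still because
  \<open>(Re a)\<^sup>2 \<ge> Re (a\<^sup>2)\<close>.\<close>

lemma Gauss_approx:
  assumes a: "Re a > 0" "Re (a\<^sup>2) > 0" and t: "t > 0" "t * Re a \<ge> 1"
  shows "cmod (Gauss (of_real t * a) - of_real (sqrt pi / 2)) \<le> (1 + t * \<bar>Im a\<bar>) * exp (- (t\<^sup>2 * Re (a\<^sup>2)))"
proof -
  define x where "x = t * Re a"
  have Ra: "Re (a\<^sup>2) = (Re a)\<^sup>2 - (Im a)\<^sup>2" by (simp add: power2_eq_square)
  have "cmod (Gauss (of_real t * a) - Gauss (of_real x)) \<le> exp (- (t\<^sup>2 * Re (a\<^sup>2))) * cmod (of_real t * a - of_real x)"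
  proof (rule field_differentiable_bound[OF convex_closed_segment])
    fix z assume z: "z \<in> closed_segment (of_real x) (of_real t * a)"
    show "(Gauss has_field_derivative exp (- z\<^sup>2)) (at z within closed_segment (of_real x) (of_real t * a))"
      by (rule has_field_derivative_at_within[OF Gauss_deriv])
    obtain u where u: "0 \<le> u" "u \<le> 1" "z = (1 - u) *\<^sub>R of_real x + u *\<^sub>R (of_real t * a)"
      using z by (auto simp: in_segment)
    have r: "Re z = t * Re a" "Im z = u * (t * Im a)" unfolding u(3) by (simp_all add: x_def algebra_simps)
    have "\<bar>u * (t * Im a)\<bar> \<le> 1 * \<bar>t * Im a\<bar>" unfolding abs_mult[of u] using u by (intro mult_right_mono) auto
    then have "(u * (t * Im a))\<^sup>2 \<le> (t * Im a)\<^sup>2" by (simp add: abs_le_square_iff)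
    then have "t\<^sup>2 * Re (a\<^sup>2) \<le> Re (z\<^sup>2)"
      unfolding Ra by (simp add: r power2_eq_square algebra_simps)
    then show "cmod (exp (- z\<^sup>2)) \<le> exp (- (t\<^sup>2 * Re (a\<^sup>2)))" by simp
  qed auto
  also have "of_real t * a - of_real x = \<i> * of_real (t * Im a)" by (simp add: x_def complex_eq_iff)
  finally have 1: "cmod (Gauss (of_real t * a) - Gauss (of_real x)) \<le> exp (- (t\<^sup>2 * Re (a\<^sup>2))) * (t * \<bar>Im a\<bar>)"
    using t by (simp add: norm_mult abs_mult)
  have "\<bar>gauss x - sqrt pi / 2\<bar> \<le> exp (- x\<^sup>2)"
    using gauss_bounds[of x] t exp_gt_zero[of "- x\<^sup>2"] unfolding x_def abs_le_iff by linarith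
  also have "\<dots> \<le> exp (- (t\<^sup>2 * Re (a\<^sup>2)))"
    unfolding Ra x_def by (simp add: power_mult_distrib algebra_simps)
  finally have 2: "\<bar>gauss x - sqrt pi / 2\<bar> \<le> exp (- (t\<^sup>2 * Re (a\<^sup>2)))" .
  have "Gauss (of_real x) = of_real (gauss x)" using t by (intro Gauss_of_real) (simp add: x_def)
  then have "Gauss (of_real x) - of_real (sqrt pi / 2) = of_real (gauss x - sqrt pi / 2)" by simp
  then have "cmod (Gauss (of_real x) - of_real (sqrt pi / 2)) \<le> exp (- (t\<^sup>2 * Re (a\<^sup>2)))"
    using 2 by (simp only: norm_of_real)
  then show ?thesis
    using 1 norm_triangle_ineq[of "Gauss (of_real t * a) - Gauss (of_real x)" "Gauss (of_real x) - of_real (sqrt pi / 2)"]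
    by (simp add: algebra_simps)
qed

lemma holomorphic_factor_zero:
  assumes "f holomorphic_on B" "open B" "zc \<in> B" "f zc = 0"
  shows "\<exists>g. g holomorphic_on B \<and> (\<forall>z. z \<in> B \<longrightarrow> f z = (z - zc) * g z)"
proof (intro exI conjI allI impI)
  define g where "g = (\<lambda>z. if z = zc then deriv f zc else f z / (z - zc))"
  show "g holomorphic_on B"
    by (rule pole_theorem_open_0[OF assms(1,2), where a = zc]) (auto simp: g_def assms)
  show "f z = (z - zc) * g z" for z using assms(4) by (simp add: g_def)
qed

lemma has_vector_derivative_shift:
  assumes "(F has_field_derivative F') (at (zc + of_real x))"
  shows "((\<lambda>x. F (zc + of_real x)) has_vector_derivative F') (at x)"
proof -
  have "((\<lambda>z. F (zc + z)) has_field_derivative F' * 1) (at (of_real x))"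
    by (rule DERIV_chain2[where f = F]) (use assms in \<open>auto intro!: derivative_eq_intros\<close>)
  from has_vector_derivative_real_field[OF this] show ?thesis by simp
qed

text \<open>
  The phase \<open>p\<close> has a nondegenerate critical point at \<open>zc\<close>, and \<open>s\<close> is a holomorphic square root of \<open>p zc - p\<close>, so that
  \<open>exp (\<nu> * (p - p zc)) * deriv s\<close> is the derivative of an error function of \<open>s\<close>. The conditions at the end points
  place \<open>s\<close> in the sector where the error function tends to its limit.
\<close>
locale laplace =
  fixes p s k :: "complex \<Rightarrow> complex" and zc :: complex and B :: "complex set" and d c :: real
  assumes open_B: "open B" and d: "d > 0" and c: "c > 0"
    and seg: "\<And>x. \<bar>x\<bar> \<le> d \<Longrightarrow> zc + of_real x \<in> B"
    and hol_p: "p holomorphic_on B" and hol_s: "s holomorphic_on B" and hol_k: "k holomorphic_on B"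
    and k_ne: "\<And>z. z \<in> B \<Longrightarrow> k z \<noteq> 0" and p_k: "\<And>z. z \<in> B \<Longrightarrow> deriv p z = (z - zc) * k z"
    and s_sq: "\<And>z. z \<in> B \<Longrightarrow> (s z)\<^sup>2 = p zc - p z" and s1: "deriv s zc \<noteq> 0"
    and right_end: "Re (s (zc + of_real d)) > 0" "Re ((s (zc + of_real d))\<^sup>2) > 0"
    and left_end: "Re (- s (zc - of_real d)) > 0" "Re ((- s (zc - of_real d))\<^sup>2) > 0"
    and decay: "\<And>x. \<bar>x\<bar> \<le> d \<Longrightarrow> Re (p (zc + of_real x)) \<le> Re (p zc) - c * x\<^sup>2"
begin

text \<open>Subtracting \<open>p zc\<close> and multiplying by \<open>sqrt (nu N)\<close> normalises
  the integral to order one.\<close>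

definition lap :: "(complex \<Rightarrow> complex) \<Rightarrow> nat \<Rightarrow> complex" where
  "lap f N = of_real (sqrt (nu N)) * integral {-d..d} (\<lambda>x. exp (of_real (nu N) * (p (zc + of_real x) - p zc)) * f (zc + of_real x))"

lemma zc_B: "zc \<in> B" using seg[of 0] d by simp

lemma cont_shift: "f holomorphic_on B \<Longrightarrow> continuous_on {-d..d} (\<lambda>x. f (zc + of_real x))"
  by (intro continuous_on_compose2[OF holomorphic_on_imp_continuous_on, of f B]) (auto intro!: continuous_intros seg)

lemma lap_bound:
  assumes "continuous_on {-d..d} (\<lambda>x. f (zc + of_real x))" "\<And>x. \<bar>x\<bar> \<le> d \<Longrightarrow> cmod (f (zc + of_real x)) \<le> C"
  shows "cmod (lap f N) \<le> C * sqrt pi / sqrt c"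
proof -
  define r where "r = sqrt (c * nu N)"
  have r: "r > 0" "r\<^sup>2 = c * nu N" using c nu_pos[of N] by (simp_all add: r_def)
  have C: "C \<ge> 0" using assms(2)[of 0] d norm_ge_zero[of "f zc"] by (auto intro: order_trans[OF norm_ge_zero])
  have hi1: "((\<lambda>x. exp (- (r * x)\<^sup>2)) has_integral (gauss (r * d) / r)) {0..d}"
  proof -
    have "continuous_on {0..r * d} gauss" unfolding gauss_def
      by (intro indefinite_integral_continuous_1 integrable_continuous_interval continuous_intros)
    moreover have "continuous_on {0..d} (\<lambda>x. r * x)" by (intro continuous_intros)
    moreover have "(\<lambda>x. r * x) ` {0..d} \<subseteq> {0..r * d}" using r by auto
    ultimately have "continuous_on {0..d} (\<lambda>x. gauss (r * x))"
      by (rule continuous_on_compose2)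
    then have co: "continuous_on {0..d} (\<lambda>x. gauss (r * x) / r)"
      by (rule continuous_on_divide[OF _ continuous_on_const]) (use r in auto)
    have "((\<lambda>x. exp (- (r * x)\<^sup>2)) has_integral (gauss (r * d) / r - gauss (r * 0) / r)) {0..d}"
    \<comment> \<open>\<open>gauss_deriv\<close> is available for positive arguments only, so the
      end point \<open>0\<close> is covered by continuity.\<close>
    proof (rule fundamental_theorem_of_calculus_interior[OF _ co])
      fix x assume "x \<in> {0<..<d}"
      then have "r * x > 0" using r by simp
      have "((\<lambda>x. gauss (r * x)) has_real_derivative (exp (- (r * x)\<^sup>2) * r)) (at x)"
        by (rule DERIV_chain2[where f = gauss and g = "\<lambda>x. r * x", OF gauss_deriv[OF \<open>r * x > 0\<close>]])
           (auto intro!: derivative_eq_intros)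
      then have "((\<lambda>x. gauss (r * x) / r) has_real_derivative (exp (- (r * x)\<^sup>2) * r / r)) (at x)"
        by (rule DERIV_cdivide)
      then show "((\<lambda>x. gauss (r * x) / r) has_vector_derivative exp (- (r * x)\<^sup>2)) (at x)"
        using r by (simp add: has_real_derivative_iff_has_vector_derivative)
    qed (use d in auto)
    moreover have "gauss 0 = 0" by (simp add: gauss_def)
    ultimately show ?thesis by simp
  qed
  have "((\<lambda>x. exp (- (r * - x)\<^sup>2)) has_integral (gauss (r * d) / r)) {-d..-0}"
    by (subst has_integral_reflect_real) (rule hi1)
  then have hi2: "((\<lambda>x. exp (- (r * x)\<^sup>2)) has_integral (gauss (r * d) / r)) {-d..0}" by simp
  have hi3: "((\<lambda>x. exp (- (r * x)\<^sup>2)) has_integral (gauss (r * d) / r + gauss (r * d) / r)) {-d..d}"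
    by (rule has_integral_combine[OF _ _ hi2 hi1]) (use d in auto)
  have "norm (integral {-d..d} (\<lambda>x. exp (of_real (nu N) * (p (zc + of_real x) - p zc)) * f (zc + of_real x)))
     \<le> integral {-d..d} (\<lambda>x. C * exp (- (r * x)\<^sup>2))"
  proof (rule integral_norm_bound_integral)
    show "(\<lambda>x. exp (of_real (nu N) * (p (zc + of_real x) - p zc)) * f (zc + of_real x)) integrable_on {-d..d}"
      by (intro integrable_continuous_interval continuous_intros cont_shift hol_p assms)
    show "(\<lambda>x. C * exp (- (r * x)\<^sup>2)) integrable_on {-d..d}"
      by (intro integrable_continuous_interval continuous_intros)
    fix x assume "x \<in> {-d..d}"
    then have x: "\<bar>x\<bar> \<le> d" by auto
    have "nu N * (Re (p (zc + of_real x)) - Re (p zc)) \<le> nu N * (- c * x\<^sup>2)"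
      using decay[OF x] nu_pos[of N] by (intro mult_left_mono) auto
    also have "\<dots> = - (r * x)\<^sup>2" using r(2) by (simp add: power_mult_distrib)
    finally have "exp (nu N * (Re (p (zc + of_real x)) - Re (p zc))) \<le> exp (- (r * x)\<^sup>2)" by simp
    then show "norm (exp (of_real (nu N) * (p (zc + of_real x) - p zc)) * f (zc + of_real x)) \<le> C * exp (- (r * x)\<^sup>2)"
      using assms(2)[OF x] C by (simp add: norm_mult mult.commute mult_mono)
  qed
  also have "\<dots> = C * (2 * gauss (r * d) / r)"
    using integral_unique[OF has_integral_mult_right[OF hi3, of C]] by simp
  also have "\<dots> \<le> C * (sqrt pi / r)"
    using gauss_le[of "r * d"] C r by (intro mult_left_mono divide_right_mono) auto
  finally have b: "cmod (integral {-d..d} (\<lambda>x. exp (of_real (nu N) * (p (zc + of_real x) - p zc)) * f (zc + of_real x))) \<le> C * (sqrt pi / r)" .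
  have "cmod (lap f N) = sqrt (nu N) * cmod (integral {-d..d} (\<lambda>x. exp (of_real (nu N) * (p (zc + of_real x) - p zc)) * f (zc + of_real x)))"
    unfolding lap_def norm_mult using nu_pos[of N] by simp
  also have "\<dots> \<le> sqrt (nu N) * (C * (sqrt pi / r))"
    by (rule mult_left_mono[OF b]) (use nu_pos[of N] in simp)
  also have "\<dots> = C * sqrt pi / sqrt c" using nu_pos[of N] by (simp add: r_def real_sqrt_mult)
  finally show ?thesis .
qed

lemma lap_add:
  assumes "continuous_on {-d..d} (\<lambda>x. f (zc + of_real x))" "continuous_on {-d..d} (\<lambda>x. g (zc + of_real x))"
  shows "lap (\<lambda>z. f z + of_real t * g z) N = lap f N + of_real t * lap g N"
proof -
  define e where "e = (\<lambda>x. exp (of_real (nu N) * (p (zc + of_real x) - p zc)))"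
  have ce: "continuous_on {-d..d} e" unfolding e_def by (intro continuous_intros cont_shift hol_p)
  have "integral {-d..d} (\<lambda>x. e x * (f (zc + of_real x) + of_real t * g (zc + of_real x)))
    = integral {-d..d} (\<lambda>x. e x * f (zc + of_real x) + of_real t * (e x * g (zc + of_real x)))"
    by (simp add: algebra_simps)
  also have "\<dots> = integral {-d..d} (\<lambda>x. e x * f (zc + of_real x)) + integral {-d..d} (\<lambda>x. of_real t * (e x * g (zc + of_real x)))"
    by (intro Henstock_Kurzweil_Integration.integral_add integrable_continuous_interval continuous_intros ce assms)
  finally have i: "integral {-d..d} (\<lambda>x. e x * (f (zc + of_real x) + of_real t * g (zc + of_real x))) =
      integral {-d..d} (\<lambda>x. e x * f (zc + of_real x)) + of_real t * integral {-d..d} (\<lambda>x. e x * g (zc + of_real x))"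
    by simp
  have l: "lap f N = of_real (sqrt (nu N)) * integral {-d..d} (\<lambda>x. e x * f (zc + of_real x))" for f
    by (simp add: lap_def e_def)
  show ?thesis unfolding l i by (simp add: algebra_simps)
qed

text \<open>
  Subtracting a multiple of \<open>deriv s\<close>, whose integral is an error function, makes the amplitude vanish at \<open>zc\<close>. It is then
  \<open>deriv p\<close> times a holomorphic function and an integration by parts gains a factor \<open>1 / nu N\<close>.
\<close>
lemma lap_step:
  assumes e: "e holomorphic_on B"
  shows "\<exists>h n. h holomorphic_on B \<and> (\<forall>M T. has_asymp inv_nu T M (\<lambda>N _. n N)) \<and>
     (\<forall>N. lap e N = e zc * of_real (sqrt pi) / deriv s zc + of_real (inv_nu N) * (n N - lap h N))"
proof -
  define c0 where "c0 = e zc / deriv s zc"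
  have ds: "deriv s holomorphic_on B" by (rule holomorphic_deriv[OF hol_s open_B])
  have "(\<lambda>z. e z - c0 * deriv s z) holomorphic_on B" by (intro holomorphic_intros e ds)
  moreover have "e zc - c0 * deriv s zc = 0" using s1 by (simp add: c0_def)
  ultimately obtain g where g: "g holomorphic_on B" "\<And>z. z \<in> B \<Longrightarrow> e z - c0 * deriv s z = (z - zc) * g z"
    using holomorphic_factor_zero[OF _ open_B zc_B, of "\<lambda>z. e z - c0 * deriv s z"] by blast
  define h where "h = (\<lambda>z. g z / k z)"
  have hol_h: "h holomorphic_on B" unfolding h_def by (intro holomorphic_intros g hol_k k_ne)
  have dh: "deriv h holomorphic_on B" by (rule holomorphic_deriv[OF hol_h open_B])
  have e_eq: "e z = c0 * deriv s z + deriv p z * h z" if "z \<in> B" for z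
  proof -
    have "deriv p z * h z = (z - zc) * g z" using p_k[OF that] k_ne[OF that] by (simp add: h_def)
    then show ?thesis using g(2)[OF that] by (metis add.commute diff_add_cancel)
  qed
  define ap where "ap = s (zc + of_real d)"
  define am where "am = - s (zc - of_real d)"
  define ex where "ex = (\<lambda>N x. exp (of_real (nu N) * (p (zc + of_real x) - p zc)))"
  \<comment> \<open>Collects the deviations of the error function from its limit and the boundary
    terms of the integration by parts. All of them decay exponentially, so the factors
    \<open>nu N\<close> and \<open>sqrt (nu N)\<close> are harmless.\<close>
  define n where "n = (\<lambda>N. of_real (nu N) * c0 * ((Gauss (of_real (sqrt (nu N)) * ap) - of_real (sqrt pi / 2))
      + (Gauss (of_real (sqrt (nu N)) * am) - of_real (sqrt pi / 2)))
      + of_real (sqrt (nu N)) * (ex N d * h (zc + of_real d) - ex N (-d) * h (zc + of_real (-d))))"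
  have "lap e N = e zc * of_real (sqrt pi) / deriv s zc + of_real (inv_nu N) * (n N - lap (deriv h) N)" for N
  proof -
    define \<nu> where "\<nu> = complex_of_real (nu N)"
    define r where "r = complex_of_real (sqrt (nu N))"
    have r: "r\<^sup>2 = \<nu>" "r * r = \<nu>" "r \<noteq> 0" "\<nu> \<noteq> 0" using nu_pos[of N]
      by (simp_all add: r_def \<nu>_def power2_eq_square flip: of_real_mult)
    have i1: "((\<lambda>x. ex N x * deriv s (zc + of_real x) * r) has_integral
        (Gauss (r * s (zc + of_real d)) - Gauss (r * s (zc + of_real (-d))))) {-d..d}"
    proof (rule fundamental_theorem_of_calculus[where f = "\<lambda>x. Gauss (r * s (zc + of_real x))"])
      fix x assume "x \<in> {-d..d}"
      then have x: "zc + of_real x \<in> B" by (intro seg) auto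
      have "((\<lambda>z. Gauss (r * s z)) has_field_derivative exp (- (r * s (zc + of_real x))\<^sup>2) * (r * deriv s (zc + of_real x))) (at (zc + of_real x))"
        by (rule DERIV_chain2[where f = Gauss, OF Gauss_deriv])
           (intro DERIV_cmult holomorphic_derivI[OF hol_s open_B x])
      moreover have "exp (- (r * s (zc + of_real x))\<^sup>2) = ex N x"
        unfolding power_mult_distrib s_sq[OF x] r ex_def by (simp add: \<nu>_def algebra_simps)
      ultimately have "((\<lambda>z. Gauss (r * s z)) has_field_derivative ex N x * deriv s (zc + of_real x) * r) (at (zc + of_real x))"
        by (simp add: mult_ac)
      from has_vector_derivative_shift[OF this]
      show "((\<lambda>x. Gauss (r * s (zc + of_real x))) has_vector_derivative ex N x * deriv s (zc + of_real x) * r) (at x within {-d..d})"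
        by (rule has_vector_derivative_at_within)
    qed (use d in auto)
    have i2: "((\<lambda>x. ex N x * (\<nu> * (deriv p (zc + of_real x) * h (zc + of_real x))) + ex N x * deriv h (zc + of_real x)) has_integral
        (ex N d * h (zc + of_real d) - ex N (-d) * h (zc + of_real (-d)))) {-d..d}"
    proof (rule fundamental_theorem_of_calculus[where f = "\<lambda>x. ex N x * h (zc + of_real x)"])
      fix x assume "x \<in> {-d..d}"
      then have x: "zc + of_real x \<in> B" by (intro seg) auto
      have "((\<lambda>z. exp (\<nu> * (p z - p zc)) * h z) has_field_derivative
          ex N x * (\<nu> * (deriv p (zc + of_real x) * h (zc + of_real x))) + ex N x * deriv h (zc + of_real x)) (at (zc + of_real x))"
        by (auto intro!: derivative_eq_intros holomorphic_derivI[OF hol_p open_B x] holomorphic_derivI[OF hol_h open_B x]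
             simp: ex_def \<nu>_def algebra_simps)
      from has_vector_derivative_shift[OF this]
      show "((\<lambda>x. ex N x * h (zc + of_real x)) has_vector_derivative
          ex N x * (\<nu> * (deriv p (zc + of_real x) * h (zc + of_real x))) + ex N x * deriv h (zc + of_real x)) (at x within {-d..d})"
        unfolding ex_def \<nu>_def by (rule has_vector_derivative_at_within)
    qed (use d in auto)
    have ce: "continuous_on {-d..d} (ex N)" unfolding ex_def by (intro continuous_intros cont_shift hol_p)
    have i3: "((\<lambda>x. ex N x * deriv h (zc + of_real x)) has_integral (lap (deriv h) N / r)) {-d..d}"
    proof -
      have "(\<lambda>x. ex N x * deriv h (zc + of_real x)) integrable_on {-d..d}"
        by (intro integrable_continuous_interval continuous_intros ce cont_shift dh)
      then show ?thesis using r unfolding lap_def ex_def r_def by (simp add: integrable_integral)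
    qed
    define W where "W = ex N d * h (zc + of_real d) - ex N (-d) * h (zc + of_real (-d))"
    define V where "V = Gauss (r * s (zc + of_real d)) - Gauss (r * s (zc + of_real (-d)))"
    have I: "((\<lambda>x. (c0 / r) * (ex N x * deriv s (zc + of_real x) * r)
        + (1 / \<nu>) * ((ex N x * (\<nu> * (deriv p (zc + of_real x) * h (zc + of_real x))) + ex N x * deriv h (zc + of_real x))
            - ex N x * deriv h (zc + of_real x))) has_integral
        ((c0 / r) * V + (1 / \<nu>) * (W - lap (deriv h) N / r))) {-d..d}"
      unfolding V_def W_def
      by (intro has_integral_add has_integral_mult_right has_integral_diff i1 i2 i3)
    have eq: "(c0 / r) * (ex N x * deriv s (zc + of_real x) * r)
        + (1 / \<nu>) * ((ex N x * (\<nu> * (deriv p (zc + of_real x) * h (zc + of_real x))) + ex N x * deriv h (zc + of_real x))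
            - ex N x * deriv h (zc + of_real x)) = ex N x * e (zc + of_real x)" if "x \<in> {-d..d}" for x
    proof -
      have "zc + of_real x \<in> B" using that by (intro seg) auto
      from e_eq[OF this] show ?thesis using r by (simp add: algebra_simps)
    qed
    have "((\<lambda>x. ex N x * e (zc + of_real x)) has_integral
        ((c0 / r) * V + (1 / \<nu>) * (W - lap (deriv h) N / r))) {-d..d}"
      by (rule has_integral_eq[OF eq I])
    from integral_unique[OF this]
    have "lap e N = r * ((c0 / r) * V + (1 / \<nu>) * (W - lap (deriv h) N / r))"
      unfolding lap_def ex_def r_def by simp
    also have "\<dots> = c0 * V + (1 / \<nu>) * (r * W - lap (deriv h) N)" using r by (simp add: field_simps)
    \<comment> \<open>As \<open>Gauss\<close> is odd, the left end enters with a plus sign and an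
      argument in the right half plane. Both summands tend to \<open>sqrt pi / 2\<close>.\<close>
    also have "V = Gauss (r * ap) + Gauss (r * am)"
    proof -
      have "r * s (zc + of_real (-d)) = - (r * am)" by (simp add: am_def)
      then show ?thesis unfolding V_def ap_def by (simp only: Gauss_minus diff_minus_eq_add)
    qed
    also have "c0 * (Gauss (r * ap) + Gauss (r * am)) + (1 / \<nu>) * (r * W - lap (deriv h) N)
       = c0 * of_real (sqrt pi) + (1 / \<nu>) * (n N - lap (deriv h) N)"
      using r unfolding n_def W_def[symmetric] r_def[symmetric] \<nu>_def[symmetric]
      by (simp add: field_simps)
    also have "1 / \<nu> = of_real (inv_nu N)" by (simp add: inv_nu_def \<nu>_def)
    also have "c0 * of_real (sqrt pi) = e zc * of_real (sqrt pi) / deriv s zc" by (simp add: c0_def)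
    finally show ?thesis .
  qed
  moreover have "has_asymp inv_nu T M (\<lambda>N _. n N)" for M T
  proof -
    have G: "has_asymp inv_nu T M (\<lambda>N _. of_real (nu N) * (Gauss (of_real (sqrt (nu N)) * a) - of_real (sqrt pi / 2)))"
      if a: "Re a > 0" "Re (a\<^sup>2) > 0" for a
    proof (rule has_asymp_exp_small[OF a(2), where k = 2 and A = "1 + \<bar>Im a\<bar>"])
      have "filterlim (\<lambda>N. sqrt (nu N) * Re a) at_top sequentially"
      proof -
        have "filterlim (\<lambda>N. Re a * sqrt (nu N)) at_top sequentially"
          unfolding nu_def by (rule filterlim_tendsto_pos_mult_at_top[OF tendsto_const a(1)]) real_asymp
        then show ?thesis by (simp add: mult.commute)
      qed
      then have "\<forall>\<^sub>F N in sequentially. sqrt (nu N) * Re a \<ge> 1" by (simp add: filterlim_at_top)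
      moreover have "\<forall>\<^sub>F N in sequentially. nu N \<ge> 1"
        using eventually_ge_at_top[of 1] by eventually_elim (simp add: nu_def)
      ultimately show "\<forall>\<^sub>F N in sequentially. \<forall>z\<in>T. cmod (of_real (nu N) * (Gauss (of_real (sqrt (nu N)) * a) - of_real (sqrt pi / 2)))
         \<le> (1 + \<bar>Im a\<bar>) * nu N ^ 2 * exp (- (Re (a\<^sup>2) * nu N))"
      proof eventually_elim
        case (elim N)
        have sq: "sqrt (nu N) \<le> nu N" using elim by (intro real_le_lsqrt) (auto simp: power2_eq_square)
        have "cmod (Gauss (of_real (sqrt (nu N)) * a) - of_real (sqrt pi / 2)) \<le> (1 + sqrt (nu N) * \<bar>Im a\<bar>) * exp (- ((sqrt (nu N))\<^sup>2 * Re (a\<^sup>2)))"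
          using Gauss_approx[OF a _ elim(1)] nu_pos[of N] by simp
        also have "\<dots> \<le> (nu N * (1 + \<bar>Im a\<bar>)) * exp (- (Re (a\<^sup>2) * nu N))"
        proof (rule mult_mono)
          have "sqrt (nu N) * \<bar>Im a\<bar> \<le> nu N * \<bar>Im a\<bar>" using sq by (intro mult_right_mono) auto
          then show "1 + sqrt (nu N) * \<bar>Im a\<bar> \<le> nu N * (1 + \<bar>Im a\<bar>)" using elim by (simp add: algebra_simps)
        qed (use nu_pos[of N] in \<open>auto simp: mult.commute\<close>)
        finally have "nu N * cmod (Gauss (of_real (sqrt (nu N)) * a) - of_real (sqrt pi / 2)) \<le> nu N * ((nu N * (1 + \<bar>Im a\<bar>)) * exp (- (Re (a\<^sup>2) * nu N)))"
          using nu_pos[of N] by (intro mult_left_mono) auto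
        then show ?case using nu_pos[of N] by (simp add: norm_mult power2_eq_square mult_ac)
      qed
    qed
    have E: "has_asymp inv_nu T M (\<lambda>N _. of_real (sqrt (nu N)) * ex N x)" if x: "\<bar>x\<bar> = d" for x
    proof (rule has_asymp_exp_small[where k = 1 and A = 1 and c = "c * d\<^sup>2"])
      show "c * d\<^sup>2 > 0" using c d by simp
      have "\<forall>\<^sub>F N in sequentially. nu N \<ge> 1"
        using eventually_ge_at_top[of 1] by eventually_elim (simp add: nu_def)
      then show "\<forall>\<^sub>F N in sequentially. \<forall>z\<in>T. cmod (of_real (sqrt (nu N)) * ex N x) \<le> 1 * nu N ^ 1 * exp (- (c * d\<^sup>2 * nu N))"
      proof eventually_elim
        case (elim N)
        have sq: "sqrt (nu N) \<le> nu N" using elim by (intro real_le_lsqrt) (auto simp: power2_eq_square)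
        have "x\<^sup>2 = d\<^sup>2" using x by (metis power2_abs)
        then have "nu N * (Re (p (zc + of_real x)) - Re (p zc)) \<le> nu N * (- (c * d\<^sup>2))"
          using decay[of x] x nu_pos[of N] by (intro mult_left_mono) auto
        then have "cmod (ex N x) \<le> exp (- (c * d\<^sup>2 * nu N))" unfolding ex_def by (simp add: mult_ac)
        then show ?case using sq nu_pos[of N] by (auto simp: norm_mult intro!: mult_mono)
      qed
    qed
    have "has_asymp inv_nu T M (\<lambda>N _. c0 * (of_real (nu N) * (Gauss (of_real (sqrt (nu N)) * ap) - of_real (sqrt pi / 2))
      + of_real (nu N) * (Gauss (of_real (sqrt (nu N)) * am) - of_real (sqrt pi / 2)))
      + (of_real (sqrt (nu N)) * ex N d * h (zc + of_real d) - of_real (sqrt (nu N)) * ex N (-d) * h (zc + of_real (-d))))"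
      using right_end left_end d
      by (intro inv_nu.has_asymp_add inv_nu.has_asymp_diff inv_nu.has_asymp_mult G E has_asymp_constant) (auto simp: ap_def am_def)
    then show ?thesis unfolding n_def by (rule has_asymp_cong[rotated]) (auto simp: algebra_simps)
  qed
  ultimately show ?thesis using dh by blast
qed

lemma lap_holomorphic_has_asymp:
  "e holomorphic_on B \<Longrightarrow> has_asymp inv_nu T M (\<lambda>N _. lap e N)"
proof (induction M arbitrary: e)
  case 0
  have "continuous_on {-d..d} (\<lambda>x. e (zc + of_real x))" by (rule cont_shift[OF 0])
  then have "compact ((\<lambda>x. e (zc + of_real x)) ` {-d..d})" by (intro compact_continuous_image) auto
  then obtain C where "\<forall>x\<in>{-d..d}. cmod (e (zc + of_real x)) \<le> C"
    by (auto dest!: compact_imp_bounded simp: bounded_iff)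
  then have "cmod (e (zc + of_real x)) \<le> C" if "\<bar>x\<bar> \<le> d" for x using that by (auto simp: abs_le_iff)
  from lap_bound[OF cont_shift[OF 0] this] show ?case by (auto intro: always_eventually)
next
  case (Suc M)
  from lap_step[OF Suc.prems] obtain h n where h: "h holomorphic_on B" "\<And>M T. has_asymp inv_nu T M (\<lambda>N _. n N)"
    "\<And>N. lap e N = e zc * of_real (sqrt pi) / deriv s zc + of_real (inv_nu N) * (n N - lap h N)" by blast
  have "has_asymp inv_nu T (Suc M) (\<lambda>N _. e zc * of_real (sqrt pi) / deriv s zc + of_real (inv_nu N) * (n N - lap h N))"
    by (intro inv_nu.has_asymp_add inv_nu.has_asymp_y inv_nu.has_asymp_diff has_asymp_constant h Suc.IH)
  then show ?case by (simp only: h(3))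
qed

lemma lap_has_asymp:
  assumes "\<And>N. continuous_on {-d..d} (\<lambda>x. a N (zc + of_real x))" "has_asymp inv_nu B M a"
  shows "has_asymp inv_nu T M (\<lambda>N _. lap (a N) N)"
  using assms
proof (induction M arbitrary: a)
  case 0
  then obtain C where C: "\<forall>\<^sub>F N in sequentially. \<forall>z\<in>B. cmod (a N z) \<le> C" by auto
  then have "\<forall>\<^sub>F N in sequentially. \<forall>z\<in>T. cmod (lap (a N) N) \<le> C * sqrt pi / sqrt c"
    by eventually_elim (auto intro!: lap_bound 0 seg)
  then show ?case by auto
next
  case (Suc M)
  from Suc.prems(2) obtain e a' where e: "e holomorphic_on B" "has_asymp inv_nu B M a'"
    "\<forall>\<^sub>F N in sequentially. \<forall>z\<in>B. a N z = e z + of_real (inv_nu N) * a' N z" by auto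
  \<comment> \<open>The remainder \<open>a'\<close> of the expansion need not be continuous, nor is
    the identity known for small \<open>N\<close>. Solving for the remainder gives a version that is
    continuous for every \<open>N\<close> and eventually equal to \<open>a'\<close>.\<close>
  define b where "b = (\<lambda>N z. (a N z - e z) / of_real (inv_nu N))"
  have yne: "inv_nu N \<noteq> 0" for N using inv_nu.y_pos[of N] by simp
  have "\<forall>\<^sub>F N in sequentially. \<forall>z\<in>B. b N z = a' N z"
    using e(3) by eventually_elim (auto simp: b_def yne)
  then have ab: "has_asymp inv_nu B M b" by (rule has_asymp_cong[OF _ e(2)])
  have cb: "continuous_on {-d..d} (\<lambda>x. b N (zc + of_real x))" for N
    unfolding b_def by (intro continuous_intros Suc.prems cont_shift e) (simp add: yne)
  have "a N = (\<lambda>z. e z + of_real (inv_nu N) * b N z)" for N by (auto simp: b_def yne)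
  then have "lap (a N) N = lap e N + of_real (inv_nu N) * lap (b N) N" for N
    using lap_add[OF cont_shift[OF e(1)] cb] by metis
  moreover have "has_asymp inv_nu T (Suc M) (\<lambda>N _. lap e N + of_real (inv_nu N) * lap (b N) N)"
    by (intro inv_nu.has_asymp_add inv_nu.has_asymp_y Suc.IH cb ab lap_holomorphic_has_asymp e)
  ultimately show ?case by simp
qed

lemma inv_nu_bounded_tendsto_0:
  assumes "has_asymp inv_nu {zc} 0 (\<lambda>N _. f N)"
  shows "(\<lambda>N. of_real (inv_nu N) * f N) \<longlonglongrightarrow> 0"
proof -
  from assms obtain C where C: "\<forall>\<^sub>F N in sequentially. cmod (f N) \<le> C" by auto
  have "(\<lambda>N. C * inv_nu N) \<longlonglongrightarrow> 0" using tendsto_mult_right_zero[OF inv_nu.y_tendsto] by simp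
  moreover have "\<forall>\<^sub>F N in sequentially. norm (of_real (inv_nu N) * f N) \<le> C * inv_nu N"
    using C
  proof eventually_elim
    case (elim N)
    then show ?case using inv_nu.y_pos[of N] by (simp add: norm_mult mult.commute mult_left_mono)
  qed
  ultimately show ?thesis by (rule Lim_null_comparison[rotated])
qed

text \<open>The expansion only asserts that some leading coefficient \<open>e\<close> exists. Its
  value at \<open>zc\<close> is recovered as the limit of \<open>a N zc\<close>, and the leading
  term of \<open>lap e\<close> depends on no other value of \<open>e\<close>.\<close>

lemma lap_tendsto:
  assumes a: "\<And>N. continuous_on {-d..d} (\<lambda>x. a N (zc + of_real x))" "has_asymp inv_nu B 1 a"
    and l: "(\<lambda>N. a N zc) \<longlonglongrightarrow> l"
  shows "(\<lambda>N. lap (a N) N) \<longlonglongrightarrow> l * of_real (sqrt pi) / deriv s zc"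
proof -
  from a(2) obtain e a' where e: "e holomorphic_on B" "has_asymp inv_nu B 0 a'"
    "\<forall>\<^sub>F N in sequentially. \<forall>z\<in>B. a N z = e z + of_real (inv_nu N) * a' N z" by auto
  define b where "b = (\<lambda>N z. (a N z - e z) / of_real (inv_nu N))"
  have yne: "inv_nu N \<noteq> 0" for N using inv_nu.y_pos[of N] by simp
  have "\<forall>\<^sub>F N in sequentially. \<forall>z\<in>B. b N z = a' N z"
    using e(3) by eventually_elim (auto simp: b_def yne)
  then have ab: "has_asymp inv_nu B 0 b" by (rule has_asymp_cong[OF _ e(2)])
  have cb: "continuous_on {-d..d} (\<lambda>x. b N (zc + of_real x))" for N
    unfolding b_def by (intro continuous_intros a cont_shift e) (simp add: yne)
  have "a N = (\<lambda>z. e z + of_real (inv_nu N) * b N z)" for N by (auto simp: b_def yne)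
  then have lap_eq: "lap (a N) N = lap e N + of_real (inv_nu N) * lap (b N) N" for N
    using lap_add[OF cont_shift[OF e(1)] cb] by metis
  have "has_asymp inv_nu {zc} 0 (\<lambda>N _. b N zc)"
  proof -
    from ab obtain C where "\<forall>\<^sub>F N in sequentially. \<forall>z\<in>B. cmod (b N z) \<le> C" by auto
    then have "\<forall>\<^sub>F N in sequentially. \<forall>z\<in>{zc}. cmod (b N zc) \<le> C"
      by eventually_elim (use zc_B in auto)
    then show ?thesis unfolding has_asymp.simps by blast
  qed
  from tendsto_diff[OF l inv_nu_bounded_tendsto_0[OF this]] have "(\<lambda>_::nat. e zc) \<longlonglongrightarrow> l"
    by (simp add: b_def yne)
  then have el: "e zc = l" by (simp add: LIMSEQ_const_iff)
  from lap_step[OF e(1)] obtain h n where h: "h holomorphic_on B" "\<And>M T. has_asymp inv_nu T M (\<lambda>N _. n N)"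
    "\<And>N. lap e N = e zc * of_real (sqrt pi) / deriv s zc + of_real (inv_nu N) * (n N - lap h N)" by blast
  have "(\<lambda>N. (e zc * of_real (sqrt pi) / deriv s zc + of_real (inv_nu N) * (n N - lap h N)) + of_real (inv_nu N) * lap (b N) N)
     \<longlonglongrightarrow> (e zc * of_real (sqrt pi) / deriv s zc + 0) + 0"
    by (intro tendsto_add tendsto_const inv_nu_bounded_tendsto_0 inv_nu.has_asymp_diff h lap_holomorphic_has_asymp
        lap_has_asymp cb ab)
  then show ?thesis unfolding lap_eq h(3) el by simp
qed

end

text \<open>Splitting off the double zero gives \<open>p zc - p z = (z - zc)\<^sup>2 * q z\<close>
  with \<open>q zc = - p2 / 2\<close> in the right half plane. On a small ball \<open>q\<close>
  stays there, and \<open>s z = (z - zc) * csqrt (q z)\<close> is the required root. The ball is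
  fixed before \<open>d\<close>, which can still be shrunk.\<close>

lemma laplace_exists:
  assumes "open U" "zc \<in> U" "p holomorphic_on U" "deriv p zc = 0"
    and p2: "(deriv p has_field_derivative p2) (at zc)" "Re p2 < 0"
  shows "\<exists>r>0. \<exists>s k c. cball zc r \<subseteq> U \<and> deriv s zc = csqrt (- p2 / 2) \<and> (\<forall>d. 0 < d \<longrightarrow> d < r \<longrightarrow> laplace p s k zc (ball zc r) d c)"
proof -
  obtain g1 where g1: "g1 holomorphic_on U" "\<And>z. z \<in> U \<Longrightarrow> p z - p zc = (z - zc) * g1 z"
    using holomorphic_factor_zero[OF holomorphic_on_diff[OF assms(3) holomorphic_on_const[of "p zc"]] assms(1,2)] by auto
  have dp: "deriv p z = g1 z + (z - zc) * deriv g1 z" if "z \<in> U" for z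
  proof (rule DERIV_imp_deriv)
    have "((\<lambda>z. p zc + (z - zc) * g1 z) has_field_derivative g1 z + (z - zc) * deriv g1 z) (at z)"
      by (auto intro!: derivative_eq_intros holomorphic_derivI[OF g1(1) assms(1) that])
    then show "(p has_field_derivative g1 z + (z - zc) * deriv g1 z) (at z)"
      by (rule has_field_derivative_transform_within_open[OF _ assms(1) that]) (use g1(2) in \<open>simp add: algebra_simps\<close>)
  qed
  have "g1 zc = 0" using dp[OF assms(2)] assms(4) by simp
  then obtain g2 where g2: "g2 holomorphic_on U" "\<And>z. z \<in> U \<Longrightarrow> g1 z = (z - zc) * g2 z"
    using holomorphic_factor_zero[OF g1(1) assms(1,2)] by blast
  have dg1: "deriv g1 z = g2 z + (z - zc) * deriv g2 z" if "z \<in> U" for z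
  proof (rule DERIV_imp_deriv)
    have "((\<lambda>z. (z - zc) * g2 z) has_field_derivative g2 z + (z - zc) * deriv g2 z) (at z)"
      by (auto intro!: derivative_eq_intros holomorphic_derivI[OF g2(1) assms(1) that])
    then show "(g1 has_field_derivative g2 z + (z - zc) * deriv g2 z) (at z)"
      by (rule has_field_derivative_transform_within_open[OF _ assms(1) that]) (use g2(2) in \<open>simp add: algebra_simps\<close>)
  qed
  define k where "k = (\<lambda>z. 2 * g2 z + (z - zc) * deriv g2 z)"
  have dg2: "deriv g2 holomorphic_on U" by (rule holomorphic_deriv[OF g2(1) assms(1)])
  have hk: "k holomorphic_on U" unfolding k_def by (intro holomorphic_intros g2 dg2)
  have pk: "deriv p z = (z - zc) * k z" if "z \<in> U" for z
    using dp[OF that] g2(2)[OF that] dg1[OF that] by (simp add: k_def algebra_simps)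
  have "(deriv p has_field_derivative k zc) (at zc)"
  proof -
    have "((\<lambda>z. (z - zc) * k z) has_field_derivative k zc) (at zc)"
      by (auto intro!: derivative_eq_intros holomorphic_derivI[OF hk assms(1,2)])
    then show ?thesis
      by (rule has_field_derivative_transform_within_open[OF _ assms(1,2)]) (use pk in simp)
  qed
  then have "k zc = p2" using p2(1) by (rule DERIV_unique)
  then have g2z: "g2 zc = p2 / 2" unfolding k_def by (simp add: field_simps)
  define q where "q = (\<lambda>z. - g2 z)"
  have hq: "q holomorphic_on U" unfolding q_def by (intro holomorphic_intros g2)
  \<comment> \<open>Half of \<open>Re (q zc)\<close>, so that \<open>Re (q z) > c\<close> persists
    near \<open>zc\<close>; it becomes the Gaussian decay rate on the segment.\<close>
  define c where "c = - Re p2 / 4"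
  have c: "c > 0" "Re (q zc) > c" "k zc \<noteq> 0" using p2(2) \<open>k zc = p2\<close> by (auto simp: c_def q_def g2z)
  have "open {z \<in> U. Re (q z) > c \<and> k z \<noteq> 0}"
  proof -
    have 1: "continuous_on U (\<lambda>z. Re (q z))" by (intro continuous_intros holomorphic_on_imp_continuous_on hq)
    have 2: "continuous_on U k" by (intro holomorphic_on_imp_continuous_on hk)
    have "open (U \<inter> (\<lambda>z. Re (q z)) -` {c<..})" "open (U \<inter> k -` (- {0}))"
      by (rule continuous_open_preimage[OF 1 assms(1)], simp, rule continuous_open_preimage[OF 2 assms(1)], simp add: open_Compl)
    then have "open ((U \<inter> (\<lambda>z. Re (q z)) -` {c<..}) \<inter> (U \<inter> k -` (- {0})))" by (rule open_Int)
    moreover have "(U \<inter> (\<lambda>z. Re (q z)) -` {c<..}) \<inter> (U \<inter> k -` (- {0})) = {z \<in> U. Re (q z) > c \<and> k z \<noteq> 0}" by auto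
    ultimately show ?thesis by simp
  qed
  moreover have "zc \<in> {z \<in> U. Re (q z) > c \<and> k z \<noteq> 0}" using c assms(2) by simp
  ultimately obtain r where r: "r > 0" "cball zc r \<subseteq> {z \<in> U. Re (q z) > c \<and> k z \<noteq> 0}"
    unfolding open_contains_cball by blast
  have B: "z \<in> U" "Re (q z) > c" "k z \<noteq> 0" "q z \<notin> \<real>\<^sub>\<le>\<^sub>0" if "z \<in> ball zc r" for z
  proof -
    have "z \<in> {z \<in> U. Re (q z) > c \<and> k z \<noteq> 0}" using r(2) that ball_subset_cball by blast
    then show "z \<in> U" "Re (q z) > c" "k z \<noteq> 0" "q z \<notin> \<real>\<^sub>\<le>\<^sub>0"
      using c(1) by (auto simp: complex_nonpos_Reals_iff)
  qed
  have BU: "ball zc r \<subseteq> U" using B(1) by blast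
  define s where "s = (\<lambda>z. (z - zc) * csqrt (q z))"
  have hs: "s holomorphic_on ball zc r" unfolding s_def
    by (intro holomorphic_intros holomorphic_on_csqrt' holomorphic_on_subset[OF hq BU]) (use B in auto)
  have zcr: "zc \<in> ball zc r" using r by simp
  have ds: "deriv s zc = csqrt (- p2 / 2)"
  proof -
    have hcs: "(\<lambda>z. csqrt (q z)) holomorphic_on ball zc r"
      by (intro holomorphic_on_csqrt' holomorphic_on_subset[OF hq BU]) (use B in auto)
    have "((\<lambda>z. z - zc) has_field_derivative 1) (at zc)" by (auto intro!: derivative_eq_intros)
    from DERIV_mult[OF this holomorphic_derivI[OF hcs open_ball zcr]]
    have "((\<lambda>z. (z - zc) * csqrt (q z)) has_field_derivative csqrt (q zc)) (at zc)" by simp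
    then show ?thesis unfolding s_def by (simp add: DERIV_imp_deriv q_def g2z)
  qed
  have pq: "p zc - p z = (z - zc)\<^sup>2 * q z" if "z \<in> U" for z
    using g1(2)[OF that] g2(2)[OF that] by (simp add: q_def power2_eq_square algebra_simps)
  have ssq: "(s z)\<^sup>2 = (z - zc)\<^sup>2 * q z" for z by (simp add: s_def power_mult_distrib)
  have "laplace p s k zc (ball zc r) d c" if d: "0 < d" "d < r" for d
  proof
    have mem: "zc + of_real x \<in> ball zc r" if "\<bar>x\<bar> \<le> d" for x using that d by (simp add: dist_norm)
    show "zc + of_real x \<in> ball zc r" if "\<bar>x\<bar> \<le> d" for x by (rule mem[OF that])
    show "deriv s zc \<noteq> 0" unfolding ds using p2(2) by auto
    show "(s z)\<^sup>2 = p zc - p z" if "z \<in> ball zc r" for z using pq[of z] B(1)[OF that] ssq by simp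
    show "Re (p (zc + of_real x)) \<le> Re (p zc) - c * x\<^sup>2" if "\<bar>x\<bar> \<le> d" for x
    proof -
      have "p zc - p (zc + of_real x) = of_real (x\<^sup>2) * q (zc + of_real x)"
        using pq[OF B(1)[OF mem[OF that]]] by simp
      then have "Re (p zc - p (zc + of_real x)) = x\<^sup>2 * Re (q (zc + of_real x))"
        by (simp del: of_real_power)
      moreover have "x\<^sup>2 * c \<le> x\<^sup>2 * Re (q (zc + of_real x))"
        using B(2)[OF mem[OF that]] by (intro mult_left_mono) auto
      ultimately show ?thesis by (simp add: mult.commute)
    qed
    have cs: "Re (csqrt (q z)) > 0" if "z \<in> ball zc r" for z
    proof (rule ccontr)
      assume "\<not> Re (csqrt (q z)) > 0"
      then have "Re (csqrt (q z)) = 0" using Re_csqrt[of "q z"] by simp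
      then have "Re ((csqrt (q z))\<^sup>2) \<le> 0" unfolding power2_eq_square by simp
      then show False using B(2)[OF that] c(1) by simp
    qed
    have m1: "zc + of_real d \<in> ball zc r" "zc - of_real d \<in> ball zc r" using mem[of d] mem[of "-d"] d by auto
    show "Re (s (zc + of_real d)) > 0" using cs[OF m1(1)] d by (simp add: s_def)
    show "Re (- s (zc - of_real d)) > 0" using cs[OF m1(2)] d by (simp add: s_def)
    have e: "(zc + of_real d - zc)\<^sup>2 = of_real (d\<^sup>2)" "(zc - of_real d - zc)\<^sup>2 = of_real (d\<^sup>2)" by auto
    show "Re ((s (zc + of_real d))\<^sup>2) > 0" "Re ((- s (zc - of_real d))\<^sup>2) > 0"
      unfolding power2_minus ssq e using B(2)[OF m1(1)] B(2)[OF m1(2)] c(1) d by (auto simp del: of_real_power)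
  qed (use d c B hs in \<open>auto intro: holomorphic_on_subset[OF hk BU] holomorphic_on_subset[OF assms(3) BU] pk\<close>)
  moreover have "cball zc r \<subseteq> U" using r by blast
  ultimately show ?thesis using r(1) ds by blast
qed

section \<open>Residues and size of the generating function\<close>

text \<open>The sum of the powers of \<open>X\<close> below \<open>M\<close> and the product of the
  linear factors \<open>X - \<zeta> ^ j\<close> have the same degree and leading coefficient and the
  same \<open>M - 1\<close> distinct zeros. Evaluate both at \<open>1\<close>.\<close>

lemma prod_one_minus_root_unity:
  fixes \<zeta> :: complex
  assumes M: "M > 0" and \<zeta>: "\<zeta> ^ M = 1" "\<And>j. 0 < j \<Longrightarrow> j < M \<Longrightarrow> \<zeta> ^ j \<noteq> 1"
  shows "(\<Prod>j=1..<M. 1 - \<zeta> ^ j) = of_nat M"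
proof -
  define P where "P = (\<Prod>j=1..<M. [:- (\<zeta> ^ j), 1:])"
  define R where "R = (\<Sum>i<M. monom (1::complex) i)"
  have \<zeta>0: "\<zeta> \<noteq> 0" using \<zeta>(1) M by (auto simp: power_0_left)
  have inj: "inj_on (\<lambda>j. \<zeta> ^ j) {1..<M}"
  proof (rule linorder_inj_onI)
    fix i j assume ij: "i < j" "i \<in> {1..<M}" "j \<in> {1..<M}"
    have "\<zeta> ^ j = \<zeta> ^ i * \<zeta> ^ (j - i)" using ij by (simp flip: power_add)
    then show "\<zeta> ^ i \<noteq> \<zeta> ^ j" using \<zeta>(2)[of "j - i"] ij \<zeta>0 by auto
  qed auto
  have degP: "degree P = M - 1" unfolding P_def by (subst degree_prod_eq_sum_degree) auto
  have "P = R"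
  proof (rule poly_eqI_degree_lead_coeff[where n = "M - 1" and A = "(\<lambda>j. \<zeta> ^ j) ` {1..<M}"])
    have "lead_coeff P = 1" unfolding P_def by (simp add: lead_coeff_prod)
    moreover have "poly.coeff R (M - 1) = 1"
      using M unfolding R_def by (simp add: coeff_sum)
    ultimately show "poly.coeff P (M - 1) = poly.coeff R (M - 1)" using degP by simp
    show "card ((\<lambda>j. \<zeta> ^ j) ` {1..<M}) \<ge> M - 1" by (subst card_image[OF inj]) simp
    show "degree P \<le> M - 1" using degP by simp
    show "degree R \<le> M - 1" unfolding R_def
      by (intro degree_sum_le) (auto intro: order_trans[OF degree_monom_le])
    fix z assume "z \<in> (\<lambda>j. \<zeta> ^ j) ` {1..<M}"
    then obtain j where j: "j \<in> {1..<M}" "z = \<zeta> ^ j" by blast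
    have "poly P z = 0" using j unfolding P_def by (auto simp: poly_prod)
    moreover have "(1 - z) * poly R z = 1 - z ^ M"
      unfolding R_def by (simp add: poly_sum poly_monom one_diff_power_eq)
    moreover have "z ^ M = 1" using j \<zeta>(1) by (simp flip: power_mult add: mult.commute[of j] power_mult)
    moreover have "z \<noteq> 1" using \<zeta>(2)[of j] j by auto
    ultimately show "poly P z = poly R z" by simp
  qed
  then have "poly P 1 = poly R 1" by simp
  then show ?thesis unfolding P_def R_def by (simp add: poly_prod poly_sum poly_monom)
qed

text \<open>
  By the symmetry \<open>j \<leftrightarrow> 2 * N + 1 - j\<close> this is the square root of the product over all nontrivial roots of unity.
\<close>
lemma prod_norm_one_minus_cis:
  assumes "coprime c (2 * N + 1)"
  shows "(\<Prod>j=1..N. cmod (1 - cis (2 * pi * real c * real j / (2 * real N + 1)))) = sqrt (2 * real N + 1)"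
proof -
  define M where "M = 2 * N + 1"
  define \<theta> where "\<theta> = 2 * pi * real c / real M"
  have M: "real M = 2 * real N + 1" "M > 0" by (simp_all add: M_def)
  have pw: "cis \<theta> ^ j = cis (2 * pi * real c * real j / (2 * real N + 1))" for j
    by (simp add: Complex.DeMoivre \<theta>_def M mult_ac)
  have M1: "cis \<theta> ^ M = 1"
  proof -
    have "cis \<theta> ^ M = cis (2 * pi * real c)" unfolding pw M(1)[symmetric] using M(2) by simp
    also have "\<dots> = 1" by (rule cis_multiple_2pi) simp
    finally show ?thesis .
  qed
  have ne: "cis \<theta> ^ j \<noteq> 1" if "0 < j" "j < M" for j
  proof
    assume "cis \<theta> ^ j = 1"
    then have "cos (real j * \<theta>) = 1" by (simp add: Complex.DeMoivre complex_eq_iff)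
    then obtain n :: int where n: "real j * \<theta> = of_int n * 2 * pi"
      by (auto simp: cos_one_2pi_int)
    then have "real j * real c = of_int n * real M" using M(2) by (simp add: \<theta>_def field_simps)
    then have "of_int (int j * int c) = (of_int (n * int M) :: real)" by simp
    then have "int j * int c = n * int M" by (simp only: of_int_eq_iff)
    then have "int M dvd int j * int c" by simp
    then have "M dvd j * c" by (metis of_nat_mult int_dvd_int_iff)
    then have "M dvd j" using assms coprime_dvd_mult_left_iff[of M c j] by (simp add: M_def coprime_commute)
    then show False using that by (auto dest: dvd_imp_le)
  qed
  define f where "f = (\<lambda>j. cmod (1 - cis \<theta> ^ j))"
  have "(\<Prod>j=1..<M. f j) = real M"
    using arg_cong[OF prod_one_minus_root_unity[OF M(2) M1 ne], of cmod] by (simp add: f_def prod_norm)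
  moreover have "(\<Prod>j=1..<M. f j) = (\<Prod>j=1..N. f j) * (\<Prod>j=N+1..<M. f j)"
  proof -
    have "{1..<M} = {1..N} \<union> {N+1..<M}" by (auto simp: M_def)
    then have "(\<Prod>j=1..<M. f j) = (\<Prod>j\<in>{1..N} \<union> {N+1..<M}. f j)" by (rule arg_cong)
    also have "\<dots> = (\<Prod>j=1..N. f j) * (\<Prod>j=N+1..<M. f j)" by (rule prod.union_disjoint) auto
    finally show ?thesis .
  qed
  moreover have "(\<Prod>j=N+1..<M. f j) = (\<Prod>j=1..N. f j)"
  proof (rule prod.reindex_bij_witness[where i = "\<lambda>j. M - j" and j = "\<lambda>j. M - j"])
    fix j assume j: "j \<in> {N+1..<M}"
    have "cis \<theta> ^ (M - j) * cis \<theta> ^ j = 1" using j M1 by (simp flip: power_add)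
    then have "1 - cis \<theta> ^ (M - j) = - (cis \<theta> ^ (M - j)) * (1 - cis \<theta> ^ j)" by (simp add: algebra_simps)
    then show "f (M - j) = f j" unfolding f_def by (simp only: norm_mult norm_minus_cancel norm_power norm_cis) simp
  qed (auto simp: M_def)
  ultimately have "(\<Prod>j=1..N. f j)\<^sup>2 = 2 * real N + 1" using M by (simp add: power2_eq_square)
  moreover have "(\<Prod>j=1..N. f j) \<ge> 0" by (intro prod_nonneg) (auto simp: f_def)
  ultimately have "(\<Prod>j=1..N. f j) = sqrt (2 * real N + 1)" by (simp add: real_sqrt_unique)
  then show ?thesis unfolding f_def pw .
qed

text \<open>The square of \<open>cmod (1 - r * cis t)\<close> is \<open>(1 - r)\<^sup>2\<close> plus
  \<open>r\<close> times the square of \<open>cmod (1 - cis t)\<close>. Dropping the first summand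
  separates the modulus from the argument.\<close>

lemma norm_one_minus_polar_ge:
  assumes "r > 0" shows "sqrt r * cmod (1 - cis t) \<le> cmod (1 - of_real r * cis t)"
proof -
  have 1: "(cmod (1 - of_real r * cis t))\<^sup>2 = (1 - r)\<^sup>2 + r * (2 - 2 * cos t)" for r
  proof -
    have s: "sin t * sin t = 1 - cos t * cos t" using sin_cos_squared_add[of t] by (simp add: power2_eq_square)
    show ?thesis unfolding cmod_power2 by (simp add: power2_eq_square algebra_simps s)
  qed
  have "(sqrt r * cmod (1 - cis t))\<^sup>2 = r * (2 - 2 * cos t)"
    using 1[of 1] assms by (simp add: power_mult_distrib)
  also have "\<dots> \<le> (cmod (1 - of_real r * cis t))\<^sup>2" unfolding 1[of r] by simp
  finally show ?thesis by (rule power2_le_imp_le) simp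
qed

lemma exp_2pi_j: "exp (2 * of_real pi * \<i> * of_nat j * Complex x y) = of_real (exp (- (2 * pi * real j * y))) * cis (2 * pi * real j * x)"
proof -
  have "2 * of_real pi * \<i> * of_nat j * Complex x y = of_real (- (2 * pi * real j * y)) + \<i> * of_real (2 * pi * real j * x)"
    by (simp add: complex_eq_iff)
  then show ?thesis by (simp only: exp_add cis_conv_exp exp_of_real)
qed

lemma norm_Q:
  "cmod (Q (Complex x y) N (of_int \<sigma>)) = exp (- (2 * pi * of_int \<sigma> * y)) /
     (\<Prod>j=1..N. cmod (1 - of_real (exp (- (2 * pi * real j * y))) * cis (2 * pi * real j * x)))"
  unfolding Q_def norm_mult exp_2pi_j by (simp add: prod_norm[symmetric] norm_inverse divide_inverse prod_inversef[symmetric])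

lemma sum_upto: "(\<Sum>j=1..N. real j) = real N * (real N + 1) / 2"
  by (induction N) (auto simp: field_simps)

text \<open>Each factor is at least \<open>sqrt (r j)\<close> times a factor on the unit circle. The
  latter multiply to \<open>sqrt (2 * N + 1)\<close>, which is at least \<open>1\<close>, and the
  former to \<open>exp (- pi * y * N * (N + 1) / 2)\<close>. The estimate is useful for heights
  \<open>y\<close> of order \<open>1 / nu N\<close>, where its exponent is linear in
  \<open>nu N\<close>.\<close>

lemma norm_Q_vertical:
  assumes c: "coprime c (2 * N + 1)" and y: "\<bar>y\<bar> \<le> 1"
  shows "cmod (Q (Complex (real c / (2 * real N + 1)) y) N (of_int \<sigma>)) \<le> exp (2 * pi * \<bar>of_int \<sigma>\<bar>) * exp (pi * max y 0 * (real N + 1/2)\<^sup>2 / 2)"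
proof -
  define x where "x = real c / (2 * real N + 1)"
  define r where "r = (\<lambda>j::nat. exp (- (2 * pi * real j * y)))"
  have "(\<Prod>j=1..N. sqrt (r j) * cmod (1 - cis (2 * pi * real j * x))) \<le>
      (\<Prod>j=1..N. cmod (1 - of_real (r j) * cis (2 * pi * real j * x)))"
    by (intro prod_mono conjI norm_one_minus_polar_ge) (auto simp: r_def)
  moreover have "(\<Prod>j=1..N. sqrt (r j) * cmod (1 - cis (2 * pi * real j * x))) = exp (- (pi * y * (real N * (real N + 1)) / 2)) * sqrt (2 * real N + 1)"
  proof -
    have "sqrt (r j) = exp (- (pi * y) * real j)" for j
    proof (rule real_sqrt_unique)
      have "(exp (- (pi * y) * real j))\<^sup>2 = exp (2 * (- (pi * y) * real j))" by (simp flip: exp_double)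
      then show "(exp (- (pi * y) * real j))\<^sup>2 = r j" by (simp add: r_def mult_ac)
    qed simp
    then have p1: "(\<Prod>j=1..N. sqrt (r j)) = exp (- (pi * y) * (\<Sum>j=1..N. real j))"
      by (simp add: exp_sum sum_distrib_left)
    have p2: "(\<Prod>j=1..N. cmod (1 - cis (2 * pi * real j * x))) = sqrt (2 * real N + 1)"
      using prod_norm_one_minus_cis[OF c] by (simp add: x_def mult_ac)
    show ?thesis unfolding prod.distrib p1 p2 sum_upto by simp
  qed
  ultimately have P: "exp (- (pi * y * (real N * (real N + 1)) / 2)) * sqrt (2 * real N + 1) \<le> (\<Prod>j=1..N. cmod (1 - of_real (r j) * cis (2 * pi * real j * x)))" by simp
  have s1: "sqrt (2 * real N + 1) \<ge> 1" by simp
  have "exp (- (pi * y * (real N * (real N + 1)) / 2)) \<le> exp (- (pi * y * (real N * (real N + 1)) / 2)) * sqrt (2 * real N + 1)"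
    using s1 mult_left_mono[OF s1, of "exp (- (pi * y * (real N * (real N + 1)) / 2))"] by simp
  with P have P': "exp (- (pi * y * (real N * (real N + 1)) / 2)) \<le> (\<Prod>j=1..N. cmod (1 - of_real (r j) * cis (2 * pi * real j * x)))" by linarith
  have Ppos: "0 < (\<Prod>j=1..N. cmod (1 - of_real (r j) * cis (2 * pi * real j * x)))"
    by (rule less_le_trans[OF exp_gt_zero P'])
  have "cmod (Q (Complex x y) N (of_int \<sigma>)) \<le> exp (- (2 * pi * of_int \<sigma> * y)) / exp (- (pi * y * (real N * (real N + 1)) / 2))"
    unfolding norm_Q
    by (rule divide_left_mono[OF P'[unfolded r_def]])
       (use mult_pos_pos[OF Ppos exp_gt_zero] in \<open>simp_all add: r_def\<close>)
  also have "\<dots> = exp (- (2 * pi * of_int \<sigma> * y)) * exp (pi * y * (real N * (real N + 1)) / 2)"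
    by (simp add: exp_minus field_simps)
  also have "\<dots> \<le> exp (2 * pi * \<bar>of_int \<sigma>\<bar>) * exp (pi * max y 0 * (real N + 1/2)\<^sup>2 / 2)"
  proof (intro mult_mono)
    have "- (of_int \<sigma> * y) \<le> \<bar>of_int \<sigma>\<bar> * 1"
      using y mult_left_mono[of "\<bar>y\<bar>" 1 "\<bar>of_int \<sigma>\<bar>"] abs_ge_minus_self[of "of_int \<sigma> * y"] by (simp add: abs_mult)
    then have "2 * pi * (- (of_int \<sigma> * y)) \<le> 2 * pi * (\<bar>of_int \<sigma>\<bar> * 1)" by (intro mult_left_mono) auto
    then show "exp (- (2 * pi * of_int \<sigma> * y)) \<le> exp (2 * pi * \<bar>of_int \<sigma>\<bar>)" by (simp add: mult.assoc)
    have "y * (real N * (real N + 1)) \<le> max y 0 * (real N + 1/2)\<^sup>2"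
    proof (cases "y \<ge> 0")
      case True
      then show ?thesis by (intro mult_mono) (auto simp: power2_eq_square algebra_simps)
    next
      case False
      then show ?thesis by (simp add: mult_nonpos_nonneg)
    qed
    then have "pi * (y * (real N * (real N + 1))) \<le> pi * (max y 0 * (real N + 1/2)\<^sup>2)" by (intro mult_left_mono) auto
    then have "pi * (y * (real N * (real N + 1))) / 2 \<le> pi * (max y 0 * (real N + 1/2)\<^sup>2) / 2"
      by (rule divide_right_mono) simp
    then show "exp (pi * y * (real N * (real N + 1)) / 2) \<le> exp (pi * max y 0 * (real N + 1/2)\<^sup>2 / 2)"
      unfolding exp_le_cancel_iff by (simp only: mult.assoc)
  qed auto
  finally show ?thesis unfolding x_def .
qed

text \<open>Below the real axis the exponentials are large: at height \<open>-1\<close> each factor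
  has modulus at least \<open>exp (2 * pi * j) - 1 \<ge> 1\<close>.\<close>

lemma norm_Q_bottom: "cmod (Q (Complex x (-1)) N (of_int \<sigma>)) \<le> exp (2 * pi * \<bar>of_int \<sigma>\<bar>)"
proof -
  have "1 \<le> cmod (1 - of_real (exp (- (2 * pi * real j * (-1)))) * cis (2 * pi * real j * x))" if "j \<in> {1..N}" for j
  proof -
    have "1 \<le> pi * real j" using that pi_gt3 mult_mono[of 1 pi 1 "real j"] by simp
    then have "2 \<le> exp (2 * pi * real j)" using exp_ge_add_one_self[of "2 * pi * real j"] by linarith
    then show ?thesis
      using norm_triangle_ineq2[of "of_real (exp (2 * pi * real j)) * cis (2 * pi * real j * x)" 1]
      by (simp add: norm_mult norm_minus_commute)
  qed
  then have P: "1 \<le> (\<Prod>j=1..N. cmod (1 - of_real (exp (- (2 * pi * real j * (-1)))) * cis (2 * pi * real j * x)))"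
    by (rule prod_ge_1)
  have "cmod (Q (Complex x (-1)) N (of_int \<sigma>)) \<le> exp (- (2 * pi * of_int \<sigma> * (-1))) / 1"
    unfolding norm_Q by (rule divide_left_mono[OF P]) (use P in auto)
  also have "\<dots> \<le> exp (2 * pi * \<bar>of_int \<sigma>\<bar>)" by simp
  finally show ?thesis .
qed

lemma exp_2pi_eq_1_iff: "exp (2 * of_real pi * \<i> * of_nat j * z) = 1 \<longleftrightarrow> (\<exists>n::int. of_nat j * z = of_int n)"
proof -
  have "exp (2 * of_real pi * \<i> * of_nat j * z) = 1 \<longleftrightarrow> (\<exists>n::int. Re (2 * of_real pi * \<i> * of_nat j * z) = 0 \<and> Im (2 * of_real pi * \<i> * of_nat j * z) = of_int (2 * n) * pi)"
    unfolding exp_eq_1 by blast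
  also have "\<dots> \<longleftrightarrow> (\<exists>n::int. of_nat j * z = of_int n)"
    by (intro ex_cong1) (auto simp: complex_eq_iff)
  finally show ?thesis .
qed

lemma Q_holomorphic:
  assumes "open S" "\<And>z j. z \<in> S \<Longrightarrow> 1 \<le> j \<Longrightarrow> j \<le> N \<Longrightarrow> \<not> (\<exists>n::int. of_nat j * z = of_int n)"
  shows "(\<lambda>z. Q z N \<sigma>) holomorphic_on S"
  unfolding Q_def
  by (intro holomorphic_intros) (use assms exp_2pi_eq_1_iff in auto)

definition res_term :: "nat \<Rightarrow> nat \<Rightarrow> int \<Rightarrow> nat \<Rightarrow> complex" where
  "res_term h k \<sigma> N = - exp (2 * of_real pi * \<i> * of_int \<sigma> * (of_nat h / of_nat k)) *
     (\<Prod>j\<in>{1..N}-{k}. inverse (1 - exp (2 * of_real pi * \<i> * of_nat j * (of_nat h / of_nat k)))) / of_nat k"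

text \<open>Because \<open>N < 2 * k\<close>, the only multiple of \<open>k\<close> among the
  indices is \<open>k\<close> itself. So exactly one factor vanishes at \<open>h/k\<close>, and the
  pole is simple.\<close>

lemma Q_res_eq:
  assumes k: "N < 2 * k" "k \<le> N" "coprime h k"
  shows "Q_res h k (of_int \<sigma>) N = res_term h k \<sigma> N"
proof -
  define a where "a = complex_of_nat h / of_nat k"
  define f where "f = (\<lambda>z. exp (2 * of_real pi * \<i> * of_int \<sigma> * z) *
     (\<Prod>j\<in>{1..N}-{k}. inverse (1 - exp (2 * of_real pi * \<i> * of_nat j * z))))"
  define g where "g = (\<lambda>z. 1 - exp (2 * of_real pi * \<i> * of_nat k * z))"
  have k0: "k > 0" using k by simp
  have ne: "1 - exp (2 * of_real pi * \<i> * of_nat j * a) \<noteq> 0" if j: "j \<in> {1..N}-{k}" for j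
  proof
    assume "1 - exp (2 * of_real pi * \<i> * of_nat j * a) = 0"
    then obtain n :: int where "of_nat j * a = of_int n" using exp_2pi_eq_1_iff by auto
    then have "complex_of_int (int j * int h) = of_int (n * int k)" using k0 by (simp add: a_def field_simps)
    then have "int j * int h = n * int k" by (simp only: of_int_eq_iff)
    then have "int k dvd int j * int h" by simp
    then have "k dvd j * h" by (metis of_nat_mult int_dvd_int_iff)
    then have "k dvd j" using k(3) coprime_dvd_mult_left_iff[of k h j] by (simp add: coprime_commute)
    then obtain m where "j = k * m" by (elim dvdE)
    then show False using j k by (cases m; cases "m - 1") auto
  qed
  define S where "S = (\<Inter>j\<in>{1..N}-{k}. {z. 1 - exp (2 * of_real pi * \<i> * of_nat j * z) \<noteq> 0})"
  have "open S" unfolding S_def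
    by (intro open_INT ballI) (auto intro!: open_Collect_neq continuous_intros)
  moreover have "a \<in> S" unfolding S_def using ne by simp
  ultimately obtain e where e: "e > 0" "ball a e \<subseteq> S" by (meson open_contains_ball)
  have "residue (\<lambda>w. f w / g w) a = f a / (- (2 * of_real pi * \<i> * of_nat k))"
  proof (rule residue_simple_pole_deriv[where s = "ball a e"])
    show "f holomorphic_on ball a e" unfolding f_def
      by (intro holomorphic_intros) (use e in \<open>auto simp: S_def\<close>)
    show "g holomorphic_on ball a e" unfolding g_def by (intro holomorphic_intros)
    have "of_nat k * a = of_int (int h)" using k0 by (simp add: a_def)
    then have ex: "exp (2 * of_real pi * \<i> * of_nat k * a) = 1" using exp_2pi_eq_1_iff by blast
    then show "g a = 0" by (simp add: g_def)
    have "(g has_field_derivative - (exp (2 * of_real pi * \<i> * of_nat k * a) * (2 * of_real pi * \<i> * of_nat k))) (at a)"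
      unfolding g_def by (auto intro!: derivative_eq_intros)
    then show "(g has_field_derivative - (2 * of_real pi * \<i> * of_nat k)) (at a)" by (simp add: ex)
    show "f a \<noteq> 0" unfolding f_def using ne by auto
    show "- (2 * of_real pi * \<i> * of_nat k) \<noteq> (0::complex)" using k0 by simp
  qed (use e in auto)
  moreover have "(\<lambda>z. Q z N (of_int \<sigma>)) = (\<lambda>w. f w / g w)"
  proof
    fix z
    have "(\<Prod>j=1..N. inverse (1 - exp (2 * of_real pi * \<i> * of_nat j * z))) =
        inverse (1 - exp (2 * of_real pi * \<i> * of_nat k * z)) * (\<Prod>j\<in>{1..N}-{k}. inverse (1 - exp (2 * of_real pi * \<i> * of_nat j * z)))"
      using k k0 by (intro prod.remove) auto
    then show "Q z N (of_int \<sigma>) = f z / g z" unfolding Q_def f_def g_def by (simp add: divide_inverse mult_ac)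
  qed
  ultimately have "Q_res h k (of_int \<sigma>) N = 2 * of_real pi * \<i> * (f a / (- (2 * of_real pi * \<i> * of_nat k)))"
    unfolding Q_res_def a_def by simp
  also have "\<dots> = - f a / of_nat k" using k0 by (simp add: field_simps)
  finally show ?thesis unfolding res_term_def f_def a_def by simp
qed

text \<open>For an integer \<open>j\<close>, replacing \<open>h/k\<close> by \<open>1 - h/k\<close>
  conjugates \<open>exp (2 pi i j h/k)\<close>. The prefactor is covered because
  \<open>\<sigma>\<close> is an integer.\<close>

lemma res_term_cnj:
  assumes "h \<le> k" "k > 0"
  shows "res_term (k - h) k \<sigma> N = cnj (res_term h k \<sigma> N)"
proof -
  have e: "exp (2 * of_real pi * \<i> * of_int j * (of_nat (k - h) / of_nat k)) = cnj (exp (2 * of_real pi * \<i> * of_int j * (of_nat h / of_nat k)))" for j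
  proof -
    have "complex_of_nat (k - h) / of_nat k = 1 - of_nat h / of_nat k" using assms by (simp add: of_nat_diff field_simps)
    from arg_cong[OF this, of "\<lambda>x. 2 * of_real pi * \<i> * of_int j * x"] have "2 * of_real pi * \<i> * of_int j * (of_nat (k - h) / of_nat k) = cnj (2 * of_real pi * \<i> * of_int j * (of_nat h / of_nat k)) + of_int (2 * j) * of_real pi * \<i>"
      by (simp add: algebra_simps)
    moreover have "exp (of_int (2 * j) * of_real pi * \<i>) = 1"
      by (subst exp_eq_1) (auto intro!: exI[of _ j])
    ultimately show ?thesis by (simp only: exp_add exp_cnj mult_1_right)
  qed
  have e': "exp (2 * of_real pi * \<i> * of_nat j * (of_nat (k - h) / of_nat k)) = cnj (exp (2 * of_real pi * \<i> * of_nat j * (of_nat h / of_nat k)))" for j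
    using e[of "int j"] by simp
  show ?thesis unfolding res_term_def e e' by (simp del: exp_cnj)
qed

text \<open>For \<open>N \<ge> 4\<close> every admissible \<open>k\<close> is at least
  \<open>3\<close>, so \<open>1\<close> and \<open>k - 1\<close> are different numerators and the
  two families of pairs are disjoint. Conjugate residues then add up to twice the real part.\<close>

lemma A1_eq:
  assumes N: "N \<ge> 4"
  shows "A1 N (of_int \<sigma>) = of_real (2 * Re (\<Sum>k\<in>{k. N < 2 * k \<and> k \<le> N}. Q_res 1 k (of_int \<sigma>) N))"
proof -
  define I where "I = {k. N < 2 * k \<and> k \<le> N}"
  have fin: "finite I" unfolding I_def by (rule finite_subset[of _ "{..N}"]) auto
  have "A_set N = (\<lambda>k. (1, k)) ` I \<union> (\<lambda>k. (k - 1, k)) ` I"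
    using N coprime_diff_one_left_nat by (auto simp: A_set_def I_def)
  moreover have "(\<lambda>k::nat. (1::nat, k)) ` I \<inter> (\<lambda>k. (k - 1, k)) ` I = {}"
    using N by (auto simp: I_def)
  ultimately have "A1 N (of_int \<sigma>) = (\<Sum>(h,k)\<in>(\<lambda>k. (1, k)) ` I. Q_res h k (of_int \<sigma>) N) + (\<Sum>(h,k)\<in>(\<lambda>k. (k - 1, k)) ` I. Q_res h k (of_int \<sigma>) N)"
    unfolding A1_def using fin by (simp add: sum.union_disjoint)
  also have "(\<Sum>(h,k)\<in>(\<lambda>k. (1, k)) ` I. Q_res h k (of_int \<sigma>) N) = (\<Sum>k\<in>I. Q_res 1 k (of_int \<sigma>) N)"
    by (subst sum.reindex) (auto simp: inj_on_def)
  also have "(\<Sum>(h,k)\<in>(\<lambda>k. (k - 1, k)) ` I. Q_res h k (of_int \<sigma>) N) = (\<Sum>k\<in>I. Q_res (k - 1) k (of_int \<sigma>) N)"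
    by (subst sum.reindex) (auto simp: inj_on_def)
  also have "\<dots> = (\<Sum>k\<in>I. cnj (Q_res 1 k (of_int \<sigma>) N))"
  proof (rule sum.cong[OF refl])
    fix k assume k: "k \<in> I"
    then have "k \<ge> 1" "coprime (k - 1) k" using coprime_diff_one_left_nat[of k] N by (auto simp: I_def)
    then show "Q_res (k - 1) k (of_int \<sigma>) N = cnj (Q_res 1 k (of_int \<sigma>) N)"
      using k res_term_cnj[of 1 k \<sigma> N] by (simp add: Q_res_eq I_def)
  qed
  finally show ?thesis unfolding I_def[symmetric]
    by (simp add: complex_add_cnj flip: cnj_sum)
qed

lemma sum_Q_res_eq_contour:
  assumes N: "N \<ge> 1" and v: "v > 0"
  shows "contour_integral (rectpath (Complex (2 / (2 * real N + 1)) (-1)) (Complex (4 / (2 * real N + 1)) v)) (\<lambda>z. Q z N (of_int \<sigma>)) =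
    (\<Sum>k\<in>{k. N < 2 * k \<and> k \<le> N}. Q_res 1 k (of_int \<sigma>) N)"
    and "continuous_on (path_image (rectpath (Complex (2 / (2 * real N + 1)) (-1)) (Complex (4 / (2 * real N + 1)) v))) (\<lambda>z. Q z N (of_int \<sigma>))"
proof -
  define I where "I = {k. N < 2 * k \<and> k \<le> N}"
  have fin: "finite I" unfolding I_def by (rule finite_subset[of _ "{..N}"]) auto
  define pts where "pts = (\<lambda>k. complex_of_nat 1 / of_nat k) ` I"
  \<comment> \<open>A convex strip slightly wider than the rectangle. A pole \<open>n/j\<close> with
    \<open>n \<ge> 2\<close> and \<open>j \<le> N\<close> has real part at least \<open>2/N\<close>
    and so stays outside.\<close>
  define S where "S = {z. Re z > 0} \<inter> {z. Re z < 2 / real N}"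
  define a where "a = Complex (2 / (2 * real N + 1)) (-1)"
  define b where "b = Complex (4 / (2 * real N + 1)) v"
  have S: "open S" "convex S" unfolding S_def
    by (intro open_Int open_halfspace_Re_gt open_halfspace_Re_lt, intro convex_Int convex_halfspace_Re_gt convex_halfspace_Re_lt)
  have ab: "Re a < Re b" "Im a < Im b" using v by (simp_all add: a_def b_def divide_simps)
  have cb: "cbox a b \<subseteq> S"
  proof
    fix z assume "z \<in> cbox a b"
    then have "2 / (2 * real N + 1) \<le> Re z" "Re z \<le> 4 / (2 * real N + 1)" by (auto simp: in_cbox_complex_iff a_def b_def)
    moreover have "0 < 2 / (2 * real N + 1)" "4 / (2 * real N + 1) < 2 / real N" using N by (auto simp: divide_simps)
    ultimately have "0 < Re z" "Re z < 2 / real N" by linarith+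
    then show "z \<in> S" by (simp add: S_def)
  qed
  have pts: "p \<in> box a b" if "p \<in> pts" for p
  proof -
    from that obtain k where k: "N < 2 * k" "k \<le> N" "p = 1 / of_nat k" by (auto simp: pts_def I_def)
    then have p: "Re p = 1 / real k" "Im p = 0" by (simp_all add: Re_divide_of_nat Im_divide_of_nat)
    have "real N + 1 \<le> 2 * real k" "real k \<le> real N" using k by linarith+
    then show ?thesis using v k by (auto simp: in_box_complex_iff p a_def b_def divide_simps)
  qed
  have hol: "(\<lambda>z. Q z N (of_int \<sigma>)) holomorphic_on S - pts"
  proof (rule Q_holomorphic)
    show "open (S - pts)" using fin by (intro open_Diff S finite_imp_closed) (simp add: pts_def)
    fix z j assume z: "z \<in> S - pts" and j: "1 \<le> j" "j \<le> N"
    show "\<not> (\<exists>n::int. of_nat j * z = of_int n)"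
    proof
      assume "\<exists>n::int. of_nat j * z = of_int n"
      then obtain n :: int where n: "of_nat j * z = of_int n" by blast
      then have "Re (of_nat j * z) = of_int n" by simp
      then have r: "real j * Re z = of_int n" by simp
      have "0 < real j * Re z" using z j by (auto simp: S_def)
      then have "n > 0" using r by simp
      have "real j * Re z < real j * (2 / real N)"
        using z j by (intro mult_strict_left_mono) (auto simp: S_def)
      also have "\<dots> \<le> real N * (2 / real N)" using j by (intro mult_right_mono) auto
      also have "\<dots> = 2" using N by simp
      finally have "n < 2" using r by simp
      with \<open>n > 0\<close> have "n = 1" by simp
      then have zj: "z = 1 / of_nat j" using n j by (simp add: field_simps)
      then have "Re z = 1 / real j" by (simp add: Re_divide_of_nat)
      then have "1 / real j < 2 / real N" using z by (auto simp: S_def)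
      then have "N < 2 * j" using j N by (simp add: field_simps)
      then show False using z zj j by (auto simp: pts_def I_def)
    qed
  qed
  have "path_image (rectpath a b) = cbox a b - box a b"
    using ab by (intro path_image_rectpath_cbox_minus_box) auto
  then have sub: "path_image (rectpath a b) \<subseteq> S - pts" using cb pts by auto
  show "continuous_on (path_image (rectpath (Complex (2 / (2 * real N + 1)) (-1)) (Complex (4 / (2 * real N + 1)) v))) (\<lambda>z. Q z N (of_int \<sigma>))"
    using continuous_on_subset[OF holomorphic_on_imp_continuous_on[OF hol] sub] unfolding a_def b_def .
  have "contour_integral (rectpath a b) (\<lambda>z. Q z N (of_int \<sigma>)) =
     2 * pi * \<i> * (\<Sum>p\<in>pts. winding_number (rectpath a b) p * residue (\<lambda>z. Q z N (of_int \<sigma>)) p)"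
  proof (rule Residue_theorem[OF S(1) convex_connected[OF S(2)] _ hol])
    show "finite pts" using fin by (simp add: pts_def)
    show "path_image (rectpath a b) \<subseteq> S - pts" by (rule sub)
    show "\<forall>z. z \<notin> S \<longrightarrow> winding_number (rectpath a b) z = 0"
      using cb ab by (auto intro!: winding_number_rectpath_outside)
  qed auto
  also have "(\<Sum>p\<in>pts. winding_number (rectpath a b) p * residue (\<lambda>z. Q z N (of_int \<sigma>)) p) = (\<Sum>p\<in>pts. residue (\<lambda>z. Q z N (of_int \<sigma>)) p)"
    by (rule sum.cong) (use pts winding_number_rectpath in auto)
  also have "\<dots> = (\<Sum>k\<in>I. residue (\<lambda>z. Q z N (of_int \<sigma>)) (of_nat 1 / of_nat k))"
    unfolding pts_def by (subst sum.reindex) (auto simp: inj_on_def I_def)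
  also have "complex_of_real (2 * pi) * \<i> * \<dots> = (\<Sum>k\<in>I. Q_res 1 k (of_int \<sigma>) N)"
    unfolding Q_res_def by (simp add: sum_distrib_left)
  finally show "contour_integral (rectpath (Complex (2 / (2 * real N + 1)) (-1)) (Complex (4 / (2 * real N + 1)) v)) (\<lambda>z. Q z N (of_int \<sigma>)) =
    (\<Sum>k\<in>{k. N < 2 * k \<and> k \<le> N}. Q_res 1 k (of_int \<sigma>) N)" unfolding a_def b_def I_def .
qed

section \<open>Asymptotics of the generating function\<close>

text \<open>The normalisation \<open>\<phi> 0 = 0\<close> removes the term
  \<open>\<phi> 0 / 2\<close> from the Euler-Maclaurin formula, and \<open>F\<close> evaluates the
  integral along a ray.\<close>

lemma log_primitive:
  assumes U: "open U" "starlike U" "0 \<in> U" and E: "E holomorphic_on U" "\<And>t. t \<in> U \<Longrightarrow> E t \<noteq> 0" "E 0 = 1"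
  shows "\<exists>\<phi> F. \<phi> holomorphic_on U \<and> \<phi> 0 = 0 \<and> (\<forall>t\<in>U. exp (\<phi> t) = E t) \<and> F 0 = 0 \<and>
     (\<forall>t\<in>U. (F has_field_derivative \<phi> t) (at t))"
proof -
  have "simply_connected U" using U by (intro starlike_imp_simply_connected)
  then have "\<exists>g. g holomorphic_on U \<and> (\<forall>z\<in>U. E z = exp (g z))"
    using simply_connected_eq_holomorphic_log[OF U(1)] E by blast
  then obtain g where g: "g holomorphic_on U" "\<And>z. z \<in> U \<Longrightarrow> E z = exp (g z)" by blast
  define \<phi> where "\<phi> = (\<lambda>t. g t - g 0)"
  have \<phi>: "\<phi> holomorphic_on U" unfolding \<phi>_def by (intro holomorphic_intros g)
  have "exp (g 0) = 1" using g(2)[OF U(3)] E(3) by simp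
  then have \<phi>E: "exp (\<phi> t) = E t" if "t \<in> U" for t
    using g(2)[OF that] by (simp add: \<phi>_def exp_diff)
  have "\<exists>F. \<forall>x\<in>U. (F has_field_derivative \<phi> x) (at x)"
    by (rule holomorphic_starlike_primitive[where k = "{}"])
       (use \<phi> U in \<open>auto intro: holomorphic_on_imp_continuous_on simp: holomorphic_on_open field_differentiable_def\<close>)
  then obtain F where F: "\<And>x. x \<in> U \<Longrightarrow> (F has_field_derivative \<phi> x) (at x)" by blast
  have "((\<lambda>t. F t - F 0) has_field_derivative \<phi> t) (at t)" if "t \<in> U" for t
    using F[OF that] by (auto intro!: derivative_eq_intros)
  then show ?thesis using \<phi> \<phi>E
    by (intro exI[of _ \<phi>] exI[of _ "\<lambda>t. F t - F 0"]) (auto simp: \<phi>_def)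
qed

text \<open>
  This domain contains the rays from \<open>0\<close> to the upper half plane and avoids the zeros of \<open>exp_quot\<close>, the nonzero integers.
\<close>
definition strip_dom :: "complex set" where
  "strip_dom = {t. Im t > 0} \<union> {t. \<bar>Re t\<bar> < 1}"

lemma open_strip_dom: "open strip_dom"
  unfolding strip_dom_def by (intro open_Un open_Collect_less continuous_intros)

lemma strip_dom_scale: "t \<in> strip_dom \<Longrightarrow> 0 \<le> s \<Longrightarrow> s \<le> 1 \<Longrightarrow> of_real s * t \<in> strip_dom"
proof -
  assume t: "t \<in> strip_dom" and s: "0 \<le> s" "s \<le> 1"
  show ?thesis
  proof (cases "s = 0")
    case False
    show ?thesis
    proof (cases "Im t > 0")
      case True
      then show ?thesis using s False by (simp add: strip_dom_def)
    next
      case False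
      then have "\<bar>Re t\<bar> < 1" using t by (simp add: strip_dom_def)
      moreover have "\<bar>s * Re t\<bar> \<le> 1 * \<bar>Re t\<bar>" unfolding abs_mult using s by (intro mult_right_mono) auto
      ultimately show ?thesis by (simp add: strip_dom_def)
    qed
  qed (simp add: strip_dom_def)
qed

lemma zero_in_strip_dom: "0 \<in> strip_dom" by (simp add: strip_dom_def)

lemma starlike_strip_dom: "starlike strip_dom"
  unfolding starlike_def
  using strip_dom_scale zero_in_strip_dom by (auto simp: closed_segment_def scaleR_conv_of_real intro!: bexI[of _ 0])

text \<open>With the zero at \<open>0\<close> divided out, the logarithm is holomorphic along the
  whole ray. The factors \<open>- 2 pi i t\<close> taken out multiply to a factorial times powers,
  which \<open>stirling\<close> handles.\<close>

definition exp_quot :: "complex \<Rightarrow> complex" where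
  "exp_quot t = (if t = 0 then 1 else (1 - exp (2 * of_real pi * \<i> * t)) / (- 2 * of_real pi * \<i> * t))"

lemma exp_quot_holomorphic: "exp_quot holomorphic_on UNIV"
proof (rule pole_theorem_open_0[where g = "\<lambda>t. (1 - exp (2 * of_real pi * \<i> * t)) / (- 2 * of_real pi * \<i>)" and a = 0])
  have "((\<lambda>t. (1 - exp (2 * of_real pi * \<i> * t)) / (- 2 * of_real pi * \<i>)) has_field_derivative 1) (at 0)"
    by (auto intro!: derivative_eq_intros)
  then show "exp_quot 0 = deriv (\<lambda>t. (1 - exp (2 * of_real pi * \<i> * t)) / (- 2 * of_real pi * \<i>)) 0"
    by (simp add: exp_quot_def DERIV_imp_deriv)
qed (auto intro!: holomorphic_intros simp: exp_quot_def field_simps)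

lemma exp_quot_mult: "exp_quot t * (- 2 * of_real pi * \<i> * t) = 1 - exp (2 * of_real pi * \<i> * t)"
  by (simp add: exp_quot_def)

lemma exp_quot_nonzero: "t \<in> strip_dom \<Longrightarrow> exp_quot t \<noteq> 0"
proof
  assume t: "t \<in> strip_dom" and z: "exp_quot t = 0"
  then have "t \<noteq> 0" by (auto simp: exp_quot_def)
  have "exp (2 * of_real pi * \<i> * of_nat 1 * t) = 1" using exp_quot_mult[of t] z by simp
  then obtain n :: int where n: "t = of_int n" using exp_2pi_eq_1_iff[of 1 t] by auto
  then have "\<bar>of_int n :: real\<bar> < 1" using t by (auto simp: strip_dom_def)
  then have "n = 0" by linarith
  with n \<open>t \<noteq> 0\<close> show False by simp
qed

text \<open>In the upper half plane \<open>\<phi>\<close> is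
  \<open>Ln (1 - unit_exp t) - Ln (- 2 pi i t)\<close>: the derivatives agree, and the constant is
  found at \<open>0\<close>. A second integration brings in \<open>Li2\<close>, whose limit at
  \<open>1\<close> supplies the \<open>pi\<^sup>2 / 6\<close> in \<open>phase\<close>.\<close>

lemma log_exp_quot:
  obtains \<phi> F where "\<phi> holomorphic_on strip_dom" "\<phi> 0 = 0" "\<And>t. t \<in> strip_dom \<Longrightarrow> exp (\<phi> t) = exp_quot t" "F 0 = 0"
    "\<And>t. t \<in> strip_dom \<Longrightarrow> (F has_field_derivative \<phi> t) (at t)"
    "\<And>t. Im t > 0 \<Longrightarrow> F t = t * (1 - phase t - Ln (- 2 * of_real pi * \<i> * t))"
proof -
  obtain \<phi> F where f: "\<phi> holomorphic_on strip_dom" "\<phi> 0 = 0" "\<And>t. t \<in> strip_dom \<Longrightarrow> exp (\<phi> t) = exp_quot t" "F 0 = 0"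
    "\<And>t. t \<in> strip_dom \<Longrightarrow> (F has_field_derivative \<phi> t) (at t)"
    using log_primitive[OF open_strip_dom starlike_strip_dom zero_in_strip_dom holomorphic_on_subset[OF exp_quot_holomorphic subset_UNIV] exp_quot_nonzero]
    by (auto simp: exp_quot_def)
  define H where "H = {t. Im t > 0}"
  have H: "open H" "convex H" "H \<subseteq> strip_dom"
    unfolding H_def strip_dom_def by (auto intro: open_halfspace_Im_gt convex_halfspace_Im_gt)
  define L where "L = (\<lambda>t. Ln (- 2 * of_real pi * \<i> * t))"
  have nn: "- 2 * of_real pi * \<i> * t \<notin> \<real>\<^sub>\<le>\<^sub>0" "- 2 * of_real pi * \<i> * t \<noteq> 0" if "t \<in> H" for t
  proof -
    have "pi * Im t > 0" using that by (simp add: H_def)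
    then have "Re (- 2 * of_real pi * \<i> * t) > 0" by simp
    then show "- 2 * of_real pi * \<i> * t \<notin> \<real>\<^sub>\<le>\<^sub>0" "- 2 * of_real pi * \<i> * t \<noteq> 0"
      unfolding complex_nonpos_Reals_iff by (linarith, metis less_irrefl zero_complex.sel(1))
  qed
  have dL: "(L has_field_derivative 1 / t) (at t)" if "t \<in> H" for t
  proof -
    have "t \<noteq> 0" using that by (auto simp: H_def)
    then show ?thesis unfolding L_def using nn[OF that] by (auto intro!: derivative_eq_intros simp: field_simps)
  qed
  define lam where "lam = (\<lambda>t. Ln (1 - unit_exp t) - L t)"
  have dlam: "(lam has_field_derivative (- 2 * of_real pi * \<i> * unit_exp t / (1 - unit_exp t) - 1 / t)) (at t)" if "t \<in> H" for t
    unfolding lam_def using that by (intro DERIV_diff Ln_unit_exp_has_field_derivative dL) (auto simp: H_def)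
  have d\<phi>: "(\<phi> has_field_derivative (- 2 * of_real pi * \<i> * unit_exp t / (1 - unit_exp t) - 1 / t)) (at t)" if t: "t \<in> H" for t
  proof -
    have tU: "t \<in> strip_dom" and t0: "t \<noteq> 0" using t H by (auto simp: H_def)
    have u1: "1 - unit_exp t \<noteq> 0" using t by (intro one_minus_unit_exp(3)) (simp add: H_def)
    have d: "(\<phi> has_field_derivative deriv \<phi> t) (at t)" by (rule holomorphic_derivI[OF f(1) open_strip_dom tU])
    define c where "c = - 2 * of_real pi * \<i>"
    have "((\<lambda>t. exp (\<phi> t) * (c * t)) has_field_derivative
        (exp (\<phi> t) * deriv \<phi> t * (c * t) + exp (\<phi> t) * c)) (at t)"
      by (rule derivative_eq_intros d refl | simp)+
    moreover have "((\<lambda>t. 1 - unit_exp t) has_field_derivative c * unit_exp t) (at t)"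
      by (rule derivative_eq_intros refl | simp add: c_def)+
    then have "((\<lambda>t. exp (\<phi> t) * (c * t)) has_field_derivative c * unit_exp t) (at t)"
      by (rule has_field_derivative_transform_within_open[OF _ H(1) t])
         (use f(3) H(3) exp_quot_mult in \<open>auto simp: c_def unit_exp_def mult.assoc\<close>)
    ultimately have e: "exp (\<phi> t) * deriv \<phi> t * (c * t) + exp (\<phi> t) * c = c * unit_exp t" by (rule DERIV_unique)
    have ex: "exp (\<phi> t) * (c * t) = 1 - unit_exp t" using f(3)[OF tU] exp_quot_mult[of t] by (simp add: c_def unit_exp_def)
    have "(1 - unit_exp t) * deriv \<phi> t + (1 - unit_exp t) / t = c * unit_exp t"
      using e unfolding ex[symmetric] using t0 by (simp add: algebra_simps)
    then have "deriv \<phi> t = c * unit_exp t / (1 - unit_exp t) - 1 / t"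
      using u1 t0 by (simp add: field_simps)
    then show ?thesis using d by (simp add: c_def)
  qed
  have "\<exists>k. \<forall>t\<in>H. \<phi> t - lam t = k"
  proof (rule has_field_derivative_zero_constant[OF H(2)])
    fix t assume "t \<in> H"
    from DERIV_diff[OF d\<phi>[OF this] dlam[OF this]]
    show "((\<lambda>t. \<phi> t - lam t) has_field_derivative 0) (at t within H)" by (simp add: has_field_derivative_at_within)
  qed
  then obtain k where k: "\<And>t. t \<in> H \<Longrightarrow> \<phi> t - lam t = k" by blast
  \<comment> \<open>On the positive imaginary axis \<open>unit_exp\<close> and the argument of
    \<open>L\<close> are positive reals, so the limits reduce to real ones.\<close>
  define h where "h = (\<lambda>e::real. \<i> * of_real e)"
  have h0: "(h \<longlongrightarrow> 0) (at_right 0)" unfolding h_def by (auto intro!: tendsto_eq_intros)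
  have hH: "h e \<in> H" if "e > 0" for e using that by (simp add: h_def H_def)
  have uh: "unit_exp (h e) = of_real (exp (- 2 * pi * e))" for e
  proof -
    have "2 * of_real pi * \<i> * h e = of_real (- 2 * pi * e)" by (simp add: h_def complex_eq_iff)
    then show ?thesis unfolding unit_exp_def by (simp only: exp_of_real)
  qed
  have Lh: "L (h e) = of_real (ln (2 * pi * e))" if "e > 0" for e
  proof -
    have "- 2 * of_real pi * \<i> * h e = of_real (2 * pi * e)" by (simp add: h_def complex_eq_iff)
    then show ?thesis unfolding L_def using that by (simp only: Ln_of_real mult_pos_pos pi_gt_zero zero_less_numeral)
  qed
  have "((\<lambda>e. \<phi> (h e) - of_real (ln (1 - exp (- 2 * pi * e)) - ln (2 * pi * e))) \<longlongrightarrow> \<phi> 0 - of_real 0) (at_right 0)"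
  proof (intro tendsto_intros)
    have "isCont \<phi> 0" using f(1) open_strip_dom zero_in_strip_dom
      by (meson continuous_on_eq_continuous_at holomorphic_on_imp_continuous_on)
    then show "((\<lambda>e. \<phi> (h e)) \<longlongrightarrow> \<phi> 0) (at_right 0)" by (rule isCont_tendsto_compose[OF _ h0])
    show "((\<lambda>e. ln (1 - exp (- 2 * pi * e)) - ln (2 * pi * e)) \<longlongrightarrow> 0) (at_right 0)"
      using pi_gt_zero by real_asymp
  qed
  moreover have "\<forall>\<^sub>F e in at_right 0. \<phi> (h e) - of_real (ln (1 - exp (- 2 * pi * e)) - ln (2 * pi * e)) = k"
  proof (rule eventually_at_rightI[of 0 1])
    fix e :: real assume e: "e \<in> {0<..<1}"
    then have "exp (- 2 * pi * e) < 1" by simp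
    then have "Ln (1 - unit_exp (h e)) = of_real (ln (1 - exp (- 2 * pi * e)))"
      unfolding uh by (simp flip: Ln_of_real)
    then show "\<phi> (h e) - of_real (ln (1 - exp (- 2 * pi * e)) - ln (2 * pi * e)) = k"
      using k[of "h e"] hH[of e] Lh[of e] e unfolding lam_def by simp
  qed simp
  ultimately have "((\<lambda>e::real. k) \<longlongrightarrow> 0) (at_right 0)" using f(2) by (auto intro: Lim_transform_eventually)
  then have "k = 0" by (simp add: tendsto_const_iff)
  then have phi_lam: "\<phi> t = lam t" if "t \<in> H" for t using k[OF that] by simp
  \<comment> \<open>An explicit primitive of \<open>lam\<close>: the dilogarithm for the first
    logarithm, and \<open>t * L t - t\<close> for the second since \<open>L\<close> has derivative
    \<open>1 / t\<close>.\<close>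
  define F2 where "F2 = (\<lambda>t. - Li2 (unit_exp t) / (2 * of_real pi * \<i>) - t * L t + t)"
  have dF2: "(F2 has_field_derivative \<phi> t) (at t)" if t: "t \<in> H" for t
  proof -
    have t0: "t \<noteq> 0" using t by (auto simp: H_def)
    have im: "Im t > 0" using t by (simp add: H_def)
    have "(F2 has_field_derivative (- (- 2 * of_real pi * \<i> * Ln (1 - unit_exp t)) / (2 * of_real pi * \<i>) - (1 * L t + 1 / t * t) + 1)) (at t)"
      unfolding F2_def
      by (intro DERIV_add DERIV_diff DERIV_cdivide DERIV_minus DERIV_mult Li2_unit_exp_has_field_derivative dL im t DERIV_ident)
    then show ?thesis using t0 by (simp add: phi_lam[OF t] lam_def)
  qed
  have "\<exists>k. \<forall>t\<in>H. F t - F2 t = k"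
  proof (rule has_field_derivative_zero_constant[OF H(2)])
    fix t assume t: "t \<in> H"
    from DERIV_diff[OF f(5) dF2[OF this]] t H(3)
    show "((\<lambda>t. F t - F2 t) has_field_derivative 0) (at t within H)" by (auto simp: has_field_derivative_at_within)
  qed
  then obtain k2 where k2: "\<And>t. t \<in> H \<Longrightarrow> F t - F2 t = k2" by blast
  have "((\<lambda>e. F (h e) + Li2 (unit_exp (h e)) / (2 * of_real pi * \<i>) + \<i> * of_real (e * ln (2 * pi * e)) - h e)
     \<longlongrightarrow> F 0 + of_real (pi\<^sup>2 / 6) / (2 * of_real pi * \<i>) + \<i> * of_real 0 - 0) (at_right 0)"
  proof (intro tendsto_intros h0)
    have "isCont F 0" using f(5)[OF zero_in_strip_dom] by (rule DERIV_isCont)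
    then show "((\<lambda>e. F (h e)) \<longlongrightarrow> F 0) (at_right 0)" by (rule isCont_tendsto_compose[OF _ h0])
    show "((\<lambda>e. e * ln (2 * pi * e)) \<longlongrightarrow> 0) (at_right 0)" using pi_gt_zero by real_asymp
    show "((\<lambda>e. Li2 (unit_exp (h e))) \<longlongrightarrow> of_real (pi\<^sup>2 / 6)) (at_right 0)"
    proof (rule Li2_real_tendsto)
      have "isCont unit_exp 0" using unit_exp_has_field_derivative by (rule DERIV_isCont)
      then have "((\<lambda>e. unit_exp (h e)) \<longlongrightarrow> unit_exp 0) (at_right 0)" by (rule isCont_tendsto_compose[OF _ h0])
      then show "((\<lambda>e. unit_exp (h e)) \<longlongrightarrow> 1) (at_right 0)" by (simp add: unit_exp_def)
      show "\<forall>\<^sub>F e in at_right 0. cmod (unit_exp (h e)) < 1"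
        by (rule eventually_at_rightI[of 0 1]) (auto simp: h_def intro!: norm_unit_exp_less_1)
    qed
  qed auto
  moreover have "\<forall>\<^sub>F e in at_right 0. F (h e) + Li2 (unit_exp (h e)) / (2 * of_real pi * \<i>) + \<i> * of_real (e * ln (2 * pi * e)) - h e = k2"
  proof (rule eventually_at_rightI[of 0 1])
    fix e :: real assume e: "e \<in> {0<..<1}"
    then show "F (h e) + Li2 (unit_exp (h e)) / (2 * of_real pi * \<i>) + \<i> * of_real (e * ln (2 * pi * e)) - h e = k2"
      using k2[OF hH[of e]] Lh[of e] unfolding F2_def by (simp add: h_def algebra_simps)
  qed simp
  ultimately have "((\<lambda>e::real. k2) \<longlongrightarrow> of_real (pi\<^sup>2 / 6) / (2 * of_real pi * \<i>)) (at_right 0)"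
    using f(4) by (auto intro: Lim_transform_eventually)
  then have k2': "k2 = of_real (pi\<^sup>2 / 6) / (2 * of_real pi * \<i>)" by (simp add: tendsto_const_iff)
  have "F t = t * (1 - phase t - Ln (- 2 * of_real pi * \<i> * t))" if t: "Im t > 0" for t
  proof -
    have t0: "t \<noteq> 0" using t by auto
    define c where "c = 2 * of_real pi * \<i>"
    define Y where "Y = complex_of_real (pi\<^sup>2 / 6)"
    have tpp: "t * phase t = (Li2 (unit_exp t) - Y) / c" using t0 by (simp add: phase_def c_def Y_def)
    have "F t = F2 t + k2" using k2[of t] t by (simp add: H_def algebra_simps)
    then have "F t = - Li2 (unit_exp t) / c - t * L t + t + Y / c"
      unfolding F2_def k2' c_def[symmetric] Y_def[symmetric] .
    also have "\<dots> = t - (Li2 (unit_exp t) - Y) / c - t * L t" by (simp add: diff_divide_distrib)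
    also have "\<dots> = t * (1 - phase t - L t)" unfolding tpp[symmetric] by (simp add: algebra_simps)
    finally show ?thesis by (simp only: L_def)
  qed
  then show ?thesis using that f by blast
qed

section \<open>Stirling's formula from a product of sines\<close>

definition sinc_half :: "complex \<Rightarrow> complex" where
  "sinc_half t = (if t = 0 then 1 else sin (of_real pi * t / 2) / (of_real pi * t / 2))"

lemma sinc_half_holomorphic: "sinc_half holomorphic_on UNIV"
proof (rule pole_theorem_open_0[where g = "\<lambda>t. sin (of_real pi * t / 2) / (of_real pi / 2)" and a = 0])
  have "((\<lambda>t. sin (of_real pi * t / 2) / (of_real pi / 2)) has_field_derivative 1) (at (0::complex))"
    by (auto intro!: derivative_eq_intros)
  then show "sinc_half 0 = deriv (\<lambda>t. sin (of_real pi * t / 2) / (of_real pi / 2)) 0"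
    by (simp add: sinc_half_def DERIV_imp_deriv)
qed (auto intro!: holomorphic_intros simp: sinc_half_def field_simps)

lemma sinc_half_nonzero: "\<bar>Re t\<bar> < 2 \<Longrightarrow> sinc_half t \<noteq> 0"
proof
  assume t: "\<bar>Re t\<bar> < 2" and z: "sinc_half t = 0"
  then have t0: "t \<noteq> 0" by (auto simp: sinc_half_def)
  then have "sin (of_real pi * t / 2) = 0" using z by (simp add: sinc_half_def)
  then obtain n :: int where n: "of_real pi * t / 2 = of_real (of_int n * pi)"
    by (auto simp: Complex_Transcendental.sin_eq_0)
  then have "t = of_int (2 * n)" by (simp add: field_simps)
  then have "\<bar>of_int (2 * n) :: real\<bar> < 2" using t by simp
  then have "n = 0" by linarith
  with n t0 show False by simp
qed

text \<open>The case \<open>c = 1\<close> of \<open>prod_norm_one_minus_cis\<close>, because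
  \<open>cmod (1 - cis (2 * t)) = 2 * sin t\<close> for \<open>t\<close> between \<open>0\<close>
  and \<open>pi\<close>.\<close>

lemma prod_sin: "(\<Prod>j=1..N. 2 * sin (pi * real j * inv_nu N / 2)) = sqrt (2 * nu N)"
proof -
  have "(\<Prod>j=1..N. cmod (1 - cis (2 * pi * real 1 * real j / (2 * real N + 1)))) = sqrt (2 * real N + 1)"
    by (rule prod_norm_one_minus_cis) simp
  moreover have "cmod (1 - cis (2 * pi * real 1 * real j / (2 * real N + 1))) = 2 * sin (pi * real j * inv_nu N / 2)"
    if j: "j \<in> {1..N}" for j
  proof -
    define t where "t = pi * real j * inv_nu N / 2"
    have "2 * pi * real 1 * real j / (2 * real N + 1) = 2 * t" unfolding t_def inv_nu_def nu_def by (simp add: divide_simps)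
    moreover have "(cmod (1 - cis (2 * t)))\<^sup>2 = (2 * sin t)\<^sup>2"
    proof -
      have "(cmod (1 - cis (2 * t)))\<^sup>2 = 2 - 2 * cos (2 * t)"
        unfolding cmod_power2 using sin_cos_squared_add[of "2 * t"] by (simp add: power2_eq_square algebra_simps)
      also have "\<dots> = (2 * sin t)\<^sup>2" by (simp add: cos_double_sin power_mult_distrib)
      finally show ?thesis .
    qed
    moreover have "sin t \<ge> 0"
    proof (rule sin_ge_zero)
      show "0 \<le> t" unfolding t_def using inv_nu.y_pos[of N] by simp
      have "real j * inv_nu N \<le> nu N * inv_nu N" using j inv_nu.y_pos[of N] by (intro mult_right_mono) (auto simp: nu_def)
      then have "real j * inv_nu N \<le> 1" by simp
      then have "pi * (real j * inv_nu N) \<le> pi * 1" by (intro mult_left_mono) auto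
      then show "t \<le> pi" unfolding t_def by (simp add: mult.assoc)
    qed
    ultimately show ?thesis unfolding t_def[symmetric] by (metis abs_of_nonneg mult_nonneg_nonneg norm_ge_zero power2_eq_iff_nonneg zero_le_numeral)
  qed
  ultimately show ?thesis by (simp add: nu_def)
qed

text \<open>
  The error of Stirling's formula is needed as an expansion in powers of \<open>1 / nu N\<close>. It follows from the Euler-Maclaurin
  formula for \<open>ln (sinc_half)\<close>, since \<open>prod_sin\<close> gives the product of the sines in closed form.
\<close>
lemma stirling:
  obtains R where "\<And>S M. has_asymp inv_nu S M (\<lambda>N _. R N)"
    "\<And>N. of_real (fact N * inv_nu N ^ N * exp (real N)) = of_real (sqrt (2 * nu N) * sqrt (pi / exp 1)) * exp (- (of_real (inv_nu N) * R N))"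
proof -
  define U where "U = {t::complex. \<bar>Re t\<bar> < 2}"
  have U: "open U" unfolding U_def by (intro open_Collect_less continuous_intros)
  have "U = {t. Re t < 2} \<inter> {t. Re t > - 2}" by (auto simp: U_def)
  then have "convex U" by (simp add: convex_Int convex_halfspace_Re_lt convex_halfspace_Re_gt)
  moreover have U0: "0 \<in> U" by (simp add: U_def)
  ultimately have "starlike U" by (intro convex_imp_starlike) auto
  then obtain \<phi> F where f: "\<phi> holomorphic_on U" "\<phi> 0 = 0" "\<And>t. t \<in> U \<Longrightarrow> exp (\<phi> t) = sinc_half t" "F 0 = 0"
    "\<And>t. t \<in> U \<Longrightarrow> (F has_field_derivative \<phi> t) (at t)"
    using log_primitive[OF U _ U0 holomorphic_on_subset[OF sinc_half_holomorphic subset_UNIV]] sinc_half_nonzero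
    by (auto simp: sinc_half_def U_def)
  interpret em: em_region U "{1}" "closed_segment 0 1"
  proof
    show "closed_segment 0 1 \<subseteq> U" using \<open>convex U\<close> U0 by (intro closed_segment_subset) (auto simp: U_def)
    show "complex_of_real t * z \<in> closed_segment 0 1" if "z \<in> {1}" "0 \<le> t" "t \<le> 1" for z t
      using that by (auto simp: closed_segment_def scaleR_conv_of_real)
  qed (use U in auto)
  obtain R1 where R1: "\<And>M. has_asymp inv_nu {1} M R1" "\<And>N. (\<Sum>j=1..N. \<phi> (of_real (real j * inv_nu N) * 1)) =
     integral {0..nu N} (\<lambda>s. \<phi> (of_real (s * inv_nu N) * 1)) - \<phi> 0 / 2 + of_real (inv_nu N) * R1 N 1"
    using em.euler_maclaurin_has_asymp[OF f(1)] by auto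
  define R where "R = (\<lambda>N. R1 N 1)"
  define c where "c = F 1"
  have FU: "F holomorphic_on U" using f(5) U by (auto simp: holomorphic_on_open)
  have "1 * integral {0..nu N} (\<lambda>s. \<phi> (of_real (s * inv_nu N) * 1)) = of_real (nu N) * (F 1 - F 0)" for N
    by (rule em.ray_integral[OF FU]) (use f(5) in \<open>auto intro: DERIV_imp_deriv\<close>)
  then have sum: "(\<Sum>j=1..N. \<phi> (of_real (real j * inv_nu N))) = of_real (nu N) * c + of_real (inv_nu N) * R N" for N
    using R1(2)[of N] f(2,4) by (simp add: c_def R_def)
  define a where "a = (\<lambda>N. fact N * inv_nu N ^ N)"
  have apos: "a N > 0" for N unfolding a_def using inv_nu.y_pos[of N] by simp
  have main: "of_real (sqrt (2 * nu N)) = of_real (a N * pi ^ N) * exp (of_real (nu N) * c + of_real (inv_nu N) * R N)" for N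
  proof -
    have "exp (\<phi> (of_real (real j * inv_nu N))) * of_real (pi * real j * inv_nu N) = of_real (2 * sin (pi * real j * inv_nu N / 2))" if j: "j \<in> {1..N}" for j
    proof -
      have "real j * inv_nu N \<le> nu N * inv_nu N" using j inv_nu.y_pos[of N] by (intro mult_right_mono) (auto simp: nu_def)
      then have jy: "real j * inv_nu N \<le> 1" "real j * inv_nu N > 0" using j inv_nu.y_pos[of N] by simp_all
      then have "complex_of_real (real j * inv_nu N) \<in> U" by (simp add: U_def)
      then have "exp (\<phi> (of_real (real j * inv_nu N))) = sinc_half (of_real (real j * inv_nu N))" by (rule f(3))
      also have "\<dots> = of_real (sin (pi * (real j * inv_nu N) / 2) / (pi * (real j * inv_nu N) / 2))"
      proof -
        have "complex_of_real (real j * inv_nu N) \<noteq> 0" using jy by (simp only: of_real_eq_0_iff)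
        then show ?thesis unfolding sinc_half_def by (simp flip: sin_of_real)
      qed
      finally have "exp (\<phi> (of_real (real j * inv_nu N))) * of_real (pi * real j * inv_nu N) =
          of_real (sin (pi * (real j * inv_nu N) / 2) / (pi * (real j * inv_nu N) / 2) * (pi * real j * inv_nu N))"
        by (simp only: of_real_mult[symmetric])
      also have "sin (pi * (real j * inv_nu N) / 2) / (pi * (real j * inv_nu N) / 2) * (pi * real j * inv_nu N) = 2 * sin (pi * real j * inv_nu N / 2)"
        using j inv_nu.y_pos[of N] by (simp add: field_simps)
      finally show ?thesis .
    qed
    then have "(\<Prod>j=1..N. exp (\<phi> (of_real (real j * inv_nu N))) * of_real (pi * real j * inv_nu N)) = (\<Prod>j=1..N. of_real (2 * sin (pi * real j * inv_nu N / 2)))"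
      by (rule prod.cong[OF refl])
    also have "\<dots> = complex_of_real (sqrt (2 * nu N))" by (simp only: of_real_prod[symmetric] prod_sin)
    finally have 1: "(\<Prod>j=1..N. exp (\<phi> (of_real (real j * inv_nu N))) * of_real (pi * real j * inv_nu N)) = of_real (sqrt (2 * nu N))" .
    have 2: "(\<Prod>j=1..N. pi * real j * inv_nu N) = a N * pi ^ N"
      by (simp add: prod.distrib fact_prod a_def)
    have "(\<Prod>j=1..N. exp (\<phi> (of_real (real j * inv_nu N))) * of_real (pi * real j * inv_nu N)) = exp (\<Sum>j=1..N. \<phi> (of_real (real j * inv_nu N))) * of_real (a N * pi ^ N)"
      unfolding 2[symmetric] of_real_prod exp_sum[OF finite_atLeastAtMost] by (rule prod.distrib)
    then show ?thesis using 1 unfolding sum by (simp add: mult.commute)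
  qed
  have yR: "(\<lambda>N. of_real (inv_nu N) * R N) \<longlonglongrightarrow> 0"
  proof -
    from R1(1)[of 0] obtain C where C: "\<forall>\<^sub>F N in sequentially. cmod (R N) \<le> C" by (auto simp: R_def)
    have "(\<lambda>N. C * inv_nu N) \<longlonglongrightarrow> 0" using tendsto_mult_right_zero[OF inv_nu.y_tendsto] by simp
    moreover have "\<forall>\<^sub>F N in sequentially. norm (of_real (inv_nu N) * R N) \<le> C * inv_nu N"
      using C
    proof eventually_elim
      case (elim N)
      then show ?case using inv_nu.y_pos[of N] by (simp add: norm_mult mult.commute mult_left_mono)
    qed
    ultimately show ?thesis by (rule Lim_null_comparison[rotated])
  qed
  define q where "q = exp (- c)"
  \<comment> \<open>The integral of the logarithm of the sine need not be evaluated. The ratio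
    \<open>a (Suc N) / a N\<close> tends to \<open>q / pi\<close> by the expansion and to
    \<open>exp (-1)\<close> by the definition of \<open>a\<close>.\<close>
  have q: "q = of_real (pi / exp 1)"
  proof -
    have an: "of_real (a N) = of_real (sqrt (2 * nu N) / pi ^ N) * exp (- (of_real (nu N) * c)) * exp (- (of_real (inv_nu N) * R N))" for N
      using main[of N] pi_gt_zero by (simp add: exp_add exp_minus field_simps)
    have ratio: "of_real (a (Suc N) / a N) = of_real (sqrt (nu (Suc N) / nu N) / pi) * q * exp (of_real (inv_nu N) * R N - of_real (inv_nu (Suc N)) * R (Suc N))" for N
    proof -
      have nn: "complex_of_real (nu (Suc N)) = of_real (nu N) + 1" by (simp add: nu_def)
      have n0: "nu N > 0" by (rule nu_pos)
      have "complex_of_real (a (Suc N) / a N) = of_real (a (Suc N)) / of_real (a N)" by simp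
      also have "\<dots> = (of_real (sqrt (2 * nu (Suc N)) / pi ^ Suc N) / of_real (sqrt (2 * nu N) / pi ^ N)) *
          (exp (- (of_real (nu (Suc N)) * c)) / exp (- (of_real (nu N) * c))) * (exp (- (of_real (inv_nu (Suc N)) * R (Suc N))) / exp (- (of_real (inv_nu N) * R N)))"
        unfolding an by simp
      also have "exp (- (of_real (nu (Suc N)) * c)) / exp (- (of_real (nu N) * c)) = q"
        unfolding nn q_def by (simp flip: exp_diff add: algebra_simps)
      also have "exp (- (of_real (inv_nu (Suc N)) * R (Suc N))) / exp (- (of_real (inv_nu N) * R N)) = exp (of_real (inv_nu N) * R N - of_real (inv_nu (Suc N)) * R (Suc N))"
        by (simp flip: exp_diff add: algebra_simps)
      also have "of_real (sqrt (2 * nu (Suc N)) / pi ^ Suc N) / of_real (sqrt (2 * nu N) / pi ^ N) = complex_of_real (sqrt (nu (Suc N) / nu N) / pi)"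
        using n0 pi_gt_zero by (simp flip: of_real_divide add: real_sqrt_divide real_sqrt_mult)
      finally show ?thesis .
    qed
    have "(\<lambda>N. of_real (sqrt (nu (Suc N) / nu N) / pi) * q * exp (of_real (inv_nu N) * R N - of_real (inv_nu (Suc N)) * R (Suc N))) \<longlonglongrightarrow> of_real (1 / pi) * q * exp (0 - 0)"
    proof -
      have "(\<lambda>N. sqrt (nu (Suc N) / nu N)) \<longlonglongrightarrow> 1" unfolding nu_def by real_asymp
      then have "(\<lambda>N. sqrt (nu (Suc N) / nu N) / pi) \<longlonglongrightarrow> 1 / pi"
        by (rule tendsto_divide[OF _ tendsto_const]) simp
      then have "(\<lambda>N. complex_of_real (sqrt (nu (Suc N) / nu N) / pi)) \<longlonglongrightarrow> of_real (1 / pi)"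
        by (rule tendsto_of_real)
      from tendsto_mult[OF tendsto_mult[OF this tendsto_const] tendsto_exp[OF tendsto_diff[OF yR LIMSEQ_Suc[OF yR]]]]
      show ?thesis .
    qed
    then have l1: "(\<lambda>N. of_real (a (Suc N) / a N)) \<longlonglongrightarrow> of_real (1 / pi) * q" unfolding ratio by simp
    have "a (Suc N) / a N = (real N + 1) / (real N + 3/2) * ((real N + 1/2) / (real N + 3/2)) ^ N" for N
    proof -
      have y: "inv_nu (Suc N) = 1 / (real N + 3/2)" "inv_nu N = 1 / (real N + 1/2)"
        by (simp_all add: inv_nu_def nu_def)
      have "a (Suc N) / a N = (real N + 1) * inv_nu (Suc N) * (inv_nu (Suc N) / inv_nu N) ^ N"
        using inv_nu.y_pos[of N] by (simp add: a_def power_divide field_simps)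
      moreover have "inv_nu (Suc N) / inv_nu N = (real N + 1/2) / (real N + 3/2)" unfolding y by simp
      ultimately show ?thesis by (simp add: y(1))
    qed
    moreover have "(\<lambda>N. (real N + 1) / (real N + 3/2) * ((real N + 1/2) / (real N + 3/2)) ^ N) \<longlonglongrightarrow> exp (-1)" by real_asymp
    ultimately have "(\<lambda>N. a (Suc N) / a N) \<longlonglongrightarrow> exp (-1)" by simp
    then have "(\<lambda>N. complex_of_real (a (Suc N) / a N)) \<longlonglongrightarrow> of_real (exp (-1))" by (rule tendsto_of_real)
    from LIMSEQ_unique[OF l1 this] have "q = of_real pi * of_real (exp (-1))" using pi_gt_zero by (simp add: field_simps)
    then show ?thesis by (simp add: exp_minus field_simps)
  qed
  define g where "g = exp (- c / 2)"
  have gN: "exp (- (of_real (nu N) * c)) = q ^ N * g" for N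
    unfolding q_def g_def by (simp flip: exp_of_nat_mult exp_add add: nu_def algebra_simps)
  have aN: "of_real (a N * exp (real N)) = of_real (sqrt (2 * nu N)) * g * exp (- (of_real (inv_nu N) * R N))" for N
  proof -
    have "complex_of_real (a N * pi ^ N) = of_real (sqrt (2 * nu N)) * exp (- (of_real (nu N) * c)) * exp (- (of_real (inv_nu N) * R N))"
      using main[of N] by (simp add: exp_add exp_minus field_simps)
    also have "\<dots> = of_real (sqrt (2 * nu N)) * (of_real (pi ^ N / exp (real N)) * g) * exp (- (of_real (inv_nu N) * R N))"
    proof -
      have "exp (real N) = exp 1 ^ N" by (simp flip: exp_of_nat_mult)
      then show ?thesis unfolding gN q by (simp add: power_divide)
    qed
    finally have "complex_of_real (a N) * of_real (pi ^ N) = of_real (sqrt (2 * nu N)) * g * exp (- (of_real (inv_nu N) * R N)) * of_real (pi ^ N) / of_real (exp (real N))" by simp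
    then have "complex_of_real (a N) = of_real (sqrt (2 * nu N)) * g * exp (- (of_real (inv_nu N) * R N)) / of_real (exp (real N))"
      using pi_gt_zero by (simp add: field_simps)
    then show ?thesis by simp
  qed
  \<comment> \<open>\<open>g\<close> is a square root of \<open>q\<close>; its sign is settled
    because it is also a limit of positive reals.\<close>
  have gpos: "g = of_real (sqrt (pi / exp 1))"
  proof -
    have "(\<lambda>N. of_real (a N * exp (real N) / sqrt (2 * nu N)) * exp (of_real (inv_nu N) * R N)) = (\<lambda>_. g)"
    proof
      fix N
      have "sqrt (2 * nu N) \<noteq> 0" using nu_pos[of N] by simp
      then show "of_real (a N * exp (real N) / sqrt (2 * nu N)) * exp (of_real (inv_nu N) * R N) = g"
        unfolding of_real_divide aN by (simp add: exp_minus field_simps)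
    qed
    then have "(\<lambda>N. of_real (a N * exp (real N) / sqrt (2 * nu N)) * exp (of_real (inv_nu N) * R N) * exp (- (of_real (inv_nu N) * R N))) \<longlonglongrightarrow> g * exp (- 0)"
      by (intro tendsto_intros yR) simp
    then have lim: "(\<lambda>N. complex_of_real (a N * exp (real N) / sqrt (2 * nu N))) \<longlonglongrightarrow> g"
      by (simp add: mult.assoc flip: exp_add)
    from tendsto_Im[OF lim] have "Im g = 0" by (simp add: LIMSEQ_const_iff)
    moreover have "Re g \<ge> 0"
    proof (rule tendsto_lowerbound[OF tendsto_Re[OF lim]])
      show "\<forall>\<^sub>F N in sequentially. 0 \<le> Re (complex_of_real (a N * exp (real N) / sqrt (2 * nu N)))"
        using apos nu_pos by (intro always_eventually allI) (simp add: less_imp_le)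
    qed simp
    moreover have "g\<^sup>2 = of_real (pi / exp 1)" unfolding q[symmetric] q_def g_def by (simp flip: exp_double)
    ultimately have "(Re g)\<^sup>2 = pi / exp 1" and gr: "g = of_real (Re g)"
      by (simp_all add: complex_eq_iff power2_eq_square)
    then have "Re g = sqrt (pi / exp 1)" using \<open>Re g \<ge> 0\<close> by (simp add: real_sqrt_unique)
    then show ?thesis using gr by simp
  qed
  show ?thesis
  proof (rule that[of R])
    show "has_asymp inv_nu S M (\<lambda>N _. R N)" for S M
      unfolding R_def by (rule inv_nu.has_asymp_at_point[OF R1(1)])
    show "of_real (fact N * inv_nu N ^ N * exp (real N)) = of_real (sqrt (2 * nu N) * sqrt (pi / exp 1)) * exp (- (of_real (inv_nu N) * R N))" for N
      using aN[of N] unfolding gpos a_def by simp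
  qed
qed

text \<open>With \<open>L = Ln (- 2 pi i z)\<close>, the Euler-Maclaurin formula gives the exponent
  \<open>nu N * (1 - phase z - L)\<close>, while the factors \<open>j * y * exp L\<close> contribute
  \<open>N * L\<close> and a factorial. The difference between \<open>nu N\<close> and
  \<open>N\<close> leaves \<open>- L / 2\<close>, the origin of the square root of
  \<open>- 2 pi i z\<close>, and a \<open>1/2\<close> that cancels the constant of Stirling's
  formula.\<close>

lemma Q_asymptotic:
  assumes em: "em_region strip_dom S T" and S: "\<And>z. z \<in> S \<Longrightarrow> Im z > 0"
  shows "\<exists>R. (\<forall>M. has_asymp inv_nu S M R) \<and> (\<forall>N. \<forall>z\<in>S. Q (of_real (inv_nu N) * z) N (of_int \<sigma>) =
     exp (of_real (nu N) * phase z) / of_real (sqrt (2 * pi * nu N)) * exp (Ln (- 2 * of_real pi * \<i> * z) / 2) * exp (of_real (inv_nu N) * R N z))"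
proof -
  interpret em_region strip_dom S T by (rule em)
  obtain \<phi> F where f: "\<phi> holomorphic_on strip_dom" "\<phi> 0 = 0" "\<And>t. t \<in> strip_dom \<Longrightarrow> exp (\<phi> t) = exp_quot t" "F 0 = 0"
    "\<And>t. t \<in> strip_dom \<Longrightarrow> (F has_field_derivative \<phi> t) (at t)"
    "\<And>t. Im t > 0 \<Longrightarrow> F t = t * (1 - phase t - Ln (- 2 * of_real pi * \<i> * t))"
    using log_exp_quot by blast
  obtain R1 where R1: "\<And>M. has_asymp inv_nu S M R1" "\<And>N z. z \<in> S \<Longrightarrow> (\<Sum>j=1..N. \<phi> (of_real (real j * inv_nu N) * z)) =
     integral {0..nu N} (\<lambda>s. \<phi> (of_real (s * inv_nu N) * z)) - \<phi> 0 / 2 + of_real (inv_nu N) * R1 N z"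
    using euler_maclaurin_has_asymp[OF f(1)] by auto
  obtain R2 where R2: "\<And>S M. has_asymp inv_nu S M (\<lambda>N _. R2 N)"
    "\<And>N. of_real (fact N * inv_nu N ^ N * exp (real N)) = of_real (sqrt (2 * nu N) * sqrt (pi / exp 1)) * exp (- (of_real (inv_nu N) * R2 N))"
    using stirling by blast
  define R where "R = (\<lambda>N z. 2 * of_real pi * \<i> * of_int \<sigma> * z + R2 N - R1 N z)"
  have id: "has_asymp inv_nu S M (\<lambda>_ z. z)" for M
    by (intro has_asymp_const id_bounded_S) (auto intro: holomorphic_intros)
  have "has_asymp inv_nu S M R" for M
    unfolding R_def by (intro inv_nu.has_asymp_add inv_nu.has_asymp_diff inv_nu.has_asymp_mult R1 R2 id has_asymp_constant)
  moreover have "Q (of_real (inv_nu N) * z) N (of_int \<sigma>) =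
     exp (of_real (nu N) * phase z) / of_real (sqrt (2 * pi * nu N)) * exp (Ln (- 2 * of_real pi * \<i> * z) / 2) * exp (of_real (inv_nu N) * R N z)"
    if z: "z \<in> S" for N z
  proof -
    have im: "Im z > 0" by (rule S[OF z])
    then have z0: "z \<noteq> 0" by auto
    define y where "y = complex_of_real (inv_nu N)"
    define L where "L = Ln (- 2 * of_real pi * \<i> * z)"
    have eL: "exp L = - 2 * of_real pi * \<i> * z" unfolding L_def using z0 by simp
    have "z * integral {0..nu N} (\<lambda>s. \<phi> (of_real (s * inv_nu N) * z)) = of_real (nu N) * (F z - F 0)"
      by (rule ray_integral[OF _ _ z]) (use f(5) open_strip_dom in \<open>auto simp: holomorphic_on_open intro: DERIV_imp_deriv\<close>)
    then have "z * integral {0..nu N} (\<lambda>s. \<phi> (of_real (s * inv_nu N) * z)) = z * (of_real (nu N) * (1 - phase z - L))"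
      using f(4) f(6)[OF im] by (simp add: L_def)
    then have "integral {0..nu N} (\<lambda>s. \<phi> (of_real (s * inv_nu N) * z)) = of_real (nu N) * (1 - phase z - L)"
      using z0 by simp
    then have sum: "(\<Sum>j=1..N. \<phi> (of_real (real j * inv_nu N) * z)) = of_real (nu N) * (1 - phase z - L) + y * R1 N z"
      using R1(2)[OF z, of N] f(2) by (simp add: y_def)
    have t: "1 - exp (2 * of_real pi * \<i> * of_nat j * (y * z)) = exp (\<phi> (of_real (real j * inv_nu N) * z)) * (of_nat j * y * exp L)" if "j \<in> {1..N}" for j
    proof -
      have "of_real (real j * inv_nu N) * z \<in> strip_dom"
        using z that by (intro ray_mem(2)) (auto simp: nu_def)
      from f(3)[OF this] have "exp (\<phi> (of_real (real j * inv_nu N) * z)) * (- 2 * of_real pi * \<i> * (of_real (real j * inv_nu N) * z)) =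
          1 - exp (2 * of_real pi * \<i> * (of_real (real j * inv_nu N) * z))" by (simp only: exp_quot_mult)
      then show ?thesis unfolding eL by (simp add: y_def mult_ac)
    qed
    have "(\<Prod>j=1..N. 1 - exp (2 * of_real pi * \<i> * of_nat j * (y * z))) = (\<Prod>j=1..N. exp (\<phi> (of_real (real j * inv_nu N) * z)) * (of_nat j * y * exp L))"
      by (rule prod.cong[OF refl t])
    also have "\<dots> = exp (\<Sum>j=1..N. \<phi> (of_real (real j * inv_nu N) * z)) * (fact N * y ^ N * exp L ^ N)"
      unfolding exp_sum[OF finite_atLeastAtMost] by (simp add: prod.distrib fact_prod)
    also have "fact N * y ^ N * exp L ^ N = of_real (fact N * inv_nu N ^ N * exp (real N)) * exp (of_nat N * L - of_nat N)"
    proof -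
      have "complex_of_real (exp (real N)) = exp (of_nat N)" by (simp flip: exp_of_real)
      then show ?thesis by (simp add: y_def exp_diff exp_of_nat_mult)
    qed
    also have "\<dots> = of_real (sqrt (2 * nu N) * sqrt (pi / exp 1)) * exp (- (y * R2 N)) * exp (of_nat N * L - of_nat N)"
      unfolding R2(2) y_def by simp
    also have "sqrt (2 * nu N) * sqrt (pi / exp 1) = sqrt (2 * pi * nu N) * exp (- (1/2))"
    proof -
      have "sqrt (exp 1) = exp (1/2::real)" by (rule real_sqrt_unique) (simp_all flip: exp_double)
      then show ?thesis by (simp add: real_sqrt_mult real_sqrt_divide exp_minus field_simps)
    qed
    also have "exp (\<Sum>j=1..N. \<phi> (of_real (real j * inv_nu N) * z)) * (of_real (sqrt (2 * pi * nu N) * exp (- (1/2))) * exp (- (y * R2 N)) * exp (of_nat N * L - of_nat N))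
      = of_real (sqrt (2 * pi * nu N)) * exp (- (of_real (nu N) * phase z) - L / 2 - y * (R2 N - R1 N z))"
    proof -
      have "complex_of_real (exp (- (1/2))) = exp (- (1/2))" by (simp flip: exp_of_real)
      moreover have "of_real (nu N) = of_nat N + (1/2 :: complex)" by (simp add: nu_def)
      ultimately show ?thesis unfolding sum unfolding of_real_mult
        by (simp add: algebra_simps add_divide_distrib flip: exp_add)
    qed
    finally have P: "(\<Prod>j=1..N. 1 - exp (2 * of_real pi * \<i> * of_nat j * (y * z))) = of_real (sqrt (2 * pi * nu N)) * exp (- (of_real (nu N) * phase z) - L / 2 - y * (R2 N - R1 N z))" .
    have "Q (y * z) N (of_int \<sigma>) = exp (2 * of_real pi * \<i> * of_int \<sigma> * (y * z)) / (of_real (sqrt (2 * pi * nu N)) * exp (- (of_real (nu N) * phase z) - L / 2 - y * (R2 N - R1 N z)))"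
      unfolding Q_def P[symmetric] by (simp add: divide_inverse prod_inversef[symmetric])
    also have "\<dots> = exp (2 * of_real pi * \<i> * of_int \<sigma> * (y * z) + (of_real (nu N) * phase z) + L / 2 + y * (R2 N - R1 N z)) / of_real (sqrt (2 * pi * nu N))"
    proof -
      have "exp A / (s * exp (- B - C - D)) = exp (A + B + C + D) / s" for A B C D s :: complex
        by (simp add: exp_add exp_diff exp_minus field_simps)
      then show ?thesis .
    qed
    also have "\<dots> = exp (of_real (nu N) * phase z) / of_real (sqrt (2 * pi * nu N)) * exp (L / 2) * exp (y * R N z)"
      by (simp add: R_def algebra_simps flip: exp_add)
    finally show ?thesis by (simp add: y_def L_def)
  qed
  ultimately show ?thesis by blast
qed

lemma em_region_strip:
  assumes K: "compact K" "\<And>z. z \<in> K \<Longrightarrow> Im z > 0" and S: "S \<subseteq> K"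
  shows "em_region strip_dom S ((\<lambda>(t, z). complex_of_real t * z) ` ({0..1} \<times> K))"
proof
  show "compact ((\<lambda>(t, z). complex_of_real t * z) ` ({0..1} \<times> K))"
    by (intro compact_continuous_image compact_Times K)
       (auto simp: case_prod_unfold intro!: continuous_intros)
  show "(\<lambda>(t, z). complex_of_real t * z) ` ({0..1} \<times> K) \<subseteq> strip_dom"
    using K(2) by (auto intro!: strip_dom_scale) (auto simp: strip_dom_def)
qed (use S open_strip_dom in auto)

lemma Q_upper_holomorphic:
  "(\<lambda>z. Q (of_real (inv_nu N) * z) N (of_int \<sigma>)) holomorphic_on {z. Im z > 0}"
proof -
  have Q: "(\<lambda>z. Q z N (of_int \<sigma>)) holomorphic_on {z. Im z > 0}"
  proof (rule Q_holomorphic)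
    show "\<not> (\<exists>n::int. of_nat j * z = of_int n)" if "z \<in> {z. Im z > 0}" "1 \<le> j" for z j
    proof
      assume "\<exists>n::int. of_nat j * z = of_int n"
      then obtain n :: int where "of_nat j * z = of_int n" by blast
      from arg_cong[OF this, of Im] have "Im (of_nat j * z) = 0" by simp
      then show False using that by simp
    qed
  qed (rule open_halfspace_Im_gt)
  have "(\<lambda>z. Q z N (of_int \<sigma>)) \<circ> (\<lambda>z. of_real (inv_nu N) * z) holomorphic_on {z. Im z > 0}"
    by (rule holomorphic_on_compose_gen[OF _ Q]) (use inv_nu.y_pos[of N] in \<open>auto intro!: holomorphic_intros\<close>)
  then show ?thesis by (simp add: o_def)
qed

section \<open>The contour integral\<close>

text \<open>
  Negligible compared with the main term, since \<open>exp (N * growth)\<close> equals \<open>(cmod w0) powi (- N)\<close>.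
\<close>
definition exp_small :: "(nat \<Rightarrow> real) \<Rightarrow> bool" where
  "exp_small f \<longleftrightarrow> (\<exists>C e. e > 0 \<and> (\<forall>\<^sub>F N in sequentially. f N \<le> C * exp (nu N * (growth - e))))"

lemma exp_smallI: "e > 0 \<Longrightarrow> \<forall>\<^sub>F N in sequentially. f N \<le> C * exp (nu N * (growth - e)) \<Longrightarrow> exp_small f"
  unfolding exp_small_def by blast

lemma exp_small_mono: "exp_small f \<Longrightarrow> \<forall>\<^sub>F N in sequentially. g N \<le> f N \<Longrightarrow> exp_small g"
  unfolding exp_small_def by (fast elim: eventually_elim2 order_trans)

lemma exp_small_cmult: "exp_small f \<Longrightarrow> c \<ge> 0 \<Longrightarrow> exp_small (\<lambda>N. c * f N)"
proof -
  assume "exp_small f" "c \<ge> 0"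
  then obtain C e where e: "e > 0" "\<forall>\<^sub>F N in sequentially. f N \<le> C * exp (nu N * (growth - e))"
    unfolding exp_small_def by blast
  from e(2) have "\<forall>\<^sub>F N in sequentially. c * f N \<le> (c * C) * exp (nu N * (growth - e))"
    by eventually_elim (use \<open>c \<ge> 0\<close> in \<open>simp add: mult.assoc mult_left_mono\<close>)
  then show ?thesis by (rule exp_smallI[OF e(1)])
qed

lemma exp_small_add: "exp_small f \<Longrightarrow> exp_small g \<Longrightarrow> exp_small (\<lambda>N. f N + g N)"
proof -
  assume "exp_small f" "exp_small g"
  then obtain C1 e1 C2 e2 where e1: "e1 > 0" "\<forall>\<^sub>F N in sequentially. f N \<le> C1 * exp (nu N * (growth - e1))"
    and e2: "e2 > 0" "\<forall>\<^sub>F N in sequentially. g N \<le> C2 * exp (nu N * (growth - e2))"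
    unfolding exp_small_def by blast
  have le: "C * exp (nu N * (growth - e)) \<le> \<bar>C\<bar> * exp (nu N * (growth - e'))" if "e' \<le> e" for C N e e'
    using that nu_pos[of N] by (intro mult_mono) (auto intro!: mult_left_mono)
  have "\<forall>\<^sub>F N in sequentially. f N + g N \<le> (\<bar>C1\<bar> + \<bar>C2\<bar>) * exp (nu N * (growth - min e1 e2))"
    using e1(2) e2(2)
  proof eventually_elim
    case (elim N)
    show ?case using elim le[of "min e1 e2" e1 C1 N] le[of "min e1 e2" e2 C2 N]
      by (simp add: distrib_right)
  qed
  then show ?thesis using e1 e2 by (intro exp_smallI[of "min e1 e2"]) auto
qed

text \<open>By compactness the maximum of \<open>Re (phase z)\<close> is attained and stays below
  \<open>growth\<close>; the gap is \<open>e\<close>. All other factors of the expansion are bounded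
  on \<open>K\<close>.\<close>

lemma Q_bound_compact:
  assumes K: "compact K" "\<And>z. z \<in> K \<Longrightarrow> Im z > 0" "\<And>z. z \<in> K \<Longrightarrow> Re (phase z) < growth"
  shows "\<exists>C e. e > 0 \<and> (\<forall>\<^sub>F N in sequentially. \<forall>z\<in>K. cmod (Q (of_real (inv_nu N) * z) N (of_int \<sigma>)) \<le> C * exp (nu N * (growth - e)))"
proof (cases "K = {}")
  case True
  then show ?thesis by (auto intro!: exI[of _ 1])
next
  case False
  have cpp: "continuous_on K (\<lambda>z. Re (phase z))"
  proof (intro continuous_intros continuous_at_imp_continuous_on ballI)
    fix z assume "z \<in> K"
    from phase_has_field_derivative[OF K(2)[OF this]] show "isCont phase z" by (rule DERIV_isCont)
  qed
  obtain zm where zm: "zm \<in> K" "\<And>z. z \<in> K \<Longrightarrow> Re (phase z) \<le> Re (phase zm)"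
    using continuous_attains_sup[OF K(1) False cpp] by blast
  define e where "e = growth - Re (phase zm)"
  have e: "e > 0" using K(3)[OF zm(1)] by (simp add: e_def)
  have cL: "continuous_on K (\<lambda>z. exp (Ln (- 2 * of_real pi * \<i> * z) / 2))"
  proof (intro continuous_intros)
    fix z assume "z \<in> K"
    then have "pi * Im z > 0" using K(2) by simp
    then have "Re (- 2 * of_real pi * \<i> * z) > 0" by simp
    then show "- 2 * of_real pi * \<i> * z \<notin> \<real>\<^sub>\<le>\<^sub>0" unfolding complex_nonpos_Reals_iff by linarith
  qed simp
  obtain D where D: "\<And>z. z \<in> K \<Longrightarrow> cmod (exp (Ln (- 2 * of_real pi * \<i> * z) / 2)) \<le> D"
    using compact_imp_bounded[OF compact_continuous_image[OF cL K(1)]] by (auto simp: bounded_iff)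
  obtain R where R: "\<And>M. has_asymp inv_nu K M R" "\<And>N z. z \<in> K \<Longrightarrow> Q (of_real (inv_nu N) * z) N (of_int \<sigma>) =
     exp (of_real (nu N) * phase z) / of_real (sqrt (2 * pi * nu N)) * exp (Ln (- 2 * of_real pi * \<i> * z) / 2) * exp (of_real (inv_nu N) * R N z)"
    using Q_asymptotic[OF em_region_strip[OF K(1,2) subset_refl] K(2)] by blast
  have "has_asymp inv_nu K 0 (\<lambda>N z. exp (of_real (inv_nu N) * R N z))"
    by (rule inv_nu.has_asymp_Suc_imp[OF inv_nu.has_asymp_entire[OF _ R(1)]]) (intro holomorphic_intros)
  then obtain G where G: "\<forall>\<^sub>F N in sequentially. \<forall>z\<in>K. cmod (exp (of_real (inv_nu N) * R N z)) \<le> G" by auto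
  have "\<forall>\<^sub>F N in sequentially. \<forall>z\<in>K. cmod (Q (of_real (inv_nu N) * z) N (of_int \<sigma>)) \<le> (D * G) * exp (nu N * (growth - e))"
    using G eventually_ge_at_top[of 1]
  proof eventually_elim
    case (elim N)
    show ?case
    proof
      fix z assume z: "z \<in> K"
      have "2 * pi * nu N \<ge> 1 * 1" using elim(2) pi_gt3 by (intro mult_mono) (auto simp: nu_def)
      then have s: "sqrt (2 * pi * nu N) \<ge> 1" by simp
      have "cmod (exp (of_real (nu N) * phase z) / of_real (sqrt (2 * pi * nu N))) = exp (nu N * Re (phase z)) / sqrt (2 * pi * nu N)"
        using s by (simp add: norm_divide del: of_real_mult)
      also have "\<dots> \<le> exp (nu N * Re (phase z)) / 1" by (rule divide_left_mono) (use s in auto)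
      also have "\<dots> \<le> exp (nu N * (growth - e))"
        using zm(2)[OF z] nu_pos[of N] by (simp add: e_def mult_left_mono)
      finally have 1: "cmod (exp (of_real (nu N) * phase z) / of_real (sqrt (2 * pi * nu N))) \<le> exp (nu N * (growth - e))" .
      have "cmod (Q (of_real (inv_nu N) * z) N (of_int \<sigma>)) \<le> exp (nu N * (growth - e)) * D * G"
        unfolding R(2)[OF z] norm_mult[of _ "exp (of_real (inv_nu N) * R N z)"] norm_mult[of _ "exp (Ln (- 2 * of_real pi * \<i> * z) / 2)"]
      proof (rule mult_mono[OF mult_mono[OF 1 D[OF z]]])
        show "cmod (exp (of_real (inv_nu N) * R N z)) \<le> G" using elim(1) z by blast
        show "0 \<le> exp (nu N * (growth - e)) * D"
          using order_trans[OF norm_ge_zero D[OF z]] by simp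
      qed (rule exp_ge_zero norm_ge_zero)+
      then show "cmod (Q (of_real (inv_nu N) * z) N (of_int \<sigma>)) \<le> (D * G) * exp (nu N * (growth - e))" by (simp add: mult_ac)
    qed
  qed
  then show ?thesis using e by blast
qed

lemma inv_nu_Complex: "of_real (inv_nu N) * Complex x v = Complex (x * inv_nu N) (v * inv_nu N)"
  by (simp add: complex_eq_iff)

lemma inv_nu_alt: "c / (2 * real N + 1) = c / 2 * inv_nu N"
  unfolding inv_nu_def nu_def by (simp add: divide_simps)

text \<open>The expansion is not uniform down to the real axis, so the side is split at the rescaled
  height \<open>v1 = growth / pi\<close>. Below it \<open>norm_Q_vertical\<close> gives at most the
  rate \<open>pi * v1 / 2 = growth / 2\<close>; the part above is compact and covered by
  \<open>Q_bound_compact\<close>.\<close>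

lemma Q_bound_side:
  assumes c: "c = 1 \<or> c = (2::nat)"
  shows "\<exists>C e. e > 0 \<and> (\<forall>\<^sub>F N in sequentially. \<forall>t. -1 \<le> t \<longrightarrow> t \<le> v0 * inv_nu N \<longrightarrow>
     cmod (Q (Complex (real c * inv_nu N) t) N (of_int \<sigma>)) \<le> C * exp (nu N * (growth - e)))"
proof -
  define v1 where "v1 = growth / pi"
  have v1: "v1 > 0" using growth_ge by (simp add: v1_def)
  define K where "K = (\<lambda>v. Complex (real c) v) ` {v1..v0}"
  have cK: "compact K" unfolding K_def
    by (intro compact_continuous_image) (auto simp: Complex_eq intro!: continuous_intros)
  have Kim: "Im z > 0" and KF: "Re (phase z) < growth" if "z \<in> K" for z
    using that v1 c by (auto simp: K_def intro!: Re_phase_sides)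
  obtain C e where Ce: "e > 0" "\<forall>\<^sub>F N in sequentially. \<forall>z\<in>K. cmod (Q (of_real (inv_nu N) * z) N (of_int \<sigma>)) \<le> C * exp (nu N * (growth - e))"
    using Q_bound_compact[OF cK Kim KF] by blast
  define e' where "e' = min e (growth / 2)"
  have F: "growth > 0" using growth_ge by linarith
  define C' where "C' = max \<bar>C\<bar> (exp (2 * pi * \<bar>of_int \<sigma>\<bar>))"
  have "\<forall>\<^sub>F N in sequentially. v0 * inv_nu N \<le> 1"
  proof -
    have "(\<lambda>N. v0 * inv_nu N) \<longlonglongrightarrow> v0 * 0" by (intro tendsto_intros inv_nu.y_tendsto)
    then have "\<forall>\<^sub>F N in sequentially. v0 * inv_nu N < 1" by (intro order_tendstoD) auto
    then show ?thesis by eventually_elim simp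
  qed
  with Ce(2) have "\<forall>\<^sub>F N in sequentially. \<forall>t. -1 \<le> t \<longrightarrow> t \<le> v0 * inv_nu N \<longrightarrow>
     cmod (Q (Complex (real c * inv_nu N) t) N (of_int \<sigma>)) \<le> C' * exp (nu N * (growth - e'))"
  proof eventually_elim
    case (elim N)
    show ?case
    proof (intro allI impI)
      fix t assume t: "-1 \<le> t" "t \<le> v0 * inv_nu N"
      have n: "nu N > 0" by (rule nu_pos)
      show "cmod (Q (Complex (real c * inv_nu N) t) N (of_int \<sigma>)) \<le> C' * exp (nu N * (growth - e'))"
      proof (cases "t * nu N \<le> v1")
        case True
        \<comment> \<open>The numerators over \<open>2 * N + 1\<close> are \<open>2\<close> and
          \<open>4\<close>, both coprime to the odd denominator.\<close>
        have eq: "real (2 * c) / (2 * real N + 1) = real c * inv_nu N" by (simp add: inv_nu_alt)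
        have "coprime (2 * c) (2 * N + 1)" using c by auto
        from norm_Q_vertical[OF this, of t \<sigma>] t elim(2)
        have "cmod (Q (Complex (real c * inv_nu N) t) N (of_int \<sigma>)) \<le> exp (2 * pi * \<bar>of_int \<sigma>\<bar>) * exp (pi * max t 0 * (real N + 1/2)\<^sup>2 / 2)"
          unfolding eq by simp
        also have "\<dots> \<le> C' * exp (nu N * (growth - e'))"
        proof (rule mult_mono)
          have "max t 0 * (nu N)\<^sup>2 \<le> v1 * nu N"
          proof (cases "t \<ge> 0")
            case True
            then show ?thesis using \<open>t * nu N \<le> v1\<close> n by (simp add: power2_eq_square mult_right_mono mult.assoc[symmetric])
          next
            case False
            then show ?thesis using v1 n by simp
          qed
          then have "pi * (max t 0 * (nu N)\<^sup>2) \<le> pi * (v1 * nu N)" by (intro mult_left_mono) auto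
          also have "\<dots> = growth * nu N" by (simp add: v1_def)
          finally have "pi * max t 0 * (nu N)\<^sup>2 / 2 \<le> nu N * (growth - growth / 2)" by (simp add: mult_ac)
          also have "\<dots> \<le> nu N * (growth - e')" using n by (intro mult_left_mono) (auto simp: e'_def)
          finally show "exp (pi * max t 0 * (real N + 1/2)\<^sup>2 / 2) \<le> exp (nu N * (growth - e'))" by (simp add: nu_def)
        qed (auto simp: C'_def)
        finally show ?thesis .
      next
        case False
        have "t * nu N \<le> v0 * inv_nu N * nu N" using t n by (intro mult_right_mono) auto
        then have "t * nu N \<le> v0" by (simp add: mult.assoc)
        then have zK: "Complex (real c) (t * nu N) \<in> K" using False by (auto simp: K_def)
        have "of_real (inv_nu N) * Complex (real c) (t * nu N) = Complex (real c * inv_nu N) t"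
          unfolding inv_nu_Complex by (simp add: mult.assoc)
        then have "cmod (Q (Complex (real c * inv_nu N) t) N (of_int \<sigma>)) \<le> C * exp (nu N * (growth - e))"
          using elim(1) zK by metis
        also have "\<dots> \<le> C' * exp (nu N * (growth - e'))"
          using n by (intro mult_mono) (auto simp: C'_def e'_def)
        finally show ?thesis .
      qed
    qed
  qed
  moreover have "e' > 0" using Ce(1) F by (simp add: e'_def)
  ultimately show ?thesis by blast
qed

lemma contour_linepath_exp_small:
  assumes "\<exists>C e. e > 0 \<and> (\<forall>\<^sub>F N in sequentially. \<forall>z\<in>closed_segment (p N) (q N). cmod (f N z) \<le> C * exp (nu N * (growth - e)))"
    and "\<forall>\<^sub>F N in sequentially. continuous_on (closed_segment (p N) (q N)) (f N)"
    and "\<forall>\<^sub>F N in sequentially. cmod (q N - p N) \<le> L"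
  shows "exp_small (\<lambda>N. cmod (contour_integral (linepath (p N) (q N)) (f N)))"
proof -
  from assms(1) obtain C e where e: "e > 0"
    "\<forall>\<^sub>F N in sequentially. \<forall>z\<in>closed_segment (p N) (q N). cmod (f N z) \<le> C * exp (nu N * (growth - e))" by blast
  have "\<forall>\<^sub>F N in sequentially. cmod (contour_integral (linepath (p N) (q N)) (f N)) \<le> (\<bar>C\<bar> * L) * exp (nu N * (growth - e))"
    using e(2) assms(2,3)
  proof eventually_elim
    case (elim N)
    have "cmod (contour_integral (linepath (p N) (q N)) (f N)) \<le> (\<bar>C\<bar> * exp (nu N * (growth - e))) * cmod (q N - p N)"
    proof (rule contour_integral_bound_linepath)
      show "f N contour_integrable_on linepath (p N) (q N)"
        by (rule contour_integrable_continuous_linepath[OF elim(2)])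
      fix z assume "z \<in> closed_segment (p N) (q N)"
      then have "cmod (f N z) \<le> C * exp (nu N * (growth - e))" using elim(1) by blast
      also have "\<dots> \<le> \<bar>C\<bar> * exp (nu N * (growth - e))" by (intro mult_right_mono) auto
      finally show "cmod (f N z) \<le> \<bar>C\<bar> * exp (nu N * (growth - e))" .
    qed simp
    also have "\<dots> \<le> (\<bar>C\<bar> * exp (nu N * (growth - e))) * L" by (rule mult_left_mono[OF elim(3)]) simp
    finally show ?case by (simp add: mult_ac)
  qed
  then show ?thesis by (rule exp_smallI[OF e(1)])
qed

lemma contour_linepath_horizontal_scaled:
  assumes "d > 0" "y > 0"
    and g: "\<And>x. \<bar>x\<bar> \<le> d \<Longrightarrow> f (of_real y * (c + of_real x)) = g x"
    and cg: "continuous_on {-d..d} g"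
  shows "contour_integral (linepath (of_real y * (c - of_real d)) (of_real y * (c + of_real d))) f = of_real y * integral {-d..d} g"
proof -
  have "(g has_integral integral {-d..d} g) (cbox (-d) d)"
    using integrable_continuous_interval[OF cg] by (simp add: integrable_integral)
  from has_integral_affinity'[OF this, of "2 * d" "-d"] assms(1)
  have i: "((\<lambda>t. g (2 * d * t - d)) has_integral (integral {-d..d} g /\<^sub>R (2 * d))) {0..1}"
    by (simp add: field_simps)
  have "((\<lambda>t. g (2 * d * t - d) * of_real (2 * d * y)) has_integral (integral {-d..d} g /\<^sub>R (2 * d)) * of_real (2 * d * y)) {0..1}"
    by (rule has_integral_mult_left[OF i])
  moreover have "(integral {-d..d} g /\<^sub>R (2 * d)) * of_real (2 * d * y) = of_real y * integral {-d..d} g"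
    using assms(1) by (simp add: scaleR_conv_of_real field_simps)
  ultimately have j: "((\<lambda>t. g (2 * d * t - d) * of_real (2 * d * y)) has_integral of_real y * integral {-d..d} g) {0..1}" by simp
  have "((\<lambda>t. f (linepath (of_real y * (c - of_real d)) (of_real y * (c + of_real d)) t) * (of_real y * (c + of_real d) - of_real y * (c - of_real d)))
      has_integral of_real y * integral {-d..d} g) {0..1}"
  proof (rule has_integral_eq[OF _ j])
    fix t :: real assume t: "t \<in> {0..1}"
    have L: "linepath (of_real y * (c - of_real d)) (of_real y * (c + of_real d)) t = of_real y * (c + of_real (2 * d * t - d))"
      by (simp add: linepath_def scaleR_conv_of_real algebra_simps)
    have "\<bar>2 * d * t - d\<bar> \<le> d"
    proof -
      have "d * t \<le> d * 1" "0 \<le> d * t" using t assms(1) by (auto intro: mult_left_mono)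
      then show ?thesis by (simp add: abs_le_iff)
    qed
    then show "g (2 * d * t - d) * of_real (2 * d * y) = f (linepath (of_real y * (c - of_real d)) (of_real y * (c + of_real d)) t) * (of_real y * (c + of_real d) - of_real y * (c - of_real d))"
      unfolding L by (subst g) (simp_all add: algebra_simps)
  qed
  then show ?thesis
    unfolding has_contour_integral_linepath[symmetric] by (rule contour_integral_unique)
qed

lemma path_image_rectpath_Un:
  "path_image (rectpath a1 a3) = closed_segment a1 (Complex (Re a3) (Im a1)) \<union> closed_segment (Complex (Re a3) (Im a1)) a3 \<union>
     closed_segment a3 (Complex (Re a1) (Im a3)) \<union> closed_segment (Complex (Re a1) (Im a3)) a1"
  by (simp add: rectpath_def Let_def path_image_join Un_assoc path_image_linepath del: linepath_0 linepath_0')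

lemma contour_integral_rectpath:
  assumes "continuous_on (path_image (rectpath a1 a3)) f"
  shows "contour_integral (rectpath a1 a3) f =
    contour_integral (linepath a1 (Complex (Re a3) (Im a1))) f + contour_integral (linepath (Complex (Re a3) (Im a1)) a3) f +
    contour_integral (linepath a3 (Complex (Re a1) (Im a3))) f + contour_integral (linepath (Complex (Re a1) (Im a3)) a1) f"
proof -
  have "f contour_integrable_on linepath a1 (Complex (Re a3) (Im a1))" "f contour_integrable_on linepath (Complex (Re a3) (Im a1)) a3"
    "f contour_integrable_on linepath a3 (Complex (Re a1) (Im a3))" "f contour_integrable_on linepath (Complex (Re a1) (Im a3)) a1"
    by (rule contour_integrable_continuous_linepath; rule continuous_on_subset[OF assms]; simp only: path_image_rectpath_Un; blast)+
  then show ?thesis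
    unfolding rectpath_def Let_def
    by (simp add: contour_integrable_joinI valid_path_join)
qed

text \<open>All square roots are turned into exponentials of half logarithms. The principal
  logarithms of the products split additively because the arguments of \<open>1 - w0\<close> and
  \<open>z0\<close> lie between \<open>0\<close> and \<open>pi / 2\<close> and that of
  \<open>w0\<close> between \<open>- pi / 2\<close> and \<open>0\<close>.\<close>

lemma b0_value:
  "- 2 * exp (- Ln w0 / 2) * (exp (Ln (- 2 * of_real pi * \<i> * z0) / 2) / of_real (sqrt (2 * pi)) * of_real (sqrt pi) / csqrt (- phase2 / 2)) = b0"
proof -
  define u0 where "u0 = 1 - w0"
  have ne: "u0 \<noteq> 0" "w0 \<noteq> 0" "z0 \<noteq> 0" using w0_bounds z0_ne by (auto simp: u0_def)
  have q1: "0 < Im (Ln u0)" "Im (Ln u0) < pi / 2"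
    using w0_bounds ne Im_Ln_pos_lt_imp[of u0] Re_Ln_pos_lt_imp[of u0] by (auto simp: u0_def)
  have q2: "- pi / 2 < Im (Ln w0)" "Im (Ln w0) < 0"
    using w0_bounds ne Re_Ln_pos_lt_imp[of w0] w0_adm_imp(3)[OF w0_adm_w0] by auto
  have q3: "0 < Im (Ln z0)" "Im (Ln z0) < pi / 2"
    using Im_z0 Re_z0 ne Im_Ln_pos_lt_imp[of z0] Re_Ln_pos_lt_imp[of z0] by auto
  have L1: "Ln (- 2 * of_real pi * \<i> * z0) = of_real (ln (2 * pi)) + Ln z0 - \<i> * of_real (pi / 2)"
  proof (rule Ln_unique)
    have "exp (complex_of_real (ln (2 * pi)) + Ln z0 - \<i> * of_real (pi / 2)) = of_real (2 * pi) * z0 / exp (\<i> * of_real (pi / 2))"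
      using ne by (simp add: exp_add exp_diff exp_of_real del: of_real_mult of_real_divide)
    also have "exp (\<i> * of_real (pi / 2)) = \<i>" by (metis cis_conv_exp cis_pi_half)
    finally show "exp (complex_of_real (ln (2 * pi)) + Ln z0 - \<i> * of_real (pi / 2)) = - 2 * of_real pi * \<i> * z0"
      by (simp add: field_simps)
  qed (use q3 in \<open>auto simp: pi_gt_zero\<close>)
  have L2: "Ln (- phase2 / 2) = of_real (ln pi) + Ln u0 - Ln w0 - Ln z0 - \<i> * of_real (pi / 2)"
  proof (rule Ln_unique)
    have "exp (complex_of_real (ln pi) + Ln u0 - Ln w0 - Ln z0 - \<i> * of_real (pi / 2)) = of_real pi * u0 / w0 / z0 / exp (\<i> * of_real (pi / 2))"
      using ne by (simp add: exp_add exp_diff exp_of_real del: of_real_divide)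
    also have "exp (\<i> * of_real (pi / 2)) = \<i>" by (metis cis_conv_exp cis_pi_half)
    also have "of_real pi * u0 / w0 / z0 / \<i> = - phase2 / 2"
      unfolding phase2_def u0_def[symmetric] using ne(2,3) by (simp add: field_simps)
    finally show "exp (complex_of_real (ln pi) + Ln u0 - Ln w0 - Ln z0 - \<i> * of_real (pi / 2)) = - phase2 / 2" .
  qed (use q1 q2 q3 in auto)
  have s: "csqrt (- phase2 / 2) = exp (Ln (- phase2 / 2) / 2)"
    using Re_phase2 by (intro csqrt_exp_Ln) auto
  have sq: "complex_of_real (sqrt x) = exp (of_real (ln x) / 2)" if "x > 0" for x
  proof -
    have "sqrt x = exp (ln x / 2)" using that by (simp add: ln_sqrt[symmetric])
    then show ?thesis by (simp flip: exp_of_real)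
  qed
  \<comment> \<open>The summand \<open>1\<close> in \<open>z0\<close> produces the sign that cancels
    the minus of the factor \<open>- 2\<close>.\<close>
  have z: "exp (- of_real pi * \<i> * z0) = - exp (- Ln u0 / 2)"
  proof -
    have "- of_real pi * \<i> * z0 = - Ln u0 / 2 - \<i> * of_real pi" unfolding u0_def Ln_u0 by (simp add: field_simps)
    then have "exp (- of_real pi * \<i> * z0) = exp (- Ln u0 / 2) / exp (\<i> * of_real pi)" by (simp only: exp_diff)
    then show ?thesis by simp
  qed
  have e: "exp (- Ln w0 / 2) * (exp (Ln (- 2 * of_real pi * \<i> * z0) / 2) / of_real (sqrt (2 * pi)) * of_real (sqrt pi) / csqrt (- phase2 / 2)) = z0 * exp (- Ln u0 / 2)"
  proof -
    have "exp (- Ln w0 / 2) * (exp (Ln (- 2 * of_real pi * \<i> * z0) / 2) / of_real (sqrt (2 * pi)) * of_real (sqrt pi) / csqrt (- phase2 / 2))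
      = exp (- Ln w0 / 2 + (Ln (- 2 * of_real pi * \<i> * z0) / 2 - of_real (ln (2 * pi)) / 2 + of_real (ln pi) / 2 - Ln (- phase2 / 2) / 2))"
      unfolding s sq[OF pi_gt_zero] using sq[of "2 * pi"] by (simp only: exp_add exp_diff mult_pos_pos pi_gt_zero zero_less_numeral)
    also have "- Ln w0 / 2 + (Ln (- 2 * of_real pi * \<i> * z0) / 2 - of_real (ln (2 * pi)) / 2 + of_real (ln pi) / 2 - Ln (- phase2 / 2) / 2) = Ln z0 + (- Ln u0 / 2)"
      unfolding L1 L2 by (simp add: field_simps)
    also have "exp (Ln z0 + (- Ln u0 / 2)) = z0 * exp (- Ln u0 / 2)" unfolding exp_add exp_Ln[OF ne(3)] by (rule refl)
    finally show ?thesis .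
  qed
  show ?thesis unfolding mult.assoc[of "- 2" "exp (- Ln w0 / 2)"] e b0_def z by simp
qed

lemma closed_segment_horizontal:
  "Im p = Im q \<Longrightarrow> Re p \<le> Re q \<Longrightarrow> z \<in> closed_segment p q \<longleftrightarrow> Im z = Im p \<and> Re p \<le> Re z \<and> Re z \<le> Re q"
  by (auto simp: closed_segment_same_Im closed_segment_eq_real_ivl)

lemma closed_segment_vertical:
  "Re p = Re q \<Longrightarrow> Im p \<le> Im q \<Longrightarrow> z \<in> closed_segment p q \<longleftrightarrow> Re z = Re p \<and> Im p \<le> Im z \<and> Im z \<le> Im q"
  by (auto simp: closed_segment_same_Re closed_segment_eq_real_ivl)

text \<open>\<open>B\<close> is chosen so that the part of the top side near the saddle point
  reproduces the main term exactly. The other five pieces of the contour only contribute to an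
  exponentially small error.\<close>

lemma A1_asymptotic:
  "\<exists>B. (\<forall>M S. has_asymp inv_nu S M (\<lambda>N _. B N)) \<and> B \<longlonglongrightarrow> b0 \<and>
    exp_small (\<lambda>N. cmod (A1 N (of_int \<sigma>) - of_real (Re (w0 powi (- int N) / of_nat N ^ 2 * B N))))"
proof -
  define U where "U = {z. Im z > 0}"
  have oU: "open U" unfolding U_def by (rule open_halfspace_Im_gt)
  have z0U: "z0 \<in> U" using Im_z0 by (simp add: U_def)
  have dpp: "(phase has_field_derivative phase' z) (at z)" if "z \<in> U" for z
    using that by (intro phase_has_field_derivative) (simp add: U_def)
  have hpp: "phase holomorphic_on U" using dpp oU by (auto simp: holomorphic_on_open)
  have deriv_phase: "deriv phase z = phase' z" if "z \<in> U" for z using dpp[OF that] by (rule DERIV_imp_deriv)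
  have "(deriv phase has_field_derivative phase2) (at z0)"
    by (rule has_field_derivative_transform_within_open[OF phase'_z0_deriv oU z0U]) (simp add: deriv_phase)
  from laplace_exists[OF oU z0U hpp _ this Re_phase2] obtain r s k c where r: "r > 0" "cball z0 r \<subseteq> U"
    and ds: "deriv s z0 = csqrt (- phase2 / 2)" and lap: "\<And>d. 0 < d \<Longrightarrow> d < r \<Longrightarrow> laplace phase s k z0 (ball z0 r) d c"
    using deriv_phase[OF z0U] phase'_z0 by auto
  \<comment> \<open>The bound \<open>1/100\<close> keeps \<open>Re z0 - d\<close> and
    \<open>Re z0 + d\<close> strictly between \<open>1\<close> and \<open>2\<close>, hence the
    Laplace segment within the top side.\<close>
  define d where "d = min (r / 2) (1 / 100)"
  have dd: "0 < d" "d < r" "d \<le> 1/100" using r by (auto simp: d_def)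
  interpret laplace phase s k z0 "ball z0 r" d c by (rule lap[OF dd(1,2)])
  define fQ where "fQ = (\<lambda>N z. Q z N (of_int \<sigma>))"
  have em: "em_region strip_dom (ball z0 r) ((\<lambda>(t, z). complex_of_real t * z) ` ({0..1} \<times> cball z0 r))"
    by (rule em_region_strip) (use r in \<open>auto simp: U_def\<close>)
  have imb: "Im z > 0" if "z \<in> ball z0 r" for z using subsetD[OF r(2) subsetD[OF ball_subset_cball that]] by (simp add: U_def)
  obtain R where R: "\<And>M. has_asymp inv_nu (ball z0 r) M R" "\<And>N z. z \<in> ball z0 r \<Longrightarrow> Q (of_real (inv_nu N) * z) N (of_int \<sigma>) =
     exp (of_real (nu N) * phase z) / of_real (sqrt (2 * pi * nu N)) * exp (Ln (- 2 * of_real pi * \<i> * z) / 2) * exp (of_real (inv_nu N) * R N z)"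
    using Q_asymptotic[OF em imb] by blast
  define g where "g = (\<lambda>z. exp (Ln (- 2 * of_real pi * \<i> * z) / 2) / of_real (sqrt (2 * pi)))"
  have gU: "g holomorphic_on U" unfolding g_def
  proof (intro holomorphic_intros)
    fix z assume "z \<in> U"
    then have "pi * Im z > 0" by (simp add: U_def)
    then have "Re (- 2 * of_real pi * \<i> * z) > 0" by simp
    then show "- 2 * of_real pi * \<i> * z \<notin> \<real>\<^sub>\<le>\<^sub>0" unfolding complex_nonpos_Reals_iff by linarith
  qed auto
  have g: "g holomorphic_on ball z0 r" "bounded (g ` ball z0 r)"
  proof -
    show "g holomorphic_on ball z0 r" using gU r(2) ball_subset_cball by (meson holomorphic_on_subset)
    have "compact (g ` cball z0 r)"
      by (intro compact_continuous_image holomorphic_on_imp_continuous_on holomorphic_on_subset[OF gU r(2)] compact_cball)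
    then show "bounded (g ` ball z0 r)" by (meson compact_imp_bounded bounded_subset image_mono ball_subset_cball)
  qed
  \<comment> \<open>The amplitude is defined from \<open>Q\<close> itself, not from its expansion:
    this gives continuity for every \<open>N\<close>, whereas nothing is known about the continuity
    of \<open>R N\<close>.\<close>
  define a where "a = (\<lambda>N z. fQ N (of_real (inv_nu N) * z) * exp (- (of_real (nu N) * phase z)) * of_real (sqrt (nu N)))"
  have a_eq: "a N z = g z * exp (of_real (inv_nu N) * R N z)" if "z \<in> ball z0 r" for N z
  proof -
    have "sqrt (2 * pi * nu N) = sqrt (2 * pi) * sqrt (nu N)" by (rule real_sqrt_mult)
    moreover have "sqrt (nu N) \<noteq> 0" using nu_pos[of N] by simp
    ultimately show ?thesis unfolding a_def fQ_def R(2)[OF that] g_def by (simp add: exp_minus field_simps)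
  qed
  have asy_exp: "has_asymp inv_nu (ball z0 r) M (\<lambda>N z. exp (of_real (inv_nu N) * R N z))" for M
    by (rule inv_nu.has_asymp_Suc_imp[OF inv_nu.has_asymp_entire[OF _ R(1)]]) (intro holomorphic_intros)
  have asy_a: "has_asymp inv_nu (ball z0 r) M a" for M
  proof (rule has_asymp_cong)
    show "has_asymp inv_nu (ball z0 r) M (\<lambda>N z. g z * exp (of_real (inv_nu N) * R N z))"
      by (intro inv_nu.has_asymp_mult has_asymp_const g asy_exp)
  qed (use a_eq in auto)
  have hQ: "(\<lambda>z. fQ N (of_real (inv_nu N) * z)) holomorphic_on U" for N
    unfolding fQ_def U_def by (rule Q_upper_holomorphic)
  have cQ: "continuous_on {-d..d} (\<lambda>x. fQ N (of_real (inv_nu N) * (z0 + of_real x)))" for N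
    by (rule cont_shift[OF holomorphic_on_subset[OF hQ]]) (use r(2) ball_subset_cball in blast)
  have ca: "continuous_on {-d..d} (\<lambda>x. a N (z0 + of_real x))" for N
    unfolding a_def by (intro continuous_intros cQ cont_shift hol_p)
  have "has_asymp inv_nu {z0} 0 (\<lambda>N _. R N z0)"
  proof -
    from R(1)[of 0] obtain C where "\<forall>\<^sub>F N in sequentially. \<forall>z\<in>ball z0 r. cmod (R N z) \<le> C" by auto
    then have "\<forall>\<^sub>F N in sequentially. \<forall>z\<in>{z0}. cmod (R N z0) \<le> C" by eventually_elim (use r in auto)
    then show ?thesis unfolding has_asymp.simps by blast
  qed
  then have "(\<lambda>N. g z0 * exp (of_real (inv_nu N) * R N z0)) \<longlonglongrightarrow> g z0 * exp 0"
    by (intro tendsto_intros inv_nu_bounded_tendsto_0)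
  then have "(\<lambda>N. a N z0) \<longlonglongrightarrow> g z0" using a_eq[of z0] r by simp
  from lap_tendsto[OF ca asy_a this] have lim: "(\<lambda>N. lap (a N) N) \<longlonglongrightarrow> g z0 * of_real (sqrt pi) / csqrt (- phase2 / 2)"
    unfolding ds .
  \<comment> \<open>The factor \<open>- 2\<close> combines twice the real part with the leftward
    orientation of the top side. The exponential corrects \<open>nu N\<close> to \<open>N\<close> in
    the power of \<open>w0\<close>, and the squared bracket, equal to \<open>N * inv_nu N\<close>,
    turns the power of \<open>nu N\<close> into one of \<open>N\<close>.\<close>
  define B where "B = (\<lambda>N. - 2 * exp (- Ln w0 / 2) * ((1 - of_real (inv_nu N) * (1/2)) * (1 - of_real (inv_nu N) * (1/2)) * lap (a N) N))"
  have Nyy: "of_nat N * of_real (inv_nu N) = (1 - of_real (inv_nu N) * (1/2) :: complex)" for N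
  proof -
    have "real N * inv_nu N = 1 - inv_nu N * (1/2)" unfolding inv_nu_def nu_def by (simp add: divide_simps)
    from arg_cong[OF this, of complex_of_real] show ?thesis by simp
  qed
  have "has_asymp inv_nu S M (\<lambda>N _. B N)" for S M
    unfolding B_def
    by (intro inv_nu.has_asymp_mult inv_nu.has_asymp_diff inv_nu.has_asymp_y' has_asymp_constant lap_has_asymp ca asy_a)
  moreover have "B \<longlonglongrightarrow> b0"
  proof -
    have y0: "(\<lambda>N. complex_of_real (inv_nu N)) \<longlonglongrightarrow> of_real 0" by (intro tendsto_of_real inv_nu.y_tendsto)
    have "B \<longlonglongrightarrow> - 2 * exp (- Ln w0 / 2) * ((1 - of_real 0 * (1/2)) * (1 - of_real 0 * (1/2)) * (g z0 * of_real (sqrt pi) / csqrt (- phase2 / 2)))"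
      unfolding B_def by (intro tendsto_mult tendsto_diff tendsto_const lim y0)
    then show ?thesis using b0_value by (simp add: g_def)
  qed
  moreover have "exp_small (\<lambda>N. cmod (A1 N (of_int \<sigma>) - of_real (Re (w0 powi (- int N) / of_nat N ^ 2 * B N))))"
  proof -
    \<comment> \<open>The corners run counterclockwise from the lower left one; \<open>P1\<close>
      and \<open>P2\<close> bound the piece of the top side to which Laplace's method is
      applied.\<close>
    define a1 a2 a3 a4 P1 P2 where "a1 = (\<lambda>N. Complex (inv_nu N) (-1))" and "a2 = (\<lambda>N. Complex (2 * inv_nu N) (-1))"
      and "a3 = (\<lambda>N. Complex (2 * inv_nu N) (v0 * inv_nu N))" and "a4 = (\<lambda>N. Complex (inv_nu N) (v0 * inv_nu N))"
      and "P1 = (\<lambda>N. of_real (inv_nu N) * (z0 - of_real d))" and "P2 = (\<lambda>N. of_real (inv_nu N) * (z0 + of_real d))"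
    note pts = a1_def a2_def a3_def a4_def P1_def P2_def
    define ci where "ci = (\<lambda>N p q. contour_integral (linepath p q) (fQ N))"
    have P: "Re (P1 N) = (Re z0 - d) * inv_nu N" "Im (P1 N) = v0 * inv_nu N" "Re (P2 N) = (Re z0 + d) * inv_nu N" "Im (P2 N) = v0 * inv_nu N" for N
      by (simp_all add: P1_def P2_def v0_def)
    have x0: "1 < Re z0 - d" "Re z0 + d < 2" using Re_z0 dd(3) by linarith+
    have ord: "inv_nu N \<le> Re (P1 N)" "Re (P1 N) \<le> Re (P2 N)" "Re (P2 N) \<le> 2 * inv_nu N" for N
      using x0 dd inv_nu.y_pos[of N] mult_right_mono[of 1 "Re z0 - d" "inv_nu N"] mult_right_mono[of "Re z0 + d" 2 "inv_nu N"]
        mult_right_mono[of "Re z0 - d" "Re z0 + d" "inv_nu N"] unfolding P by auto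
    have vy: "0 < v0 * inv_nu N" for N using v0_bounds inv_nu.y_pos[of N] by simp
    have rect: "rectpath (Complex (2 / (2 * real N + 1)) (-1)) (Complex (4 / (2 * real N + 1)) (v0 * inv_nu N)) = rectpath (a1 N) (a3 N)" for N
      by (simp add: pts inv_nu_alt)
    have ev1: "\<forall>\<^sub>F N in sequentially. N \<ge> 1" by (rule eventually_ge_at_top)
    have cont: "continuous_on (path_image (rectpath (a1 N) (a3 N))) (fQ N)" if "N \<ge> 1" for N
      using sum_Q_res_eq_contour(2)[OF that vy[of N]] unfolding rect fQ_def .
    have im: "path_image (rectpath (a1 N) (a3 N)) = closed_segment (a1 N) (a2 N) \<union> closed_segment (a2 N) (a3 N) \<union>
        closed_segment (a3 N) (a4 N) \<union> closed_segment (a4 N) (a1 N)" for N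
      unfolding path_image_rectpath_Un by (simp add: pts)
    have P2s: "P2 N \<in> closed_segment (a3 N) (a4 N)" "P1 N \<in> closed_segment (P2 N) (a4 N)" for N
      using closed_segment_horizontal[of "a4 N" "a3 N" "P2 N"] closed_segment_horizontal[of "a4 N" "P2 N" "P1 N"]
        ord[of N] inv_nu.y_pos[of N] P[of N] by (simp_all add: closed_segment_commute a3_def a4_def)
    have sub: "closed_segment (a3 N) (P2 N) \<subseteq> closed_segment (a3 N) (a4 N)" "closed_segment (P2 N) (a4 N) \<subseteq> closed_segment (a3 N) (a4 N)"
      "closed_segment (P1 N) (a4 N) \<subseteq> closed_segment (a3 N) (a4 N)" "closed_segment (P1 N) (P2 N) \<subseteq> closed_segment (a3 N) (a4 N)" for N
    proof -
      show 1: "closed_segment (a3 N) (P2 N) \<subseteq> closed_segment (a3 N) (a4 N)" "closed_segment (P2 N) (a4 N) \<subseteq> closed_segment (a3 N) (a4 N)"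
        using P2s(1)[of N] by (simp_all add: subset_closed_segment)
      then have "P1 N \<in> closed_segment (a3 N) (a4 N)" using P2s(2)[of N] by blast
      then show "closed_segment (P1 N) (a4 N) \<subseteq> closed_segment (a3 N) (a4 N)" "closed_segment (P1 N) (P2 N) \<subseteq> closed_segment (a3 N) (a4 N)"
        using P2s(1)[of N] by (simp_all add: subset_closed_segment)
    qed
    have cs: "continuous_on (closed_segment (a1 N) (a2 N)) (fQ N)" "continuous_on (closed_segment (a2 N) (a3 N)) (fQ N)"
       "continuous_on (closed_segment (a3 N) (a4 N)) (fQ N)" "continuous_on (closed_segment (a4 N) (a1 N)) (fQ N)"
       "continuous_on (closed_segment (a3 N) (P2 N)) (fQ N)" "continuous_on (closed_segment (P2 N) (a4 N)) (fQ N)"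
       "continuous_on (closed_segment (P1 N) (a4 N)) (fQ N)" "continuous_on (closed_segment (P1 N) (P2 N)) (fQ N)"
      if "N \<ge> 1" for N
      using cont[OF that] sub[of N] unfolding im by (auto intro: continuous_on_subset)
    have F: "growth > 0" using growth_ge by linarith
    have y2: "inv_nu N \<le> 2" "inv_nu N > 0" for N by (rule inv_nu.y_le, rule inv_nu.y_pos)
    have vy2: "v0 * inv_nu N \<le> 2" for N using mult_mono[of v0 1 "inv_nu N" 2] v0_bounds y2[of N] by simp
    have dist: "cmod (Complex x y - Complex x' y') \<le> \<bar>x - x'\<bar> + \<bar>y - y'\<bar>" for x y x' y'
      using cmod_le[of "Complex x y - Complex x' y'"] by simp
    have bot: "exp_small (\<lambda>N. cmod (ci N (a1 N) (a2 N)))" unfolding ci_def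
    proof (rule contour_linepath_exp_small[where L = 4])
      have "\<forall>\<^sub>F N in sequentially. \<forall>z\<in>closed_segment (a1 N) (a2 N). cmod (fQ N z) \<le> exp (2 * pi * \<bar>of_int \<sigma>\<bar>) * exp (nu N * (growth - growth))"
      proof (intro always_eventually allI ballI)
        fix N z assume "z \<in> closed_segment (a1 N) (a2 N)"
        then have "Im z = -1" using closed_segment_horizontal[of "a1 N" "a2 N" z] y2[of N] by (simp add: pts)
        then have "z = Complex (Re z) (-1)" by (simp add: complex_eq_iff)
        then show "cmod (fQ N z) \<le> exp (2 * pi * \<bar>of_int \<sigma>\<bar>) * exp (nu N * (growth - growth))"
          using norm_Q_bottom[of "Re z" N \<sigma>] unfolding fQ_def by simp
      qed
      then show "\<exists>C e. e > 0 \<and> (\<forall>\<^sub>F N in sequentially. \<forall>z\<in>closed_segment (a1 N) (a2 N). cmod (fQ N z) \<le> C * exp (nu N * (growth - e)))"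
        using F by blast
      show "\<forall>\<^sub>F N in sequentially. continuous_on (closed_segment (a1 N) (a2 N)) (fQ N)"
        using ev1 by eventually_elim (rule cs)
      show "\<forall>\<^sub>F N in sequentially. cmod (a2 N - a1 N) \<le> 4"
        unfolding pts
      proof (intro always_eventually allI order_trans[OF dist])
        fix N
        show "\<bar>2 * inv_nu N - inv_nu N\<bar> + \<bar>- 1 - - 1\<bar> \<le> 4" using y2[of N] vy[of N] vy2[of N] by linarith
      qed
    qed
    have right: "exp_small (\<lambda>N. cmod (ci N (a2 N) (a3 N)))" unfolding ci_def
    proof (rule contour_linepath_exp_small[where L = 4])
      obtain C e where Ce: "e > 0" "\<forall>\<^sub>F N in sequentially. \<forall>t. -1 \<le> t \<longrightarrow> t \<le> v0 * inv_nu N \<longrightarrow>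
         cmod (Q (Complex (real 2 * inv_nu N) t) N (of_int \<sigma>)) \<le> C * exp (nu N * (growth - e))" using Q_bound_side[of 2] by blast
      from Ce(2) have "\<forall>\<^sub>F N in sequentially. \<forall>z\<in>closed_segment (a2 N) (a3 N). cmod (fQ N z) \<le> C * exp (nu N * (growth - e))"
      proof eventually_elim
        case (elim N)
        show ?case
        proof
          fix z assume "z \<in> closed_segment (a2 N) (a3 N)"
          then have "Re z = 2 * inv_nu N" "-1 \<le> Im z" "Im z \<le> v0 * inv_nu N"
            using closed_segment_vertical[of "a2 N" "a3 N" z] vy[of N] by (simp_all add: pts)
          moreover from this have "z = Complex (real 2 * inv_nu N) (Im z)" by (simp add: complex_eq_iff)
          ultimately show "cmod (fQ N z) \<le> C * exp (nu N * (growth - e))" using elim unfolding fQ_def by metis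
        qed
      qed
      then show "\<exists>C e. e > 0 \<and> (\<forall>\<^sub>F N in sequentially. \<forall>z\<in>closed_segment (a2 N) (a3 N). cmod (fQ N z) \<le> C * exp (nu N * (growth - e)))"
        using Ce(1) by blast
      show "\<forall>\<^sub>F N in sequentially. continuous_on (closed_segment (a2 N) (a3 N)) (fQ N)"
        using ev1 by eventually_elim (rule cs)
      show "\<forall>\<^sub>F N in sequentially. cmod (a3 N - a2 N) \<le> 4"
        unfolding pts
      proof (intro always_eventually allI order_trans[OF dist])
        fix N
        show "\<bar>2 * inv_nu N - 2 * inv_nu N\<bar> + \<bar>v0 * inv_nu N - - 1\<bar> \<le> 4" using y2[of N] vy[of N] vy2[of N] by linarith
      qed
    qed
    have left: "exp_small (\<lambda>N. cmod (ci N (a4 N) (a1 N)))" unfolding ci_def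
    proof (rule contour_linepath_exp_small[where L = 4])
      obtain C e where Ce: "e > 0" "\<forall>\<^sub>F N in sequentially. \<forall>t. -1 \<le> t \<longrightarrow> t \<le> v0 * inv_nu N \<longrightarrow>
         cmod (Q (Complex (real 1 * inv_nu N) t) N (of_int \<sigma>)) \<le> C * exp (nu N * (growth - e))" using Q_bound_side[of 1] by blast
      from Ce(2) have "\<forall>\<^sub>F N in sequentially. \<forall>z\<in>closed_segment (a4 N) (a1 N). cmod (fQ N z) \<le> C * exp (nu N * (growth - e))"
      proof eventually_elim
        case (elim N)
        show ?case
        proof
          fix z assume "z \<in> closed_segment (a4 N) (a1 N)"
          then have "Re z = inv_nu N" "-1 \<le> Im z" "Im z \<le> v0 * inv_nu N"
            using closed_segment_vertical[of "a1 N" "a4 N" z] vy[of N] by (simp_all add: pts closed_segment_commute)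
          moreover from this have "z = Complex (real 1 * inv_nu N) (Im z)" by (simp add: complex_eq_iff)
          ultimately show "cmod (fQ N z) \<le> C * exp (nu N * (growth - e))" using elim unfolding fQ_def by metis
        qed
      qed
      then show "\<exists>C e. e > 0 \<and> (\<forall>\<^sub>F N in sequentially. \<forall>z\<in>closed_segment (a4 N) (a1 N). cmod (fQ N z) \<le> C * exp (nu N * (growth - e)))"
        using Ce(1) by blast
      show "\<forall>\<^sub>F N in sequentially. continuous_on (closed_segment (a4 N) (a1 N)) (fQ N)"
        using ev1 by eventually_elim (rule cs)
      show "\<forall>\<^sub>F N in sequentially. cmod (a1 N - a4 N) \<le> 4"
        unfolding pts
      proof (intro always_eventually allI order_trans[OF dist])
        fix N
        show "\<bar>inv_nu N - inv_nu N\<bar> + \<bar>- 1 - v0 * inv_nu N\<bar> \<le> 4" using y2[of N] vy[of N] vy2[of N] by linarith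
      qed
    qed
    \<comment> \<open>The top side without the neighbourhood of the saddle point, in the rescaled
      variable.\<close>
    define K where "K = (\<lambda>x. Complex x v0) ` ({1..Re z0 - d} \<union> {Re z0 + d..2})"
    have "compact K" unfolding K_def
      by (intro compact_continuous_image compact_Un) (auto simp: Complex_eq intro!: continuous_intros)
    moreover have "Im z > 0" "Re (phase z) < growth" if "z \<in> K" for z
      using that v0_bounds x0 dd by (auto simp: K_def intro!: Re_phase_top)
    ultimately obtain C e where Ce: "e > 0" "\<forall>\<^sub>F N in sequentially. \<forall>z\<in>K. cmod (Q (of_real (inv_nu N) * z) N (of_int \<sigma>)) \<le> C * exp (nu N * (growth - e))"
      using Q_bound_compact[of K] by blast
    have resc: "z = of_real (inv_nu N) * Complex (Re z * nu N) v0" if "Im z = v0 * inv_nu N" for z N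
      using that unfolding inv_nu_Complex by (simp add: complex_eq_iff mult.assoc)
    have far_r: "exp_small (\<lambda>N. cmod (ci N (a3 N) (P2 N)))" unfolding ci_def
    proof (rule contour_linepath_exp_small[where L = 4])
      from Ce(2) have "\<forall>\<^sub>F N in sequentially. \<forall>z\<in>closed_segment (a3 N) (P2 N). cmod (fQ N z) \<le> C * exp (nu N * (growth - e))"
      proof eventually_elim
        case (elim N)
        show ?case
        proof
          fix z assume "z \<in> closed_segment (a3 N) (P2 N)"
          then have z: "Im z = v0 * inv_nu N" "(Re z0 + d) * inv_nu N \<le> Re z" "Re z \<le> 2 * inv_nu N"
            using closed_segment_horizontal[of "P2 N" "a3 N" z] ord[of N] by (simp_all add: a3_def P closed_segment_commute)
          have "(Re z0 + d) * inv_nu N * nu N \<le> Re z * nu N" "Re z * nu N \<le> 2 * inv_nu N * nu N"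
            using z nu_pos[of N] by (auto intro!: mult_right_mono)
          then have "Complex (Re z * nu N) v0 \<in> K" by (simp add: K_def mult.assoc)
          then show "cmod (fQ N z) \<le> C * exp (nu N * (growth - e))" using elim resc[OF z(1)] unfolding fQ_def by metis
        qed
      qed
      then show "\<exists>C e. e > 0 \<and> (\<forall>\<^sub>F N in sequentially. \<forall>z\<in>closed_segment (a3 N) (P2 N). cmod (fQ N z) \<le> C * exp (nu N * (growth - e)))"
        using Ce(1) by blast
      show "\<forall>\<^sub>F N in sequentially. continuous_on (closed_segment (a3 N) (P2 N)) (fQ N)"
        using ev1 by eventually_elim (rule cs)
      have "cmod (P2 N - a3 N) \<le> 4" for N
        proof -
        have "cmod (P2 N - a3 N) \<le> \<bar>Re (P2 N) - 2 * inv_nu N\<bar> + \<bar>Im (P2 N) - v0 * inv_nu N\<bar>" using cmod_le[of "P2 N - a3 N"] by (simp only: a3_def complex.sel minus_complex.sel)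
        then show ?thesis using ord[of N] y2[of N] P(2,4)[of N] by linarith
      qed
      then show "\<forall>\<^sub>F N in sequentially. cmod (P2 N - a3 N) \<le> 4" by simp
    qed
    have far_l: "exp_small (\<lambda>N. cmod (ci N (P1 N) (a4 N)))" unfolding ci_def
    proof (rule contour_linepath_exp_small[where L = 4])
      from Ce(2) have "\<forall>\<^sub>F N in sequentially. \<forall>z\<in>closed_segment (P1 N) (a4 N). cmod (fQ N z) \<le> C * exp (nu N * (growth - e))"
      proof eventually_elim
        case (elim N)
        show ?case
        proof
          fix z assume "z \<in> closed_segment (P1 N) (a4 N)"
          then have z: "Im z = v0 * inv_nu N" "inv_nu N \<le> Re z" "Re z \<le> (Re z0 - d) * inv_nu N"
            using closed_segment_horizontal[of "a4 N" "P1 N" z] ord[of N] by (simp_all add: a4_def P closed_segment_commute)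
          have yn: "inv_nu N * nu N = 1" by simp
          have "inv_nu N * nu N \<le> Re z * nu N" "Re z * nu N \<le> (Re z0 - d) * inv_nu N * nu N"
            by (rule mult_right_mono[OF z(2) less_imp_le[OF nu_pos]] mult_right_mono[OF z(3) less_imp_le[OF nu_pos]])+
          then have "1 \<le> Re z * nu N" "Re z * nu N \<le> Re z0 - d" unfolding mult.assoc[of "Re z0 - d"] yn by simp_all
          then have "Complex (Re z * nu N) v0 \<in> K" by (simp add: K_def)
          then show "cmod (fQ N z) \<le> C * exp (nu N * (growth - e))" using elim resc[OF z(1)] unfolding fQ_def by metis
        qed
      qed
      then show "\<exists>C e. e > 0 \<and> (\<forall>\<^sub>F N in sequentially. \<forall>z\<in>closed_segment (P1 N) (a4 N). cmod (fQ N z) \<le> C * exp (nu N * (growth - e)))"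
        using Ce(1) by blast
      show "\<forall>\<^sub>F N in sequentially. continuous_on (closed_segment (P1 N) (a4 N)) (fQ N)"
        using ev1 by eventually_elim (rule cs)
      have "cmod (a4 N - P1 N) \<le> 4" for N
        proof -
        have "cmod (a4 N - P1 N) \<le> \<bar>inv_nu N - Re (P1 N)\<bar> + \<bar>v0 * inv_nu N - Im (P1 N)\<bar>" using cmod_le[of "a4 N - P1 N"] by (simp only: a4_def complex.sel minus_complex.sel)
        then show ?thesis using ord[of N] y2[of N] P(2,4)[of N] by linarith
      qed
      then show "\<forall>\<^sub>F N in sequentially. cmod (a4 N - P1 N) \<le> 4" by simp
    qed
    \<comment> \<open>An identity for every \<open>N \<ge> 1\<close>: the asymptotics are hidden in
      \<open>B N\<close>.\<close>
    have mid: "w0 powi (- int N) / of_nat N ^ 2 * B N = - 2 * ci N (P1 N) (P2 N)" if N: "N \<ge> 1" for N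
    proof -
      define I where "I = integral {-d..d} (\<lambda>x. fQ N (of_real (inv_nu N) * (z0 + of_real x)))"
      define y where "y = complex_of_real (inv_nu N)"
      have n0: "of_real (nu N) * y = 1" by (simp add: y_def flip: of_real_mult)
      have w: "w0 \<noteq> 0" using w0_bounds by auto
      have "ci N (P1 N) (P2 N) = y * I" unfolding ci_def P1_def P2_def I_def y_def
        by (rule contour_linepath_horizontal_scaled[OF dd(1) _ refl cQ]) (rule inv_nu.y_pos)
      moreover have "lap (a N) N = of_real (nu N) * exp (- (of_real (nu N) * phase z0)) * I"
      proof -
        have "(\<lambda>x. exp (of_real (nu N) * (phase (z0 + of_real x) - phase z0)) * a N (z0 + of_real x)) =
            (\<lambda>x. (of_real (sqrt (nu N)) * exp (- (of_real (nu N) * phase z0))) * fQ N (of_real (inv_nu N) * (z0 + of_real x)))"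
          unfolding a_def by (intro ext) (simp only: right_diff_distrib exp_diff exp_minus, simp add: divide_simps)
        then have "lap (a N) N = of_real (sqrt (nu N)) * ((of_real (sqrt (nu N)) * exp (- (of_real (nu N) * phase z0))) * I)"
          unfolding lap_def I_def by (simp only: Henstock_Kurzweil_Integration.integral_mult_right)
        moreover have "complex_of_real (sqrt (nu N)) * of_real (sqrt (nu N)) = of_real (nu N)"
          using nu_pos[of N] by (simp flip: of_real_mult)
        ultimately show ?thesis by (simp add: mult.assoc[symmetric])
      qed
      moreover have "exp (- (of_real (nu N) * phase z0)) = w0 ^ N * exp (Ln w0 / 2)"
      proof -
        have "- (of_real (nu N) * phase z0) = of_nat N * Ln w0 + Ln w0 / 2" by (simp add: phase_z0 nu_def algebra_simps)
        then show ?thesis using w by (simp add: exp_add exp_of_nat_mult)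
      qed
      moreover have "w0 powi (- int N) = inverse (w0 ^ N)" by (simp add: power_int_minus)
      moreover have "B N = - 2 * exp (- Ln w0 / 2) * ((of_nat N * y) * (of_nat N * y) * lap (a N) N)"
        unfolding B_def y_def Nyy by simp
      moreover have "exp (- Ln w0 / 2) * exp (Ln w0 / 2) = 1" by (simp flip: exp_add)
      ultimately have e: "w0 powi (- int N) / of_nat N ^ 2 * B N = (inverse (w0 ^ N) * w0 ^ N) * ((of_nat N * of_nat N) / of_nat N ^ 2) *
          (exp (- Ln w0 / 2) * exp (Ln w0 / 2)) * (of_real (nu N) * y) * (- 2 * (y * I))"
        by (simp add: mult_ac)
      show ?thesis unfolding e using w N n0 \<open>exp (- Ln w0 / 2) * exp (Ln w0 / 2) = 1\<close> \<open>ci N (P1 N) (P2 N) = y * I\<close>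
        by (simp add: power2_eq_square)
    qed
    define err where "err = (\<lambda>N. 2 * (cmod (ci N (a1 N) (a2 N)) + cmod (ci N (a2 N) (a3 N)) + cmod (ci N (a3 N) (P2 N)) + cmod (ci N (P1 N) (a4 N)) + cmod (ci N (a4 N) (a1 N))))"
    have "exp_small err" unfolding err_def
      by (intro exp_small_cmult exp_small_add bot right far_r far_l left) simp
    moreover have "\<forall>\<^sub>F N in sequentially. cmod (A1 N (of_int \<sigma>) - of_real (Re (w0 powi (- int N) / of_nat N ^ 2 * B N))) \<le> err N"
      using eventually_ge_at_top[of 4]
    proof eventually_elim
      case (elim N)
      then have N1: "N \<ge> 1" by simp
      have "(\<Sum>k\<in>{k. N < 2 * k \<and> k \<le> N}. Q_res 1 k (of_int \<sigma>) N) = contour_integral (rectpath (a1 N) (a3 N)) (fQ N)"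
        using sum_Q_res_eq_contour(1)[OF N1 vy[of N]] unfolding rect fQ_def by simp
      also have "\<dots> = ci N (a1 N) (a2 N) + ci N (a2 N) (a3 N) + ci N (a3 N) (a4 N) + ci N (a4 N) (a1 N)"
        using contour_integral_rectpath[OF cont[OF N1]] by (simp add: ci_def pts)
      also have "ci N (a3 N) (a4 N) = ci N (a3 N) (P2 N) + ci N (P2 N) (a4 N)"
        unfolding ci_def by (rule contour_integral_split_linepath[OF cs(3)[OF N1] P2s(1)])
      also have "ci N (P2 N) (a4 N) = ci N (P2 N) (P1 N) + ci N (P1 N) (a4 N)"
        unfolding ci_def by (rule contour_integral_split_linepath[OF cs(6)[OF N1] P2s(2)])
      also have "ci N (P2 N) (P1 N) = - ci N (P1 N) (P2 N)"
        unfolding ci_def by (rule contour_integral_reverse_linepath) (use cs(8)[OF N1] in \<open>simp add: closed_segment_commute\<close>)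
      finally have S: "(\<Sum>k\<in>{k. N < 2 * k \<and> k \<le> N}. Q_res 1 k (of_int \<sigma>) N) = ci N (a1 N) (a2 N) + ci N (a2 N) (a3 N) +
         (ci N (a3 N) (P2 N) + (- ci N (P1 N) (P2 N) + ci N (P1 N) (a4 N))) + ci N (a4 N) (a1 N)" .
      define T where "T = ci N (a1 N) (a2 N) + ci N (a2 N) (a3 N) + ci N (a3 N) (P2 N) + ci N (P1 N) (a4 N) + ci N (a4 N) (a1 N)"
      have "A1 N (of_int \<sigma>) - of_real (Re (w0 powi (- int N) / of_nat N ^ 2 * B N)) = of_real (2 * Re T)"
        unfolding A1_eq[OF elim] mid[OF N1] S T_def by simp
      then have "cmod (A1 N (of_int \<sigma>) - of_real (Re (w0 powi (- int N) / of_nat N ^ 2 * B N))) = 2 * \<bar>Re T\<bar>"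
        by (simp only: norm_of_real abs_mult abs_numeral)
      also have "\<dots> \<le> 2 * cmod T" using abs_Re_le_cmod[of T] by simp
      also have "cmod T \<le> cmod (ci N (a1 N) (a2 N)) + cmod (ci N (a2 N) (a3 N)) + cmod (ci N (a3 N) (P2 N)) + cmod (ci N (P1 N) (a4 N)) + cmod (ci N (a4 N) (a1 N))"
        unfolding T_def by (intro norm_triangle_mono order_refl)
      finally show ?case by (simp add: err_def)
    qed
    ultimately show ?thesis by (rule exp_small_mono)
  qed
  ultimately show ?thesis by blast
qed

section \<open>Expansion in powers of the reciprocal\<close>

text \<open>
  The expansion comes in powers of \<open>1 / (N + 1/2)\<close> and has to be converted to powers of \<open>1 / N\<close>; \<open>max\<close> keeps the scale
  positive at \<open>N = 0\<close>.
\<close>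
definition recip :: "nat \<Rightarrow> real" where "recip N = 1 / real (max N 1)"

interpretation recip: asymp_scale recip
proof
  show "recip N > 0" for N by (simp add: recip_def)
  show "recip N \<le> 2" for N
  proof -
    have "1 / real (max N 1) \<le> 1 / 1" by (rule divide_left_mono) auto
    then show ?thesis unfolding recip_def by linarith
  qed
  have "(\<lambda>N::nat. 1 / real N) \<longlonglongrightarrow> 0" by real_asymp
  moreover have "\<forall>\<^sub>F N in sequentially. 1 / real N = recip N"
    using eventually_ge_at_top[of 1] by eventually_elim (simp add: recip_def max_def)
  ultimately show "recip \<longlonglongrightarrow> 0" by (rule Lim_transform_eventually)
qed

definition inv_nu_ratio :: "nat \<Rightarrow> real" where "inv_nu_ratio N = 1 / (1 + recip N / 2)"

lemma inv_nu_eq_recip: "N \<ge> 1 \<Longrightarrow> inv_nu N = recip N * inv_nu_ratio N"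
  unfolding inv_nu_def nu_def recip_def inv_nu_ratio_def by (simp add: field_simps max_def)

text \<open>The identity \<open>inv_nu_ratio N = 1 - recip N * inv_nu_ratio N / 2\<close> raises the
  order by one in each step.\<close>

lemma inv_nu_ratio_has_asymp: "has_asymp recip S M (\<lambda>N _. of_real (inv_nu_ratio N))"
proof (induction M)
  case 0
  have "cmod (of_real (inv_nu_ratio N)) \<le> 1" for N
  proof -
    have "0 \<le> inv_nu_ratio N" "inv_nu_ratio N \<le> 1" using recip.y_pos[of N] by (simp_all add: inv_nu_ratio_def)
    then show ?thesis unfolding norm_of_real by simp
  qed
  then show ?case by (auto intro: always_eventually)
next
  case (Suc M)
  have "has_asymp recip S (Suc M) (\<lambda>N _. 1 + of_real (recip N) * (of_real (inv_nu_ratio N) * (- 1 / 2)))"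
    by (intro recip.has_asymp_add recip.has_asymp_y recip.has_asymp_mult has_asymp_constant Suc.IH)
  moreover have "complex_of_real (inv_nu_ratio N) = 1 + of_real (recip N) * (of_real (inv_nu_ratio N) * (- 1 / 2))" for N
  proof -
    have "inv_nu_ratio N = 1 + recip N * (inv_nu_ratio N * (- 1 / 2))"
      using recip.y_pos[of N] by (simp add: inv_nu_ratio_def field_simps)
    from arg_cong[OF this, of complex_of_real] show ?thesis by simp
  qed
  ultimately show ?case by simp
qed

lemma has_asymp_inv_nu_imp_recip: "has_asymp inv_nu S M a \<Longrightarrow> has_asymp recip S M a"
proof (induction M arbitrary: a)
  case (Suc M)
  then obtain e a' where e: "e holomorphic_on S" "bounded (e ` S)" "has_asymp inv_nu S M a'"
    "\<forall>\<^sub>F N in sequentially. \<forall>z\<in>S. a N z = e z + of_real (inv_nu N) * a' N z" by auto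
  have "has_asymp recip S M (\<lambda>N z. of_real (inv_nu_ratio N) * a' N z)"
    by (intro recip.has_asymp_mult inv_nu_ratio_has_asymp Suc.IH e)
  then show ?case
  proof (rule has_asymp_SucI[OF e(1,2)])
    show "\<forall>\<^sub>F N in sequentially. \<forall>z\<in>S. a N z = e z + of_real (recip N) * (of_real (inv_nu_ratio N) * a' N z)"
      using e(4) eventually_ge_at_top[of 1] by eventually_elim (simp add: inv_nu_eq_recip)
  qed
qed simp

text \<open>Letting the scale tend to \<open>0\<close> forces \<open>c 0 = 0\<close>; then divide by
  the scale and repeat.\<close>

lemma asymp_coeffs_zero:
  fixes x :: "nat \<Rightarrow> real" and c :: "nat \<Rightarrow> complex"
  assumes x: "\<And>N. x N > 0" "x \<longlonglongrightarrow> 0"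
    and b: "\<forall>\<^sub>F N in sequentially. cmod (\<Sum>j<M. c j * of_real (x N) ^ j) \<le> C * x N ^ M"
  shows "\<forall>j<M. c j = 0"
  using b
proof (induction M arbitrary: c)
  case (Suc M)
  have split: "(\<Sum>j<Suc M. c j * of_real (x N) ^ j) = c 0 + of_real (x N) * (\<Sum>j<M. c (Suc j) * of_real (x N) ^ j)" for N
    by (subst sum.lessThan_Suc_shift) (simp add: sum_distrib_left mult_ac)
  have x0: "(\<lambda>N. complex_of_real (x N)) \<longlonglongrightarrow> of_real 0" by (intro tendsto_of_real x)
  have "(\<lambda>N. c 0 + of_real (x N) * (\<Sum>j<M. c (Suc j) * of_real (x N) ^ j)) \<longlonglongrightarrow> c 0 + of_real 0 * (\<Sum>j<M. c (Suc j) * of_real 0 ^ j)"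
    by (intro tendsto_add tendsto_mult tendsto_const x0 tendsto_sum tendsto_power)
  then have l1: "(\<lambda>N. \<Sum>j<Suc M. c j * of_real (x N) ^ j) \<longlonglongrightarrow> c 0" unfolding split by simp
  have "(\<lambda>N. C * x N ^ Suc M) \<longlonglongrightarrow> C * 0 ^ Suc M" by (intro tendsto_intros x)
  then have "(\<lambda>N. C * x N ^ Suc M) \<longlonglongrightarrow> 0" by simp
  from Lim_null_comparison[OF Suc.prems this] l1 have c0: "c 0 = 0" by (rule LIMSEQ_unique[rotated])
  have "\<forall>\<^sub>F N in sequentially. cmod (\<Sum>j<M. c (Suc j) * of_real (x N) ^ j) \<le> C * x N ^ M"
    using Suc.prems
  proof eventually_elim
    case (elim N)
    then have "x N * cmod (\<Sum>j<M. c (Suc j) * of_real (x N) ^ j) \<le> x N * (C * x N ^ M)"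
      unfolding split c0 using x(1)[of N] by (simp add: norm_mult mult_ac)
    then show ?case using x(1)[of N] by simp
  qed
  from Suc.IH[OF this] have "c (Suc j) = 0" if "j < M" for j using that by blast
  then show ?case using c0 by (metis less_Suc_eq_0_disj)
qed simp

text \<open>The coefficients provided by the hypothesis may depend on the order. By uniqueness those
  of order \<open>M + 1\<close> extend those of order \<open>M\<close>, so the diagonal choice
  \<open>bb (Suc j) j\<close> serves all orders.\<close>

lemma asymp_expansion_uniform:
  fixes x :: "nat \<Rightarrow> real" and a :: "nat \<Rightarrow> complex"
  assumes x: "\<And>N. x N > 0" "x \<longlonglongrightarrow> 0"
    and ex: "\<And>M. \<exists>b C. \<forall>\<^sub>F N in sequentially. cmod (a N - (\<Sum>j<M. b j * of_real (x N) ^ j)) \<le> C * x N ^ M"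
  shows "\<exists>b. \<forall>M. \<exists>C. \<forall>\<^sub>F N in sequentially. cmod (a N - (\<Sum>j<M. b j * of_real (x N) ^ j)) \<le> C * x N ^ M"
proof -
  have "\<forall>M. \<exists>b C. \<forall>\<^sub>F N in sequentially. cmod (a N - (\<Sum>j<M. b j * of_real (x N) ^ j)) \<le> C * x N ^ M" using ex ..
  from choice[OF this] obtain bb
    where "\<forall>M. \<exists>C. \<forall>\<^sub>F N in sequentially. cmod (a N - (\<Sum>j<M. bb M j * of_real (x N) ^ j)) \<le> C * x N ^ M" by blast
  from choice[OF this] obtain C
    where bb: "\<And>M. \<forall>\<^sub>F N in sequentially. cmod (a N - (\<Sum>j<M. bb M j * of_real (x N) ^ j)) \<le> C M * x N ^ M" by blast
  have step: "\<forall>j<M. bb (Suc M) j = bb M j" for M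
  proof -
    have "(\<lambda>N. x N) \<longlonglongrightarrow> 0" by (rule x(2))
    then have "\<forall>\<^sub>F N in sequentially. x N < 1" by (rule order_tendstoD) simp
    with bb[of M] bb[of "Suc M"]
    have "\<forall>\<^sub>F N in sequentially. cmod (\<Sum>j<M. (bb (Suc M) j - bb M j) * of_real (x N) ^ j) \<le> (C M + \<bar>C (Suc M)\<bar> + cmod (bb (Suc M) M)) * x N ^ M"
    proof eventually_elim
      case (elim N)
      define X where "X = complex_of_real (x N)"
      have nX: "cmod X = x N" using x(1)[of N] by (simp add: X_def)
      have eq: "(\<Sum>j<M. (bb (Suc M) j - bb M j) * X ^ j) = (a N - (\<Sum>j<M. bb M j * X ^ j)) - (a N - (\<Sum>j<Suc M. bb (Suc M) j * X ^ j)) - bb (Suc M) M * X ^ M"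
        by (simp add: left_diff_distrib sum_subtractf)
      have "cmod (\<Sum>j<M. (bb (Suc M) j - bb M j) * X ^ j) \<le> cmod (a N - (\<Sum>j<M. bb M j * X ^ j)) + cmod (a N - (\<Sum>j<Suc M. bb (Suc M) j * X ^ j)) + cmod (bb (Suc M) M * X ^ M)"
        unfolding eq by (rule order_trans[OF norm_triangle_ineq4]) (intro add_right_mono norm_triangle_ineq4)
      also have "\<dots> \<le> C M * x N ^ M + C (Suc M) * x N ^ Suc M + cmod (bb (Suc M) M) * x N ^ M"
        using elim(1,2) unfolding X_def[symmetric] by (simp add: norm_mult norm_power nX)
      also have "C (Suc M) * x N ^ Suc M \<le> \<bar>C (Suc M)\<bar> * x N ^ M"
        using elim(3) x(1)[of N] by (intro mult_mono) (auto intro: mult_left_le_one_le)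
      finally show ?case by (simp add: X_def distrib_right)
    qed
    from asymp_coeffs_zero[OF x this] show ?thesis by simp
  qed
  have stab: "bb (M + i) j = bb M j" if "j < M" for M i j
    by (induction i) (use step that in auto)
  define b where "b = (\<lambda>j. bb (Suc j) j)"
  have "b j = bb M j" if "j < M" for j M
    using stab[of j "Suc j" "M - Suc j"] that by (simp add: b_def)
  then have "(\<Sum>j<M. b j * of_real (x N) ^ j) = (\<Sum>j<M. bb M j * of_real (x N) ^ j)" for M N
    by (intro sum.cong) auto
  then show ?thesis using bb by (intro exI[of _ b] allI) (simp only:, blast)
qed

lemma exp_small_le:
  assumes "exp_small f"
  shows "\<exists>C. \<forall>\<^sub>F N in sequentially. f N \<le> C * (cmod w0 powi (- int N) / real N ^ M)"
proof -
  from assms obtain C e where e: "e > 0" "\<forall>\<^sub>F N in sequentially. f N \<le> C * exp (nu N * (growth - e))"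
    unfolding exp_small_def by blast
  have w: "cmod w0 > 0" using w0_bounds by linarith
  have F: "exp (nu N * growth) = exp (growth / 2) * cmod w0 powi (- int N)" for N
  proof -
    have "exp (nu N * growth) = exp (growth / 2) * exp (of_nat N * growth)" by (simp add: nu_def flip: exp_add) (simp add: algebra_simps)
    also have "exp (of_nat N * growth) = inverse (cmod w0) ^ N" using w by (simp add: exp_of_nat_mult growth_def exp_minus power_inverse)
    also have "\<dots> = inverse (cmod w0 ^ N)" by (rule power_inverse)
    also have "\<dots> = cmod w0 powi (- int N)" by (simp add: power_int_minus)
    finally show ?thesis .
  qed
  have "\<forall>\<^sub>F N in sequentially. f N \<le> (\<bar>C\<bar> * exp (growth / 2)) * (cmod w0 powi (- int N) / real N ^ M)"
    using e(2) nu_power_exp_le_1[OF e(1), of M] eventually_ge_at_top[of 1]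
  proof eventually_elim
    case (elim N)
    have p: "real N ^ M > 0" using elim by simp
    have "real N ^ M * exp (- (e * nu N)) \<le> nu N ^ M * exp (- (e * nu N))"
      by (intro mult_right_mono power_mono) (auto simp: nu_def)
    then have "real N ^ M * exp (- (e * nu N)) \<le> 1" using elim(2) by (rule order_trans)
    then have ee: "exp (- (e * nu N)) \<le> 1 / real N ^ M" using p by (simp add: field_simps)
    have "f N \<le> \<bar>C\<bar> * exp (nu N * (growth - e))" using elim(1) by (rule order_trans) (simp add: mult_right_mono)
    also have "exp (nu N * (growth - e)) = exp (nu N * growth) * exp (- (e * nu N))" by (simp add: algebra_simps flip: exp_add)
    also have "\<bar>C\<bar> * (exp (nu N * growth) * exp (- (e * nu N))) \<le> \<bar>C\<bar> * (exp (nu N * growth) * (1 / real N ^ M))"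
      using ee by (intro mult_left_mono) auto
    finally show ?case unfolding F by (simp add: mult_ac)
  qed
  then show ?thesis by blast
qed

text \<open>The finitely many exceptional \<open>N\<close> are absorbed into the constant, which is
  possible because \<open>g\<close> is positive.\<close>

lemma eventually_bound_imp_bound:
  fixes f g :: "nat \<Rightarrow> real"
  assumes "\<forall>\<^sub>F N in sequentially. f N \<le> C * g N" "\<And>N. N \<ge> 1 \<Longrightarrow> g N > 0"
  shows "\<exists>K. \<forall>N\<ge>1. f N \<le> K * g N"
proof -
  from assms(1) obtain N0 where N0: "\<And>N. N \<ge> N0 \<Longrightarrow> f N \<le> C * g N" by (auto simp: eventually_at_top_linorder)
  define K where "K = Max (insert C ((\<lambda>N. f N / g N) ` {1..N0}))"
  have "f N \<le> K * g N" if N: "N \<ge> 1" for N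
  proof (cases "N \<ge> N0")
    case True
    have "C \<le> K" unfolding K_def by (intro Max_ge) auto
    then show ?thesis using N0[OF True] assms(2)[OF N] by (meson mult_right_mono less_imp_le order_trans)
  next
    case False
    then have "f N / g N \<le> K" unfolding K_def using N by (intro Max_ge) auto
    then show ?thesis using assms(2)[OF N] by (simp add: field_simps)
  qed
  then show ?thesis by blast
qed

theorem theorem1p6:
  fixes \<sigma> :: int
  shows "\<exists>b :: nat \<Rightarrow> complex. b 0 = b0 \<and>
    (\<forall>m::nat. m \<ge> 1 \<longrightarrow> (\<exists>K::real. \<forall>N::nat. N \<ge> 1 \<longrightarrow>
      cmod (A1 N (of_int \<sigma>) -
            of_real (Re (w0 powi (- int N) / of_nat N ^ 2 * (\<Sum>j<m. b j / of_nat N ^ j))))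
      \<le> K * (cmod w0 powi (- int N) / real N ^ (m + 2))))"
proof -
  obtain B where B: "\<And>M S. has_asymp inv_nu S M (\<lambda>N _. B N)" "B \<longlonglongrightarrow> b0"
    "exp_small (\<lambda>N. cmod (A1 N (of_int \<sigma>) - of_real (Re (w0 powi (- int N) / of_nat N ^ 2 * B N))))"
    using A1_asymptotic[of \<sigma>] by blast
  \<comment> \<open>\<open>B\<close> does not depend on \<open>z\<close>; the point \<open>0\<close>
    merely instantiates the set of parameters.\<close>
  have "\<exists>b C. \<forall>\<^sub>F N in sequentially. cmod (B N - (\<Sum>j<M. b j * of_real (recip N) ^ j)) \<le> C * recip N ^ M" for M
    by (rule recip.has_asymp_expansion[where S = "{0}" and p = 0]) (auto intro: has_asymp_inv_nu_imp_recip B)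
  from asymp_expansion_uniform[OF recip.y_pos recip.y_tendsto this]
  obtain b where b: "\<And>M. \<exists>C. \<forall>\<^sub>F N in sequentially. cmod (B N - (\<Sum>j<M. b j * of_real (recip N) ^ j)) \<le> C * recip N ^ M"
    by blast
  have w: "cmod w0 > 0" using w0_bounds by linarith
  \<comment> \<open>The expansion with a single term says that \<open>B\<close> tends to
    \<open>b 0\<close>, and limits are unique.\<close>
  have "b 0 = b0"
  proof -
    from b[of 1] obtain C where "\<forall>\<^sub>F N in sequentially. cmod (B N - b 0) \<le> C * recip N" by auto
    moreover have "(\<lambda>N. C * recip N) \<longlonglongrightarrow> 0" using tendsto_mult_right_zero[OF recip.y_tendsto] by simp
    ultimately have "(\<lambda>N. B N - b 0) \<longlonglongrightarrow> 0" by (rule Lim_null_comparison)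
    then have "B \<longlonglongrightarrow> b 0" by (simp add: LIM_zero_iff)
    then show ?thesis using B(2) by (rule LIMSEQ_unique)
  qed
  moreover have "\<exists>K::real. \<forall>N::nat. N \<ge> 1 \<longrightarrow>
      cmod (A1 N (of_int \<sigma>) - of_real (Re (w0 powi (- int N) / of_nat N ^ 2 * (\<Sum>j<m. b j / of_nat N ^ j))))
      \<le> K * (cmod w0 powi (- int N) / real N ^ (m + 2))" for m
  proof -
    from b[of m] obtain C where C: "\<forall>\<^sub>F N in sequentially. cmod (B N - (\<Sum>j<m. b j * of_real (recip N) ^ j)) \<le> C * recip N ^ m" by blast
    from exp_small_le[OF B(3)] obtain D where D: "\<forall>\<^sub>F N in sequentially.
      cmod (A1 N (of_int \<sigma>) - of_real (Re (w0 powi (- int N) / of_nat N ^ 2 * B N))) \<le> D * (cmod w0 powi (- int N) / real N ^ (m + 2))" by blast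
    have ev: "\<forall>\<^sub>F N in sequentially. cmod (A1 N (of_int \<sigma>) - of_real (Re (w0 powi (- int N) / of_nat N ^ 2 * (\<Sum>j<m. b j / of_nat N ^ j))))
      \<le> (C + D) * (cmod w0 powi (- int N) / real N ^ (m + 2))"
      using C D eventually_ge_at_top[of 1]
    proof eventually_elim
      case (elim N)
      define W where "W = w0 powi (- int N) / of_nat N ^ 2"
      define S where "S = (\<Sum>j<m. b j / of_nat N ^ j)"
      have rN: "recip N = 1 / real N" using elim by (simp add: recip_def max_def)
      have "(\<Sum>j<m. b j * of_real (recip N) ^ j) = S"
        unfolding S_def rN by (simp add: power_divide)
      then have c: "cmod (B N - S) \<le> C * (1 / real N) ^ m" using elim(1) rN by simp
      have nW: "cmod W = cmod w0 powi (- int N) / real N ^ 2"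
        by (simp add: W_def norm_divide norm_power norm_power_int)
      have "cmod (of_real (Re (W * B N)) - of_real (Re (W * S))) = \<bar>Re (W * (B N - S))\<bar>"
        by (simp add: right_diff_distrib flip: of_real_diff)
      also have "\<dots> \<le> cmod W * cmod (B N - S)" using abs_Re_le_cmod[of "W * (B N - S)"] by (simp add: norm_mult)
      also have "\<dots> \<le> cmod W * (C * (1 / real N) ^ m)" using c by (intro mult_left_mono) auto
      also have "\<dots> = C * (cmod w0 powi (- int N) / real N ^ (m + 2))"
        unfolding nW by (simp add: power_add power_divide power2_eq_square mult_ac)
      finally have 1: "cmod (of_real (Re (W * B N)) - of_real (Re (W * S))) \<le> C * (cmod w0 powi (- int N) / real N ^ (m + 2))" .
      have "cmod (A1 N (of_int \<sigma>) - of_real (Re (W * S))) \<le> cmod (A1 N (of_int \<sigma>) - of_real (Re (W * B N))) + cmod (of_real (Re (W * B N)) - of_real (Re (W * S)))"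
        unfolding dist_norm[symmetric] by (rule dist_triangle)
      also have "\<dots> \<le> (C + D) * (cmod w0 powi (- int N) / real N ^ (m + 2))"
        using 1 elim(2) unfolding W_def[symmetric] distrib_right by linarith
      finally show ?case unfolding W_def S_def .
    qed
    have "cmod w0 powi (- int N) / real N ^ (m + 2) > 0" if "N \<ge> 1" for N
      using that w by simp
    with ev show ?thesis by (rule eventually_bound_imp_bound)
  qed
  ultimately show ?thesis by blast
qed

end
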